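(* Let $d\ge2$, $-d<\gamma<0$, and let $f_0\in L^1(\mathbb{R}^d)$ be a non-negative function with unit mass such that $f_0\in L^p(\mathbb{R}^d)$ for some $p>1$. Assume that the angular kernel $b$ is bounded and satisfies $$b(x)\ge b_0(1-x^2)^{\frac{\nu}{2}}$$ for some $b_0>0$, $0\le\nu\le1$. Then, if $$H_p(f_0)=\int_{\mathbb{R}^d}\mathcal{M}(v)^{1-p}f_0(v)^p\,dv<\infty ,$$ we have that for any $t_0>0$ there exist two uniform constants $C^{(1)}_{t_0},C^{(2)}_{t_0}>0$, depending only on $d,\gamma,p,b_0,\nu,t_0$ and $H_p(f_0)$, such that any non-negative solution $f(t)$ to $\partial_t f=\boldsymbol{L}_\gamma f$ with initial data $f_0$ satisfies $$\mathscr{D}_\gamma(f(t))\ge\frac{C^{(1)}_{t_0}\,H(f(t)|\mathcal{M})}{\big|\log\big(C^{(2)}_{t_0}H(f(t)|\mathcal{M})\big)\big|^{\frac{|\gamma|}{2}}}\qquad\forall\,t\ge t_0 .$$ As a consequence, one can find appropriate constants $C_1,\lambda_1>0$, depending on $d,\gamma,p,b_0$, such that $$H(f(t)|\mathcal{M})\le C_1\exp\Big(-\lambda_1 t^{\frac{2}{2+|\gamma|}}\Big)\qquad\forall\,t\ge0 .$$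
   Context: Setting: $\gamma\in(-d,0)$; $b:[-1,1]\to[0,\infty)$ is an even function with $\|b\|_1:=\int_{\mathbb{S}^{d-1}}b(\cos\theta)\,d\sigma=|\mathbb{S}^{d-2}|\int_{-1}^1 b(x)(1-x^2)^{\frac{d-3}{2}}dx=1$. The Maxwellian is $\mathcal{M}(v)=(2\pi)^{-d/2}e^{-|v|^2/2}$. For $v,v_*\in\mathbb{R}^d$, $\sigma\in\mathbb{S}^{d-1}$: $v'=\frac{v+v_*}{2}+\frac{|v-v_*|}{2}\sigma$, $v_*'=\frac{v+v_*}{2}-\frac{|v-v_*|}{2}\sigma$, $\cos\theta=\frac{v-v_*}{|v-v_*|}\cdot\sigma$. The linear Boltzmann operator is $$\boldsymbol{L}_\gamma f(v)=\int_{\mathbb{R}^d\times\mathbb{S}^{d-1}}|v-v_*|^\gamma b(\cos\theta)\big(f(v')\mathcal{M}(v_*')-f(v)\mathcal{M}(v_* )\big)\,dv_*\,d\sigma .$$ It is a bounded operator on $L^1(\mathbb{R}^d)$; the solution with initial datum $f_0\in L^1(\mathbb{R}^d)$ is $f(t)=U(t)f_0$, where $(U(t))_{t\ge0}$ is the positive, mass-preserving $C_0$-semigroup on $L^1(\mathbb{R}^d)$ generated by $\boldsymbol{L}_\gamma$. Unit mass means $\int_{\mathbb{R}^d} f_0\,dv=1$. The relative entropy of a non-negative $f$ of unit mass is $H(f|\mathcal{M})=\int_{\mathbb{R}^d}f\log\frac{f}{\mathcal{M}}\,dv$. The entropy production is $\mathscr{D}_\gamma(f)=-\int_{\mathbb{R}^d}\boldsymbol{L}_\gamma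 f\,\log\frac{f}{\mathcal{M}}\,dv$, equivalently, with $h=f/\mathcal{M}$, $$\mathscr{D}_\gamma(f)=\frac12\int_{\mathbb{R}^d\times\mathbb{R}^d\times\mathbb{S}^{d-1}}|v-v_*|^\gamma b(\cos\theta)\mathcal{M}(v)\mathcal{M}(v_* )(h(v')-h(v))\log\frac{h(v')}{h(v)}\,dv\,dv_*\,d\sigma\ \ge0 .$$
   Formalization: In the decay estimate the constants C_1 and λ_1 may also depend on H_p(f_0): at t=0 the bound would otherwise bound H(f_0|M) uniformly, which fails for normalised indicators of small balls. *)

theory Defs
  imports "HOL-Analysis.Analysis"
begin

section \<open>Surface measure on the unit sphere\<close>

text \<open>
  The library has no surface measure. We use the usual polar-coordinates definition: the surface
  measure of \<open>A\<close> is \<open>d\<close> times the Lebesgue measure of the punctured cone over \<open>A\<close> in the unit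
  ball. The underlying space is the unit sphere with its Borel sets.
\<close>

definition sphere_measure :: "'a::euclidean_space measure" where
  "sphere_measure = scale_measure (of_nat DIM('a))
     (distr (restrict_space lborel (ball 0 1 - {0})) (restrict_space borel (sphere 0 1))
        (\<lambda>x. x /\<^sub>R norm x))"

lemma space_sphere_measure: "space (sphere_measure :: 'a::euclidean_space measure) = sphere 0 1"
  by (simp add: sphere_measure_def space_restrict_space space_scale_measure)

lemma sets_sphere_measure [measurable_cong]:
  "sets (sphere_measure :: 'a::euclidean_space measure) = sets (restrict_space borel (sphere 0 1))"
  by (simp add: sphere_measure_def)

lemma emeasure_sphere_measure_sphere:
  "emeasure (sphere_measure :: 'a::euclidean_space measure) (sphere 0 1)
     = ennreal (real DIM('a) * unit_ball_vol (real DIM('a)))"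
proof -
  let ?B = "ball 0 1 - {0} :: 'a set" and ?S = "sphere 0 1 :: 'a set"
  have m: "(\<lambda>x::'a. x /\<^sub>R norm x) \<in> restrict_space lborel ?B \<rightarrow>\<^sub>M restrict_space borel ?S"
    by (rule measurable_restrict_space2) (auto simp: space_restrict_space
        intro!: measurable_restrict_space1)
  have S: "?S \<in> sets (restrict_space borel ?S)"
    by (simp add: sets_restrict_space_iff)
  have vimage: "(\<lambda>x::'a. x /\<^sub>R norm x) -` ?S \<inter> space (restrict_space lborel ?B) = ?B"
    by (auto simp: space_restrict_space)
  have "emeasure (restrict_space lborel ?B) ?B = emeasure lborel ?B"
    by (rule emeasure_restrict_space) auto
  also have "\<dots> = emeasure lborel (ball (0::'a) 1)"
  proof (rule emeasure_eq_AE)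
    have "AE x in lborel. x \<noteq> (0::'a)"
      by (rule AE_lborel_singleton)
    then show "AE x in lborel. x \<in> ?B \<longleftrightarrow> x \<in> ball (0::'a) 1"
      by eventually_elim auto
  qed auto
  also have "\<dots> = ennreal (unit_ball_vol (real DIM('a)))"
    by (subst emeasure_ball) auto
  finally have vol: "emeasure (restrict_space lborel ?B) ?B = ennreal (unit_ball_vol (real DIM('a)))" .
  show ?thesis
    unfolding sphere_measure_def emeasure_scale_measure emeasure_distr[OF m S] vimage vol
    by (simp add: ennreal_mult ennreal_of_nat_eq_real_of_nat)
qed


section \<open>The linear Boltzmann operator\<close>

definition maxwellian :: "'a::euclidean_space \<Rightarrow> real" where
  "maxwellian v = (2 * pi) powr (- real DIM('a) / 2) * exp (- (norm v)\<^sup>2 / 2)"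

definition post :: "'a::euclidean_space \<Rightarrow> 'a \<Rightarrow> 'a \<Rightarrow> 'a" where
  "post v w \<sigma> = (1/2) *\<^sub>R (v + w) + (norm (v - w) / 2) *\<^sub>R \<sigma>"

definition post_star :: "'a::euclidean_space \<Rightarrow> 'a \<Rightarrow> 'a \<Rightarrow> 'a" where
  "post_star v w \<sigma> = (1/2) *\<^sub>R (v + w) - (norm (v - w) / 2) *\<^sub>R \<sigma>"

definition cos_dev :: "'a::euclidean_space \<Rightarrow> 'a \<Rightarrow> 'a \<Rightarrow> real" where
  "cos_dev v w \<sigma> = ((v - w) /\<^sub>R norm (v - w)) \<bullet> \<sigma>"

text \<open>
  Only the values of \<open>b\<close> on \<open>[-1,1]\<close> matter. The normalisation is
  the integral of \<open>b (cos \<theta>)\<close> over the sphere, the angle being measured from an arbitrary unit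
  vector \<open>e\<close>; by rotation invariance the value does not depend on \<open>e\<close>.
\<close>

definition angular_kernel :: "'a::euclidean_space itself \<Rightarrow> (real \<Rightarrow> real) \<Rightarrow> bool" where
  "angular_kernel _ b \<longleftrightarrow>
     b \<in> borel_measurable (restrict_space borel {-1..1}) \<and>
     (\<forall>x\<in>{-1..1}. 0 \<le> b x) \<and>
     (\<forall>x\<in>{-1..1}. b (- x) = b x) \<and>
     (\<forall>e::'a. norm e = 1 \<longrightarrow> (\<integral>\<sigma>. b (e \<bullet> \<sigma>) \<partial>sphere_measure) = 1)"

definition boltzmann_op ::
    "real \<Rightarrow> (real \<Rightarrow> real) \<Rightarrow> ('a::euclidean_space \<Rightarrow> real) \<Rightarrow> 'a \<Rightarrow> real" where
  "boltzmann_op \<gamma> b f v =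
     (\<integral>(w, \<sigma>). norm (v - w) powr \<gamma> * b (cos_dev v w \<sigma>) *
        (f (post v w \<sigma>) * maxwellian (post_star v w \<sigma>) - f v * maxwellian w)
      \<partial>(lborel \<Otimes>\<^sub>M sphere_measure))"


section \<open>Semigroups on L1 and solutions\<close>

text \<open>
  Elements of L1 are represented by Borel functions that are integrable with respect to
  Lebesgue measure, and identities between them are identities almost everywhere.
\<close>

definition L1_norm :: "('a::euclidean_space \<Rightarrow> real) \<Rightarrow> real" where
  "L1_norm f = (\<integral>v. \<bar>f v\<bar> \<partial>lborel)"

definition C0_semigroup_L1 ::
    "(real \<Rightarrow> ('a::euclidean_space \<Rightarrow> real) \<Rightarrow> 'a \<Rightarrow> real) \<Rightarrow> bool" where
  "C0_semigroup_L1 U \<longleftrightarrow>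
     (\<forall>t\<ge>0. \<forall>f. integrable lborel f \<longrightarrow> integrable lborel (U t f)) \<and>
     (\<forall>t\<ge>0. \<forall>f g \<alpha> \<beta>. integrable lborel f \<longrightarrow> integrable lborel g \<longrightarrow>
        (AE v in lborel. U t (\<lambda>x. \<alpha> * f x + \<beta> * g x) v = \<alpha> * U t f v + \<beta> * U t g v)) \<and>
     (\<forall>t\<ge>0. \<exists>B. \<forall>f. integrable lborel f \<longrightarrow> L1_norm (U t f) \<le> B * L1_norm f) \<and>
     (\<forall>f. integrable lborel f \<longrightarrow> (AE v in lborel. U 0 f v = f v)) \<and>
     (\<forall>s\<ge>0. \<forall>t\<ge>0. \<forall>f. integrable lborel f \<longrightarrow>
        (AE v in lborel. U (s + t) f v = U s (U t f) v)) \<and>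
     (\<forall>f. integrable lborel f \<longrightarrow>
        ((\<lambda>t. L1_norm (\<lambda>v. U t f v - f v)) \<longlongrightarrow> 0) (at_right 0))"

text \<open>The generator is \<open>A\<close>, with all of L1 as its domain (as for every bounded generator).\<close>

definition generates_L1 ::
    "(('a::euclidean_space \<Rightarrow> real) \<Rightarrow> 'a \<Rightarrow> real) \<Rightarrow>
     (real \<Rightarrow> ('a \<Rightarrow> real) \<Rightarrow> 'a \<Rightarrow> real) \<Rightarrow> bool" where
  "generates_L1 A U \<longleftrightarrow>
     C0_semigroup_L1 U \<and>
     (\<forall>f. integrable lborel f \<longrightarrow>
        integrable lborel (A f) \<and>
        ((\<lambda>t. L1_norm (\<lambda>v. (U t f v - f v) / t - A f v)) \<longlongrightarrow> 0) (at_right 0))"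

definition boltzmann_solution ::
    "real \<Rightarrow> (real \<Rightarrow> real) \<Rightarrow> ('a::euclidean_space \<Rightarrow> real) \<Rightarrow> (real \<Rightarrow> 'a \<Rightarrow> real) \<Rightarrow> bool" where
  "boltzmann_solution \<gamma> b f0 f \<longleftrightarrow>
     (\<exists>U. generates_L1 (boltzmann_op \<gamma> b) U \<and>
       (\<forall>t\<ge>0. integrable lborel (f t) \<and> (AE v in lborel. f t v = U t f0 v)))"


section \<open>Entropy and entropy production\<close>

text \<open>Points with \<open>f v = 0\<close> contribute \<open>0\<close> to the relative entropy, since \<open>ln 0 = 0\<close>.\<close>

definition entropy_density :: "('a::euclidean_space \<Rightarrow> real) \<Rightarrow> 'a \<Rightarrow> real" where
  "entropy_density f v = f v * ln (f v / maxwellian v)"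

definition rel_entropy :: "('a::euclidean_space \<Rightarrow> real) \<Rightarrow> real" where
  "rel_entropy f = (\<integral>v. entropy_density f v \<partial>lborel)"

definition entropy_production ::
    "real \<Rightarrow> (real \<Rightarrow> real) \<Rightarrow> ('a::euclidean_space \<Rightarrow> real) \<Rightarrow> real" where
  "entropy_production \<gamma> b f =
     - (\<integral>v. boltzmann_op \<gamma> b f v * ln (f v / maxwellian v) \<partial>lborel)"

definition Hp_density :: "real \<Rightarrow> ('a::euclidean_space \<Rightarrow> real) \<Rightarrow> 'a \<Rightarrow> real" where
  "Hp_density p f v = maxwellian v powr (1 - p) * f v powr p"

definition Hp_entropy :: "real \<Rightarrow> ('a::euclidean_space \<Rightarrow> real) \<Rightarrow> real" where
  "Hp_entropy p f = (\<integral>v. Hp_density p f v \<partial>lborel)"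

definition initial_datum :: "real \<Rightarrow> ('a::euclidean_space \<Rightarrow> real) \<Rightarrow> bool" where
  "initial_datum p f0 \<longleftrightarrow>
     integrable lborel f0 \<and>
     (AE v in lborel. 0 \<le> f0 v) \<and>
     (\<integral>v. f0 v \<partial>lborel) = 1 \<and>
     integrable lborel (\<lambda>v. \<bar>f0 v\<bar> powr p) \<and>
     integrable lborel (Hp_density p f0)"

end

theory Submission
  imports "HOL-Probability.Distributions" Defs
begin

text \<open>
  In terms of \<open>h = f / M\<close>, an explicit Euler step \<open>f + \<tau> L f\<close> is a reversible Markov step. Let the
  collisions with \<open>norm (v - w) \<le> R\<close> happen at unit rate. As \<open>b\<close> is even, the post-collisional velocities
  \<open>v'\<close> and \<open>w'\<close> of a pair with joint density \<open>h v\<close> relative to the Maxwellian are exchangeable up to the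
  pairs further apart than \<open>R\<close>, and subadditivity of the entropy over the two marginals shows that such a
  step halves the entropy up to an error of order \<open>exp (- \<kappa> R\<^sup>2)\<close>, controlled by the weighted \<open>p\<close>-norm,
  which never increases. Since \<open>norm (v - w) powr \<gamma> \<ge> R powr \<gamma>\<close> for those collisions, convexity turns this
  into an entropy drop of \<open>\<tau> R powr \<gamma> / 2 (H - T exp (- \<kappa> R\<^sup>2))\<close> per Euler step.

  By Gibbs' inequality the entropy production of \<open>f\<close> is at least the entropy drop of one Euler step
  divided by \<open>\<tau>\<close>; and the flow is the \<open>L1\<close> limit of Euler iterates. Both claims follow by
  choosing \<open>R\<close>. The lower bound on \<open>b\<close> only serves to bound \<open>f t\<close> below by a Gaussian for \<open>t > 0\<close>, which makes
  \<open>ln (f / M)\<close> integrable against \<open>L f\<close>.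
\<close>

text \<open>The obstacle is that \<open>norm (v - w) powr \<gamma>\<close> tends to zero for large
  relative velocities, so the rate has no lower bound uniform over all pairs. Cutting off at
  \<open>R\<close> costs the factor \<open>R powr \<gamma>\<close> and leaves an error that is
  Gaussian in \<open>R\<close>. A unit-rate step halves the entropy because only one member of the
  pair is perturbed: relative to the product Maxwellian the pair carries exactly the entropy of
  \<open>h\<close>, collisions preserve that product, and two equal marginals have to share this
  amount. The entropy inequalities are proved by duality with nonnegative test functions, so that
  the integrals live in \<open>ennreal\<close> and infinite values do no harm. Positivity and mass
  conservation of the flow are also inherited from the Euler iterates. Their steps vary in size,
  because the time on which the generator approximates the semigroup depends on the function. For
  the production, \<open>R\<^sup>2\<close> is proportional to a logarithm of the inverse entropy,
  which makes the error at most half of the entropy; for the decay, \<open>R\<close> is the power of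
  \<open>t\<close> with \<open>t * R powr \<gamma> = R\<^sup>2\<close>.\<close>

lemma nn_integral_lborel_affine:
  fixes t :: "'a::euclidean_space"
  assumes [measurable]: "f \<in> borel_measurable borel" and c: "c \<noteq> 0"
  shows "(\<integral>\<^sup>+x. f x \<partial>lborel) = ennreal (\<bar>c\<bar> ^ DIM('a)) * (\<integral>\<^sup>+x. f (t + c *\<^sub>R x) \<partial>lborel)"
  by (subst lborel_affine[OF c, of t])
     (simp add: nn_integral_density nn_integral_distr nn_integral_cmult)

lemma nn_integral_lborel_translate:
  fixes t :: "'a::euclidean_space"
  assumes "f \<in> borel_measurable borel"
  shows "(\<integral>\<^sup>+x. f (t + x) \<partial>lborel) = (\<integral>\<^sup>+x. f x \<partial>lborel)"
  using nn_integral_lborel_affine[OF assms, of 1 t] by simp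

lemma nn_integral_lborel_reflect:
  fixes t :: "'a::euclidean_space"
  assumes "f \<in> borel_measurable borel"
  shows "(\<integral>\<^sup>+x. f (t - x) \<partial>lborel) = (\<integral>\<^sup>+x. f x \<partial>lborel)"
  using nn_integral_lborel_affine[OF assms, of "-1" t] by simp

subsection \<open>The surface measure and polar coordinates\<close>

lemma measurable_unit_vector_sphere:
  "(\<lambda>x::'a::euclidean_space. x /\<^sub>R norm x) \<in> restrict_space lborel (ball 0 1 - {0}) \<rightarrow>\<^sub>M restrict_space borel (sphere 0 1)"
  by (rule measurable_restrict_space2)
     (auto simp: space_restrict_space intro!: measurable_restrict_space1)

lemma measurable_sphere_id: "(\<lambda>x. x) \<in> (sphere_measure :: 'a::euclidean_space measure) \<rightarrow>\<^sub>M borel"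
  by (simp add: measurable_cong_sets[OF sets_sphere_measure refl] measurable_restrict_space1)

text \<open>Moved to the whole space, so that integrands need only be Borel measurable.\<close>

definition sph :: "'a::euclidean_space measure" where
  "sph = distr sphere_measure borel (\<lambda>x. x)"

lemma sets_sph [simp, measurable_cong]: "sets sph = sets borel"
  by (simp add: sph_def)

lemma space_sph [simp]: "space sph = UNIV"
  by (simp add: sph_def)

lemma nn_integral_sphere_measure:
  "f \<in> borel_measurable borel \<Longrightarrow> (\<integral>\<^sup>+\<sigma>. f \<sigma> \<partial>sphere_measure) = (\<integral>\<^sup>+\<sigma>. f \<sigma> \<partial>sph)"
  unfolding sph_def by (subst nn_integral_distr[OF measurable_sphere_id]) simp_all

lemma AE_sph_norm: "AE \<sigma> in sph. norm \<sigma> = 1"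
  unfolding sph_def by (subst AE_distr_iff[OF measurable_sphere_id]) (auto simp: space_sphere_measure)

lemma nn_integral_sph:
  fixes f :: "'a::euclidean_space \<Rightarrow> ennreal"
  assumes f [measurable]: "f \<in> borel_measurable borel"
  shows "(\<integral>\<^sup>+\<sigma>. f \<sigma> \<partial>sph) =
    of_nat DIM('a) * (\<integral>\<^sup>+x. f (x /\<^sub>R norm x) * indicator (ball 0 1 - {0}) x \<partial>lborel)"
proof -
  have "(\<integral>\<^sup>+\<sigma>. f \<sigma> \<partial>sph) = (\<integral>\<^sup>+\<sigma>. f \<sigma> \<partial>sphere_measure)"
    by (rule nn_integral_sphere_measure[OF f, symmetric])
  also have "\<dots> = of_nat DIM('a) *
     (\<integral>\<^sup>+\<sigma>. f \<sigma> \<partial>distr (restrict_space lborel (ball 0 1 - {0})) (restrict_space borel (sphere 0 1)) (\<lambda>x::'a. x /\<^sub>R norm x))"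
    unfolding sphere_measure_def by (rule nn_integral_scale_measure) (simp add: f measurable_restrict_space1)
  also have "(\<integral>\<^sup>+\<sigma>. f \<sigma> \<partial>distr (restrict_space lborel (ball 0 1 - {0})) (restrict_space borel (sphere 0 1)) (\<lambda>x::'a. x /\<^sub>R norm x))
     = (\<integral>\<^sup>+x. f (x /\<^sub>R norm x) \<partial>restrict_space lborel (ball 0 1 - {0}))"
    by (rule nn_integral_distr[OF measurable_unit_vector_sphere]) (simp add: f measurable_restrict_space1)
  also have "\<dots> = (\<integral>\<^sup>+x. f (x /\<^sub>R norm x) * indicator (ball 0 1 - {0}) x \<partial>lborel)"
    by (rule nn_integral_restrict_space) simp
  finally show ?thesis .
qed

lemma finite_measure_sph: "finite_measure (sph :: 'a::euclidean_space measure)"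
proof (rule finite_measureI)
  have "emeasure (sph :: 'a measure) (space sph) = emeasure (sphere_measure :: 'a measure) (sphere 0 1)"
    by (simp add: sph_def emeasure_distr[OF measurable_sphere_id] space_sphere_measure)
  then show "emeasure (sph :: 'a measure) (space sph) \<noteq> \<infinity>"
    by (simp add: emeasure_sphere_measure_sphere)
qed

interpretation sphere: finite_measure "sph :: 'a::euclidean_space measure"
  by (rule finite_measure_sph)

text \<open>The cone over a set and the cone over its antipodal set are exchanged by the reflection
  of Lebesgue measure at the origin.\<close>

lemma nn_integral_sph_uminus:
  fixes f :: "'a::euclidean_space \<Rightarrow> ennreal"
  assumes [measurable]: "f \<in> borel_measurable borel"
  shows "(\<integral>\<^sup>+\<sigma>. f (- \<sigma>) \<partial>sph) = (\<integral>\<^sup>+\<sigma>. f \<sigma> \<partial>sph)"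
proof -
  have "(\<integral>\<^sup>+x. f (- (x /\<^sub>R norm x)) * indicator (ball 0 1 - {0}) x \<partial>lborel) =
        (\<integral>\<^sup>+x. f (x /\<^sub>R norm x) * indicator (ball 0 1 - {0}) x \<partial>lborel)"
    by (subst nn_integral_lborel_affine[of _ "-1" 0]) (auto simp: indicator_def if_distrib cong: if_cong)
  then show ?thesis by (simp add: nn_integral_sph)
qed

text \<open>At the origin an arbitrary basis vector is taken, so that the value is always a unit
  vector and \<open>norm u *\<^sub>R unit_dir u = u\<close> holds without exception.\<close>

definition unit_dir :: "'a::euclidean_space \<Rightarrow> 'a" where
  "unit_dir u = (if u = 0 then (SOME i. i \<in> Basis) else u /\<^sub>R norm u)"

lemma norm_unit_dir [simp]: "norm (unit_dir u) = 1"
  by (auto simp: unit_dir_def some_in_eq)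

lemma norm_scaleR_unit_dir [simp]: "norm u *\<^sub>R unit_dir u = u"
  by (simp add: unit_dir_def)

lemma unit_dir_scaleR: "0 < r \<Longrightarrow> unit_dir (r *\<^sub>R u) = unit_dir u"
  by (auto simp: unit_dir_def)

lemma measurable_unit_dir [measurable]: "unit_dir \<in> borel \<rightarrow>\<^sub>M (borel :: 'a::euclidean_space measure)"
  unfolding unit_dir_def[abs_def] by measurable

lemma emeasure_sph_cone:
  fixes B :: "'a::euclidean_space set"
  assumes B[measurable]: "B \<in> sets borel"
  shows "emeasure sph B = of_nat DIM('a) * emeasure lborel {u. norm u < 1 \<and> unit_dir u \<in> B}"
proof -
  have "emeasure sph B = (\<integral>\<^sup>+\<sigma>. indicator B \<sigma> \<partial>sph)"
    using B by simp
  also have "\<dots> = of_nat DIM('a) * (\<integral>\<^sup>+x. indicator B (x /\<^sub>R norm x) * indicator (ball 0 1 - {0}) x \<partial>lborel)"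
    by (rule nn_integral_sph) simp
  also have "(\<integral>\<^sup>+x. indicator B (x /\<^sub>R norm x) * indicator (ball 0 1 - {0}) x \<partial>lborel)
     = (\<integral>\<^sup>+x. indicator {u. norm u < 1 \<and> unit_dir u \<in> B} x \<partial>(lborel :: 'a measure))"
    by (rule nn_integral_cong_AE, use AE_lborel_singleton[of "0::'a"] in eventually_elim)
       (auto simp: unit_dir_def split: split_indicator)
  also have "\<dots> = emeasure lborel {u. norm u < 1 \<and> unit_dir u \<in> B}"
    by (rule nn_integral_indicator) simp
  finally show ?thesis .
qed

lemma emeasure_cone_scale:
  fixes B :: "'a::euclidean_space set"
  assumes [measurable]: "B \<in> sets borel" and r: "0 < r"
  shows "emeasure lborel {u. norm u < r \<and> unit_dir u \<in> B} =
         ennreal (r ^ DIM('a)) * emeasure lborel {u. norm u < 1 \<and> unit_dir u \<in> B}"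
proof -
  have "emeasure lborel {u. norm u < r \<and> unit_dir u \<in> B} = (\<integral>\<^sup>+u. indicator {u. norm u < r \<and> unit_dir u \<in> B} u \<partial>lborel)"
    by (rule nn_integral_indicator[symmetric]) simp
  also have "\<dots> = ennreal (r ^ DIM('a)) * (\<integral>\<^sup>+u. indicator {u. norm u < r \<and> unit_dir u \<in> B} (0 + r *\<^sub>R u) \<partial>lborel)"
    using r by (subst nn_integral_lborel_affine[of _ r 0]) auto
  also have "(\<integral>\<^sup>+u. indicator {u. norm u < r \<and> unit_dir u \<in> B} (0 + r *\<^sub>R u) \<partial>lborel) =
             (\<integral>\<^sup>+u. indicator {u. norm u < 1 \<and> unit_dir u \<in> B} u \<partial>lborel)"
    using r by (intro nn_integral_cong) (auto simp: unit_dir_scaleR split: split_indicator)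
  also have "\<dots> = emeasure lborel {u. norm u < 1 \<and> unit_dir u \<in> B}"
    by (rule nn_integral_indicator) simp
  finally show ?thesis .
qed

section \<open>Polar coordinates as a product of measures\<close>

text \<open>This is the measure with density r^(d-1) on the positive half-line, obtained as the
  image of Lebesgue measure under the norm, divided by the total mass of the sphere. In this form no
  density has to be computed.\<close>

definition radial_measure :: "'a::euclidean_space itself \<Rightarrow> real measure" where
  "radial_measure _ = scale_measure (1 / ennreal (real DIM('a) * unit_ball_vol (real DIM('a)))) (distr lborel borel (norm :: 'a \<Rightarrow> real))"

lemma sets_radial_measure [simp, measurable_cong]: "sets (radial_measure TYPE('a::euclidean_space)) = sets borel"
  by (simp add: radial_measure_def)

lemma emeasure_radial_lessThan:
  "emeasure (radial_measure TYPE('a::euclidean_space)) {..<r} = ennreal ((max 0 r) ^ DIM('a) / DIM('a))"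
proof -
  have V: "unit_ball_vol (real DIM('a)) \<noteq> 0" using unit_ball_vol_pos[of "real DIM('a)"] by linarith
  have "emeasure (radial_measure TYPE('a)) {..<r} =
     1 / ennreal (real DIM('a) * unit_ball_vol (real DIM('a))) * emeasure lborel (norm -` {..<r} :: 'a set)"
    by (simp add: radial_measure_def emeasure_distr)
  also have "(norm -` {..<r} :: 'a set) = ball 0 r" by auto
  also have "emeasure lborel (ball (0::'a) r) = ennreal (unit_ball_vol (real DIM('a)) * (max 0 r) ^ DIM('a))"
    by (cases "r \<ge> 0") (auto simp: emeasure_ball max_def ball_empty)
  also have "1 / ennreal (real DIM('a) * unit_ball_vol (real DIM('a))) * \<dots> =
     ennreal ((max 0 r) ^ DIM('a) / DIM('a))"
    using V by (simp add: divide_ennreal_def inverse_ennreal ennreal_mult[symmetric] field_simps)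
  finally show ?thesis .
qed

lemma sigma_finite_radial_measure: "sigma_finite_measure (radial_measure TYPE('a::euclidean_space))"
proof (rule sigma_finite_measure.intro)
  show "\<exists>A. countable A \<and> A \<subseteq> sets (radial_measure TYPE('a)) \<and>
            \<Union> A = space (radial_measure TYPE('a)) \<and>
            (\<forall>a\<in>A. emeasure (radial_measure TYPE('a)) a \<noteq> \<infinity>)"
  proof (intro exI[of _ "range (\<lambda>n::nat. {..<real n})"] conjI)
    have "x \<in> \<Union> (range (\<lambda>n::nat. {..<real n}))" for x :: real
      using reals_Archimedean2[of x] by auto
    then show "\<Union> (range (\<lambda>n::nat. {..<real n})) = space (radial_measure TYPE('a))"
      by (auto simp: radial_measure_def space_scale_measure)
  qed (auto simp: emeasure_radial_lessThan)
qed

interpretation radial: sigma_finite_measure "radial_measure TYPE('a::euclidean_space)"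
  by (rule sigma_finite_radial_measure)

text \<open>It suffices to compare rectangles. For a fixed set \<open>B\<close> of directions both
  sides are measures in the radial set, and they agree on the half-lines below \<open>r\<close>
  because a cone of height \<open>r\<close> has \<open>r ^ DIM('a)\<close> times the volume of the
  cone of height one. Half-lines are stable under intersection and generate the Borel sets.\<close>

lemma polar_measure:
  "radial_measure TYPE('a) \<Otimes>\<^sub>M sph =
    distr lborel (borel \<Otimes>\<^sub>M sph) (\<lambda>u::'a::euclidean_space. (norm u, unit_dir u))"
proof (rule pair_measure_eqI)
  fix A :: "real set" and B :: "'a set"
  assume A: "A \<in> sets (radial_measure TYPE('a))" and B: "B \<in> sets (sph :: 'a measure)"
  have Bb[measurable]: "B \<in> sets borel" using B by simp
  let ?N = "distr (restrict_space lborel {u. unit_dir u \<in> B}) borel norm"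
  let ?D = "scale_measure (emeasure sph B) (radial_measure TYPE('a))"
  have N: "emeasure ?N X = emeasure lborel {u. norm u \<in> X \<and> unit_dir u \<in> B}" if [measurable]: "X \<in> sets borel" for X
  proof -
    have "emeasure ?N X = emeasure (restrict_space lborel {u. unit_dir u \<in> B}) (norm -` X \<inter> {u. unit_dir u \<in> B})"
      by (subst emeasure_distr) (auto simp: space_restrict_space intro!: measurable_restrict_space1)
    also have "\<dots> = emeasure lborel (norm -` X \<inter> {u. unit_dir u \<in> B})"
      by (rule emeasure_restrict_space) auto
    also have "norm -` X \<inter> {u. unit_dir u \<in> B} = {u. norm u \<in> X \<and> unit_dir u \<in> B}" by auto
    finally show ?thesis .
  qed
  have fin: "emeasure sph B < \<infinity>"
    by (simp add: less_top[symmetric] sphere.emeasure_finite)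
  have less: "emeasure ?D {..<r} = emeasure ?N {..<r}" for r :: real
  proof (cases "r > 0")
    case True
    have *: "ennreal (r ^ DIM('a) / DIM('a)) * of_nat DIM('a) = ennreal (r ^ DIM('a))"
      using True by (simp add: ennreal_of_nat_eq_real_of_nat ennreal_mult[symmetric])
    have "emeasure ?N {..<r} = ennreal (r ^ DIM('a)) * emeasure lborel {u. norm u < 1 \<and> unit_dir u \<in> B}"
      using emeasure_cone_scale[OF Bb True] N[of "{..<r}"] by simp
    also have "\<dots> = ennreal (r ^ DIM('a) / DIM('a)) * emeasure sph B"
      unfolding emeasure_sph_cone[OF Bb] *[symmetric] by (simp add: mult_ac)
    finally show ?thesis
      using True by (simp add: emeasure_radial_lessThan mult_ac)
  next
    case False
    have "emeasure ?N {..<r} = emeasure lborel {u. norm u \<in> {..<r} \<and> unit_dir u \<in> B}"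
      by (rule N) simp
    also have "{u. norm u \<in> {..<r} \<and> unit_dir u \<in> B} = {}"
      using False by (auto dest: order.strict_trans1[OF norm_ge_zero])
    finally have "emeasure ?N {..<r} = 0" by simp
    then show ?thesis using False by (simp add: emeasure_radial_lessThan max_def)
  qed
  have "?D = ?N"
  proof (rule measure_eqI_generator_eq[where E = "range lessThan" and \<Omega> = UNIV and A = "\<lambda>n. {..<real n}"])
    show "Int_stable (range lessThan :: real set set)"
    proof -
      have "{..<a} \<inter> {..<b} = {..<min a b}" for a b :: real by auto
      then show ?thesis by (auto simp: Int_stable_def)
    qed
    show "emeasure ?D X = emeasure ?N X" if "X \<in> range lessThan" for X
      using that less by auto
    show "(\<Union>i. {..<real i}) = UNIV"
      using reals_Archimedean2 by auto
    show "emeasure ?D {..<real n} \<noteq> \<infinity>" for n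
      using fin by (auto simp: emeasure_radial_lessThan ennreal_mult_eq_top_iff)
  qed (auto simp: borel_Iio)
  then have "emeasure ?D A = emeasure ?N A" by simp
  then show "emeasure (radial_measure TYPE('a)) A * emeasure sph B =
     emeasure (distr lborel (borel \<Otimes>\<^sub>M sph) (\<lambda>u::'a. (norm u, unit_dir u))) (A \<times> B)"
    using A B N[of A] by (subst emeasure_distr) (auto simp: mult.commute vimage_def)
qed (auto intro: sphere.sigma_finite_measure_axioms radial.sigma_finite_measure_axioms)

lemma nn_integral_polar:
  fixes f :: "real \<times> 'a::euclidean_space \<Rightarrow> ennreal"
  assumes [measurable]: "f \<in> borel_measurable borel"
  shows "(\<integral>\<^sup>+u. f (norm u, unit_dir u) \<partial>lborel) = (\<integral>\<^sup>+r. \<integral>\<^sup>+\<sigma>. f (r, \<sigma>) \<partial>sph \<partial>radial_measure TYPE('a))"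
proof -
  have [measurable]: "f \<in> borel_measurable (borel \<Otimes>\<^sub>M sph)"
    using assms by (simp add: measurable_cong_sets[OF sets_pair_measure_cong[OF refl sets_sph] refl] borel_prod)
  have "(\<integral>\<^sup>+u. f (norm u, unit_dir u) \<partial>lborel) =
        (\<integral>\<^sup>+x. f x \<partial>distr lborel (borel \<Otimes>\<^sub>M sph) (\<lambda>u::'a. (norm u, unit_dir u)))"
    by (subst nn_integral_distr) simp_all
  also have "\<dots> = (\<integral>\<^sup>+x. f x \<partial>(radial_measure TYPE('a) \<Otimes>\<^sub>M sph))"
    by (simp add: polar_measure)
  also have "\<dots> = (\<integral>\<^sup>+r. \<integral>\<^sup>+\<sigma>. f (r, \<sigma>) \<partial>sph \<partial>radial_measure TYPE('a))"
    by (subst sphere.nn_integral_fst[symmetric])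
       (simp_all add: polar_measure)
  finally show ?thesis .
qed

text \<open>At a fixed radius, the direction of \<open>u\<close> and \<open>\<sigma>\<close> are
  independent with the same law, so they may be exchanged. This replaces the Jacobian computation
  for the passage from velocities before a collision to velocities after it.\<close>

lemma nn_integral_swap_directions:
  fixes G :: "'a::euclidean_space \<Rightarrow> 'a \<Rightarrow> ennreal"
  assumes [measurable]: "case_prod G \<in> borel_measurable (borel \<Otimes>\<^sub>M borel)"
  shows "(\<integral>\<^sup>+u. \<integral>\<^sup>+\<sigma>. G u \<sigma> \<partial>sph \<partial>lborel) =
         (\<integral>\<^sup>+u. \<integral>\<^sup>+\<sigma>. G (norm u *\<^sub>R \<sigma>) (unit_dir u) \<partial>sph \<partial>lborel)"
proof -
  have m1: "(\<lambda>(r, e). \<integral>\<^sup>+\<sigma>. G (r *\<^sub>R e) \<sigma> \<partial>sph) \<in> borel_measurable (borel \<Otimes>\<^sub>M (borel :: 'a measure))"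
    by measurable
  have m2: "(\<lambda>(r, e). \<integral>\<^sup>+\<sigma>. G (r *\<^sub>R \<sigma>) e \<partial>sph) \<in> borel_measurable (borel \<Otimes>\<^sub>M (borel :: 'a measure))"
    by measurable
  have "(\<integral>\<^sup>+u. \<integral>\<^sup>+\<sigma>. G u \<sigma> \<partial>sph \<partial>lborel) =
    (\<integral>\<^sup>+r. \<integral>\<^sup>+e. \<integral>\<^sup>+\<sigma>. G (r *\<^sub>R e) \<sigma> \<partial>sph \<partial>sph \<partial>radial_measure TYPE('a))"
    using nn_integral_polar[of "\<lambda>(r, e). \<integral>\<^sup>+\<sigma>. G (r *\<^sub>R e) \<sigma> \<partial>sph"] m1
    by (simp add: borel_prod)
  also have "\<dots> = (\<integral>\<^sup>+r. \<integral>\<^sup>+e. \<integral>\<^sup>+\<sigma>. G (r *\<^sub>R \<sigma>) e \<partial>sph \<partial>sph \<partial>radial_measure TYPE('a))"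
  proof (rule nn_integral_cong)
    fix r :: real
    interpret pair_sigma_finite "sph :: 'a measure" "sph :: 'a measure" ..
    show "(\<integral>\<^sup>+e. \<integral>\<^sup>+\<sigma>. G (r *\<^sub>R e) \<sigma> \<partial>sph \<partial>sph) = (\<integral>\<^sup>+e. \<integral>\<^sup>+\<sigma>. G (r *\<^sub>R \<sigma>) e \<partial>sph \<partial>sph)"
      by (rule Fubini'[symmetric]) measurable
  qed
  also have "\<dots> = (\<integral>\<^sup>+u. \<integral>\<^sup>+\<sigma>. G (norm u *\<^sub>R \<sigma>) (unit_dir u) \<partial>sph \<partial>lborel)"
    using nn_integral_polar[of "\<lambda>(r, e). \<integral>\<^sup>+\<sigma>. G (r *\<^sub>R \<sigma>) e \<partial>sph"] m2
    by (simp add: borel_prod)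
  finally show ?thesis .
qed

subsection \<open>The Maxwellian measure\<close>

lemma nn_integral_gaussian_real:
  assumes s: "0 < s"
  shows "(\<integral>\<^sup>+x. ennreal (exp (- s * x\<^sup>2)) \<partial>(lborel :: real measure)) = ennreal (sqrt (pi / s))"
proof -
  define \<sigma> where "\<sigma> = 1 / sqrt (2 * s)"
  have \<sigma>: "0 < \<sigma>" "2 * \<sigma>\<^sup>2 = 1 / s" using s by (auto simp: \<sigma>_def power_divide)
  interpret prob_space "density lborel (normal_density 0 \<sigma>)"
    using \<sigma>(1) by (rule prob_space_normal_density)
  have "(\<integral>\<^sup>+x. ennreal (normal_density 0 \<sigma> x) \<partial>lborel) = 1"
    using emeasure_space_1 by (simp add: emeasure_density)
  moreover have "ennreal (exp (- s * x\<^sup>2)) = ennreal (sqrt (pi / s)) * ennreal (normal_density 0 \<sigma> x)" for x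
  proof -
    have "2 * pi * \<sigma>\<^sup>2 = pi / s"
      using \<sigma>(2) s by (simp add: field_simps)
    moreover have "- x\<^sup>2 / (2 * \<sigma>\<^sup>2) = - s * x\<^sup>2"
      unfolding \<sigma>(2) by simp
    ultimately have "exp (- s * x\<^sup>2) = sqrt (pi / s) * normal_density 0 \<sigma> x"
      using s by (simp add: normal_density_def)
    then show ?thesis using s by (simp add: ennreal_mult')
  qed
  ultimately show ?thesis by (simp add: nn_integral_cmult)
qed

lemma nn_integral_gaussian:
  assumes s: "0 < s"
  shows "(\<integral>\<^sup>+x. ennreal (exp (- s * (norm x)\<^sup>2)) \<partial>(lborel :: 'a::euclidean_space measure)) = ennreal (sqrt (pi / s) ^ DIM('a))"
proof -
  have "(\<integral>\<^sup>+x. ennreal (exp (- s * (norm x)\<^sup>2)) \<partial>(lborel :: 'a measure)) =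
        (\<integral>\<^sup>+x. (\<Prod>b\<in>Basis. ennreal (exp (- s * (x \<bullet> b)\<^sup>2))) \<partial>(lborel :: 'a measure))"
  proof (rule nn_integral_cong)
    fix x :: 'a
    have "(norm x)\<^sup>2 = (\<Sum>b\<in>Basis. (x \<bullet> b)\<^sup>2)"
      unfolding power2_norm_eq_inner by (subst euclidean_inner) (simp add: power2_eq_square)
    then have "exp (- s * (norm x)\<^sup>2) = (\<Prod>b\<in>Basis. exp (- s * (x \<bullet> b)\<^sup>2))"
      by (simp add: exp_sum[symmetric] sum_distrib_left sum_negf)
    then show "ennreal (exp (- s * (norm x)\<^sup>2)) = (\<Prod>b\<in>Basis. ennreal (exp (- s * (x \<bullet> b)\<^sup>2)))"
      by (simp add: prod_ennreal)
  qed
  also have "\<dots> = (\<Prod>b\<in>(Basis :: 'a set). \<integral>\<^sup>+x. ennreal (exp (- s * x\<^sup>2)) \<partial>lborel)"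
    by (rule nn_integral_lborel_prod) auto
  also have "\<dots> = ennreal (sqrt (pi / s) ^ DIM('a))"
    using s by (subst nn_integral_gaussian_real[OF s]) (simp add: ennreal_power)
  finally show ?thesis .
qed

lemma maxwellian_pos [simp]: "0 < maxwellian v"
  by (simp add: maxwellian_def)

lemma maxwellian_nonneg [simp]: "0 \<le> maxwellian v"
  using maxwellian_pos[of v] by linarith

lemma maxwellian_neq_0 [simp]: "maxwellian v \<noteq> 0"
  using maxwellian_pos[of v] by linarith

lemma measurable_maxwellian [measurable]: "maxwellian \<in> borel_measurable (borel :: 'a::euclidean_space measure)"
  unfolding maxwellian_def[abs_def] by measurable

lemma maxwellian_le_1: "maxwellian (v :: 'a::euclidean_space) \<le> 1"
proof -
  have "(2 * pi) powr (- real DIM('a) / 2) \<le> (2 * pi) powr 0"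
    using pi_gt3 by (intro powr_mono) auto
  moreover have "exp (- (norm v)\<^sup>2 / 2) \<le> 1" by simp
  ultimately show ?thesis
    unfolding maxwellian_def by (intro mult_le_one) auto
qed

definition maxwell_measure :: "'a::euclidean_space measure" where
  "maxwell_measure = density lborel (\<lambda>v. ennreal (maxwellian v))"

lemma sets_maxwell_measure [simp, measurable_cong]: "sets maxwell_measure = sets borel"
  by (simp add: maxwell_measure_def)

lemma space_maxwell_measure [simp]: "space maxwell_measure = UNIV"
  by (simp add: maxwell_measure_def)

lemma nn_integral_maxwell:
  "f \<in> borel_measurable borel \<Longrightarrow> (\<integral>\<^sup>+v. f v \<partial>maxwell_measure) = (\<integral>\<^sup>+v. ennreal (maxwellian v) * f v \<partial>lborel)"
  by (simp add: maxwell_measure_def nn_integral_density)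

lemma nn_integral_maxwellian: "(\<integral>\<^sup>+v. ennreal (maxwellian v) \<partial>(lborel :: 'a::euclidean_space measure)) = 1"
proof -
  have "(\<integral>\<^sup>+v. ennreal (maxwellian v) \<partial>(lborel :: 'a measure)) =
     (\<integral>\<^sup>+v. ennreal ((2 * pi) powr (- real DIM('a) / 2)) * ennreal (exp (- (1/2) * (norm v)\<^sup>2)) \<partial>(lborel :: 'a measure))"
    by (simp add: maxwellian_def ennreal_mult)
  also have "\<dots> = ennreal ((2 * pi) powr (- real DIM('a) / 2)) * ennreal (sqrt (pi / (1/2)) ^ DIM('a))"
    by (subst nn_integral_cmult, simp, subst nn_integral_gaussian) simp_all
  also have "\<dots> = ennreal ((2 * pi) powr (- real DIM('a) / 2) * (2 * pi) powr (real DIM('a) / 2))"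
  proof -
    have "sqrt (pi / (1/2)) ^ DIM('a) = (2 * pi) powr (real DIM('a) / 2)"
      using powr_half_sqrt[of "2 * pi"] by (simp add: powr_realpow[symmetric] powr_half_sqrt[symmetric] powr_powr mult.commute)
    then show ?thesis by (simp add: ennreal_mult)
  qed
  also have "\<dots> = 1" by (simp add: powr_add[symmetric])
  finally show ?thesis .
qed

lemma prob_space_maxwell: "prob_space (maxwell_measure :: 'a::euclidean_space measure)"
  by (rule prob_spaceI) (simp add: maxwell_measure_def emeasure_density nn_integral_maxwellian)

interpretation maxwell: prob_space "maxwell_measure :: 'a::euclidean_space measure"
  by (rule prob_space_maxwell)

text \<open>The weight halves the Gaussian exponent, which doubles the variance and contributes a
  factor \<open>sqrt 2\<close> in each dimension.\<close>

lemma nn_integral_maxwell_exp: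
  "(\<integral>\<^sup>+v. ennreal (exp ((norm v)\<^sup>2 / 4)) \<partial>(maxwell_measure :: 'a::euclidean_space measure)) = ennreal (sqrt 2 ^ DIM('a))"
proof -
  have "(\<integral>\<^sup>+v. ennreal (exp ((norm v)\<^sup>2 / 4)) \<partial>(maxwell_measure :: 'a measure)) =
     (\<integral>\<^sup>+v. ennreal ((2 * pi) powr (- real DIM('a) / 2)) * ennreal (exp (- (1/4) * (norm v)\<^sup>2)) \<partial>(lborel :: 'a measure))"
    by (simp add: nn_integral_maxwell)
       (intro nn_integral_cong, simp add: maxwellian_def ennreal_mult[symmetric] exp_add[symmetric])
  also have "\<dots> = ennreal ((2 * pi) powr (- real DIM('a) / 2)) * ennreal (sqrt (pi / (1/4)) ^ DIM('a))"
    by (subst nn_integral_cmult, simp, subst nn_integral_gaussian) simp_all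
  also have "\<dots> = ennreal (sqrt 2 ^ DIM('a) * ((2 * pi) powr (- real DIM('a) / 2) * (2 * pi) powr (real DIM('a) / 2)))"
  proof -
    have "sqrt (pi / (1/4)) ^ DIM('a) = sqrt 2 ^ DIM('a) * sqrt (2 * pi) ^ DIM('a)"
      by (simp add: power_mult_distrib[symmetric] real_sqrt_mult[symmetric] mult.commute)
    also have "sqrt (2 * pi) ^ DIM('a) = (2 * pi) powr (real DIM('a) / 2)"
      by (simp add: powr_realpow[symmetric] powr_half_sqrt[symmetric] powr_powr mult.commute)
    finally show ?thesis by (simp add: ennreal_mult[symmetric] mult_ac)
  qed
  also have "\<dots> = ennreal (sqrt 2 ^ DIM('a))" by (simp add: powr_add[symmetric])
  finally show ?thesis .
qed

section \<open>Boundedness of the collision frequency\<close>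

lemma ennreal_le_suminf: "f k \<le> (\<Sum>k. f k)" for f :: "nat \<Rightarrow> ennreal"
  using sum_le_suminf[of f "{k}"] by simp

text \<open>Dyadic shells: for norms between 2^(-k-1) and 2^(-k) the integrand is at most
  2^(-(k+1)\<gamma>), and the ball of radius 2^(-k) has volume proportional to 2^(-kd). The products
  form a geometric series whose ratio \<open>q\<close> is below one exactly because \<gamma> >
  -d.\<close>

lemma nn_integral_norm_powr_unit_ball:
  assumes \<gamma>: "- real DIM('a::euclidean_space) < \<gamma>" "\<gamma> < 0"
  shows "(\<integral>\<^sup>+u. ennreal (norm u powr \<gamma>) * indicator {u. norm u < 1} u \<partial>(lborel :: 'a measure)) < \<infinity>"
proof -
  define V where "V = unit_ball_vol (real DIM('a))"
  have V: "0 \<le> V" by (simp add: V_def)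
  define q where "q = 2 powr (- (real DIM('a) + \<gamma>))"
  have q: "0 < q" "q < 1"
    using \<gamma> powr_less_mono[of "- (real DIM('a) + \<gamma>)" 0 2] by (simp_all add: q_def)
  define T :: "nat \<Rightarrow> 'a \<Rightarrow> ennreal"
    where "T k u = ennreal (2 powr (- (real k + 1) * \<gamma>)) * indicator (cball 0 (2 powr - real k)) u" for k u
  have [measurable]: "T k \<in> borel_measurable borel" for k
    unfolding T_def by (intro borel_measurable_times_ennreal borel_measurable_const borel_measurable_indicator borel_closed closed_cball)
  have "(\<integral>\<^sup>+u. ennreal (norm u powr \<gamma>) * indicator {u. norm u < 1} u \<partial>(lborel :: 'a measure)) \<le> (\<integral>\<^sup>+u. (\<Sum>k. T k u) \<partial>lborel)"
  proof (rule nn_integral_mono)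
    fix u :: 'a
    show "ennreal (norm u powr \<gamma>) * indicator {u. norm u < 1} u \<le> (\<Sum>k. T k u)"
    proof (cases "u = 0 \<or> norm u \<ge> 1")
      case True
      then have "ennreal (norm u powr \<gamma>) * indicator {u. norm u < 1} u = 0" by (auto split: split_indicator)
      then show ?thesis by (simp only: zero_le)
    next
      case False
      then have u: "0 < norm u" "norm u < 1" by auto
      define k where "k = nat \<lfloor>- log 2 (norm u)\<rfloor>"
      have "- log 2 (norm u) > 0" using u by simp
      then have k: "real k \<le> - log 2 (norm u)" "- log 2 (norm u) < real k + 1"
        unfolding k_def by linarith+
      have le: "norm u \<le> 2 powr - real k"
        using k(1) u by (subst log_le_iff[symmetric, of 2]) auto
      have "2 powr (- (real k + 1)) \<le> norm u"
        using k(2) u by (subst le_log_iff[symmetric, of 2]) auto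
      then have "norm u powr \<gamma> \<le> (2 powr (- (real k + 1))) powr \<gamma>"
        using \<gamma> u by (intro powr_mono2') auto
      then have "norm u powr \<gamma> \<le> 2 powr (- (real k + 1) * \<gamma>)"
        by (simp add: powr_powr)
      then have "ennreal (norm u powr \<gamma>) * indicator {u. norm u < 1} u \<le> T k u"
        using u le by (auto simp: T_def intro!: ennreal_leI)
      also have "\<dots> \<le> (\<Sum>k. T k u)"
        by (rule ennreal_le_suminf)
      finally show ?thesis .
    qed
  qed
  also have "\<dots> = (\<Sum>k. \<integral>\<^sup>+u. T k u \<partial>lborel)"
    by (rule nn_integral_suminf) simp
  also have "\<dots> = (\<Sum>k. ennreal (2 powr (- \<gamma>) * V * q ^ k))"
  proof (rule suminf_cong)
    fix k
    have "(\<integral>\<^sup>+u. T k u \<partial>lborel) = ennreal (2 powr (- (real k + 1) * \<gamma>)) * emeasure lborel (cball (0::'a) (2 powr - real k))"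
      unfolding T_def by (subst nn_integral_cmult) (auto intro!: borel_measurable_indicator borel_closed)
    also have "emeasure lborel (cball (0::'a) (2 powr - real k)) = ennreal (V * (2 powr - real k) ^ DIM('a))"
      by (simp add: emeasure_cball V_def)
    also have "ennreal (2 powr (- (real k + 1) * \<gamma>)) * \<dots> = ennreal (2 powr (- \<gamma>) * V * q ^ k)"
    proof -
      have "2 powr (- (real k + 1) * \<gamma>) * (2 powr - real k) ^ DIM('a) = 2 powr (- \<gamma>) * q ^ k"
        by (simp add: q_def powr_realpow[symmetric] powr_powr powr_add[symmetric] algebra_simps)
      then show ?thesis using V by (simp add: ennreal_mult[symmetric] mult_ac)
    qed
    finally show "(\<integral>\<^sup>+u. T k u \<partial>lborel) = ennreal (2 powr (- \<gamma>) * V * q ^ k)" .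
  qed
  also have "\<dots> = ennreal (\<Sum>k. 2 powr (- \<gamma>) * V * q ^ k)"
    using q V by (intro suminf_ennreal2 summable_mult summable_geometric) auto
  also have "\<dots> < \<infinity>" by simp
  finally show ?thesis .
qed

text \<open>Near \<open>v\<close> the singularity is integrable and the Maxwellian is at most one;
  at distance at least one the rate is at most one and the Maxwellian has mass one. This bound is
  what makes short explicit Euler steps positive.\<close>

lemma collision_frequency_bounded:
  assumes \<gamma>: "- real DIM('a::euclidean_space) < \<gamma>" "\<gamma> < 0"
  shows "\<exists>a>0. \<forall>v::'a. (\<integral>\<^sup>+w. ennreal (norm (v - w) powr \<gamma>) \<partial>maxwell_measure) \<le> ennreal a"
proof -
  let ?I = "\<integral>\<^sup>+u. ennreal (norm u powr \<gamma>) * indicator {u. norm u < 1} u \<partial>(lborel :: 'a measure)"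
  obtain i where i: "?I = ennreal i" "0 \<le> i"
    using nn_integral_norm_powr_unit_ball[OF \<gamma>] by (cases ?I) auto
  show ?thesis
  proof (intro exI[of _ "i + 1"] conjI allI)
    fix v :: 'a
    have "(\<integral>\<^sup>+w. ennreal (norm (v - w) powr \<gamma>) \<partial>maxwell_measure) =
          (\<integral>\<^sup>+w. ennreal (maxwellian w) * ennreal (norm (v - w) powr \<gamma>) \<partial>lborel)"
      by (rule nn_integral_maxwell) simp
    also have "\<dots> \<le> (\<integral>\<^sup>+w. ennreal (norm (v - w) powr \<gamma>) * indicator {u. norm u < 1} (v - w) + ennreal (maxwellian w) \<partial>lborel)"
    proof (rule nn_integral_mono)
      fix w
      show "ennreal (maxwellian w) * ennreal (norm (v - w) powr \<gamma>)
            \<le> ennreal (norm (v - w) powr \<gamma>) * indicator {u. norm u < 1} (v - w) + ennreal (maxwellian w)"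
      proof (cases "norm (v - w) < 1")
        case True
        have "ennreal (maxwellian w) * ennreal (norm (v - w) powr \<gamma>) \<le> 1 * ennreal (norm (v - w) powr \<gamma>)"
          using maxwellian_le_1[of w] by (intro mult_right_mono) auto
        then show ?thesis using True by (simp add: add_increasing2)
      next
        case False
        then have "norm (v - w) powr \<gamma> \<le> 1"
          using \<gamma> powr_mono2'[of \<gamma> 1 "norm (v - w)"] by auto
        then have "ennreal (maxwellian w) * ennreal (norm (v - w) powr \<gamma>) \<le> ennreal (maxwellian w) * 1"
          by (intro mult_left_mono) auto
        then show ?thesis by (simp add: add_increasing)
      qed
    qed
    also have "\<dots> = (\<integral>\<^sup>+w. ennreal (norm (v - w) powr \<gamma>) * indicator {u. norm u < 1} (v - w) \<partial>lborel) + 1"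
      by (subst nn_integral_add) (simp_all add: nn_integral_maxwellian)
    also have "(\<integral>\<^sup>+w. ennreal (norm (v - w) powr \<gamma>) * indicator {u. norm u < 1} (v - w) \<partial>lborel) = ?I"
      by (rule nn_integral_lborel_reflect[of "\<lambda>u. ennreal (norm u powr \<gamma>) * indicator {u. norm u < 1} u"]) simp
    also have "?I + 1 = ennreal (i + 1)" using i by simp
    finally show "(\<integral>\<^sup>+w. ennreal (norm (v - w) powr \<gamma>) \<partial>maxwell_measure) \<le> ennreal (i + 1)" .
  qed (use i in auto)
qed

subsection \<open>The collision transformation\<close>

lemma post_uminus: "post v w (- \<sigma>) = post_star v w \<sigma>"
  and post_star_uminus: "post_star v w (- \<sigma>) = post v w \<sigma>"
  and cos_dev_uminus: "cos_dev v w (- \<sigma>) = - cos_dev v w \<sigma>"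
  by (simp_all add: post_def post_star_def cos_dev_def)

lemma measurable_post [measurable (raw)]:
  assumes [measurable]: "f \<in> M \<rightarrow>\<^sub>M borel" "g \<in> M \<rightarrow>\<^sub>M borel" "k \<in> M \<rightarrow>\<^sub>M borel"
  shows "(\<lambda>x. post (f x) (g x) (k x) :: 'a::euclidean_space) \<in> M \<rightarrow>\<^sub>M borel"
  unfolding post_def by measurable

lemma measurable_post_star [measurable (raw)]:
  assumes [measurable]: "f \<in> M \<rightarrow>\<^sub>M borel" "g \<in> M \<rightarrow>\<^sub>M borel" "k \<in> M \<rightarrow>\<^sub>M borel"
  shows "(\<lambda>x. post_star (f x) (g x) (k x) :: 'a::euclidean_space) \<in> M \<rightarrow>\<^sub>M borel"
  unfolding post_star_def by measurable

lemma measurable_cos_dev [measurable (raw)]: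
  assumes [measurable]: "f \<in> M \<rightarrow>\<^sub>M borel" "g \<in> M \<rightarrow>\<^sub>M borel" "k \<in> M \<rightarrow>\<^sub>M borel"
  shows "(\<lambda>x. cos_dev (f x) (g x) (k x :: 'a::euclidean_space)) \<in> M \<rightarrow>\<^sub>M borel"
  unfolding cos_dev_def by measurable

text \<open>Turns joint measurability of a curried function into a rule for arbitrary measurable
  arguments, to be declared as \<open>measurable (raw)\<close> inside proofs about a generic
  integrand.\<close>

lemma measurable_curry3:
  assumes "(\<lambda>(x, y, z). G x y z) \<in> A \<Otimes>\<^sub>M B \<Otimes>\<^sub>M C \<rightarrow>\<^sub>M N"
    and "f \<in> M \<rightarrow>\<^sub>M A" "g \<in> M \<rightarrow>\<^sub>M B" "k \<in> M \<rightarrow>\<^sub>M C"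
  shows "(\<lambda>x. G (f x) (g x) (k x)) \<in> M \<rightarrow>\<^sub>M N"
  using measurable_compose[OF measurable_Pair[OF assms(2) measurable_Pair[OF assms(3,4)]] assms(1)] by simp

lemma measurable_curry4:
  assumes "(\<lambda>(x, y, z, w). G x y z w) \<in> A \<Otimes>\<^sub>M B \<Otimes>\<^sub>M C \<Otimes>\<^sub>M D \<rightarrow>\<^sub>M N"
    and "f \<in> M \<rightarrow>\<^sub>M A" "g \<in> M \<rightarrow>\<^sub>M B" "k \<in> M \<rightarrow>\<^sub>M C" "l \<in> M \<rightarrow>\<^sub>M D"
  shows "(\<lambda>x. G (f x) (g x) (k x) (l x)) \<in> M \<rightarrow>\<^sub>M N"
  using measurable_compose[OF measurable_Pair[OF assms(2) measurable_Pair[OF assms(3) measurable_Pair[OF assms(4,5)]]] assms(1)] by simp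

lemma maxwellian_mult:
  "maxwellian (v :: 'a::euclidean_space) * maxwellian (w :: 'a) =
    ((2 * pi) powr (- real DIM('a) / 2))\<^sup>2 * exp (- ((norm v)\<^sup>2 + (norm w)\<^sup>2) / 2)"
proof -
  have "exp (- ((norm v)\<^sup>2 + (norm w)\<^sup>2) / 2) = exp (- (norm v)\<^sup>2 / 2) * exp (- (norm w)\<^sup>2 / 2)"
    by (simp add: exp_add[symmetric] add_divide_distrib diff_divide_distrib)
  then show ?thesis unfolding maxwellian_def power2_eq_square[of "(2 * pi) powr _"] by (simp add: mult_ac)
qed

text \<open>Conservation of energy: by the parallelogram law, both pairs of velocities have squared
  norms adding up to twice the squared centre of mass plus half the squared relative
  velocity.\<close>

lemma maxwellian_post:
  assumes "norm \<sigma> = 1"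
  shows "maxwellian (post v w \<sigma>) * maxwellian (post_star v w \<sigma>) = maxwellian v * maxwellian (w :: 'a::euclidean_space)"
proof -
  define x y where "x = (1/2) *\<^sub>R (v + w)" and "y = (norm (v - w) / 2) *\<^sub>R \<sigma>"
  have "(norm (post v w \<sigma>))\<^sup>2 + (norm (post_star v w \<sigma>))\<^sup>2 = 2 * (x \<bullet> x) + 2 * (y \<bullet> y)"
    unfolding post_def post_star_def x_def[symmetric] y_def[symmetric]
    by (simp add: power2_norm_eq_inner inner_simps inner_commute)
  also have "x \<bullet> x = (1/4) * ((v + w) \<bullet> (v + w))"
    unfolding x_def by simp
  also have "y \<bullet> y = (1/4) * ((v - w) \<bullet> (v - w))"
    unfolding dot_square_norm using assms by (simp add: y_def power_divide)
  also have "2 * ((1/4) * ((v + w) \<bullet> (v + w))) + 2 * ((1/4) * ((v - w) \<bullet> (v - w))) = (norm v)\<^sup>2 + (norm w)\<^sup>2"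
    unfolding power2_norm_eq_inner by (simp add: inner_simps inner_commute field_simps)
  finally show ?thesis by (simp add: maxwellian_mult)
qed

text \<open>Change to centre of mass \<open>z\<close> and relative velocity \<open>u\<close>. It is
  a reflection in \<open>w\<close> followed by a translation in \<open>v\<close> by half of
  \<open>u\<close>, with Fubini in between, so the Jacobian is one.\<close>

lemma nn_integral_pair_centre:
  fixes \<Phi> :: "'a::euclidean_space \<Rightarrow> 'a \<Rightarrow> ennreal"
  assumes [measurable]: "case_prod \<Phi> \<in> borel_measurable (borel \<Otimes>\<^sub>M borel)"
  shows "(\<integral>\<^sup>+v. \<integral>\<^sup>+w. \<Phi> v w \<partial>lborel \<partial>lborel) =
     (\<integral>\<^sup>+z. \<integral>\<^sup>+u. \<Phi> (z + (1/2) *\<^sub>R u) (z - (1/2) *\<^sub>R u) \<partial>lborel \<partial>lborel)"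
proof -
  have "(\<integral>\<^sup>+v. \<integral>\<^sup>+w. \<Phi> v w \<partial>lborel \<partial>lborel) = (\<integral>\<^sup>+v. \<integral>\<^sup>+u. \<Phi> v (v - u) \<partial>lborel \<partial>lborel)"
    by (intro nn_integral_cong nn_integral_lborel_reflect[symmetric]) measurable
  also have "\<dots> = (\<integral>\<^sup>+u. \<integral>\<^sup>+v. \<Phi> v (v - u) \<partial>lborel \<partial>lborel)"
    by (rule lborel_pair.Fubini'[symmetric]) measurable
  also have "\<dots> = (\<integral>\<^sup>+u. \<integral>\<^sup>+z. \<Phi> ((1/2) *\<^sub>R u + z) ((1/2) *\<^sub>R u + z - u) \<partial>lborel \<partial>lborel)"
    by (intro nn_integral_cong nn_integral_lborel_translate[symmetric]) measurable
  also have "\<dots> = (\<integral>\<^sup>+u. \<integral>\<^sup>+z. \<Phi> (z + (1/2) *\<^sub>R u) (z - (1/2) *\<^sub>R u) \<partial>lborel \<partial>lborel)"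
  proof (intro nn_integral_cong arg_cong2[where f = \<Phi>])
    fix u z :: 'a
    have "u = (1/2) *\<^sub>R u + (1/2) *\<^sub>R u" by (simp add: scaleR_left_distrib[symmetric])
    then show "(1/2) *\<^sub>R u + z - u = z - (1/2) *\<^sub>R u"
      by (metis add_diff_cancel_left)
  qed (rule add.commute)
  also have "\<dots> = (\<integral>\<^sup>+z. \<integral>\<^sup>+u. \<Phi> (z + (1/2) *\<^sub>R u) (z - (1/2) *\<^sub>R u) \<partial>lborel \<partial>lborel)"
    by (rule lborel_pair.Fubini') measurable
  finally show ?thesis .
qed

section \<open>Collision integrals and microreversibility\<close>

definition collision_integral :: "('a::euclidean_space \<Rightarrow> 'a \<Rightarrow> 'a \<Rightarrow> ennreal) \<Rightarrow> ennreal" where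
  "collision_integral G = (\<integral>\<^sup>+v. \<integral>\<^sup>+w. \<integral>\<^sup>+\<sigma>. G v w \<sigma> \<partial>sph \<partial>maxwell_measure \<partial>maxwell_measure)"

lemma collision_integral_lborel:
  fixes G :: "'a::euclidean_space \<Rightarrow> 'a \<Rightarrow> 'a \<Rightarrow> ennreal"
  assumes G: "(\<lambda>(v, w, \<sigma>). G v w \<sigma>) \<in> borel_measurable (borel \<Otimes>\<^sub>M borel \<Otimes>\<^sub>M borel)"
  shows "collision_integral G = (\<integral>\<^sup>+z. \<integral>\<^sup>+u. \<integral>\<^sup>+\<sigma>.
     ennreal (maxwellian (z + (1/2) *\<^sub>R u) * maxwellian (z - (1/2) *\<^sub>R u)) *
       G (z + (1/2) *\<^sub>R u) (z - (1/2) *\<^sub>R u) \<sigma> \<partial>sph \<partial>lborel \<partial>lborel)"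
proof -
  note [measurable (raw)] = measurable_curry3[OF G]
  have "collision_integral G = (\<integral>\<^sup>+v. \<integral>\<^sup>+w. \<integral>\<^sup>+\<sigma>. ennreal (maxwellian v * maxwellian w) * G v w \<sigma> \<partial>sph \<partial>lborel \<partial>lborel)"
  proof -
    have "(\<lambda>v. \<integral>\<^sup>+w. \<integral>\<^sup>+\<sigma>. G v w \<sigma> \<partial>sph \<partial>maxwell_measure) \<in> borel_measurable borel" by measurable
    then show ?thesis
      unfolding collision_integral_def
      by (simp add: nn_integral_maxwell nn_integral_cmult[symmetric] ennreal_mult mult.assoc)
  qed
  also have "\<dots> = (\<integral>\<^sup>+z. \<integral>\<^sup>+u. \<integral>\<^sup>+\<sigma>.
     ennreal (maxwellian (z + (1/2) *\<^sub>R u) * maxwellian (z - (1/2) *\<^sub>R u)) *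
       G (z + (1/2) *\<^sub>R u) (z - (1/2) *\<^sub>R u) \<sigma> \<partial>sph \<partial>lborel \<partial>lborel)"
    by (rule nn_integral_pair_centre) measurable
  finally show ?thesis .
qed

locale collision_kernel =
  fixes b :: "real \<Rightarrow> real" and ty :: "'a::euclidean_space itself"
  assumes angular: "angular_kernel TYPE('a) b"
begin

text \<open>Extension of \<open>b\<close> by zero outside its interval of definition, which makes it
  Borel, nonnegative and even on the whole line.\<close>

definition bk :: "real \<Rightarrow> real" where
  "bk x = (if x \<in> {-1..1} then b x else 0)"

lemma bk_nonneg [simp]: "0 \<le> bk x"
  using angular by (auto simp: bk_def angular_kernel_def)

lemma bk_uminus [simp]: "bk (- x) = bk x"
  using angular by (auto simp: bk_def angular_kernel_def)

lemma measurable_bk [measurable]: "bk \<in> borel_measurable borel"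
proof -
  have "b \<in> borel_measurable (restrict_space borel {-1..1})"
    using angular by (simp add: angular_kernel_def)
  then have "(\<lambda>x. indicator {-1..1} x *\<^sub>R b x) \<in> borel_measurable borel"
    by (subst (asm) borel_measurable_restrict_space_iff) auto
  also have "(\<lambda>x. indicator {-1..1} x *\<^sub>R b x) = bk"
    by (auto simp: bk_def indicator_def)
  finally show ?thesis .
qed

lemma nn_integral_bk:
  assumes e: "norm (e::'a) = 1"
  shows "(\<integral>\<^sup>+\<sigma>. ennreal (bk (e \<bullet> \<sigma>)) \<partial>sph) = 1"
proof -
  have eq: "(\<integral>\<sigma>. b (e \<bullet> \<sigma>) \<partial>sphere_measure) = 1"
    using angular e by (auto simp: angular_kernel_def)
  have cong: "b (e \<bullet> \<sigma>) = bk (e \<bullet> \<sigma>)" if "\<sigma> \<in> space sphere_measure" for \<sigma>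
    using that e Cauchy_Schwarz_ineq2[of e \<sigma>] by (auto simp: bk_def space_sphere_measure)
  have eq': "(\<integral>\<sigma>. bk (e \<bullet> \<sigma>) \<partial>sphere_measure) = 1"
    unfolding eq[symmetric] by (rule Bochner_Integration.integral_cong) (auto simp: cong)
  \<comment> \<open>A Bochner integral of a non-integrable function is zero, so the value one
    already forces integrability.\<close>
  then have "integrable sphere_measure (\<lambda>\<sigma>. bk (e \<bullet> \<sigma>))"
    using not_integrable_integral_eq by fastforce
  then have "(\<integral>\<^sup>+\<sigma>. ennreal (bk (e \<bullet> \<sigma>)) \<partial>sphere_measure) = 1"
    by (subst nn_integral_eq_integral) (auto simp: eq')
  then show ?thesis by (subst (asm) nn_integral_sphere_measure) auto
qed

lemma nn_integral_bk_cos_dev: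
  assumes "v \<noteq> (w::'a)"
  shows "(\<integral>\<^sup>+\<sigma>. ennreal (bk (cos_dev v w \<sigma>)) \<partial>sph) = 1"
  unfolding cos_dev_def using assms by (intro nn_integral_bk) simp

text \<open>The rate \<open>c\<close> is kept general because the same identities are applied to the
  soft potential, to the truncated unit rate and to the remainder between the two.\<close>

definition weight :: "(real \<Rightarrow> real) \<Rightarrow> 'a \<Rightarrow> 'a \<Rightarrow> 'a \<Rightarrow> ennreal" where
  "weight c v w \<sigma> = ennreal (c (norm (v - w)) * bk (cos_dev v w \<sigma>))"

lemma measurable_weight [measurable (raw)]:
  assumes [measurable]: "c \<in> borel_measurable borel"
  assumes [measurable]: "f \<in> M \<rightarrow>\<^sub>M borel" "g \<in> M \<rightarrow>\<^sub>M borel" "k \<in> M \<rightarrow>\<^sub>M borel"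
  shows "(\<lambda>x. weight c (f x) (g x) (k x)) \<in> borel_measurable M"
  unfolding weight_def by measurable

text \<open>Microreversibility. With centre \<open>z\<close> and relative velocity \<open>u\<close>,
  a collision keeps \<open>z\<close> and \<open>norm u\<close> and replaces the direction of
  \<open>u\<close> by \<open>\<sigma>\<close>. Exchanging these two directions exchanges the pairs
  before and after the collision, while the product of the Maxwellians, the relative speed and the
  scattering angle stay the same.\<close>

lemma collision_integral_pre_post:
  fixes F :: "'a \<Rightarrow> 'a \<Rightarrow> 'a \<Rightarrow> 'a \<Rightarrow> ennreal"
  assumes [measurable]: "c \<in> borel_measurable borel"
    and F: "(\<lambda>(v, w, x, y). F v w x y) \<in> borel_measurable (borel \<Otimes>\<^sub>M borel \<Otimes>\<^sub>M borel \<Otimes>\<^sub>M borel)"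
  shows "collision_integral (\<lambda>v w \<sigma>. weight c v w \<sigma> * F v w (post v w \<sigma>) (post_star v w \<sigma>)) =
         collision_integral (\<lambda>v w \<sigma>. weight c v w \<sigma> * F (post v w \<sigma>) (post_star v w \<sigma>) v w)"
proof -
  note [measurable (raw)] = measurable_curry4[OF F]
  let ?G = "\<lambda>v w \<sigma>. weight c v w \<sigma> * F v w (post v w \<sigma>) (post_star v w \<sigma>)"
  let ?G' = "\<lambda>v w \<sigma>. weight c v w \<sigma> * F (post v w \<sigma>) (post_star v w \<sigma>) v w"
  let ?I = "\<lambda>G z u \<sigma>. ennreal (maxwellian (z + (1/2) *\<^sub>R u) * maxwellian (z - (1/2) *\<^sub>R u)) *
       (G (z + (1/2) *\<^sub>R u) (z - (1/2) *\<^sub>R u) \<sigma> :: ennreal)"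
  have key: "?I ?G z (norm u *\<^sub>R \<sigma>) (unit_dir u) = ?I ?G' z u \<sigma>" if \<sigma>: "norm \<sigma> = 1" for z u \<sigma> :: 'a
  proof -
    let ?v = "z + (1/2) *\<^sub>R u" and ?w = "z - (1/2) *\<^sub>R u"
    let ?v' = "z + (1/2) *\<^sub>R (norm u *\<^sub>R \<sigma>)" and ?w' = "z - (1/2) *\<^sub>R (norm u *\<^sub>R \<sigma>)"
    have d: "?v - ?w = u" "?v' - ?w' = norm u *\<^sub>R \<sigma>"
      by (simp_all add: scaleR_left_distrib[symmetric])
    have s: "?v + ?w = 2 *\<^sub>R z" "?v' + ?w' = 2 *\<^sub>R z"
      by (simp_all add: scaleR_2)
    have p: "post ?v ?w \<sigma> = ?v'" "post_star ?v ?w \<sigma> = ?w'"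
      unfolding post_def post_star_def d s by simp_all
    have p': "post ?v' ?w' (unit_dir u) = ?v" "post_star ?v' ?w' (unit_dir u) = ?w"
    proof -
      have "(norm (norm u *\<^sub>R \<sigma>) / 2) *\<^sub>R unit_dir u = (1/2) *\<^sub>R (norm u *\<^sub>R unit_dir u)"
        using \<sigma> by (simp del: norm_scaleR_unit_dir)
      then show "post ?v' ?w' (unit_dir u) = ?v" "post_star ?v' ?w' (unit_dir u) = ?w"
        unfolding post_def post_star_def d s norm_scaleR_unit_dir by simp_all
    qed
    have cd: "cos_dev ?v' ?w' (unit_dir u) = cos_dev ?v ?w \<sigma>"
      unfolding cos_dev_def d using \<sigma> by (cases "u = 0") (simp_all add: unit_dir_def inner_commute)
    have "norm (?v' - ?w') = norm (?v - ?w)" unfolding d using \<sigma> by simp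
    moreover have "maxwellian ?v' * maxwellian ?w' = maxwellian ?v * maxwellian ?w"
      using maxwellian_post[OF \<sigma>, of ?v ?w] unfolding p .
    ultimately show ?thesis unfolding weight_def cd p p' by simp
  qed
  have "collision_integral ?G = (\<integral>\<^sup>+z. \<integral>\<^sup>+u. \<integral>\<^sup>+\<sigma>. ?I ?G z u \<sigma> \<partial>sph \<partial>lborel \<partial>lborel)"
    by (rule collision_integral_lborel) measurable
  also have "\<dots> = (\<integral>\<^sup>+z. \<integral>\<^sup>+u. \<integral>\<^sup>+\<sigma>. ?I ?G z (norm u *\<^sub>R \<sigma>) (unit_dir u) \<partial>sph \<partial>lborel \<partial>lborel)"
    by (intro nn_integral_cong nn_integral_swap_directions) measurable
  also have "\<dots> = (\<integral>\<^sup>+z. \<integral>\<^sup>+u. \<integral>\<^sup>+\<sigma>. ?I ?G' z u \<sigma> \<partial>sph \<partial>lborel \<partial>lborel)"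
    by (rule nn_integral_cong, rule nn_integral_cong, rule nn_integral_cong_AE, use AE_sph_norm in eventually_elim) (rule key)
  also have "\<dots> = collision_integral ?G'"
    by (rule collision_integral_lborel[symmetric]) measurable
  finally show ?thesis .
qed

text \<open>The map from \<open>\<sigma>\<close> to its antipode exchanges the two outgoing
  velocities and changes the sign of the cosine, which an even kernel does not see.\<close>

lemma collision_integral_even:
  fixes F :: "'a \<Rightarrow> 'a \<Rightarrow> 'a \<Rightarrow> 'a \<Rightarrow> ennreal"
  assumes [measurable]: "c \<in> borel_measurable borel"
    and F: "(\<lambda>(v, w, x, y). F v w x y) \<in> borel_measurable (borel \<Otimes>\<^sub>M borel \<Otimes>\<^sub>M borel \<Otimes>\<^sub>M borel)"
  shows "collision_integral (\<lambda>v w \<sigma>. weight c v w \<sigma> * F v w (post v w \<sigma>) (post_star v w \<sigma>)) =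
         collision_integral (\<lambda>v w \<sigma>. weight c v w \<sigma> * F v w (post_star v w \<sigma>) (post v w \<sigma>))"
proof -
  note [measurable (raw)] = measurable_curry4[OF F]
  have "(\<integral>\<^sup>+\<sigma>. weight c v w \<sigma> * F v w (post v w \<sigma>) (post_star v w \<sigma>) \<partial>sph) =
        (\<integral>\<^sup>+\<sigma>. weight c v w \<sigma> * F v w (post_star v w \<sigma>) (post v w \<sigma>) \<partial>sph)" for v w :: 'a
    by (subst nn_integral_sph_uminus[symmetric])
       (simp_all add: weight_def post_uminus post_star_uminus cos_dev_uminus)
  then show ?thesis by (simp add: collision_integral_def)
qed

text \<open>The angular kernel integrates to one over the sphere whenever \<open>v\<close> and
  \<open>w\<close> differ, and the diagonal is a null set.\<close>

lemma collision_integral_const_direction: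
  fixes F :: "'a \<Rightarrow> 'a \<Rightarrow> ennreal"
  assumes [measurable]: "c \<in> borel_measurable borel" "case_prod F \<in> borel_measurable (borel \<Otimes>\<^sub>M borel)"
    and c: "\<And>r. 0 \<le> c r"
  shows "collision_integral (\<lambda>v w \<sigma>. weight c v w \<sigma> * F v w) =
     (\<integral>\<^sup>+v. \<integral>\<^sup>+w. ennreal (c (norm (v - w))) * F v w \<partial>maxwell_measure \<partial>maxwell_measure)"
  unfolding collision_integral_def
proof (rule nn_integral_cong, rule nn_integral_cong_AE)
  fix v :: 'a
  have "AE w in maxwell_measure. v \<noteq> w"
    unfolding maxwell_measure_def by (subst AE_density) (use AE_lborel_singleton[of v] in \<open>auto elim!: eventually_mono\<close>)
  then show "AE w in maxwell_measure. (\<integral>\<^sup>+\<sigma>. weight c v w \<sigma> * F v w \<partial>sph) = ennreal (c (norm (v - w))) * F v w"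
  proof eventually_elim
    case (elim w)
    have "(\<integral>\<^sup>+\<sigma>. weight c v w \<sigma> * F v w \<partial>sph) =
      (\<integral>\<^sup>+\<sigma>. (ennreal (c (norm (v - w))) * F v w) * ennreal (bk (cos_dev v w \<sigma>)) \<partial>sph)"
      using c by (simp add: weight_def ennreal_mult mult_ac)
    also have "\<dots> = ennreal (c (norm (v - w))) * F v w"
      by (subst nn_integral_cmult) (simp_all add: nn_integral_bk_cos_dev[OF elim])
    finally show ?case .
  qed
qed

end

subsection \<open>Gain operator and Markov steps\<close>

definition collision_freq :: "(real \<Rightarrow> real) \<Rightarrow> 'a::euclidean_space \<Rightarrow> ennreal" where
  "collision_freq c v = (\<integral>\<^sup>+w. ennreal (c (norm (v - w))) \<partial>maxwell_measure)"

lemma measurable_collision_freq [measurable (raw)]: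
  assumes [measurable]: "c \<in> borel_measurable borel" "f \<in> M \<rightarrow>\<^sub>M borel"
  shows "(\<lambda>x. collision_freq c (f x :: 'a::euclidean_space)) \<in> borel_measurable M"
  unfolding collision_freq_def by measurable

lemma collision_integral_mono:
  assumes "\<And>v w \<sigma>. F v w \<sigma> \<le> G v w \<sigma>"
  shows "collision_integral F \<le> collision_integral G"
  unfolding collision_integral_def by (intro nn_integral_mono assms)

lemma collision_integral_add:
  fixes F G :: "'a::euclidean_space \<Rightarrow> 'a \<Rightarrow> 'a \<Rightarrow> ennreal"
  assumes F: "(\<lambda>(v, w, \<sigma>). F v w \<sigma>) \<in> borel_measurable (borel \<Otimes>\<^sub>M borel \<Otimes>\<^sub>M borel)"
    and G: "(\<lambda>(v, w, \<sigma>). G v w \<sigma>) \<in> borel_measurable (borel \<Otimes>\<^sub>M borel \<Otimes>\<^sub>M borel)"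
  shows "collision_integral (\<lambda>v w \<sigma>. F v w \<sigma> + G v w \<sigma>) = collision_integral F + collision_integral G"
proof -
  note [measurable (raw)] = measurable_curry3[OF F] measurable_curry3[OF G]
  show ?thesis unfolding collision_integral_def by (simp add: nn_integral_add)
qed

context collision_kernel
begin

text \<open>The gain part of the operator divided by the Maxwellian, as a function of
  \<open>h = f / M\<close>: conservation of energy turns the Maxwellian weights of the outgoing pair
  into those of \<open>v\<close> and \<open>w\<close>.\<close>

definition gain :: "(real \<Rightarrow> real) \<Rightarrow> ('a \<Rightarrow> ennreal) \<Rightarrow> 'a \<Rightarrow> ennreal" where
  "gain c h v = (\<integral>\<^sup>+w. \<integral>\<^sup>+\<sigma>. weight c v w \<sigma> * h (post v w \<sigma>) \<partial>sph \<partial>maxwell_measure)"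

text \<open>Subtraction in \<open>ennreal\<close> is truncated, so the formula is used together with
  \<open>collision_freq c v \<le> 1\<close>. It is then a Markov operator that is reversible with
  respect to \<open>maxwell_measure\<close>: jump with probability
  \<open>collision_freq c v\<close>, otherwise stay.\<close>

definition step :: "(real \<Rightarrow> real) \<Rightarrow> ('a \<Rightarrow> ennreal) \<Rightarrow> 'a \<Rightarrow> ennreal" where
  "step c h v = (1 - collision_freq c v) * h v + gain c h v"

lemma measurable_gain [measurable (raw)]:
  assumes [measurable]: "c \<in> borel_measurable borel" "h \<in> borel_measurable borel" "f \<in> M \<rightarrow>\<^sub>M borel"
  shows "(\<lambda>x. gain c h (f x)) \<in> borel_measurable M"
  unfolding gain_def by measurable

lemma measurable_step [measurable (raw)]:
  assumes [measurable]: "c \<in> borel_measurable borel" "h \<in> borel_measurable borel" "f \<in> M \<rightarrow>\<^sub>M borel"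
  shows "(\<lambda>x. step c h (f x)) \<in> borel_measurable M"
  unfolding step_def by measurable

lemma gain_weak:
  assumes [measurable]: "c \<in> borel_measurable borel" "h \<in> borel_measurable borel" "\<phi> \<in> borel_measurable borel"
  shows "(\<integral>\<^sup>+v. gain c h v * \<phi> v \<partial>maxwell_measure) = collision_integral (\<lambda>v w \<sigma>. weight c v w \<sigma> * (h v * \<phi> (post v w \<sigma>)))"
proof -
  have "(\<integral>\<^sup>+v. gain c h v * \<phi> v \<partial>maxwell_measure) =
      collision_integral (\<lambda>v w \<sigma>. weight c v w \<sigma> * (h (post v w \<sigma>) * \<phi> v))"
    unfolding gain_def collision_integral_def
    by (simp add: nn_integral_multc[symmetric] mult.assoc)
  also have "\<dots> = collision_integral (\<lambda>v w \<sigma>. weight c v w \<sigma> * (h v * \<phi> (post v w \<sigma>)))"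
    by (rule collision_integral_pre_post[where F = "\<lambda>v w x y. h x * \<phi> v"]) measurable
  finally show ?thesis .
qed

text \<open>Evenness of the kernel allows the test function to be evaluated at either outgoing
  velocity. This is the exchangeability on which the halving of the entropy rests.\<close>

lemma gain_weak_star:
  assumes [measurable]: "c \<in> borel_measurable borel" "h \<in> borel_measurable borel" "\<phi> \<in> borel_measurable borel"
  shows "(\<integral>\<^sup>+v. gain c h v * \<phi> v \<partial>maxwell_measure) = collision_integral (\<lambda>v w \<sigma>. weight c v w \<sigma> * (h v * \<phi> (post_star v w \<sigma>)))"
  unfolding gain_weak[OF assms]
  by (rule collision_integral_even[where F = "\<lambda>v w x y. h v * \<phi> x"]) measurable

lemma collision_integral_pre:
  assumes [measurable]: "c \<in> borel_measurable borel" "A \<in> borel_measurable borel" and c: "\<And>r. 0 \<le> c r"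
  shows "collision_integral (\<lambda>v w \<sigma>. weight c v w \<sigma> * A v) = (\<integral>\<^sup>+v. collision_freq c v * A v \<partial>maxwell_measure)"
  unfolding collision_freq_def
  by (subst collision_integral_const_direction[where F = "\<lambda>v w. A v"]) (simp_all add: c nn_integral_multc)

lemma collision_integral_post:
  assumes [measurable]: "c \<in> borel_measurable borel" "A \<in> borel_measurable borel" and c: "\<And>r. 0 \<le> c r"
  shows "collision_integral (\<lambda>v w \<sigma>. weight c v w \<sigma> * A (post v w \<sigma>)) = (\<integral>\<^sup>+v. collision_freq c v * A v \<partial>maxwell_measure)"
  by (subst collision_integral_pre_post[where F = "\<lambda>v w x y. A x"]) (simp_all add: c collision_integral_pre)

lemma freq_split: "a \<le> 1 \<Longrightarrow> (1 - a) * x + a * x = (x :: ennreal)"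
  by (simp add: distrib_right[symmetric] diff_add_cancel_ennreal)

text \<open>The inequality \<open>le\<close> is integrated against the joint law of the states
  \<open>x\<close> before and \<open>y\<close> after the step. By reversibility both marginals are
  the Maxwell measure, which gives the two integrals on the right. The constant \<kappa> stands on
  the left so that nothing is ever subtracted in \<open>ennreal\<close>.\<close>

lemma step_dual:
  assumes [measurable]: "c \<in> borel_measurable borel" "h \<in> borel_measurable borel" "\<phi> \<in> borel_measurable borel"
      "A \<in> borel_measurable borel" "B \<in> borel_measurable borel"
    and c: "\<And>r. 0 \<le> c r" and freq: "\<And>v::'a. collision_freq c v \<le> 1"
    and le: "\<And>x y. h x * \<phi> y + \<kappa> \<le> A x + B y"
  shows "(\<integral>\<^sup>+v. step c h v * \<phi> v \<partial>maxwell_measure) + \<kappa> \<le> (\<integral>\<^sup>+v. A v \<partial>maxwell_measure) + (\<integral>\<^sup>+v. B v \<partial>maxwell_measure)"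
proof -
  let ?f = "collision_freq c :: 'a \<Rightarrow> ennreal"
  \<comment> \<open>The joint law has mass one, split into the part that stays and the part that
    jumps.\<close>
  have k: "\<kappa> = (\<integral>\<^sup>+v. (1 - ?f v) * \<kappa> \<partial>maxwell_measure) + collision_integral (\<lambda>v w \<sigma>. weight c v w \<sigma> * \<kappa>)"
  proof -
    have "(\<integral>\<^sup>+v. (1 - ?f v) * \<kappa> \<partial>maxwell_measure) + collision_integral (\<lambda>v w \<sigma>. weight c v w \<sigma> * \<kappa>)
       = (\<integral>\<^sup>+v. (1 - ?f v) * \<kappa> + ?f v * \<kappa> \<partial>maxwell_measure)"
      by (subst collision_integral_pre[where A = "\<lambda>_. \<kappa>"]) (simp_all add: c nn_integral_add)
    also have "\<dots> = \<kappa>"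
      by (simp add: freq_split[OF freq] maxwell.emeasure_space_1[simplified])
    finally show ?thesis ..
  qed
  have "(\<integral>\<^sup>+v. step c h v * \<phi> v \<partial>maxwell_measure) =
      (\<integral>\<^sup>+v. (1 - ?f v) * (h v * \<phi> v) \<partial>maxwell_measure) + (\<integral>\<^sup>+v. gain c h v * \<phi> v \<partial>maxwell_measure)"
    unfolding step_def by (subst nn_integral_add[symmetric]) (simp_all add: distrib_right mult.assoc)
  also have "(\<integral>\<^sup>+v. gain c h v * \<phi> v \<partial>maxwell_measure) = collision_integral (\<lambda>v w \<sigma>. weight c v w \<sigma> * (h v * \<phi> (post v w \<sigma>)))"
    by (rule gain_weak) measurable
  finally have "(\<integral>\<^sup>+v. step c h v * \<phi> v \<partial>maxwell_measure) + \<kappa> =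
      ((\<integral>\<^sup>+v. (1 - ?f v) * (h v * \<phi> v) \<partial>maxwell_measure) + (\<integral>\<^sup>+v. (1 - ?f v) * \<kappa> \<partial>maxwell_measure)) +
      (collision_integral (\<lambda>v w \<sigma>. weight c v w \<sigma> * (h v * \<phi> (post v w \<sigma>))) + collision_integral (\<lambda>v w \<sigma>. weight c v w \<sigma> * \<kappa>))"
    by (subst k) (simp only: add_ac)
  also have "\<dots> = (\<integral>\<^sup>+v. (1 - ?f v) * (h v * \<phi> v + \<kappa>) \<partial>maxwell_measure) +
      collision_integral (\<lambda>v w \<sigma>. weight c v w \<sigma> * (h v * \<phi> (post v w \<sigma>) + \<kappa>))"
    by (subst collision_integral_add[symmetric], measurable, subst nn_integral_add[symmetric])
       (simp_all add: distrib_left)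
  also have "\<dots> \<le> (\<integral>\<^sup>+v. (1 - ?f v) * (A v + B v) \<partial>maxwell_measure) +
      collision_integral (\<lambda>v w \<sigma>. weight c v w \<sigma> * (A v + B (post v w \<sigma>)))"
    by (intro add_mono nn_integral_mono collision_integral_mono mult_left_mono le) auto
  also have "collision_integral (\<lambda>v w \<sigma>. weight c v w \<sigma> * (A v + B (post v w \<sigma>))) =
      collision_integral (\<lambda>v w \<sigma>. weight c v w \<sigma> * A v) + collision_integral (\<lambda>v w \<sigma>. weight c v w \<sigma> * B (post v w \<sigma>))"
    by (subst collision_integral_add[symmetric]) (measurable, simp add: distrib_left)
  also have "\<dots> = (\<integral>\<^sup>+v. ?f v * (A v + B v) \<partial>maxwell_measure)"
    by (simp add: collision_integral_pre collision_integral_post c nn_integral_add distrib_left)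
  also have "(\<integral>\<^sup>+v. (1 - ?f v) * (A v + B v) \<partial>maxwell_measure) + (\<integral>\<^sup>+v. ?f v * (A v + B v) \<partial>maxwell_measure) =
      (\<integral>\<^sup>+v. A v + B v \<partial>maxwell_measure)"
    by (subst nn_integral_add[symmetric]) (simp_all add: freq_split[OF freq])
  also have "\<dots> = (\<integral>\<^sup>+v. A v \<partial>maxwell_measure) + (\<integral>\<^sup>+v. B v \<partial>maxwell_measure)"
    by (rule nn_integral_add) simp_all
  finally show ?thesis .
qed

lemma nn_integral_step:
  assumes [measurable]: "c \<in> borel_measurable borel" "h \<in> borel_measurable borel"
    and c: "\<And>r. 0 \<le> c r" and freq: "\<And>v::'a. collision_freq c v \<le> 1"
  shows "(\<integral>\<^sup>+v. step c h v \<partial>maxwell_measure) = (\<integral>\<^sup>+v. h v \<partial>maxwell_measure)"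
proof -
  have "(\<integral>\<^sup>+v. step c h v \<partial>maxwell_measure) =
      (\<integral>\<^sup>+v. (1 - collision_freq c v) * h v \<partial>maxwell_measure) + (\<integral>\<^sup>+v. gain c h v * 1 \<partial>maxwell_measure)"
    unfolding step_def by (subst nn_integral_add) simp_all
  also have "(\<integral>\<^sup>+v. gain c h v * 1 \<partial>maxwell_measure) = (\<integral>\<^sup>+v. collision_freq c v * h v \<partial>maxwell_measure)"
    by (subst gain_weak[where \<phi> = "\<lambda>_. 1"]) (simp_all add: collision_integral_pre c)
  also have "(\<integral>\<^sup>+v. (1 - collision_freq c v) * h v \<partial>maxwell_measure) + (\<integral>\<^sup>+v. collision_freq c v * h v \<partial>maxwell_measure)
      = (\<integral>\<^sup>+v. h v \<partial>maxwell_measure)"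
    by (subst nn_integral_add[symmetric]) (simp_all add: freq_split[OF freq])
  finally show ?thesis .
qed

end

subsection \<open>Entropy functionals\<close>

text \<open>The terms \<open>- x + 1\<close> integrate to zero for a probability density and make
  the integrand nonnegative, so the entropy can be taken as a nonnegative integral. The convention
  \<open>ln 0 = 0\<close> gives the right value one at zero.\<close>

definition ent :: "real \<Rightarrow> real" where
  "ent x = x * ln x - x + 1"

lemma measurable_ent [measurable]: "ent \<in> borel_measurable borel"
  unfolding ent_def[abs_def] by measurable

text \<open>Gibbs' inequality, that is, convex duality of \<open>x * ln x\<close> with the dual
  variable written as \<open>ln y\<close>. Equality holds at \<open>y = x\<close>, which makes the
  entropy a supremum over test functions.\<close>

lemma ent_young: "0 \<le> x \<Longrightarrow> 0 < y \<Longrightarrow> x * ln y \<le> ent x + y - 1"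
proof (cases "x = 0")
  case False
  assume "0 \<le> x" "0 < y"
  with False have x: "0 < x" and y: "0 < y" by auto
  have "ln (y / x) \<le> y / x - 1" using x y by (intro ln_le_minus_one) simp
  then have "x * ln (y / x) \<le> x * (y / x - 1)" using x by (intro mult_left_mono) auto
  then show ?thesis using x y by (simp add: ln_div ent_def algebra_simps)
qed (simp add: ent_def)

lemma ent_nonneg: "0 \<le> x \<Longrightarrow> 0 \<le> ent x"
  using ent_young[of x 1] by simp

text \<open>The optimal test function \<open>ln k\<close> takes negative values. Shifting by
  \<delta> and dividing by \<delta> makes the logarithm nonnegative, hence admissible in
  \<open>ennreal\<close>; the price is the term with \<open>ln (1 / \<delta>)\<close>, which is
  known because the mass is one.\<close>

lemma ent_le_regularized:
  assumes "0 \<le> k" "0 < \<delta>"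
  shows "ent k + k + k * ln (1 / \<delta>) \<le> k * ln ((k + \<delta>) / \<delta>) + 1"
proof -
  have "k * ln k \<le> k * ln (k + \<delta>)"
    using assms by (cases "k = 0") (auto intro!: mult_left_mono)
  then show ?thesis using assms by (simp add: ent_def ln_div algebra_simps)
qed

lemma regularized_young:
  assumes "0 \<le> h" "0 \<le> k" "0 < \<delta>"
  shows "h * ln ((k + \<delta>) / \<delta>) + 1 \<le> ent h + h * ln (1 / \<delta>) + (k + \<delta>)"
  using ent_young[of h "k + \<delta>"] assms by (simp add: ln_div algebra_simps)

lemma ent_le_regularized_integral:
  fixes k :: "'a::euclidean_space \<Rightarrow> real"
  assumes [measurable]: "k \<in> borel_measurable borel" and k: "\<And>v. 0 \<le> k v"
    and k1: "(\<integral>\<^sup>+v. ennreal (k v) \<partial>maxwell_measure) = 1" and \<delta>: "0 < \<delta>" "\<delta> < 1"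
  shows "(\<integral>\<^sup>+v. ennreal (ent (k v)) \<partial>maxwell_measure) + ennreal (1 + ln (1 / \<delta>)) \<le>
    (\<integral>\<^sup>+v. ennreal (k v) * ennreal (ln ((k v + \<delta>) / \<delta>)) \<partial>maxwell_measure) + 1"
proof -
  have ld: "0 \<le> ln (1 / \<delta>)" using \<delta> by simp
  have lk: "0 \<le> ln ((k v + \<delta>) / \<delta>)" for v using \<delta> k[of v] by (intro ln_ge_zero) (simp add: field_simps)
  have "(\<integral>\<^sup>+v. ennreal (ent (k v)) \<partial>maxwell_measure) + ennreal (1 + ln (1 / \<delta>)) =
     (\<integral>\<^sup>+v. ennreal (ent (k v)) + ennreal (k v) * ennreal (1 + ln (1 / \<delta>)) \<partial>maxwell_measure)"
    by (simp add: nn_integral_add nn_integral_multc k1)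
  also have "\<dots> \<le> (\<integral>\<^sup>+v. ennreal (k v) * ennreal (ln ((k v + \<delta>) / \<delta>)) + 1 \<partial>maxwell_measure)"
  proof (rule nn_integral_mono)
    fix v
    have "ennreal (ent (k v)) + ennreal (k v) * ennreal (1 + ln (1 / \<delta>)) = ennreal (ent (k v) + k v + k v * ln (1 / \<delta>))"
      using k[of v] ld ent_nonneg[OF k[of v]] by (simp add: ennreal_mult'[symmetric] ennreal_plus[symmetric] algebra_simps del: ennreal_plus)
    also have "\<dots> \<le> ennreal (k v * ln ((k v + \<delta>) / \<delta>) + 1)"
      using ent_le_regularized[OF k \<delta>(1)] by (rule ennreal_leI)
    also have "\<dots> = ennreal (k v) * ennreal (ln ((k v + \<delta>) / \<delta>)) + 1"
      using k[of v] lk[of v] by (simp add: ennreal_mult)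
    finally show "ennreal (ent (k v)) + ennreal (k v) * ennreal (1 + ln (1 / \<delta>)) \<le> ennreal (k v) * ennreal (ln ((k v + \<delta>) / \<delta>)) + 1" .
  qed
  also have "\<dots> = (\<integral>\<^sup>+v. ennreal (k v) * ennreal (ln ((k v + \<delta>) / \<delta>)) \<partial>maxwell_measure) + 1"
    by (subst nn_integral_add) (simp_all add: maxwell.emeasure_space_1[simplified])
  finally show ?thesis .
qed

context collision_kernel
begin

text \<open>The entropy of \<open>k\<close> is tested with its own regularised logarithm,
  \<open>step_dual\<close> moves the test function over to \<open>h\<close>, and Gibbs' inequality
  bounds the outcome by the entropy of \<open>h\<close> up to \<delta>.\<close>

lemma ent_step_le:
  assumes [measurable]: "c \<in> borel_measurable borel" "h \<in> borel_measurable borel" "k \<in> borel_measurable borel"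
    and c: "\<And>r. 0 \<le> c r" and freq: "\<And>v::'a. collision_freq c v \<le> 1"
    and h: "\<And>v. 0 \<le> h v" and k: "\<And>v. 0 \<le> k v"
    and h1: "(\<integral>\<^sup>+v. ennreal (h v) \<partial>maxwell_measure) = 1"
    and hk: "AE v in maxwell_measure. step c (\<lambda>v. ennreal (h v)) v = ennreal (k v)"
  shows "(\<integral>\<^sup>+v. ennreal (ent (k v)) \<partial>maxwell_measure) \<le> (\<integral>\<^sup>+v. ennreal (ent (h v)) \<partial>maxwell_measure)"
proof (rule ennreal_le_epsilon)
  fix e :: real assume "0 < e"
  \<comment> \<open>The final error is \<delta> itself; a value below one keeps
    \<open>ln (1 / \<delta>)\<close> nonnegative.\<close>
  define \<delta> where "\<delta> = min e (1/2)"
  have \<delta>: "0 < \<delta>" "\<delta> < 1" "\<delta> \<le> e" using \<open>0 < e\<close> by (auto simp: \<delta>_def)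
  have k1: "(\<integral>\<^sup>+v. ennreal (k v) \<partial>maxwell_measure) = 1"
    using nn_integral_step[OF assms(1) _ c freq, of "\<lambda>v. ennreal (h v)"] hk h1
    by (simp cong: nn_integral_cong_AE)
  have ld: "0 \<le> ln (1 / \<delta>)" using \<delta> by simp
  let ?\<phi> = "\<lambda>v. ennreal (ln ((k v + \<delta>) / \<delta>))"
  have lk: "0 \<le> ln ((k v + \<delta>) / \<delta>)" for v using \<delta> k[of v] by (intro ln_ge_zero) (simp add: field_simps)
  have "(\<integral>\<^sup>+v. ennreal (ent (k v)) \<partial>maxwell_measure) + ennreal (1 + ln (1 / \<delta>)) \<le>
     (\<integral>\<^sup>+v. ennreal (k v) * ?\<phi> v \<partial>maxwell_measure) + 1"
    by (rule ent_le_regularized_integral[OF assms(3) k k1 \<delta>(1,2)])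
  also have "(\<integral>\<^sup>+v. ennreal (k v) * ?\<phi> v \<partial>maxwell_measure) =
      (\<integral>\<^sup>+v. step c (\<lambda>v. ennreal (h v)) v * ?\<phi> v \<partial>maxwell_measure)"
    by (rule nn_integral_cong_AE) (use hk in eventually_elim, simp)
  also have "\<dots> + 1 \<le> (\<integral>\<^sup>+v. ennreal (ent (h v) + h v * ln (1 / \<delta>)) \<partial>maxwell_measure) + (\<integral>\<^sup>+v. ennreal (k v + \<delta>) \<partial>maxwell_measure)"
  proof (rule step_dual)
    fix x y :: 'a
    have "ennreal (h x) * ?\<phi> y + 1 = ennreal (h x * ln ((k y + \<delta>) / \<delta>) + 1)"
      using h[of x] lk[of y] by (simp add: ennreal_mult)
    also have "\<dots> \<le> ennreal ((ent (h x) + h x * ln (1 / \<delta>)) + (k y + \<delta>))"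
      by (intro ennreal_leI regularized_young h k \<delta>)
    also have "\<dots> = ennreal (ent (h x) + h x * ln (1 / \<delta>)) + ennreal (k y + \<delta>)"
      using h[of x] k[of y] ld \<delta> ent_nonneg[OF h[of x]] by (intro ennreal_plus) auto
    finally show "ennreal (h x) * ?\<phi> y + 1 \<le> ennreal (ent (h x) + h x * ln (1 / \<delta>)) + ennreal (k y + \<delta>)" .
  qed (use c freq in \<open>simp_all\<close>)
  also have "(\<integral>\<^sup>+v. ennreal (ent (h v) + h v * ln (1 / \<delta>)) \<partial>maxwell_measure) =
     (\<integral>\<^sup>+v. ennreal (ent (h v)) \<partial>maxwell_measure) + ennreal (ln (1 / \<delta>))"
    using h ld by (simp add: ent_nonneg ennreal_mult nn_integral_add nn_integral_multc h1)
  also have "(\<integral>\<^sup>+v. ennreal (k v + \<delta>) \<partial>maxwell_measure) = 1 + ennreal \<delta>"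
    using k \<delta> by (simp add: nn_integral_add k1 maxwell.emeasure_space_1[simplified])
  \<comment> \<open>Only the finite constant is cancelled, so the entropies may be infinite
    here.\<close>
  finally have "ennreal (1 + ln (1 / \<delta>)) + (\<integral>\<^sup>+v. ennreal (ent (k v)) \<partial>maxwell_measure) \<le>
     ennreal (1 + ln (1 / \<delta>)) + ((\<integral>\<^sup>+v. ennreal (ent (h v)) \<partial>maxwell_measure) + ennreal \<delta>)"
    using ld by (simp add: add_ac)
  then have "(\<integral>\<^sup>+v. ennreal (ent (k v)) \<partial>maxwell_measure) \<le> (\<integral>\<^sup>+v. ennreal (ent (h v)) \<partial>maxwell_measure) + ennreal \<delta>"
    by (simp only: ennreal_add_left_cancel_le) simp
  also have "\<dots> \<le> (\<integral>\<^sup>+v. ennreal (ent (h v)) \<partial>maxwell_measure) + ennreal e"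
    using \<delta> by (intro add_left_mono ennreal_leI)
  finally show "(\<integral>\<^sup>+v. ennreal (ent (k v)) \<partial>maxwell_measure) \<le> (\<integral>\<^sup>+v. ennreal (ent (h v)) \<partial>maxwell_measure) + ennreal e" .
qed

text \<open>Duality again, now with test function \<open>k powr (p - 1)\<close> and Young's
  inequality for the exponents \<open>p\<close> and \<open>q\<close>. The term with \<open>k\<close>
  on the right is absorbed into the left side, which requires that it be finite; hence the
  truncation, removed afterwards by monotone convergence.\<close>

lemma powr_step_le:
  assumes [measurable]: "c \<in> borel_measurable borel" "h \<in> borel_measurable borel" "k \<in> borel_measurable borel"
    and c: "\<And>r. 0 \<le> c r" and freq: "\<And>v::'a. collision_freq c v \<le> 1"
    and h: "\<And>v. 0 \<le> h v" and k: "\<And>v. 0 \<le> k v" and p: "1 < p"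
    and hk: "AE v in maxwell_measure. step c (\<lambda>v. ennreal (h v)) v = ennreal (k v)"
  shows "(\<integral>\<^sup>+v. ennreal (k v powr p) \<partial>maxwell_measure) \<le> (\<integral>\<^sup>+v. ennreal (h v powr p) \<partial>maxwell_measure)"
proof (cases "(\<integral>\<^sup>+v. ennreal (h v powr p) \<partial>maxwell_measure)")
  case (real j)
  define kn where "kn n v = min (k v) (real n)" for n v
  have [measurable]: "kn n \<in> borel_measurable borel" for n unfolding kn_def[abs_def] by measurable
  have kn: "0 \<le> kn n v" "kn n v \<le> k v" "kn n v \<le> real n" for n v using k[of v] by (auto simp: kn_def)
  define q where "q = p / (p - 1)"
  have q: "1 < q" "1 / p + 1 / q = 1" "(p - 1) * q = p" using p by (auto simp: q_def field_simps)
  have bound: "(\<integral>\<^sup>+v. ennreal (kn n v powr p) \<partial>maxwell_measure) \<le> ennreal j" for n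
  proof -
    let ?I = "\<integral>\<^sup>+v. ennreal (kn n v powr p) \<partial>maxwell_measure"
    have "?I \<le> (\<integral>\<^sup>+v. ennreal (real n powr p) \<partial>(maxwell_measure :: 'a measure))"
      using kn p by (intro nn_integral_mono ennreal_leI powr_mono2) auto
    also have "\<dots> < \<infinity>" by (simp add: maxwell.emeasure_space_1[simplified])
    finally obtain i where i: "?I = ennreal i" "0 \<le> i" by (cases ?I) auto
    have "?I \<le> (\<integral>\<^sup>+v. step c (\<lambda>v. ennreal (h v)) v * ennreal (kn n v powr (p - 1)) \<partial>maxwell_measure) + 0"
      unfolding add_0_right
    proof (rule nn_integral_mono_AE, use hk in eventually_elim)
      case (elim v)
      have "kn n v powr p = kn n v * kn n v powr (p - 1)"
        using kn[of n v] by (cases "kn n v = 0") (auto simp: powr_diff)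
      also have "\<dots> \<le> k v * kn n v powr (p - 1)" using kn[of n v] by (intro mult_right_mono) auto
      finally show ?case unfolding elim using k[of v] by (simp add: ennreal_mult[symmetric] ennreal_leI)
    qed
    also have "\<dots> \<le> (\<integral>\<^sup>+v. ennreal (1 / p) * ennreal (h v powr p) \<partial>maxwell_measure) + (\<integral>\<^sup>+v. ennreal (1 / q) * ennreal (kn n v powr p) \<partial>maxwell_measure)"
    proof (rule step_dual)
      fix x y
      have "h x * kn n y powr (p - 1) \<le> h x powr p / p + (kn n y powr (p - 1)) powr q / q"
        using h[of x] kn[of n y] p q by (intro Youngs_inequality) auto
      also have "(kn n y powr (p - 1)) powr q = kn n y powr p"
        using q(3) by (simp add: powr_powr)
      finally have "ennreal (h x * kn n y powr (p - 1)) \<le> ennreal (h x powr p / p + kn n y powr p / q)"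
        by (rule ennreal_leI)
      then show "ennreal (h x) * ennreal (kn n y powr (p - 1)) + 0 \<le> ennreal (1 / p) * ennreal (h x powr p) + ennreal (1 / q) * ennreal (kn n y powr p)"
        using h[of x] p q by (simp add: ennreal_mult[symmetric] ennreal_plus[symmetric] del: ennreal_plus)
    qed (use c freq in \<open>simp_all\<close>)
    also have "\<dots> = ennreal (1 / p) * ennreal j + ennreal (1 / q) * ennreal i"
      by (simp add: nn_integral_cmult real i)
    \<comment> \<open>With \<open>i\<close> finite this says \<open>i \<le> j / p + i / q\<close>,
      and \<open>1 - 1 / q = 1 / p\<close> leaves \<open>i \<le> j\<close>.\<close>
    also have "\<dots> = ennreal (j / p + i / q)"
      using p q real i by (simp add: ennreal_mult[symmetric] ennreal_plus[symmetric] del: ennreal_plus)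
    finally have "ennreal i \<le> ennreal (j / p + i / q)" unfolding i .
    then have "i \<le> j / p + i / q" using i(2) real p q by (subst (asm) ennreal_le_iff) auto
    moreover have "i / q = i - i / p"
    proof -
      have "1 / q = 1 - 1 / p" using q(2) by simp
      then have "i * (1 / q) = i * (1 - 1 / p)" by simp
      then show ?thesis by (simp add: algebra_simps)
    qed
    ultimately have "i / p \<le> j / p" by simp
    then have "i \<le> j" using p by (simp add: divide_le_cancel)
    then show ?thesis using i by (simp add: ennreal_leI)
  qed
  have "(\<lambda>n. \<integral>\<^sup>+v. ennreal (kn n v powr p) \<partial>maxwell_measure) \<longlonglongrightarrow> (\<integral>\<^sup>+v. ennreal (k v powr p) \<partial>maxwell_measure)"
  proof (rule nn_integral_LIMSEQ)
    show "incseq (\<lambda>n v. ennreal (kn n v powr p))"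
      using k p by (intro incseq_SucI le_funI ennreal_leI powr_mono2) (auto simp: kn_def)
    fix v
    obtain N where "k v \<le> real N" using real_arch_simple by blast
    then have "eventually (\<lambda>n. ennreal (kn n v powr p) = ennreal (k v powr p)) sequentially"
      unfolding eventually_sequentially by (intro exI[of _ N]) (auto simp: kn_def min_def)
    then show "(\<lambda>n. ennreal (kn n v powr p)) \<longlonglongrightarrow> ennreal (k v powr p)"
      by (rule tendsto_eventually)
  qed measurable
  then have "(\<integral>\<^sup>+v. ennreal (k v powr p) \<partial>maxwell_measure) \<le> ennreal j"
    by (rule LIMSEQ_le_const2) (use bound in auto)
  then show ?thesis by (simp add: real)
qed (simp add: top_unique)

end

subsection \<open>Truncated collisions\<close>

definition near :: "real \<Rightarrow> real \<Rightarrow> real" where "near R r = (if r \<le> R then 1 else 0)"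
definition far :: "real \<Rightarrow> real \<Rightarrow> real" where "far R r = (if r \<le> R then 0 else 1)"

lemma measurable_near [measurable]: "near R \<in> borel_measurable borel"
  unfolding near_def[abs_def] by measurable

lemma measurable_far [measurable]: "far R \<in> borel_measurable borel"
  unfolding far_def[abs_def] by measurable

lemma near_nonneg [simp]: "0 \<le> near R r" by (simp add: near_def)
lemma far_nonneg [simp]: "0 \<le> far R r" by (simp add: far_def)

lemma near_far_split: "ennreal (near R r) * x + ennreal (far R r) * x = x"
  by (simp add: near_def far_def)

lemma collision_freq_near_far: "collision_freq (near R) v + collision_freq (far R) v = 1"
  unfolding collision_freq_def
  by (subst nn_integral_add[symmetric])
     (simp_all add: near_far_split[where x = 1, simplified] maxwell.emeasure_space_1[simplified])

lemma collision_freq_near_le: "collision_freq (near R) v \<le> 1"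
  by (subst collision_freq_near_far[of R v, symmetric]) simp

lemma one_minus_collision_freq_near: "1 - collision_freq (near R) v = collision_freq (far R) v"
proof -
  have "collision_freq (near R) v \<noteq> \<infinity>"
    using collision_freq_near_le[of R v] by (metis ennreal_one_less_top infinity_ennreal_def leD)
  then show ?thesis
    unfolding collision_freq_near_far[of R v, symmetric] by simp
qed

lemma collision_freq_far_le: "collision_freq (far R) v \<le> 1"
  by (subst collision_freq_near_far[of R v, symmetric]) simp

abbreviation maxwell_pairs :: "('a::euclidean_space \<Rightarrow> 'a \<Rightarrow> ennreal) \<Rightarrow> ennreal" where
  "maxwell_pairs F \<equiv> \<integral>\<^sup>+v. \<integral>\<^sup>+w. F v w \<partial>maxwell_measure \<partial>maxwell_measure"

text \<open>For pairs with density \<open>h v\<close> relative to the product Maxwellian, this is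
  the density of the partner \<open>w\<close> that comes from the pairs too far apart to
  collide.\<close>

definition stray :: "real \<Rightarrow> ('a::euclidean_space \<Rightarrow> real) \<Rightarrow> 'a \<Rightarrow> ennreal" where
  "stray R h w = (\<integral>\<^sup>+v. ennreal (far R (norm (v - w))) * ennreal (h v) \<partial>maxwell_measure)"

lemma measurable_stray [measurable (raw)]:
  assumes [measurable]: "h \<in> borel_measurable borel" "f \<in> M \<rightarrow>\<^sub>M borel"
  shows "(\<lambda>x. stray R h (f x :: 'a::euclidean_space)) \<in> borel_measurable M"
  unfolding stray_def by measurable

lemma nn_integral_stray:
  fixes h :: "'a::euclidean_space \<Rightarrow> real"
  assumes [measurable]: "h \<in> borel_measurable borel" "\<phi> \<in> borel_measurable borel"
  shows "(\<integral>\<^sup>+w. stray R h w * \<phi> w \<partial>maxwell_measure) =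
     maxwell_pairs (\<lambda>v w. ennreal (far R (norm (v - w))) * (ennreal (h v) * \<phi> w))"
proof -
  interpret pair_sigma_finite "maxwell_measure :: 'a measure" "maxwell_measure :: 'a measure" ..
  have "(\<integral>\<^sup>+w. stray R h w * \<phi> w \<partial>maxwell_measure) =
     (\<integral>\<^sup>+w. \<integral>\<^sup>+v. ennreal (far R (norm (v - w))) * (ennreal (h v) * \<phi> w) \<partial>maxwell_measure \<partial>maxwell_measure)"
    unfolding stray_def by (simp add: nn_integral_multc[symmetric] mult.assoc)
  also have "\<dots> = maxwell_pairs (\<lambda>v w. ennreal (far R (norm (v - w))) * (ennreal (h v) * \<phi> w))"
    by (rule Fubini') measurable
  finally show ?thesis .
qed

text \<open>The dual form of subadditivity of the entropy: the test function is the logarithm of a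
  product density, which splits into one term for each marginal.\<close>

lemma two_marginal_young:
  assumes "0 \<le> h" "0 \<le> x" "0 \<le> y" "0 < \<delta>"
  shows "h * ln ((x + \<delta>) / \<delta>) + h * ln ((y + \<delta>) / \<delta>) + 1 \<le> ent h + 2 * (h * ln (1 / \<delta>)) + (x + \<delta>) * (y + \<delta>)"
proof -
  have "h * ln ((x + \<delta>) * (y + \<delta>)) \<le> ent h + (x + \<delta>) * (y + \<delta>) - 1"
    using assms by (intro ent_young) auto
  moreover have "ln ((x + \<delta>) * (y + \<delta>)) = ln (x + \<delta>) + ln (y + \<delta>)"
    using assms by (subst ln_mult_pos) auto
  ultimately show ?thesis using assms by (simp add: ln_div algebra_simps)
qed

context collision_kernel
begin

text \<open>Expectation over the following experiment: \<open>v\<close> and \<open>w\<close> are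
  independent Maxwellian velocities, a near pair collides with a random direction, a far pair stays,
  and \<open>F\<close> sees the pair before and after.\<close>

definition jump :: "real \<Rightarrow> ('a \<Rightarrow> 'a \<Rightarrow> 'a \<Rightarrow> 'a \<Rightarrow> ennreal) \<Rightarrow> ennreal" where
  "jump R F = collision_integral (\<lambda>v w \<sigma>. weight (near R) v w \<sigma> * F v w (post v w \<sigma>) (post_star v w \<sigma>)) +
     maxwell_pairs (\<lambda>v w. ennreal (far R (norm (v - w))) * F v w v w)"

lemma jump_mono: "(\<And>v w x y. F v w x y \<le> G v w x y) \<Longrightarrow> jump R F \<le> jump R G"
  unfolding jump_def by (intro add_mono collision_integral_mono nn_integral_mono mult_left_mono) auto

lemma jump_add:
  assumes F: "(\<lambda>(v, w, x, y). F v w x y) \<in> borel_measurable (borel \<Otimes>\<^sub>M borel \<Otimes>\<^sub>M borel \<Otimes>\<^sub>M borel)"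
    and G: "(\<lambda>(v, w, x, y). G v w x y) \<in> borel_measurable (borel \<Otimes>\<^sub>M borel \<Otimes>\<^sub>M borel \<Otimes>\<^sub>M borel)"
  shows "jump R (\<lambda>v w x y. F v w x y + G v w x y) = jump R F + jump R G"
proof -
  note [measurable (raw)] = measurable_curry4[OF F] measurable_curry4[OF G]
  have 1: "collision_integral (\<lambda>v w \<sigma>. weight (near R) v w \<sigma> * F v w (post v w \<sigma>) (post_star v w \<sigma>) + weight (near R) v w \<sigma> * G v w (post v w \<sigma>) (post_star v w \<sigma>)) =
     collision_integral (\<lambda>v w \<sigma>. weight (near R) v w \<sigma> * F v w (post v w \<sigma>) (post_star v w \<sigma>)) +
     collision_integral (\<lambda>v w \<sigma>. weight (near R) v w \<sigma> * G v w (post v w \<sigma>) (post_star v w \<sigma>))"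
    by (rule collision_integral_add) measurable
  have 2: "maxwell_pairs (\<lambda>v w. ennreal (far R (norm (v - w))) * F v w v w + ennreal (far R (norm (v - w))) * G v w v w) =
     maxwell_pairs (\<lambda>v w. ennreal (far R (norm (v - w))) * F v w v w) + maxwell_pairs (\<lambda>v w. ennreal (far R (norm (v - w))) * G v w v w)"
    by (simp add: nn_integral_add)
  show ?thesis unfolding jump_def distrib_left 1 2 by (simp add: add_ac)
qed

lemma jump_pre:
  assumes [measurable]: "case_prod P \<in> borel_measurable (borel \<Otimes>\<^sub>M borel)"
  shows "jump R (\<lambda>v w x y. P v w) = maxwell_pairs P"
  unfolding jump_def
  by (subst collision_integral_const_direction) (simp_all add: nn_integral_add[symmetric] near_far_split)

text \<open>The product Maxwellian is stationary for the experiment: on near pairs by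
  microreversibility, on far pairs because nothing moves.\<close>

lemma jump_post:
  assumes [measurable]: "case_prod P \<in> borel_measurable (borel \<Otimes>\<^sub>M borel)"
  shows "jump R (\<lambda>v w x y. P x y) = maxwell_pairs P"
proof -
  have "jump R (\<lambda>v w x y. P x y) = jump R (\<lambda>v w x y. P v w)"
    unfolding jump_def by (subst collision_integral_pre_post[where F = "\<lambda>v w x y. P x y"]) simp_all
  then show ?thesis by (simp add: jump_pre)
qed

text \<open>When the pair starts with density \<open>h v\<close>, the first velocity afterwards has
  density \<open>step (near R) h\<close>.\<close>

lemma jump_step:
  assumes [measurable]: "h \<in> borel_measurable borel" "\<phi> \<in> borel_measurable borel"
  shows "(\<integral>\<^sup>+v. step (near R) h v * \<phi> v \<partial>maxwell_measure) = jump R (\<lambda>v w x y. h v * \<phi> x)"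
proof -
  have "(\<integral>\<^sup>+v. step (near R) h v * \<phi> v \<partial>maxwell_measure) =
      (\<integral>\<^sup>+v. gain (near R) h v * \<phi> v \<partial>maxwell_measure) + (\<integral>\<^sup>+v. collision_freq (far R) v * (h v * \<phi> v) \<partial>maxwell_measure)"
    unfolding step_def one_minus_collision_freq_near
    by (subst nn_integral_add[symmetric]) (simp_all add: distrib_right mult.assoc add.commute)
  also have "(\<integral>\<^sup>+v. collision_freq (far R) v * (h v * \<phi> v) \<partial>maxwell_measure) =
      maxwell_pairs (\<lambda>v w. ennreal (far R (norm (v - w))) * (h v * \<phi> v))"
    unfolding collision_freq_def by (simp add: nn_integral_multc)
  finally show ?thesis by (simp add: jump_def gain_weak)
qed

text \<open>The same for the second velocity afterwards. Its part from collisions equals that of the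
  first velocity, by evenness of the kernel; only the uncollided part differs.\<close>

lemma jump_gain_stray:
  assumes [measurable]: "h \<in> borel_measurable borel" "\<phi> \<in> borel_measurable borel"
  shows "(\<integral>\<^sup>+v. (gain (near R) (\<lambda>v. ennreal (h v)) v + stray R h v) * \<phi> v \<partial>maxwell_measure) =
    jump R (\<lambda>v w x y. ennreal (h v) * \<phi> y)"
  unfolding jump_def
  by (simp add: distrib_right nn_integral_add gain_weak_star nn_integral_stray)

text \<open>Since \<open>b\<close> is even, \<open>k1\<close> and \<open>k2\<close> differ only by what the far collisions leave in place. They are the
  two marginals of one joint density, whose entropy is at most that of \<open>h\<close>.\<close>

lemma ent_two_marginals:
  assumes [measurable]: "h \<in> borel_measurable borel" "k1 \<in> borel_measurable borel" "k2 \<in> borel_measurable borel"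
    and h: "\<And>v. 0 \<le> h v" and k: "\<And>v. 0 \<le> k1 v" "\<And>v. 0 \<le> k2 v"
    and h1: "(\<integral>\<^sup>+v. ennreal (h v) \<partial>maxwell_measure) = 1"
    and hk1: "AE v in maxwell_measure. step (near R) (\<lambda>v. ennreal (h v)) v = ennreal (k1 v)"
    and hk2: "AE v in maxwell_measure. gain (near R) (\<lambda>v. ennreal (h v)) v + stray R h v = ennreal (k2 v)"
  shows "(\<integral>\<^sup>+v. ennreal (ent (k1 v)) \<partial>maxwell_measure) + (\<integral>\<^sup>+v. ennreal (ent (k2 v)) \<partial>maxwell_measure)
     \<le> (\<integral>\<^sup>+v. ennreal (ent (h v)) \<partial>maxwell_measure)"
proof (rule ennreal_le_epsilon)
  fix e :: real assume "0 < e"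
  \<comment> \<open>The product of the two shifted masses exceeds one by
    \<open>2 * \<delta> + \<delta> * \<delta>\<close>, which is at most
    \<open>3 * \<delta>\<close>.\<close>
  define \<delta> where "\<delta> = min (e / 3) (1/2)"
  have \<delta>: "0 < \<delta>" "\<delta> < 1" "\<delta> \<le> e / 3" using \<open>0 < e\<close> by (auto simp: \<delta>_def)
  have k1_weak: "(\<integral>\<^sup>+v. ennreal (k1 v) * \<phi> v \<partial>maxwell_measure) = jump R (\<lambda>v w x y. ennreal (h v) * \<phi> x)"
    if [measurable]: "\<phi> \<in> borel_measurable borel" for \<phi>
    by (subst jump_step[symmetric]) (auto intro!: nn_integral_cong_AE eventually_mono[OF hk1])
  have k2_weak: "(\<integral>\<^sup>+v. ennreal (k2 v) * \<phi> v \<partial>maxwell_measure) = jump R (\<lambda>v w x y. ennreal (h v) * \<phi> y)"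
    if [measurable]: "\<phi> \<in> borel_measurable borel" for \<phi>
    by (subst jump_gain_stray[symmetric]) (auto intro!: nn_integral_cong_AE eventually_mono[OF hk2])
  have one: "maxwell_pairs (\<lambda>v w. \<kappa>) = \<kappa>" for \<kappa>
    by (simp add: maxwell.emeasure_space_1[simplified])
  have h_mass: "jump R (\<lambda>v w x y. ennreal (h v) * 1) = 1"
    by (subst jump_pre) (simp_all add: h1 maxwell.emeasure_space_1[simplified])
  have k11: "(\<integral>\<^sup>+v. ennreal (k1 v) \<partial>maxwell_measure) = 1" and k21: "(\<integral>\<^sup>+v. ennreal (k2 v) \<partial>maxwell_measure) = 1"
    using k1_weak[of "\<lambda>_. 1"] k2_weak[of "\<lambda>_. 1"] h_mass by simp_all
  have ld: "0 \<le> ln (1 / \<delta>)" using \<delta> by simp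
  let ?\<phi> = "\<lambda>k v. ennreal (ln ((k v + \<delta>) / \<delta>))"
  have lk: "0 \<le> ln ((k1 v + \<delta>) / \<delta>)" "0 \<le> ln ((k2 v + \<delta>) / \<delta>)" for v
    using \<delta> k[of v] by (auto intro!: ln_ge_zero simp: field_simps)
  have "(\<integral>\<^sup>+v. ennreal (k1 v) * ?\<phi> k1 v \<partial>maxwell_measure) + (\<integral>\<^sup>+v. ennreal (k2 v) * ?\<phi> k2 v \<partial>maxwell_measure) + 1 =
     jump R (\<lambda>v w x y. ennreal (h v) * ?\<phi> k1 x + ennreal (h v) * ?\<phi> k2 y + 1)"
  proof -
    have "jump R (\<lambda>v w x y. 1) = 1" using one[of 1] by (subst jump_pre) simp_all
    then show ?thesis by (simp add: jump_add k1_weak k2_weak)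
  qed
  also have "\<dots> \<le> jump R (\<lambda>v w x y. (ennreal (ent (h v)) + ennreal (h v) * ennreal (2 * ln (1 / \<delta>))) + ennreal (k1 x + \<delta>) * ennreal (k2 y + \<delta>))"
  proof (rule jump_mono)
    fix v w x y :: 'a
    have "ennreal (h v) * ?\<phi> k1 x + ennreal (h v) * ?\<phi> k2 y + 1 =
       ennreal (h v * ln ((k1 x + \<delta>) / \<delta>) + h v * ln ((k2 y + \<delta>) / \<delta>) + 1)"
      using h[of v] lk(1)[of x] lk(2)[of y] by (simp add: ennreal_mult)
    also have "\<dots> \<le> ennreal (ent (h v) + 2 * (h v * ln (1 / \<delta>)) + (k1 x + \<delta>) * (k2 y + \<delta>))"
      by (intro ennreal_leI two_marginal_young h k \<delta>)
    also have "\<dots> = (ennreal (ent (h v)) + ennreal (h v) * ennreal (2 * ln (1 / \<delta>))) + ennreal (k1 x + \<delta>) * ennreal (k2 y + \<delta>)"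
    proof -
      have "ennreal (ent (h v) + h v * (2 * ln (1 / \<delta>)) + (k1 x + \<delta>) * (k2 y + \<delta>)) =
          (ennreal (ent (h v)) + ennreal (h v * (2 * ln (1 / \<delta>)))) + ennreal ((k1 x + \<delta>) * (k2 y + \<delta>))"
        using h[of v] k(1)[of x] k(2)[of y] ld \<delta> ent_nonneg[OF h[of v]]
        by (subst ennreal_plus, simp, simp, subst ennreal_plus) simp_all
      then show ?thesis
        using h[of v] k(1)[of x] k(2)[of y] ld \<delta> by (simp only: ennreal_mult'[symmetric] ennreal_mult[symmetric]) (simp add: ennreal_mult mult_ac)
    qed
    finally show "ennreal (h v) * ?\<phi> k1 x + ennreal (h v) * ?\<phi> k2 y + 1 \<le> \<dots>" .
  qed
  also have "\<dots> = ((\<integral>\<^sup>+v. ennreal (ent (h v)) \<partial>maxwell_measure) + ennreal (2 * ln (1 / \<delta>))) + (1 + ennreal \<delta>) * (1 + ennreal \<delta>)"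
  proof -
    have kd: "(\<integral>\<^sup>+v. ennreal (k1 v + \<delta>) \<partial>maxwell_measure) = 1 + ennreal \<delta>" "(\<integral>\<^sup>+v. ennreal (k2 v + \<delta>) \<partial>maxwell_measure) = 1 + ennreal \<delta>"
      using k \<delta> by (simp_all add: nn_integral_add k11 k21 maxwell.emeasure_space_1[simplified])
    have "jump R (\<lambda>v w x y. ennreal (k1 x + \<delta>) * ennreal (k2 y + \<delta>)) = maxwell_pairs (\<lambda>x y. ennreal (k1 x + \<delta>) * ennreal (k2 y + \<delta>))"
      by (rule jump_post) measurable
    also have "\<dots> = (1 + ennreal \<delta>) * (1 + ennreal \<delta>)"
      by (simp add: nn_integral_cmult nn_integral_multc kd)
    finally have P: "jump R (\<lambda>v w x y. ennreal (k1 x + \<delta>) * ennreal (k2 y + \<delta>)) = (1 + ennreal \<delta>) * (1 + ennreal \<delta>)" .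
    have "jump R (\<lambda>v w x y. ennreal (ent (h v)) + ennreal (h v) * ennreal (2 * ln (1 / \<delta>))) =
       (\<integral>\<^sup>+v. ennreal (ent (h v)) \<partial>maxwell_measure) + ennreal (2 * ln (1 / \<delta>))"
      by (subst jump_pre) (simp_all add: maxwell.emeasure_space_1[simplified] nn_integral_add nn_integral_multc h1)
    with P show ?thesis by (simp add: jump_add)
  qed
  finally have up: "(\<integral>\<^sup>+v. ennreal (k1 v) * ?\<phi> k1 v \<partial>maxwell_measure) + (\<integral>\<^sup>+v. ennreal (k2 v) * ?\<phi> k2 v \<partial>maxwell_measure) + 1 \<le>
      ((\<integral>\<^sup>+v. ennreal (ent (h v)) \<partial>maxwell_measure) + ennreal (2 * ln (1 / \<delta>))) + (1 + ennreal \<delta>) * (1 + ennreal \<delta>)" .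
  have "((\<integral>\<^sup>+v. ennreal (ent (k1 v)) \<partial>maxwell_measure) + ennreal (1 + ln (1 / \<delta>))) +
      ((\<integral>\<^sup>+v. ennreal (ent (k2 v)) \<partial>maxwell_measure) + ennreal (1 + ln (1 / \<delta>))) \<le>
      ((\<integral>\<^sup>+v. ennreal (k1 v) * ?\<phi> k1 v \<partial>maxwell_measure) + 1) + ((\<integral>\<^sup>+v. ennreal (k2 v) * ?\<phi> k2 v \<partial>maxwell_measure) + 1)"
    by (intro add_mono ent_le_regularized_integral k k11 k21 \<delta>) simp_all
  also have "\<dots> = ((\<integral>\<^sup>+v. ennreal (k1 v) * ?\<phi> k1 v \<partial>maxwell_measure) + (\<integral>\<^sup>+v. ennreal (k2 v) * ?\<phi> k2 v \<partial>maxwell_measure) + 1) + 1"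
    by (simp add: add_ac)
  also have "\<dots> \<le> ((\<integral>\<^sup>+v. ennreal (ent (h v)) \<partial>maxwell_measure) + ennreal (2 * ln (1 / \<delta>))) + (1 + ennreal \<delta>) * (1 + ennreal \<delta>) + 1"
    by (intro add_right_mono up)
  also have "\<dots> = (\<integral>\<^sup>+v. ennreal (ent (h v)) \<partial>maxwell_measure) + ennreal (2 * ln (1 / \<delta>) + (1 + \<delta>) * (1 + \<delta>) + 1)"
  proof -
    have "ennreal (2 * ln (1 / \<delta>) + (1 + \<delta>) * (1 + \<delta>) + 1) = ennreal (2 * ln (1 / \<delta>)) + ennreal ((1 + \<delta>) * (1 + \<delta>)) + 1"
      using ld \<delta> by (subst ennreal_plus, simp, simp, subst ennreal_plus) simp_all
    also have "ennreal ((1 + \<delta>) * (1 + \<delta>)) = (1 + ennreal \<delta>) * (1 + ennreal \<delta>)"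
      using \<delta> by (subst ennreal_mult) simp_all
    finally show ?thesis by (simp add: add_ac)
  qed
  also have "\<dots> \<le> (\<integral>\<^sup>+v. ennreal (ent (h v)) \<partial>maxwell_measure) + (ennreal (2 * (1 + ln (1 / \<delta>))) + ennreal e)"
  proof -
    define sq where "sq = \<delta> * \<delta>"
    have "sq \<le> \<delta> * 1" unfolding sq_def using \<delta> by (intro mult_left_mono) auto
    moreover have "(1 + \<delta>) * (1 + \<delta>) = 1 + 2 * \<delta> + sq" by (simp add: sq_def algebra_simps)
    ultimately have "2 * ln (1 / \<delta>) + (1 + \<delta>) * (1 + \<delta>) + 1 \<le> 2 * (1 + ln (1 / \<delta>)) + e"
      using \<delta> by simp
    then have "ennreal (2 * ln (1 / \<delta>) + (1 + \<delta>) * (1 + \<delta>) + 1) \<le> ennreal (2 * (1 + ln (1 / \<delta>)) + e)"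
      by (rule ennreal_leI)
    also have "\<dots> = ennreal (2 * (1 + ln (1 / \<delta>))) + ennreal e"
      using ld \<open>0 < e\<close> by (intro ennreal_plus) auto
    finally show ?thesis by (rule add_left_mono)
  qed
  finally have "ennreal (2 * (1 + ln (1 / \<delta>))) + ((\<integral>\<^sup>+v. ennreal (ent (k1 v)) \<partial>maxwell_measure) + (\<integral>\<^sup>+v. ennreal (ent (k2 v)) \<partial>maxwell_measure)) \<le>
      ennreal (2 * (1 + ln (1 / \<delta>))) + ((\<integral>\<^sup>+v. ennreal (ent (h v)) \<partial>maxwell_measure) + ennreal e)"
  proof -
    have "ennreal (2 * (1 + ln (1 / \<delta>))) = ennreal (1 + ln (1 / \<delta>)) + ennreal (1 + ln (1 / \<delta>))"
      using ld by (subst ennreal_plus[symmetric]) simp_all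
    then show "(\<integral>\<^sup>+v. ennreal (ent (k1 v)) \<partial>maxwell_measure) + ennreal (1 + ln (1 / \<delta>)) +
      ((\<integral>\<^sup>+v. ennreal (ent (k2 v)) \<partial>maxwell_measure) + ennreal (1 + ln (1 / \<delta>))) \<le>
      (\<integral>\<^sup>+v. ennreal (ent (h v)) \<partial>maxwell_measure) + (ennreal (2 * (1 + ln (1 / \<delta>))) + ennreal e) \<Longrightarrow> ?thesis"
      by (simp only: add_ac)
  qed
  then show "(\<integral>\<^sup>+v. ennreal (ent (k1 v)) \<partial>maxwell_measure) + (\<integral>\<^sup>+v. ennreal (ent (k2 v)) \<partial>maxwell_measure)
      \<le> (\<integral>\<^sup>+v. ennreal (ent (h v)) \<partial>maxwell_measure) + ennreal e"
    by (simp only: ennreal_add_left_cancel_le) simp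
qed

end

subsection \<open>Entropy contraction with a Gaussian error\<close>

text \<open>The two densities share the part \<open>q\<close> that comes from collisions;
  \<open>\<alpha> * h\<close> and \<beta> are the uncollided remainders, small in mean. Since the
  derivative of \<open>x * ln x\<close> is unbounded at both ends, small mean alone does not control
  the difference. The parameter \<rho> weighs the small remainders against \<open>p\<close>-th
  powers that are merely bounded and against a constant.\<close>

lemma ent_perturb:
  fixes p \<rho> \<alpha> \<beta> h q :: real
  assumes p: "1 < p" and \<rho>: "1 \<le> \<rho>" and h: "0 \<le> h" and q: "0 \<le> q"
    and \<alpha>: "0 \<le> \<alpha>" "\<alpha> \<le> 1" and \<beta>: "0 \<le> \<beta>"
  defines "k1 \<equiv> q + \<alpha> * h" and "k2 \<equiv> q + \<beta>"
  shows "ent k1 \<le> ent k2 + 1 / (p - 1) * (\<rho> * (\<alpha> * h) + (h powr p + k1 powr p) / \<rho>) + (2 * \<rho> * \<beta> + 1 / \<rho>)"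
proof -
  have k1: "0 \<le> k1" and qk: "q \<le> k1" and ah: "0 \<le> \<alpha> * h" using \<alpha> h q by (auto simp: k1_def)
  \<comment> \<open>Superadditivity of \<open>x * ln x\<close> lets the contribution of \<beta> be
    discarded down to \<open>\<beta> * ln \<beta>\<close>.\<close>
  have super: "q * ln q + \<beta> * ln \<beta> \<le> k2 * ln k2"
  proof -
    have "q * ln q \<le> q * ln k2" using q \<beta> by (cases "q = 0") (auto simp: k2_def intro!: mult_left_mono)
    moreover have "\<beta> * ln \<beta> \<le> \<beta> * ln k2" using q \<beta> by (cases "\<beta> = 0") (auto simp: k2_def intro!: mult_left_mono)
    moreover have "k2 * ln k2 = q * ln k2 + \<beta> * ln k2" by (simp add: k2_def distrib_right)
    ultimately show ?thesis by linarith
  qed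
  \<comment> \<open>Convexity: the increment from \<open>q\<close> to \<open>k1\<close> is at most
    its length times the derivative at \<open>k1\<close>.\<close>
  have tangent: "k1 * ln k1 - q * ln q \<le> \<alpha> * h * ln k1 + \<alpha> * h"
  proof (cases "k1 = 0")
    case True
    then have "q = 0" using qk q by simp
    then show ?thesis using True ah by simp
  next
    case False
    have "q * ln k1 \<le> ent q + k1 - 1" using False k1 q by (intro ent_young) auto
    moreover have "k1 * ln k1 = q * ln k1 + \<alpha> * h * ln k1" by (simp add: k1_def distrib_right)
    ultimately show ?thesis by (simp add: ent_def k1_def)
  qed
  have young_beta: "- (\<beta> * ln \<beta>) \<le> \<rho> * \<beta> + 1 / \<rho>"
  proof (cases "\<beta> = 0")
    case False
    then have b: "0 < \<beta>" using \<beta> by simp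
    have "ln (1 / (\<rho> * \<beta>)) \<le> 1 / (\<rho> * \<beta>) - 1" using b \<rho> by (intro ln_le_minus_one) auto
    then have "\<beta> * (- ln \<beta> - ln \<rho>) \<le> \<beta> * (1 / (\<rho> * \<beta>) - 1)"
      using b \<rho> by (intro mult_left_mono) (auto simp: ln_div ln_mult_pos)
    also have "\<dots> = 1 / \<rho> - \<beta>" using b \<rho> by (simp add: field_simps)
    finally have "- (\<beta> * ln \<beta>) \<le> \<beta> * ln \<rho> + 1 / \<rho> - \<beta>" by (simp add: algebra_simps)
    also have "\<beta> * ln \<rho> \<le> \<beta> * \<rho>" using ln_le_minus_one[of \<rho>] b \<rho> by (intro mult_left_mono) auto
    finally show ?thesis using b by (simp add: mult.commute)
  qed (use \<rho> in simp)
  have young_log: "\<alpha> * h * ln k1 \<le> 1 / (p - 1) * (\<rho> * (\<alpha> * h) + (h powr p + k1 powr p) / \<rho>)"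
  proof (cases "1 \<le> k1")
    case False
    then have "ln k1 \<le> 0" using k1 by (cases "k1 = 0") auto
    then have "\<alpha> * h * ln k1 \<le> 0" using ah by (intro mult_nonneg_nonpos) auto
    also have "0 \<le> 1 / (p - 1) * (\<rho> * (\<alpha> * h) + (h powr p + k1 powr p) / \<rho>)"
      using p \<rho> \<alpha> h by (intro mult_nonneg_nonneg add_nonneg_nonneg divide_nonneg_nonneg) auto
    finally show ?thesis .
  next
    case True
    \<comment> \<open>With half of the exponent \<open>p - 1\<close>, the square of
      \<open>k1 powr r\<close> is \<open>k1 powr (p - 1)\<close>, so the arithmetic-geometric mean
      inequality with weight \<rho> brings in the \<open>p\<close>-th power.\<close>
    define r where "r = (p - 1) / 2"
    have r: "0 < r" using p by (simp add: r_def)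
    have "ln k1 \<le> k1 powr r / r" using True r by (rule ln_powr_bound)
    then have "\<alpha> * h * ln k1 \<le> \<alpha> * h * (k1 powr r / r)" using ah by (rule mult_left_mono)
    also have "k1 powr r \<le> (\<rho> + k1 powr (p - 1) / \<rho>) / 2"
    proof -
      have "0 \<le> (\<rho> - k1 powr r)\<^sup>2" by simp
      then have "2 * \<rho> * k1 powr r \<le> \<rho>\<^sup>2 + (k1 powr r)\<^sup>2" by (simp add: power2_diff)
      also have "(k1 powr r)\<^sup>2 = k1 powr (p - 1)"
        using True by (simp add: power2_eq_square powr_add[symmetric] r_def)
      finally have "\<rho> * (2 * k1 powr r) \<le> \<rho> * (\<rho> + k1 powr (p - 1) / \<rho>)"
        using \<rho> by (simp add: power2_eq_square algebra_simps)
      then show ?thesis using \<rho> by simp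
    qed
    then have "\<alpha> * h * (k1 powr r / r) \<le> \<alpha> * h * ((\<rho> + k1 powr (p - 1) / \<rho>) / 2 / r)"
      using ah r by (intro mult_left_mono divide_right_mono) auto
    also have "\<dots> = 1 / (p - 1) * (\<rho> * (\<alpha> * h) + \<alpha> * h * k1 powr (p - 1) / \<rho>)"
      using p by (simp add: r_def field_simps)
    also have "\<dots> \<le> 1 / (p - 1) * (\<rho> * (\<alpha> * h) + (h powr p + k1 powr p) / \<rho>)"
    proof -
      have "\<alpha> * h * k1 powr (p - 1) \<le> h * k1 powr (p - 1)"
        using \<alpha> h by (intro mult_right_mono) (auto simp: mult_left_le_one_le)
      also have "\<dots> \<le> h powr p + k1 powr p"
      proof (cases "h \<le> k1")
        case True
        then have "h * k1 powr (p - 1) \<le> k1 * k1 powr (p - 1)" by (intro mult_right_mono) auto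
        also have "\<dots> = k1 powr p" using \<open>1 \<le> k1\<close> by (simp add: powr_diff)
        finally show ?thesis by (simp add: add_increasing)
      next
        case False
        then have "h * k1 powr (p - 1) \<le> h * h powr (p - 1)" using h k1 p by (intro mult_left_mono powr_mono2) auto
        also have "\<dots> = h powr p" using \<open>1 \<le> k1\<close> False by (simp add: powr_diff)
        finally show ?thesis by (simp add: add_increasing2)
      qed
      finally show ?thesis using p \<rho> by (intro mult_left_mono add_left_mono divide_right_mono) auto
    qed
    finally show ?thesis .
  qed
  have "ent k1 - ent k2 = (k1 * ln k1 - q * ln q) - (k2 * ln k2 - q * ln q) - \<alpha> * h + \<beta>"
    by (simp add: ent_def k1_def k2_def)
  also have "\<dots> \<le> \<alpha> * h * ln k1 - \<beta> * ln \<beta> + \<beta>" using super tangent by linarith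
  also have "\<dots> \<le> 1 / (p - 1) * (\<rho> * (\<alpha> * h) + (h powr p + k1 powr p) / \<rho>) + (\<rho> * \<beta> + 1 / \<rho>) + \<rho> * \<beta>"
  proof -
    have "\<beta> \<le> \<rho> * \<beta>" using \<rho> \<beta> by (simp add: mult_le_cancel_right1)
    with young_log young_beta show ?thesis by linarith
  qed
  finally show ?thesis by (simp add: algebra_simps)
qed

text \<open>The exponent is chosen so that Young's inequality only calls for \<open>exp (norm v ^ 2 / 4)\<close>.\<close>

definition tail_rate :: "real \<Rightarrow> real" where "tail_rate p = (1 - 1 / p) / 16"

lemma tail_rate_pos: "1 < p \<Longrightarrow> 0 < tail_rate p"
  by (simp add: tail_rate_def)

text \<open>Young's inequality with the exponent \<open>q\<close> conjugate to \<open>p\<close>: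
  \<open>4 * tail_rate p\<close> equals \<open>1 / (4 * q)\<close>, so the \<open>q\<close>-th power
  of the exponential is \<open>exp (s / 4)\<close>.\<close>

lemma exp_moment_pointwise:
  assumes p: "1 < p" and h: "0 \<le> (h::real)"
  shows "h * exp (4 * tail_rate p * s) \<le> h powr p + exp (s / 4)"
proof -
  define q where "q = p / (p - 1)"
  have q: "1 < q" "1 / p + 1 / q = 1" using p by (auto simp: q_def field_simps)
  have "h * exp (4 * tail_rate p * s) \<le> h powr p / p + exp (4 * tail_rate p * s) powr q / q"
    using p q h by (intro Youngs_inequality) auto
  also have "exp (4 * tail_rate p * s) powr q = exp (s / 4)"
  proof -
    have "q * (4 * tail_rate p * s) = s / 4" using p by (simp add: tail_rate_def q_def field_simps)
    then show ?thesis by (simp add: powr_def)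
  qed
  also have "h powr p / p + exp (s / 4) / q \<le> h powr p + exp (s / 4)"
  proof -
    have "h powr p / p \<le> h powr p / 1" "exp (s / 4) / q \<le> exp (s / 4) / 1"
      using p q by (auto intro!: divide_left_mono simp del: div_by_1)
    then show ?thesis by simp
  qed
  finally show ?thesis .
qed

text \<open>The mean of \<open>exp ((norm v)\<^sup>2 / 4)\<close> under the Maxwell measure.\<close>

definition gauss_const :: "'a::euclidean_space itself \<Rightarrow> real" where
  "gauss_const _ = sqrt 2 ^ DIM('a)"

lemma gauss_const_ge_1: "1 \<le> gauss_const TYPE('a::euclidean_space)"
  by (simp add: gauss_const_def)

lemma exp_moment:
  fixes h :: "'a::euclidean_space \<Rightarrow> real"
  assumes [measurable]: "h \<in> borel_measurable borel" and h: "\<And>v. 0 \<le> h v" and p: "1 < p"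
    and K: "(\<integral>\<^sup>+v. ennreal (h v powr p) \<partial>maxwell_measure) \<le> ennreal K" "0 \<le> K"
  shows "(\<integral>\<^sup>+v. ennreal (h v * exp (4 * tail_rate p * (norm v)\<^sup>2)) \<partial>maxwell_measure) \<le> ennreal (K + gauss_const TYPE('a))"
proof -
  have "(\<integral>\<^sup>+v. ennreal (h v * exp (4 * tail_rate p * (norm v)\<^sup>2)) \<partial>maxwell_measure) \<le>
    (\<integral>\<^sup>+v. ennreal (h v powr p) + ennreal (exp ((norm v)\<^sup>2 / 4)) \<partial>maxwell_measure)"
    by (intro nn_integral_mono) (use exp_moment_pointwise[OF p h] in \<open>simp add: ennreal_plus[symmetric] ennreal_leI del: ennreal_plus\<close>)
  also have "\<dots> = (\<integral>\<^sup>+v. ennreal (h v powr p) \<partial>maxwell_measure) + ennreal (gauss_const TYPE('a))"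
    by (subst nn_integral_add) (simp_all add: nn_integral_maxwell_exp gauss_const_def)
  also have "\<dots> \<le> ennreal K + ennreal (gauss_const TYPE('a))" by (intro add_right_mono K)
  also have "\<dots> = ennreal (K + gauss_const TYPE('a))"
    using K gauss_const_ge_1[where 'a='a] by (intro ennreal_plus[symmetric]) auto
  finally show ?thesis .
qed

text \<open>A Chernoff bound. If the distance exceeds \<open>R\<close>, the squared norms of
  \<open>v\<close> and \<open>w\<close> add up to at least half of \<open>R\<^sup>2\<close>, so the
  indicator is dominated by a product of exponentials. The moment in \<open>v\<close> is controlled
  by the \<open>p\<close>-norm, the one in \<open>w\<close> by the Maxwellian, since
  \<open>4 * tail_rate p \<le> 1 / 4\<close>.\<close>

lemma far_mass_le:
  fixes h :: "'a::euclidean_space \<Rightarrow> real"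
  assumes [measurable]: "h \<in> borel_measurable borel" and h: "\<And>v. 0 \<le> h v" and p: "1 < p" and R: "0 \<le> R"
    and K: "(\<integral>\<^sup>+v. ennreal (h v powr p) \<partial>maxwell_measure) \<le> ennreal K" "0 \<le> K"
  shows "maxwell_pairs (\<lambda>v w. ennreal (far R (norm (v - w))) * ennreal (h v)) \<le>
    ennreal (exp (- 2 * tail_rate p * R\<^sup>2) * ((K + gauss_const TYPE('a)) * gauss_const TYPE('a)))"
proof -
  let ?\<kappa> = "tail_rate p" and ?E = "gauss_const TYPE('a)"
  have \<kappa>: "0 < ?\<kappa>" "4 * ?\<kappa> \<le> 1 / 4" using p by (auto simp: tail_rate_def field_simps)
  have "maxwell_pairs (\<lambda>v w. ennreal (far R (norm (v - w))) * ennreal (h v)) \<le>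
     maxwell_pairs (\<lambda>v w::'a. ennreal (exp (- 2 * ?\<kappa> * R\<^sup>2)) * (ennreal (h v * exp (4 * ?\<kappa> * (norm v)\<^sup>2)) * ennreal (exp ((norm w)\<^sup>2 / 4))))"
  proof (intro nn_integral_mono)
    fix v w :: 'a
    have "far R (norm (v - w)) \<le> exp (- 2 * ?\<kappa> * R\<^sup>2) * (exp (4 * ?\<kappa> * (norm v)\<^sup>2) * exp ((norm w)\<^sup>2 / 4))"
    proof (cases "norm (v - w) \<le> R")
      case False
      have "R\<^sup>2 \<le> (norm (v - w))\<^sup>2" using False R by (intro power_mono) auto
      also have "\<dots> \<le> (norm v + norm w)\<^sup>2" by (intro power_mono norm_triangle_ineq4) auto
      also have "\<dots> \<le> 2 * ((norm v)\<^sup>2 + (norm w)\<^sup>2)"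
        using sum_squares_bound[of "norm v" "norm w"] by (simp add: power2_sum)
      finally have "?\<kappa> * R\<^sup>2 \<le> ?\<kappa> * (2 * ((norm v)\<^sup>2 + (norm w)\<^sup>2))"
        using \<kappa> by (intro mult_left_mono) auto
      moreover have "4 * ?\<kappa> * (norm w)\<^sup>2 \<le> 1 / 4 * (norm w)\<^sup>2" using \<kappa>(2) by (rule mult_right_mono) simp
      ultimately have "0 \<le> - 2 * ?\<kappa> * R\<^sup>2 + (4 * ?\<kappa> * (norm v)\<^sup>2 + (norm w)\<^sup>2 / 4)"
        by (simp add: algebra_simps)
      then show ?thesis unfolding exp_add[symmetric] using False by (simp add: far_def)
    qed (simp add: far_def)
    then have "far R (norm (v - w)) * h v \<le> exp (- 2 * ?\<kappa> * R\<^sup>2) * (exp (4 * ?\<kappa> * (norm v)\<^sup>2) * exp ((norm w)\<^sup>2 / 4)) * h v"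
      using h by (intro mult_right_mono) auto
    then show "ennreal (far R (norm (v - w))) * ennreal (h v) \<le>
      ennreal (exp (- 2 * ?\<kappa> * R\<^sup>2)) * (ennreal (h v * exp (4 * ?\<kappa> * (norm v)\<^sup>2)) * ennreal (exp ((norm w)\<^sup>2 / 4)))"
      using h by (simp add: ennreal_mult[symmetric] mult_ac ennreal_leI)
  qed
  also have "\<dots> = ennreal (exp (- 2 * ?\<kappa> * R\<^sup>2)) *
     ((\<integral>\<^sup>+v. ennreal (h v * exp (4 * ?\<kappa> * (norm v)\<^sup>2)) \<partial>maxwell_measure) * ennreal ?E)"
    by (simp add: nn_integral_cmult nn_integral_multc nn_integral_maxwell_exp gauss_const_def)
  also have "\<dots> \<le> ennreal (exp (- 2 * ?\<kappa> * R\<^sup>2)) * (ennreal (K + ?E) * ennreal ?E)"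
    by (intro mult_left_mono mult_right_mono exp_moment h p K) simp_all
  also have "\<dots> = ennreal (exp (- 2 * ?\<kappa> * R\<^sup>2) * ((K + ?E) * ?E))"
    using K gauss_const_ge_1[where 'a='a] by (simp add: ennreal_mult[symmetric] del: ennreal_plus)
  finally show ?thesis .
qed

text \<open>Sum of the error terms of \<open>ent_perturb\<close>: \<open>X\<close> bounds either far
  mass without its exponential factor, \<open>2 * K\<close> comes from the \<open>p\<close>-norms of
  \<open>h\<close> and of the new density, and the final one from \<open>1 / \<rho>\<close>.\<close>

definition tail_const :: "'a::euclidean_space itself \<Rightarrow> real \<Rightarrow> real \<Rightarrow> real" where
  "tail_const T p K = (let X = (K + gauss_const T) * gauss_const T in (X + 2 * K) / (p - 1) + 2 * X + 1)"

lemma tail_const_pos: "1 < p \<Longrightarrow> 0 \<le> K \<Longrightarrow> 0 < tail_const TYPE('a::euclidean_space) p K"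
proof -
  assume p: "1 < p" and K: "0 \<le> K"
  have "0 \<le> (K + gauss_const TYPE('a)) * gauss_const TYPE('a)"
    using K gauss_const_ge_1[where 'a='a] by (intro mult_nonneg_nonneg) auto
  then have "0 \<le> ((K + gauss_const TYPE('a)) * gauss_const TYPE('a) + 2 * K) / (p - 1)"
    using p K by (intro divide_nonneg_nonneg) auto
  with \<open>0 \<le> (K + gauss_const TYPE('a)) * gauss_const TYPE('a)\<close> show ?thesis
    by (simp add: tail_const_def Let_def)
qed

context collision_kernel
begin

text \<open>Subadditivity bounds the sum of the entropies of \<open>k1\<close> and
  \<open>k2\<close>, and \<open>k2\<close> may be replaced by \<open>k1\<close> up to the
  perturbation error. The error is small although \<open>h\<close> is only known to have a finite
  weighted \<open>p\<close>-norm.\<close>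

lemma ent_near_step_le:
  assumes [measurable]: "h \<in> borel_measurable borel" "k \<in> borel_measurable borel"
    and h: "\<And>v. 0 \<le> h v" and k: "\<And>v. 0 \<le> k v"
    and h1: "(\<integral>\<^sup>+v. ennreal (h v) \<partial>maxwell_measure) = 1"
    and hk: "AE v in maxwell_measure. step (near R) (\<lambda>v. ennreal (h v)) v = ennreal (k v)"
    and p: "1 < p" and R: "0 \<le> R"
    and K: "(\<integral>\<^sup>+v. ennreal (h v powr p) \<partial>maxwell_measure) \<le> ennreal K" "0 \<le> K"
  shows "2 * (\<integral>\<^sup>+v. ennreal (ent (k v)) \<partial>maxwell_measure) \<le>
    (\<integral>\<^sup>+v. ennreal (ent (h v)) \<partial>maxwell_measure) + ennreal (tail_const TYPE('a) p K * exp (- tail_rate p * R\<^sup>2))"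
proof -
  define q where "q v = enn2real (gain (near R) (\<lambda>v. ennreal (h v)) v)" for v
  define \<alpha> where "\<alpha> v = enn2real (collision_freq (far R) v)" for v :: 'a
  define \<beta> where "\<beta> v = enn2real (stray R h v)" for v
  define k1 where "k1 v = q v + \<alpha> v * h v" for v
  define k2 where "k2 v = q v + \<beta> v" for v
  have [measurable]: "q \<in> borel_measurable borel" "\<alpha> \<in> borel_measurable borel" "\<beta> \<in> borel_measurable borel"
    unfolding q_def[abs_def] \<alpha>_def[abs_def] \<beta>_def[abs_def] by measurable
  have [measurable]: "k1 \<in> borel_measurable borel" "k2 \<in> borel_measurable borel"
    unfolding k1_def[abs_def] k2_def[abs_def] by measurable
  have nn: "0 \<le> q v" "0 \<le> \<alpha> v" "0 \<le> \<beta> v" for v by (auto simp: q_def \<alpha>_def \<beta>_def)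
  have \<alpha>: "ennreal (\<alpha> v) = collision_freq (far R) v" "\<alpha> v \<le> 1" for v
  proof -
    have f: "collision_freq (far R) v < top"
      using collision_freq_far_le[of R v] by (rule le_less_trans) simp
    then show "ennreal (\<alpha> v) = collision_freq (far R) v" by (simp add: \<alpha>_def)
    from this[symmetric] show "\<alpha> v \<le> 1" using collision_freq_far_le[of R v] by simp
  qed
  have hi: "(\<lambda>v. ennreal (h v)) \<in> borel_measurable borel" by measurable
  have step_k1: "step (near R) (\<lambda>v. ennreal (h v)) v = ennreal (k1 v)" if "gain (near R) (\<lambda>v. ennreal (h v)) v < top" for v
    unfolding step_def one_minus_collision_freq_near k1_def using that nn h
    by (simp add: q_def \<alpha>(1)[symmetric] ennreal_mult add.commute)
  have "(\<integral>\<^sup>+v. step (near R) (\<lambda>v. ennreal (h v)) v \<partial>maxwell_measure) = 1"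
    using nn_integral_step[OF measurable_near hi near_nonneg collision_freq_near_le, of R] h1 by simp
  then have "AE v in maxwell_measure. step (near R) (\<lambda>v. ennreal (h v)) v \<noteq> \<infinity>"
    by (intro nn_integral_PInf_AE) simp_all
  then have gfin: "AE v in maxwell_measure. gain (near R) (\<lambda>v. ennreal (h v)) v < top"
    by eventually_elim (auto simp: step_def less_top)
  have kk: "AE v in maxwell_measure. k1 v = k v"
    using gfin hk
  proof eventually_elim
    case (elim v)
    then have "ennreal (k1 v) = ennreal (k v)" using step_k1[of v] by simp
    moreover have "0 \<le> k1 v" using nn h by (simp add: k1_def)
    ultimately show ?case using k by (simp add: ennreal_inj)
  qed
  have mass_stray: "(\<integral>\<^sup>+v. stray R h v \<partial>maxwell_measure) = maxwell_pairs (\<lambda>v w. ennreal (far R (norm (v - w))) * ennreal (h v))"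
    using nn_integral_stray[of h "\<lambda>_. 1" R] by simp
  define X where "X = (K + gauss_const TYPE('a)) * gauss_const TYPE('a)"
  have X: "0 \<le> X" using K gauss_const_ge_1[where 'a='a] by (auto simp: X_def)
  have far_mass: "maxwell_pairs (\<lambda>v w. ennreal (far R (norm (v - w))) * ennreal (h v)) \<le> ennreal (exp (- 2 * tail_rate p * R\<^sup>2) * X)"
    unfolding X_def by (rule far_mass_le) (use h p R K in simp_all)
  then have "(\<integral>\<^sup>+v. stray R h v \<partial>maxwell_measure) < \<infinity>"
    unfolding mass_stray by (rule le_less_trans) simp
  then have "AE v in maxwell_measure. stray R h v \<noteq> \<infinity>"
    by (intro nn_integral_PInf_AE) simp_all
  then have sfin: "AE v in maxwell_measure. ennreal (\<beta> v) = stray R h v"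
    by eventually_elim (simp add: \<beta>_def less_top)
  have two: "(\<integral>\<^sup>+v. ennreal (ent (k1 v)) \<partial>maxwell_measure) + (\<integral>\<^sup>+v. ennreal (ent (k2 v)) \<partial>maxwell_measure)
     \<le> (\<integral>\<^sup>+v. ennreal (ent (h v)) \<partial>maxwell_measure)"
  proof (rule ent_two_marginals)
    show "AE v in maxwell_measure. step (near R) (\<lambda>v. ennreal (h v)) v = ennreal (k1 v)"
      using gfin by eventually_elim (rule step_k1)
    show "AE v in maxwell_measure. gain (near R) (\<lambda>v. ennreal (h v)) v + stray R h v = ennreal (k2 v)"
      using gfin sfin by eventually_elim (simp add: k2_def nn, simp add: q_def)
  qed (use h h1 nn in \<open>simp_all add: k1_def k2_def\<close>)
  \<comment> \<open>Far masses are of order \<open>exp (- 2 * tail_rate p * R\<^sup>2)\<close>. This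
    \<rho> balances them against the terms of order \<open>1 / \<rho>\<close>: all become multiples
    of \<open>exp (- tail_rate p * R\<^sup>2)\<close>.\<close>
  define \<rho> where "\<rho> = exp (tail_rate p * R\<^sup>2)"
  have \<rho>: "1 \<le> \<rho>" using tail_rate_pos[OF p] by (simp add: \<rho>_def)
  have mass_\<alpha>: "(\<integral>\<^sup>+v. ennreal (\<alpha> v * h v) \<partial>maxwell_measure) \<le> ennreal (exp (- 2 * tail_rate p * R\<^sup>2) * X)"
  proof -
    have "(\<integral>\<^sup>+v. ennreal (\<alpha> v * h v) \<partial>maxwell_measure) = maxwell_pairs (\<lambda>v w. ennreal (far R (norm (v - w))) * ennreal (h v))"
      using nn h by (simp add: ennreal_mult \<alpha>(1) collision_freq_def nn_integral_multc)
    with far_mass show ?thesis by simp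
  qed
  have mass_\<beta>: "(\<integral>\<^sup>+v. ennreal (\<beta> v) \<partial>maxwell_measure) \<le> ennreal (exp (- 2 * tail_rate p * R\<^sup>2) * X)"
    using far_mass sfin unfolding mass_stray[symmetric] by (simp cong: nn_integral_cong_AE)
  have Kk: "(\<integral>\<^sup>+v. ennreal (k1 v powr p) \<partial>maxwell_measure) \<le> ennreal K"
  proof (rule order_trans[OF _ K(1)], rule powr_step_le[where c = "near R"])
    show "AE v in maxwell_measure. step (near R) (\<lambda>v. ennreal (h v)) v = ennreal (k1 v)"
      using gfin by eventually_elim (rule step_k1)
  qed (use h nn p collision_freq_near_le in \<open>simp_all add: k1_def\<close>)
  have "(\<integral>\<^sup>+v. ennreal (ent (k1 v)) \<partial>maxwell_measure) \<le>
     (\<integral>\<^sup>+v. ennreal (ent (k2 v)) + ennreal (1 / (p - 1)) * (ennreal \<rho> * ennreal (\<alpha> v * h v) + ennreal (1 / \<rho>) * (ennreal (h v powr p) + ennreal (k1 v powr p)))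
       + (ennreal (2 * \<rho>) * ennreal (\<beta> v) + ennreal (1 / \<rho>)) \<partial>maxwell_measure)"
  proof (rule nn_integral_mono)
    fix v
    have k2: "0 \<le> ent (k2 v)" using nn by (intro ent_nonneg) (simp add: k2_def)
    have "ennreal (ent (k1 v)) \<le> ennreal (ent (k2 v) + 1 / (p - 1) * (\<rho> * (\<alpha> v * h v) + (h v powr p + k1 v powr p) / \<rho>) + (2 * \<rho> * \<beta> v + 1 / \<rho>))"
      unfolding k1_def k2_def by (intro ennreal_leI ent_perturb p \<rho> h nn \<alpha>)
    also have "\<dots> = ennreal (ent (k2 v)) + ennreal (1 / (p - 1) * (\<rho> * (\<alpha> v * h v) + 1 / \<rho> * (h v powr p + k1 v powr p))) + ennreal (2 * \<rho> * \<beta> v + 1 / \<rho>)"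
      using k2 nn h \<rho> p by (subst ennreal_plus[symmetric], simp, simp, subst ennreal_plus[symmetric]) (simp_all add: add_nonneg_nonneg)
    also have "ennreal (1 / (p - 1) * (\<rho> * (\<alpha> v * h v) + 1 / \<rho> * (h v powr p + k1 v powr p))) =
       ennreal (1 / (p - 1)) * (ennreal \<rho> * ennreal (\<alpha> v * h v) + ennreal (1 / \<rho>) * (ennreal (h v powr p) + ennreal (k1 v powr p)))"
      using nn h \<rho> p by (subst ennreal_mult, simp, simp, subst ennreal_plus) (simp_all add: ennreal_mult[symmetric] ennreal_plus[symmetric] del: ennreal_plus)
    also have "ennreal (2 * \<rho> * \<beta> v + 1 / \<rho>) = ennreal (2 * \<rho>) * ennreal (\<beta> v) + ennreal (1 / \<rho>)"
      using nn \<rho> by (simp add: ennreal_mult[symmetric])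
    finally show "ennreal (ent (k1 v)) \<le> ennreal (ent (k2 v)) + ennreal (1 / (p - 1)) * (ennreal \<rho> * ennreal (\<alpha> v * h v) + ennreal (1 / \<rho>) * (ennreal (h v powr p) + ennreal (k1 v powr p)))
       + (ennreal (2 * \<rho>) * ennreal (\<beta> v) + ennreal (1 / \<rho>))" .
  qed
  also have "\<dots> = (\<integral>\<^sup>+v. ennreal (ent (k2 v)) \<partial>maxwell_measure) +
      ennreal (1 / (p - 1)) * (ennreal \<rho> * (\<integral>\<^sup>+v. ennreal (\<alpha> v * h v) \<partial>maxwell_measure) +
        ennreal (1 / \<rho>) * ((\<integral>\<^sup>+v. ennreal (h v powr p) \<partial>maxwell_measure) + (\<integral>\<^sup>+v. ennreal (k1 v powr p) \<partial>maxwell_measure)))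
       + (ennreal (2 * \<rho>) * (\<integral>\<^sup>+v. ennreal (\<beta> v) \<partial>maxwell_measure) + ennreal (1 / \<rho>))"
    by (simp add: nn_integral_add nn_integral_cmult maxwell.emeasure_space_1[simplified])
  also have "\<dots> \<le> (\<integral>\<^sup>+v. ennreal (ent (k2 v)) \<partial>maxwell_measure) +
      ennreal (1 / (p - 1)) * (ennreal \<rho> * ennreal (exp (- 2 * tail_rate p * R\<^sup>2) * X) + ennreal (1 / \<rho>) * (ennreal K + ennreal K))
       + (ennreal (2 * \<rho>) * ennreal (exp (- 2 * tail_rate p * R\<^sup>2) * X) + ennreal (1 / \<rho>))"
    by (intro add_mono mult_left_mono mass_\<alpha> mass_\<beta> K Kk order_refl) simp_all
  also have "\<dots> = (\<integral>\<^sup>+v. ennreal (ent (k2 v)) \<partial>maxwell_measure) + ennreal (tail_const TYPE('a) p K * exp (- tail_rate p * R\<^sup>2))"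
  proof -
    let ?e = "exp (- tail_rate p * R\<^sup>2)"
    have e2: "exp (- 2 * tail_rate p * R\<^sup>2) = ?e * ?e" by (simp add: exp_add[symmetric])
    have \<rho>e: "\<rho> * ?e = 1" by (simp add: \<rho>_def exp_add[symmetric])
    have e: "\<rho> * (exp (- 2 * tail_rate p * R\<^sup>2) * X) = ?e * X"
      unfolding e2 mult.assoc[symmetric] \<rho>e by simp
    have e': "1 / \<rho> = ?e" by (simp add: \<rho>_def exp_minus inverse_eq_divide)
    have "ennreal (1 / (p - 1)) * (ennreal \<rho> * ennreal (exp (- 2 * tail_rate p * R\<^sup>2) * X) + ennreal (1 / \<rho>) * (ennreal K + ennreal K))
       + (ennreal (2 * \<rho>) * ennreal (exp (- 2 * tail_rate p * R\<^sup>2) * X) + ennreal (1 / \<rho>)) =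
       ennreal (1 / (p - 1) * (\<rho> * (exp (- 2 * tail_rate p * R\<^sup>2) * X) + 1 / \<rho> * (K + K)) + (2 * (\<rho> * (exp (- 2 * tail_rate p * R\<^sup>2) * X)) + 1 / \<rho>))"
      using X K \<rho> p by (simp add: ennreal_mult[symmetric] ennreal_plus[symmetric] mult.assoc del: ennreal_plus)
    also have "1 / (p - 1) * (\<rho> * (exp (- 2 * tail_rate p * R\<^sup>2) * X) + 1 / \<rho> * (K + K)) + (2 * (\<rho> * (exp (- 2 * tail_rate p * R\<^sup>2) * X)) + 1 / \<rho>) =
        tail_const TYPE('a) p K * ?e"
      unfolding e e' tail_const_def Let_def X_def[symmetric] using p by (simp add: field_simps)
    finally show ?thesis by (simp add: add.assoc)
  qed
  finally have one: "(\<integral>\<^sup>+v. ennreal (ent (k1 v)) \<partial>maxwell_measure) \<le>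
     (\<integral>\<^sup>+v. ennreal (ent (k2 v)) \<partial>maxwell_measure) + ennreal (tail_const TYPE('a) p K * exp (- tail_rate p * R\<^sup>2))" .
  have "2 * (\<integral>\<^sup>+v. ennreal (ent (k v)) \<partial>maxwell_measure) = 2 * (\<integral>\<^sup>+v. ennreal (ent (k1 v)) \<partial>maxwell_measure)"
    by (intro arg_cong2[where f = "(*)"] refl nn_integral_cong_AE, use kk in eventually_elim) simp
  also have "\<dots> = (\<integral>\<^sup>+v. ennreal (ent (k1 v)) \<partial>maxwell_measure) + (\<integral>\<^sup>+v. ennreal (ent (k1 v)) \<partial>maxwell_measure)"
    by (rule mult_2)
  also have "\<dots> \<le> (\<integral>\<^sup>+v. ennreal (ent (k1 v)) \<partial>maxwell_measure) + ((\<integral>\<^sup>+v. ennreal (ent (k2 v)) \<partial>maxwell_measure) + ennreal (tail_const TYPE('a) p K * exp (- tail_rate p * R\<^sup>2)))"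
    by (intro add_left_mono one)
  also have "\<dots> \<le> (\<integral>\<^sup>+v. ennreal (ent (h v)) \<partial>maxwell_measure) + ennreal (tail_const TYPE('a) p K * exp (- tail_rate p * R\<^sup>2))"
    unfolding add.assoc[symmetric] by (intro add_right_mono two)
  finally show ?thesis .
qed

end

section \<open>Convex splitting of the collision rate\<close>

text \<open>The tangent of the entropy at the convex combination is compared with both points by
  \<open>ent_young\<close>; a vanishing combination is treated apart because the logarithm has no
  tangent there.\<close>

lemma ent_convex:
  assumes "0 \<le> x" "0 \<le> y" "0 < s" "s < 1"
  shows "ent ((1 - s) * x + s * y) \<le> (1 - s) * ent x + s * ent y"
proof (cases "(1 - s) * x + s * y = 0")
  case True
  then have "x = 0 \<and> y = 0"
    using assms by (subst (asm) add_nonneg_eq_0_iff) auto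
  then show ?thesis by (simp add: ent_def algebra_simps)
next
  case False
  define z where "z = (1 - s) * x + s * y"
  have z: "0 < z" using False assms unfolding z_def by (metis add_nonneg_nonneg diff_ge_0_iff_ge less_eq_real_def mult_nonneg_nonneg)
  have "(1 - s) * (x * ln z) \<le> (1 - s) * (ent x + z - 1)" "s * (y * ln z) \<le> s * (ent y + z - 1)"
    using assms z by (auto intro!: mult_left_mono ent_young)
  then have "(1 - s) * (x * ln z) + s * (y * ln z) \<le> (1 - s) * (ent x + z - 1) + s * (ent y + z - 1)"
    by (rule add_mono)
  also have "(1 - s) * (x * ln z) + s * (y * ln z) = z * ln z" by (simp add: z_def algebra_simps)
  also have "(1 - s) * (ent x + z - 1) + s * (ent y + z - 1) = (1 - s) * ent x + s * ent y + z - 1" by (simp add: algebra_simps)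
  finally show ?thesis unfolding z_def[symmetric] by (simp add: ent_def[of z])
qed

lemma ennreal_convex_complement:
  fixes x y :: ennreal
  assumes "x \<le> 1" "y \<le> 1" "0 \<le> s" "s \<le> 1"
  shows "1 - (ennreal (1 - s) * x + ennreal s * y) = ennreal (1 - s) * (1 - x) + ennreal s * (1 - y)"
proof -
  have 1: "ennreal (1 - s) + ennreal s = 1" using assms by (simp flip: ennreal_plus)
  have "(ennreal (1 - s) * (1 - x) + ennreal s * (1 - y)) + (ennreal (1 - s) * x + ennreal s * y)
      = ennreal (1 - s) * ((1 - x) + x) + ennreal s * ((1 - y) + y)"
    by (simp only: distrib_left add_ac)
  also have "\<dots> = 1" using assms 1 by (simp add: diff_add_cancel_ennreal)
  finally have e: "1 = (ennreal (1 - s) * (1 - x) + ennreal s * (1 - y)) + (ennreal (1 - s) * x + ennreal s * y)" ..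
  have "x < top" "y < top"
    using le_less_trans[OF assms(1) ennreal_one_less_top] le_less_trans[OF assms(2) ennreal_one_less_top] by simp_all
  then have "ennreal (1 - s) * x + ennreal s * y \<noteq> top"
    by (auto simp: ennreal_mult_eq_top_iff)
  then show ?thesis by (subst e) simp
qed

lemma AE_maxwell_neq: "AE w in maxwell_measure. (v::'a::euclidean_space) \<noteq> w"
  unfolding maxwell_measure_def by (subst AE_density) (use AE_lborel_singleton[of v] in \<open>auto elim!: eventually_mono\<close>)

context collision_kernel
begin

lemma measurable_curried_weight:
  assumes [measurable]: "c \<in> borel_measurable borel" "h \<in> borel_measurable borel"
  shows "(\<lambda>w. \<integral>\<^sup>+\<sigma>. weight c v w \<sigma> * h (post v w \<sigma>) \<partial>sph) \<in> borel_measurable borel"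
  by measurable

text \<open>The step is affine in the rate. The rates need to agree only for \<open>0 < r\<close>
  because the diagonal is null, and this matters: at \<open>r = 0\<close> the convention
  \<open>0 powr \<gamma> = 0\<close> breaks the splitting used later.\<close>

lemma step_convex_rates:
  assumes [measurable]: "c1 \<in> borel_measurable borel" "c2 \<in> borel_measurable borel" "c \<in> borel_measurable borel" "h \<in> borel_measurable borel"
    and c: "\<And>r. 0 < r \<Longrightarrow> c r = (1 - s) * c1 r + s * c2 r" and nn: "\<And>r. 0 \<le> c1 r" "\<And>r. 0 \<le> c2 r"
    and freq: "\<And>v::'a. collision_freq c1 v \<le> 1" "\<And>v::'a. collision_freq c2 v \<le> 1"
    and s: "0 \<le> s" "s \<le> 1"
  shows "step c h v = ennreal (1 - s) * step c1 h v + ennreal s * step c2 h v"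
proof -
  have f: "collision_freq c v = ennreal (1 - s) * collision_freq c1 v + ennreal s * collision_freq c2 v"
  proof -
    have "collision_freq c v = (\<integral>\<^sup>+w. ennreal (1 - s) * ennreal (c1 (norm (v - w))) + ennreal s * ennreal (c2 (norm (v - w))) \<partial>maxwell_measure)"
      unfolding collision_freq_def
      by (rule nn_integral_cong_AE, use AE_maxwell_neq[of v] in eventually_elim) (use s nn in \<open>simp add: c ennreal_mult\<close>)
    then show ?thesis unfolding collision_freq_def by (simp add: nn_integral_add nn_integral_cmult)
  qed
  have g: "gain c h v = ennreal (1 - s) * gain c1 h v + ennreal s * gain c2 h v"
  proof -
    have "gain c h v = (\<integral>\<^sup>+w. ennreal (1 - s) * (\<integral>\<^sup>+\<sigma>. weight c1 v w \<sigma> * h (post v w \<sigma>) \<partial>sph) + ennreal s * (\<integral>\<^sup>+\<sigma>. weight c2 v w \<sigma> * h (post v w \<sigma>) \<partial>sph) \<partial>maxwell_measure)"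
      unfolding gain_def
    proof (rule nn_integral_cong_AE, use AE_maxwell_neq[of v] in eventually_elim)
      case (elim w)
      have "weight c v w \<sigma> * h (post v w \<sigma>) = ennreal (1 - s) * (weight c1 v w \<sigma> * h (post v w \<sigma>)) + ennreal s * (weight c2 v w \<sigma> * h (post v w \<sigma>))" for \<sigma>
        using elim s nn by (simp add: weight_def c ennreal_mult distrib_left distrib_right mult_ac)
      then show ?case by (simp add: nn_integral_add nn_integral_cmult)
    qed
    then show ?thesis unfolding gain_def by (simp add: nn_integral_add nn_integral_cmult)
  qed
  show ?thesis
    unfolding step_def f g ennreal_convex_complement[OF freq s]
    by (simp only: distrib_left distrib_right mult.assoc add_ac)
qed

lemma step_real:
  assumes [measurable]: "c \<in> borel_measurable borel" "h \<in> borel_measurable borel"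
    and c: "\<And>r. 0 \<le> c r" and freq: "\<And>v::'a. collision_freq c v \<le> 1"
    and h: "(\<integral>\<^sup>+v. h v \<partial>maxwell_measure) < \<infinity>"
  shows "AE v in maxwell_measure. step c h v = ennreal (enn2real (step c h v))"
proof -
  have "(\<integral>\<^sup>+v. step c h v \<partial>maxwell_measure) \<noteq> \<infinity>"
    using nn_integral_step[OF assms(1-2) c freq] h by simp
  then have "AE v in maxwell_measure. step c h v \<noteq> \<infinity>"
    by (intro nn_integral_PInf_AE) simp_all
  then show ?thesis by eventually_elim (simp add: less_top)
qed

end

context collision_kernel
begin

text \<open>For \<open>r \<le> R\<close> the soft rate is at least \<open>R powr \<gamma>\<close>,
  so it dominates \<open>s\<close> times the unit near rate and the rest is a nonnegative rate. Thus
  the step is a mixture: with weight \<open>s\<close> the near step, which halves the entropy up to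
  the tail, and otherwise a step that does not increase it.\<close>

lemma ent_soft_step:
  assumes \<gamma>: "\<gamma> < 0" and a: "1 \<le> a" "\<And>v::'a. collision_freq (\<lambda>r. r powr \<gamma>) v \<le> ennreal a"
    and \<tau>: "0 < \<tau>" "\<tau> * (2 * a) \<le> 1" and R: "1 \<le> R"
    and hm[measurable]: "h \<in> borel_measurable borel" "k \<in> borel_measurable borel"
    and h: "\<And>v. 0 \<le> h v" and k: "\<And>v. 0 \<le> k v"
    and h1: "(\<integral>\<^sup>+v. ennreal (h v) \<partial>maxwell_measure) = 1"
    and hk: "AE v in maxwell_measure. step (\<lambda>r. \<tau> * r powr \<gamma>) (\<lambda>v. ennreal (h v)) v = ennreal (k v)"
    and p: "1 < p"
    and K: "(\<integral>\<^sup>+v. ennreal (h v powr p) \<partial>maxwell_measure) \<le> ennreal K" "0 \<le> K"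
  defines "s \<equiv> \<tau> * R powr \<gamma>"
  shows "(\<integral>\<^sup>+v. ennreal (ent (k v)) \<partial>maxwell_measure) \<le>
     ennreal (1 - s / 2) * (\<integral>\<^sup>+v. ennreal (ent (h v)) \<partial>maxwell_measure) + ennreal (s / 2 * (tail_const TYPE('a) p K * exp (- tail_rate p * R\<^sup>2)))"
proof -
  have "\<tau> * 2 \<le> \<tau> * (2 * a)" using a \<tau> by (intro mult_left_mono) auto
  then have "\<tau> \<le> 1 / 2" using \<tau> by linarith
  moreover have "R powr \<gamma> \<le> 1" using R \<gamma> powr_mono2'[of \<gamma> 1 R] by simp
  ultimately have "\<tau> * R powr \<gamma> \<le> 1 / 2 * 1" using \<tau> by (intro mult_mono) auto
  then have s: "0 < s" "s \<le> 1 / 2" using \<tau> R by (auto simp: s_def)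
  \<comment> \<open>Among distances, the maximum with zero acts only at \<open>r = 0\<close>, where
    \<open>0 powr \<gamma> = 0\<close> would make the difference negative.\<close>
  define c' where "c' r = max 0 ((\<tau> * r powr \<gamma> - s * near R r) / (1 - s))" for r
  have [measurable]: "c' \<in> borel_measurable borel" unfolding c'_def[abs_def] by measurable
  have c'_le: "c' r \<le> 2 * \<tau> * r powr \<gamma>" for r
  proof -
    have "(\<tau> * r powr \<gamma> - s * near R r) / (1 - s) \<le> (\<tau> * r powr \<gamma>) / (1 / 2)"
      using s \<tau> by (intro frac_le) auto
    then show ?thesis using \<tau> by (simp add: c'_def)
  qed
  have c_eq: "\<tau> * r powr \<gamma> = (1 - s) * c' r + s * near R r" if "0 < r" for r
  proof -
    have "s * near R r \<le> \<tau> * r powr \<gamma>"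
      using that \<gamma> \<tau> R powr_mono2'[of \<gamma> r R] by (auto simp: near_def s_def intro!: mult_left_mono)
    then have "c' r = (\<tau> * r powr \<gamma> - s * near R r) / (1 - s)"
      using s by (simp add: c'_def)
    then have "(1 - s) * c' r = \<tau> * r powr \<gamma> - s * near R r" using s by simp
    then show ?thesis by simp
  qed
  \<comment> \<open>Division by \<open>1 - s\<close> at most doubles the rate; this is why the step
    size is required to satisfy \<open>\<tau> * (2 * a) \<le> 1\<close>.\<close>
  have freq': "collision_freq c' v \<le> 1" for v :: 'a
  proof -
    have "collision_freq c' v \<le> (\<integral>\<^sup>+w. ennreal (2 * \<tau>) * ennreal (norm (v - w) powr \<gamma>) \<partial>maxwell_measure)"
      unfolding collision_freq_def using \<tau>
      by (intro nn_integral_mono) (simp add: ennreal_mult[symmetric] ennreal_leI c'_le)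
    also have "\<dots> = ennreal (2 * \<tau>) * collision_freq (\<lambda>r. r powr \<gamma>) v"
      unfolding collision_freq_def by (simp add: nn_integral_cmult)
    also have "\<dots> \<le> ennreal (2 * \<tau>) * ennreal a" by (intro mult_left_mono a) simp
    also have "\<dots> \<le> 1" using \<tau> a by (simp add: ennreal_mult[symmetric] mult_ac)
    finally show ?thesis .
  qed
  let ?h = "\<lambda>v. ennreal (h v)"
  have hi: "?h \<in> borel_measurable borel" by measurable
  have hfin: "(\<integral>\<^sup>+v. ?h v \<partial>maxwell_measure) < \<infinity>" using h1 by simp
  define k' where "k' v = enn2real (step c' ?h v)" for v
  define k'' where "k'' v = enn2real (step (near R) ?h v)" for v
  have [measurable]: "k' \<in> borel_measurable borel" "k'' \<in> borel_measurable borel"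
    unfolding k'_def[abs_def] k''_def[abs_def] by measurable
  have c'_nn: "0 \<le> c' r" for r by (simp add: c'_def)
  have k'_nn: "0 \<le> k' v" "0 \<le> k'' v" for v by (simp_all add: k'_def k''_def)
  have hk': "AE v in maxwell_measure. step c' ?h v = ennreal (k' v)"
    unfolding k'_def by (rule step_real) (use c'_nn freq' hfin in simp_all)
  have hk'': "AE v in maxwell_measure. step (near R) ?h v = ennreal (k'' v)"
    unfolding k''_def by (rule step_real) (use collision_freq_near_le hfin in simp_all)
  have e': "(\<integral>\<^sup>+v. ennreal (ent (k' v)) \<partial>maxwell_measure) \<le> (\<integral>\<^sup>+v. ennreal (ent (h v)) \<partial>maxwell_measure)"
    by (rule ent_step_le[OF _ _ _ c'_nn freq' h k'_nn(1) h1 hk']) simp_all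
  have e'': "2 * (\<integral>\<^sup>+v. ennreal (ent (k'' v)) \<partial>maxwell_measure) \<le>
    (\<integral>\<^sup>+v. ennreal (ent (h v)) \<partial>maxwell_measure) + ennreal (tail_const TYPE('a) p K * exp (- tail_rate p * R\<^sup>2))"
    by (rule ent_near_step_le[OF _ _ h k'_nn(2) h1 hk'' p _ K]) (use R in simp_all)
  have kk: "AE v in maxwell_measure. k v = (1 - s) * k' v + s * k'' v"
    using hk hk' hk''
  proof eventually_elim
    case (elim v)
    have "step (\<lambda>r. \<tau> * r powr \<gamma>) ?h v = ennreal (1 - s) * step c' ?h v + ennreal s * step (near R) ?h v"
      using s by (intro step_convex_rates c_eq c'_nn freq' collision_freq_near_le near_nonneg) simp_all
    then have "ennreal (k v) = ennreal ((1 - s) * k' v + s * k'' v)"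
      using elim s k'_nn by (simp add: ennreal_mult)
    moreover have "0 \<le> (1 - s) * k' v + s * k'' v" using s k'_nn by simp
    ultimately show ?case using k by (simp add: ennreal_inj)
  qed
  let ?e = "tail_const TYPE('a) p K * exp (- tail_rate p * R\<^sup>2)"
  have e0: "0 \<le> ?e" using tail_const_pos[OF p K(2), where 'a='a] by simp
  have "(\<integral>\<^sup>+v. ennreal (ent (k v)) \<partial>maxwell_measure) \<le>
     (\<integral>\<^sup>+v. ennreal (1 - s) * ennreal (ent (k' v)) + ennreal s * ennreal (ent (k'' v)) \<partial>maxwell_measure)"
  proof (rule nn_integral_mono_AE, use kk in eventually_elim)
    case (elim v)
    have "ent (k v) \<le> (1 - s) * ent (k' v) + s * ent (k'' v)"
      unfolding elim using s by (intro ent_convex k'_nn) auto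
    then show ?case using s by (simp add: ennreal_mult[symmetric] ennreal_plus[symmetric] ennreal_leI ent_nonneg k'_nn del: ennreal_plus)
  qed
  also have "\<dots> = ennreal (1 - s) * (\<integral>\<^sup>+v. ennreal (ent (k' v)) \<partial>maxwell_measure) + ennreal (s / 2) * (2 * (\<integral>\<^sup>+v. ennreal (ent (k'' v)) \<partial>maxwell_measure))"
  proof -
    have "ennreal (s / 2) * (2 * x) = ennreal s * x" for x
    proof -
      have "ennreal (s / 2) * 2 = ennreal s" using s by (subst ennreal_numeral[symmetric], subst ennreal_mult[symmetric]) simp_all
      then show ?thesis by (simp add: mult.assoc[symmetric])
    qed
    then show ?thesis by (simp add: nn_integral_add nn_integral_cmult)
  qed
  also have "\<dots> \<le> ennreal (1 - s) * (\<integral>\<^sup>+v. ennreal (ent (h v)) \<partial>maxwell_measure) + ennreal (s / 2) * ((\<integral>\<^sup>+v. ennreal (ent (h v)) \<partial>maxwell_measure) + ennreal ?e)"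
    by (intro add_mono mult_left_mono e' e'') simp_all
  also have "\<dots> = (ennreal (1 - s) + ennreal (s / 2)) * (\<integral>\<^sup>+v. ennreal (ent (h v)) \<partial>maxwell_measure) + ennreal (s / 2) * ennreal ?e"
    by (simp only: distrib_left distrib_right add_ac)
  also have "ennreal (1 - s) + ennreal (s / 2) = ennreal (1 - s / 2)"
    using s by (subst ennreal_plus[symmetric]) auto
  also have "ennreal (s / 2) * ennreal ?e = ennreal (s / 2 * ?e)"
    using s e0 by (intro ennreal_mult[symmetric]) auto
  finally show ?thesis .
qed

end

subsection \<open>The Boltzmann operator as a Markov generator\<close>

lemma distr_lborel_sphere:
  "distr (lborel \<Otimes>\<^sub>M sphere_measure) (borel \<Otimes>\<^sub>M borel) (\<lambda>x. x) = (lborel \<Otimes>\<^sub>M sph :: ('a::euclidean_space \<times> 'a) measure)"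
proof -
  have "distr lborel borel (\<lambda>x. x) \<Otimes>\<^sub>M distr sphere_measure borel (\<lambda>x. x) =
     distr (lborel \<Otimes>\<^sub>M sphere_measure) (borel \<Otimes>\<^sub>M borel) (\<lambda>(x::'a, y::'a). (x, y))"
  proof (rule pair_measure_distr)
    show "sigma_finite_measure (distr sphere_measure borel (\<lambda>x::'a. x))"
      using sphere.sigma_finite_measure_axioms by (simp add: sph_def)
  qed (simp_all add: measurable_sphere_id)
  then show ?thesis
    by (simp add: sph_def[symmetric] distr_id2 id_def)
qed

text \<open>Carries the integral defining the Boltzmann operator from the sphere to the measure
  \<open>sph\<close> on the whole space.\<close>

lemma integral_lborel_sphere:
  fixes g :: "'a::euclidean_space \<times> 'a \<Rightarrow> real"
  assumes "g \<in> borel_measurable (borel \<Otimes>\<^sub>M borel)"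
  shows "(\<integral>x. g x \<partial>(lborel \<Otimes>\<^sub>M sphere_measure)) = (\<integral>x. g x \<partial>(lborel \<Otimes>\<^sub>M sph))"
proof -
  have "(\<lambda>x. (fst x, snd x)) \<in> (lborel \<Otimes>\<^sub>M sphere_measure) \<rightarrow>\<^sub>M (borel \<Otimes>\<^sub>M borel :: ('a \<times> 'a) measure)"
    by (intro measurable_Pair measurable_compose[OF measurable_snd measurable_sphere_id]) (simp add: measurable_fst'')
  then have "(\<lambda>x. x) \<in> (lborel \<Otimes>\<^sub>M sphere_measure) \<rightarrow>\<^sub>M (borel \<Otimes>\<^sub>M borel :: ('a \<times> 'a) measure)"
    by simp
  from integral_distr[OF this assms] show ?thesis by (simp add: distr_lborel_sphere)
qed

lemma AE_maxwell_iff: "(AE v in maxwell_measure. P v) \<longleftrightarrow> (AE v in lborel. P v)"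
  unfolding maxwell_measure_def by (subst AE_density) simp_all

lemma nn_integral_maxwell_div:
  assumes [measurable]: "g \<in> borel_measurable borel" and g: "\<And>v. 0 \<le> g v"
  shows "(\<integral>\<^sup>+v. ennreal (g v / maxwellian v) \<partial>maxwell_measure) = (\<integral>\<^sup>+v. ennreal (g v) \<partial>lborel)"
  by (subst nn_integral_maxwell) (simp_all add: ennreal_mult[symmetric] g)

text \<open>The number \<open>a\<close> is a uniform bound for the collision frequency and fixes the
  admissible step sizes. Integrability of the operator is assumed here; it is supplied later by the
  semigroup that it generates.\<close>

locale soft_collisions = collision_kernel b ty
  for b :: "real \<Rightarrow> real" and ty :: "'a::euclidean_space itself" +
  fixes \<gamma> a :: real
  assumes \<gamma>_neg: "\<gamma> < 0" and a_ge: "1 \<le> a"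
    and freq_le: "\<And>v::'a. collision_freq (\<lambda>r. r powr \<gamma>) v \<le> ennreal a"
    and op_integrable: "\<And>f::'a \<Rightarrow> real. integrable lborel f \<Longrightarrow> integrable lborel (boltzmann_op \<gamma> b f)"
begin

abbreviation L :: "('a \<Rightarrow> real) \<Rightarrow> 'a \<Rightarrow> real" where "L \<equiv> boltzmann_op \<gamma> b"
abbreviation rate :: "real \<Rightarrow> real" where "rate \<equiv> \<lambda>r. r powr \<gamma>"

definition nu :: "'a \<Rightarrow> real" where "nu v = enn2real (collision_freq rate v)"

lemma nu: "ennreal (nu v) = collision_freq rate v" "0 \<le> nu v" "nu v \<le> a"
proof -
  have "collision_freq rate v < top" using freq_le[of v] by (rule le_less_trans) simp
  then show e: "ennreal (nu v) = collision_freq rate v" by (simp add: nu_def)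
  show "0 \<le> nu v" by (simp add: nu_def)
  have "ennreal (nu v) \<le> ennreal a" unfolding e by (rule freq_le)
  then show "nu v \<le> a" using a_ge by (subst (asm) ennreal_le_iff) auto
qed

lemma measurable_nu [measurable]: "nu \<in> borel_measurable borel"
  unfolding nu_def[abs_def] by measurable

definition gain_integrand :: "('a \<Rightarrow> real) \<Rightarrow> 'a \<Rightarrow> 'a \<times> 'a \<Rightarrow> real" where
  "gain_integrand f v = (\<lambda>(w, \<sigma>). norm (v - w) powr \<gamma> * bk (cos_dev v w \<sigma>) * (f (post v w \<sigma>) * maxwellian (post_star v w \<sigma>)))"

definition loss_integrand :: "'a \<Rightarrow> 'a \<times> 'a \<Rightarrow> real" where
  "loss_integrand v = (\<lambda>(w, \<sigma>). norm (v - w) powr \<gamma> * bk (cos_dev v w \<sigma>) * maxwellian w)"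

lemma measurable_gain_integrand [measurable]:
  assumes [measurable]: "f \<in> borel_measurable borel"
  shows "gain_integrand f v \<in> borel_measurable (borel \<Otimes>\<^sub>M borel)"
  unfolding gain_integrand_def by measurable

lemma measurable_loss_integrand [measurable]: "loss_integrand v \<in> borel_measurable (borel \<Otimes>\<^sub>M borel)"
  unfolding loss_integrand_def by measurable

lemma sets_lborel_sph [simp]: "sets (lborel \<Otimes>\<^sub>M sph :: ('a \<times> 'a) measure) = sets (borel \<Otimes>\<^sub>M borel)"
  by (rule sets_pair_measure_cong) simp_all

lemma nn_integral_gain_integrand:
  assumes [measurable]: "g \<in> borel_measurable borel" and g: "\<And>v. 0 \<le> g v"
  shows "(\<integral>\<^sup>+x. ennreal (gain_integrand g v x) \<partial>(lborel \<Otimes>\<^sub>M sph)) =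
     ennreal (maxwellian v) * gain rate (\<lambda>v. ennreal (g v / maxwellian v)) v"
proof -
  let ?h = "\<lambda>v. ennreal (g v / maxwellian v)"
  have [measurable]: "(\<lambda>w. \<integral>\<^sup>+\<sigma>. weight rate v w \<sigma> * ?h (post v w \<sigma>) \<partial>sph) \<in> borel_measurable borel"
    by (rule measurable_curried_weight) measurable
  have "(\<integral>\<^sup>+x. ennreal (gain_integrand g v x) \<partial>(lborel \<Otimes>\<^sub>M sph)) = (\<integral>\<^sup>+w. \<integral>\<^sup>+\<sigma>. ennreal (gain_integrand g v (w, \<sigma>)) \<partial>sph \<partial>lborel)"
    by (rule sphere.nn_integral_fst[symmetric]) (simp add: measurable_cong_sets[OF sets_lborel_sph refl])
  also have "\<dots> = (\<integral>\<^sup>+w. \<integral>\<^sup>+\<sigma>. ennreal (maxwellian v) * (ennreal (maxwellian w) * (weight rate v w \<sigma> * ?h (post v w \<sigma>))) \<partial>sph \<partial>lborel)"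
  proof (rule nn_integral_cong, rule nn_integral_cong_AE, use AE_sph_norm in eventually_elim)
    case (elim w \<sigma>)
    define q where "q = g (post v w \<sigma>) / maxwellian (post v w \<sigma>)"
    have q: "0 \<le> q" using g by (simp add: q_def)
    have "g (post v w \<sigma>) * maxwellian (post_star v w \<sigma>) = q * (maxwellian (post v w \<sigma>) * maxwellian (post_star v w \<sigma>))"
      by (simp add: q_def)
    also have "\<dots> = q * (maxwellian v * maxwellian w)"
      by (simp only: maxwellian_post[OF elim(2)])
    finally have "gain_integrand g v (w, \<sigma>) = maxwellian v * (maxwellian w * ((norm (v - w) powr \<gamma> * bk (cos_dev v w \<sigma>)) * q))"
      by (simp add: gain_integrand_def mult_ac)
    then show ?case unfolding q_def[symmetric] by (simp add: weight_def ennreal_mult q)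
  qed
  also have "\<dots> = (\<integral>\<^sup>+w. ennreal (maxwellian v) * (ennreal (maxwellian w) * (\<integral>\<^sup>+\<sigma>. weight rate v w \<sigma> * ?h (post v w \<sigma>) \<partial>sph)) \<partial>lborel)"
    by (simp add: nn_integral_cmult)
  also have "\<dots> = ennreal (maxwellian v) * gain rate ?h v"
    unfolding gain_def by (simp add: nn_integral_cmult nn_integral_maxwell)
  finally show ?thesis .
qed

lemma nn_integral_loss_integrand:
  "(\<integral>\<^sup>+x. ennreal (loss_integrand v x) \<partial>(lborel \<Otimes>\<^sub>M sph)) = collision_freq rate v"
proof -
  have "(\<integral>\<^sup>+x. ennreal (loss_integrand v x) \<partial>(lborel \<Otimes>\<^sub>M sph)) = (\<integral>\<^sup>+w. \<integral>\<^sup>+\<sigma>. ennreal (loss_integrand v (w, \<sigma>)) \<partial>sph \<partial>lborel)"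
    by (rule sphere.nn_integral_fst[symmetric]) (simp add: measurable_cong_sets[OF sets_lborel_sph refl])
  also have "\<dots> = (\<integral>\<^sup>+w. ennreal (maxwellian w) * ennreal (norm (v - w) powr \<gamma>) \<partial>lborel)"
  proof (rule nn_integral_cong_AE, use AE_lborel_singleton[of v] in eventually_elim)
    case (elim w)
    have "(\<integral>\<^sup>+\<sigma>. ennreal (loss_integrand v (w, \<sigma>)) \<partial>sph) = (\<integral>\<^sup>+\<sigma>. (ennreal (maxwellian w) * ennreal (norm (v - w) powr \<gamma>)) * ennreal (bk (cos_dev v w \<sigma>)) \<partial>sph)"
      by (simp add: loss_integrand_def ennreal_mult[symmetric] mult_ac)
    also have "\<dots> = ennreal (maxwellian w) * ennreal (norm (v - w) powr \<gamma>)"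
      by (subst nn_integral_cmult) (use elim nn_integral_bk_cos_dev[of v w] in simp_all)
    finally show ?case .
  qed
  finally show ?thesis unfolding collision_freq_def by (simp add: nn_integral_maxwell)
qed

lemma loss_integrable: "integrable (lborel \<Otimes>\<^sub>M sph) (loss_integrand v)"
  and loss_integral: "(\<integral>x. loss_integrand v x \<partial>(lborel \<Otimes>\<^sub>M sph)) = nu v"
proof -
  have m: "loss_integrand v \<in> borel_measurable (lborel \<Otimes>\<^sub>M sph)"
    by (simp add: measurable_cong_sets[OF sets_lborel_sph refl])
  have nn: "0 \<le> loss_integrand v x" for x
    by (cases x) (simp add: loss_integrand_def)
  show "integrable (lborel \<Otimes>\<^sub>M sph) (loss_integrand v)"
    by (rule integrableI_nonneg[OF m]) (use nn nn_integral_loss_integrand[of v] nu(1)[of v, symmetric] in \<open>auto simp: less_top\<close>)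
  show "(\<integral>x. loss_integrand v x \<partial>(lborel \<Otimes>\<^sub>M sph)) = nu v"
    using nn by (subst integral_eq_nn_integral[OF m]) (auto simp: nn_integral_loss_integrand nu_def)
qed

definition gain_op :: "('a \<Rightarrow> real) \<Rightarrow> 'a \<Rightarrow> real" where
  "gain_op f v = (\<integral>x. gain_integrand f v x \<partial>(lborel \<Otimes>\<^sub>M sph))"

abbreviation abs_gain :: "('a \<Rightarrow> real) \<Rightarrow> 'a \<Rightarrow> ennreal" where
  "abs_gain f v \<equiv> gain rate (\<lambda>v. ennreal (\<bar>f v\<bar> / maxwellian v)) v"

lemma abs_gain_integral_le:
  assumes [measurable]: "f \<in> borel_measurable borel"
  shows "(\<integral>\<^sup>+v. abs_gain f v \<partial>maxwell_measure) \<le> ennreal a * (\<integral>\<^sup>+v. ennreal \<bar>f v\<bar> \<partial>lborel)"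
proof -
  have "(\<integral>\<^sup>+v. abs_gain f v * 1 \<partial>maxwell_measure) = (\<integral>\<^sup>+v. collision_freq rate v * ennreal (\<bar>f v\<bar> / maxwellian v) \<partial>maxwell_measure)"
    by (subst gain_weak[where \<phi> = "\<lambda>_. 1"]) (simp_all add: collision_integral_pre)
  also have "\<dots> \<le> (\<integral>\<^sup>+v. ennreal a * ennreal (\<bar>f v\<bar> / maxwellian v) \<partial>maxwell_measure)"
    by (intro nn_integral_mono mult_right_mono freq_le) simp
  also have "\<dots> = ennreal a * (\<integral>\<^sup>+v. ennreal \<bar>f v\<bar> \<partial>lborel)"
    by (simp add: nn_integral_cmult nn_integral_maxwell_div)
  finally show ?thesis by simp
qed

text \<open>The operator is one integral of a difference, and splitting it requires the gain
  integrand to be integrable at the given \<open>v\<close>. The total gain is at most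
  \<open>a\<close> times the mass of the absolute value of \<open>f\<close>, so this holds for
  almost every \<open>v\<close>.\<close>

lemma op_decomp:
  assumes f: "integrable lborel f"
  shows "AE v in lborel. abs_gain f v < top \<and> integrable (lborel \<Otimes>\<^sub>M sph) (gain_integrand f v) \<and> L f v = gain_op f v - f v * nu v"
proof -
  have fm[measurable]: "f \<in> borel_measurable borel" using f by auto
  have "(\<integral>\<^sup>+v. ennreal \<bar>f v\<bar> \<partial>lborel) < \<infinity>"
    using f by (simp add: integrable_iff_bounded)
  then have "(\<integral>\<^sup>+v. abs_gain f v \<partial>maxwell_measure) \<noteq> \<infinity>"
    using le_less_trans[OF abs_gain_integral_le[OF fm], of top] by (auto simp: ennreal_mult_less_top)
  then have "AE v in maxwell_measure. abs_gain f v \<noteq> \<infinity>"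
    by (intro nn_integral_PInf_AE) simp_all
  then show ?thesis unfolding AE_maxwell_iff
  proof eventually_elim
    case (elim v)
    then have fin: "abs_gain f v < top" by (simp add: less_top)
    have m: "gain_integrand f v \<in> borel_measurable (lborel \<Otimes>\<^sub>M sph)"
      by (simp add: measurable_cong_sets[OF sets_lborel_sph refl])
    have abs: "ennreal (norm (gain_integrand f v x)) = ennreal (gain_integrand (\<lambda>v. \<bar>f v\<bar>) v x)" for x
      by (cases x) (simp add: gain_integrand_def abs_mult)
    have i: "integrable (lborel \<Otimes>\<^sub>M sph) (gain_integrand f v)"
      unfolding integrable_iff_bounded abs using m fin
      by (subst nn_integral_gain_integrand) (auto simp: ennreal_mult_less_top)
    have "L f v = (\<integral>x. gain_integrand f v x - f v * loss_integrand v x \<partial>(lborel \<Otimes>\<^sub>M sphere_measure))"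
      unfolding boltzmann_op_def
    proof (rule Bochner_Integration.integral_cong[OF refl])
      fix x assume "x \<in> space (lborel \<Otimes>\<^sub>M sphere_measure :: ('a \<times> 'a) measure)"
      then obtain w \<sigma> where x: "x = (w, \<sigma>)" "norm \<sigma> = 1"
        by (cases x) (auto simp: space_pair_measure space_sphere_measure)
      have "\<bar>cos_dev v w \<sigma>\<bar> \<le> norm ((v - w) /\<^sub>R norm (v - w)) * norm \<sigma>"
        unfolding cos_dev_def by (rule Cauchy_Schwarz_ineq2)
      also have "\<dots> \<le> 1" using x by (cases "v = w") simp_all
      finally have "b (cos_dev v w \<sigma>) = bk (cos_dev v w \<sigma>)" by (auto simp: bk_def)
      then show "(case x of (w, \<sigma>) \<Rightarrow> norm (v - w) powr \<gamma> * b (cos_dev v w \<sigma>) *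
          (f (post v w \<sigma>) * maxwellian (post_star v w \<sigma>) - f v * maxwellian w)) =
          gain_integrand f v x - f v * loss_integrand v x"
        by (simp add: x gain_integrand_def loss_integrand_def algebra_simps)
    qed
    also have "\<dots> = (\<integral>x. gain_integrand f v x - f v * loss_integrand v x \<partial>(lborel \<Otimes>\<^sub>M sph))"
      by (rule integral_lborel_sphere) measurable
    also have "\<dots> = gain_op f v - f v * nu v"
      using i loss_integrable[of v] by (simp add: gain_op_def loss_integral)
    finally show ?case using fin i by simp
  qed
qed

lemma gain_op_abs_le:
  assumes [measurable]: "f \<in> borel_measurable borel"
  shows "\<bar>gain_op f v\<bar> \<le> maxwellian v * enn2real (abs_gain f v)"
proof -
  have abs: "norm (gain_integrand f v x) = gain_integrand (\<lambda>v. \<bar>f v\<bar>) v x" for x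
    by (cases x) (simp add: gain_integrand_def abs_mult)
  have m: "gain_integrand (\<lambda>v. \<bar>f v\<bar>) v \<in> borel_measurable (lborel \<Otimes>\<^sub>M sph)"
    by (simp add: measurable_cong_sets[OF sets_lborel_sph refl])
  have nn: "0 \<le> gain_integrand (\<lambda>v. \<bar>f v\<bar>) v x" for x
    by (cases x) (simp add: gain_integrand_def)
  have "\<bar>gain_op f v\<bar> \<le> (\<integral>x. norm (gain_integrand f v x) \<partial>(lborel \<Otimes>\<^sub>M sph))"
    unfolding gain_op_def by (simp flip: real_norm_def)
  also have "\<dots> = maxwellian v * enn2real (abs_gain f v)"
    unfolding abs using m nn
    by (subst integral_eq_nn_integral) (simp_all add: nn_integral_gain_integrand enn2real_mult)
  finally show ?thesis .
qed

lemma gain_op_nonneg_eq: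
  assumes [measurable]: "f \<in> borel_measurable borel" and f: "\<And>v. 0 \<le> f v"
  shows "gain_op f v = maxwellian v * enn2real (gain rate (\<lambda>v. ennreal (f v / maxwellian v)) v)"
proof -
  have m: "gain_integrand f v \<in> borel_measurable (lborel \<Otimes>\<^sub>M sph)"
    by (simp add: measurable_cong_sets[OF sets_lborel_sph refl])
  have nn: "0 \<le> gain_integrand f v x" for x
    by (cases x) (simp add: gain_integrand_def f)
  show ?thesis
    unfolding gain_op_def using m nn
    by (subst integral_eq_nn_integral) (simp_all add: nn_integral_gain_integrand f enn2real_mult)
qed

lemma op_linear:
  assumes f: "integrable lborel f" and g: "integrable lborel g"
  shows "AE v in lborel. L (\<lambda>v. \<alpha> * f v + \<beta> * g v) v = \<alpha> * L f v + \<beta> * L g v"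
proof -
  have "integrable lborel (\<lambda>v. \<alpha> * f v + \<beta> * g v)" using f g by simp
  from op_decomp[OF f] op_decomp[OF g] op_decomp[OF this] show ?thesis
  proof eventually_elim
    case (elim v)
    have sum: "gain_integrand (\<lambda>v. \<alpha> * f v + \<beta> * g v) v = (\<lambda>x. \<alpha> * gain_integrand f v x + \<beta> * gain_integrand g v x)"
      by (auto simp: gain_integrand_def algebra_simps)
    have gl: "gain_op (\<lambda>v. \<alpha> * f v + \<beta> * g v) v = \<alpha> * gain_op f v + \<beta> * gain_op g v"
      unfolding gain_op_def sum using elim by simp
    have e: "L f v = gain_op f v - f v * nu v" "L g v = gain_op g v - g v * nu v"
      "L (\<lambda>v. \<alpha> * f v + \<beta> * g v) v = gain_op (\<lambda>v. \<alpha> * f v + \<beta> * g v) v - (\<alpha> * f v + \<beta> * g v) * nu v"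
      using elim by blast+
    show ?case unfolding e gl by (simp add: algebra_simps)
  qed
qed

text \<open>The operator evaluates \<open>f\<close> at outgoing velocities, so it is not evident
  that null sets are harmless. They are, because the gain is controlled in mean by the mass of the
  absolute value of \<open>f\<close>.\<close>

lemma op_zero:
  assumes f: "integrable lborel f" and 0: "AE v in lborel. f v = 0"
  shows "AE v in lborel. L f v = 0"
proof -
  have fm[measurable]: "f \<in> borel_measurable borel" using f by auto
  have "(\<integral>\<^sup>+v. ennreal \<bar>f v\<bar> \<partial>lborel) = (\<integral>\<^sup>+v. 0 \<partial>(lborel :: 'a measure))"
    by (rule nn_integral_cong_AE) (use 0 in eventually_elim, simp)
  then have "(\<integral>\<^sup>+v. abs_gain f v \<partial>maxwell_measure) = 0"
    using abs_gain_integral_le[OF fm] by simp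
  then have "AE v in lborel. abs_gain f v = 0"
    unfolding AE_maxwell_iff[symmetric] by (subst (asm) nn_integral_0_iff_AE) simp_all
  with op_decomp[OF f] 0 show ?thesis
  proof eventually_elim
    case (elim v)
    then show ?case using gain_op_abs_le[OF fm, of v] by simp
  qed
qed

lemma op_cong:
  assumes f: "integrable lborel f" and g: "integrable lborel g" and eq: "AE v in lborel. f v = g v"
  shows "AE v in lborel. L f v = L g v"
proof -
  have i: "integrable lborel (\<lambda>v. 1 * f v + (-1) * g v)" using f g by simp
  have "AE v in lborel. L (\<lambda>v. 1 * f v + (-1) * g v) v = 0"
    by (rule op_zero[OF i]) (use eq in eventually_elim, simp)
  with op_linear[OF f g, of 1 "-1"] show ?thesis by eventually_elim simp
qed

text \<open>The gain is nonnegative and the loss frequency is at most \<open>a\<close>. Hence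
  \<open>L + a\<close> preserves positivity, the source of all order arguments below.\<close>

lemma op_lower:
  assumes f: "integrable lborel f" and nn: "AE v in lborel. 0 \<le> f v"
  shows "AE v in lborel. 0 \<le> L f v + a * f v"
proof -
  let ?f = "\<lambda>v. max 0 (f v)"
  have fm[measurable]: "f \<in> borel_measurable borel" using f by auto
  have i: "integrable lborel ?f" using f by simp
  have "AE v in lborel. f v = ?f v" using nn by eventually_elim simp
  with op_cong[OF f i this] op_decomp[OF i] nn show ?thesis
  proof eventually_elim
    case (elim v)
    have "0 \<le> gain_op ?f v" by (subst gain_op_nonneg_eq) auto
    moreover have "f v * nu v \<le> f v * a" using elim nu(3)[of v] by (intro mult_left_mono) auto
    ultimately show ?case using elim by (simp add: mult.commute)
  qed
qed

lemma op_lower_mono: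
  assumes f: "integrable lborel f" and g: "integrable lborel g" and le: "AE v in lborel. f v \<le> g v"
  shows "AE v in lborel. L f v + a * f v \<le> L g v + a * g v"
proof -
  have "AE v in lborel. 0 \<le> L (\<lambda>v. 1 * g v + (-1) * f v) v + a * (1 * g v + (-1) * f v)"
    by (rule op_lower) (use f g le in auto)
  with op_linear[OF g f, of 1 "-1"] show ?thesis
    by eventually_elim (simp add: algebra_simps)
qed

section \<open>Euler steps as Markov steps\<close>

definition euler :: "real \<Rightarrow> ('a \<Rightarrow> real) \<Rightarrow> 'a \<Rightarrow> real" where
  "euler \<tau> f v = f v + \<tau> * L f v"

lemma integrable_euler: "integrable lborel f \<Longrightarrow> integrable lborel (euler \<tau> f)"
  unfolding euler_def[abs_def] using op_integrable by simp

lemma collision_freq_cmult: "0 \<le> \<tau> \<Longrightarrow> collision_freq (\<lambda>r. \<tau> * r powr \<gamma>) v = ennreal \<tau> * collision_freq rate (v::'a)"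
  unfolding collision_freq_def by (simp add: ennreal_mult nn_integral_cmult)

lemma gain_cmult:
  assumes [measurable]: "h \<in> borel_measurable borel" and \<tau>: "0 \<le> \<tau>"
  shows "gain (\<lambda>r. \<tau> * r powr \<gamma>) h v = ennreal \<tau> * gain rate h v"
proof -
  have [measurable]: "(\<lambda>w. \<integral>\<^sup>+\<sigma>. weight rate v w \<sigma> * h (post v w \<sigma>) \<partial>sph) \<in> borel_measurable borel"
    by (rule measurable_curried_weight) measurable
  have "weight (\<lambda>r. \<tau> * r powr \<gamma>) v w \<sigma> * h (post v w \<sigma>) = ennreal \<tau> * (weight rate v w \<sigma> * h (post v w \<sigma>))" for w \<sigma>
    using \<tau> by (simp add: weight_def ennreal_mult mult_ac)
  then show ?thesis unfolding gain_def by (simp add: nn_integral_cmult)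
qed

lemma freq_euler_le: "0 \<le> \<tau> \<Longrightarrow> \<tau> * a \<le> 1 \<Longrightarrow> collision_freq (\<lambda>r. \<tau> * r powr \<gamma>) (v::'a) \<le> 1"
proof -
  assume \<tau>: "0 \<le> \<tau>" "\<tau> * a \<le> 1"
  have "ennreal \<tau> * collision_freq rate v \<le> ennreal \<tau> * ennreal a" by (intro mult_left_mono freq_le) simp
  also have "\<dots> \<le> 1" using \<tau> a_ge by (simp add: ennreal_mult[symmetric])
  finally show ?thesis using \<tau> by (simp add: collision_freq_cmult)
qed

text \<open>After division by the Maxwellian the Euler step is \<open>step\<close> with rate
  \<open>\<tau> * r powr \<gamma>\<close>. The bound \<open>\<tau> * a \<le> 1\<close> keeps the
  coefficient \<open>1 - \<tau> * nu v\<close> of the old value nonnegative.\<close>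

lemma euler_step_nonneg:
  assumes f: "integrable lborel f" and nn: "\<And>v. 0 \<le> f v" and \<tau>: "0 \<le> \<tau>" "\<tau> * a \<le> 1"
  shows "AE v in lborel. 0 \<le> euler \<tau> f v \<and>
     step (\<lambda>r. \<tau> * r powr \<gamma>) (\<lambda>v. ennreal (f v / maxwellian v)) v = ennreal (euler \<tau> f v / maxwellian v)"
proof -
  have fm[measurable]: "f \<in> borel_measurable borel" using f by auto
  show ?thesis using op_decomp[OF f]
  proof eventually_elim
    case (elim v)
    let ?h = "\<lambda>v. ennreal (f v / maxwellian v)"
    have fin: "gain rate ?h v < top" using elim nn by simp
    define G where "G = enn2real (gain rate ?h v)"
    have G: "0 \<le> G" "gain rate ?h v = ennreal G" using fin by (simp_all add: G_def)
    have tn: "\<tau> * nu v \<le> 1"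
      using \<tau> nu(3)[of v] by (meson mult_left_mono order_trans)
    have e: "euler \<tau> f v = (1 - \<tau> * nu v) * f v + \<tau> * (maxwellian v * G)"
    proof -
      have Lv: "L f v = gain_op f v - f v * nu v" using elim by blast
      show ?thesis unfolding euler_def Lv gain_op_nonneg_eq[OF fm nn] G_def by (simp add: algebra_simps)
    qed
    then have e0: "0 \<le> euler \<tau> f v" using tn G \<tau> nn by simp
    have "step (\<lambda>r. \<tau> * r powr \<gamma>) ?h v = (1 - ennreal \<tau> * ennreal (nu v)) * ?h v + ennreal \<tau> * ennreal G"
      unfolding step_def using \<tau> by (simp add: collision_freq_cmult gain_cmult nu(1) G)
    also have "1 - ennreal \<tau> * ennreal (nu v) = ennreal (1 - \<tau> * nu v)"
      using \<tau> nu(2)[of v] by (simp add: ennreal_mult[symmetric] ennreal_minus[symmetric] ennreal_1[symmetric] del: ennreal_1)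
    also have "ennreal (1 - \<tau> * nu v) * ?h v + ennreal \<tau> * ennreal G = ennreal ((1 - \<tau> * nu v) * (f v / maxwellian v) + \<tau> * G)"
      using \<tau> tn nn[of v] G by (simp add: ennreal_mult[symmetric] ennreal_plus[symmetric] del: ennreal_plus)
    also have "(1 - \<tau> * nu v) * (f v / maxwellian v) + \<tau> * G = euler \<tau> f v / maxwellian v"
      unfolding e by (simp add: field_simps)
    finally show ?case using e0 by simp
  qed
qed

lemma euler_mass_nonneg:
  assumes f: "integrable lborel f" and nn: "\<And>v. 0 \<le> f v" and \<tau>: "0 \<le> \<tau>" "\<tau> * a \<le> 1"
  shows "(\<integral>v. euler \<tau> f v \<partial>lborel) = (\<integral>v. f v \<partial>lborel)"
proof -
  have fm[measurable]: "f \<in> borel_measurable borel" using f by auto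
  have em[measurable]: "euler \<tau> f \<in> borel_measurable borel" using integrable_euler[OF f] by auto
  have st: "AE v in lborel. 0 \<le> euler \<tau> f v \<and>
     step (\<lambda>r. \<tau> * r powr \<gamma>) (\<lambda>v. ennreal (f v / maxwellian v)) v = ennreal (euler \<tau> f v / maxwellian v)"
    by (rule euler_step_nonneg) (use assms in auto)
  then have st': "AE v in maxwell_measure. step (\<lambda>r. \<tau> * r powr \<gamma>) (\<lambda>v. ennreal (f v / maxwellian v)) v = ennreal (max 0 (euler \<tau> f v) / maxwellian v)"
    unfolding AE_maxwell_iff by eventually_elim simp
  have e_nn: "AE v in lborel. 0 \<le> euler \<tau> f v" using st by eventually_elim simp
  have "(\<integral>\<^sup>+v. ennreal (euler \<tau> f v) \<partial>lborel) = (\<integral>\<^sup>+v. ennreal (max 0 (euler \<tau> f v)) \<partial>lborel)"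
    by (rule nn_integral_cong_AE, use e_nn in eventually_elim) simp
  also have "\<dots> = (\<integral>\<^sup>+v. ennreal (max 0 (euler \<tau> f v) / maxwellian v) \<partial>maxwell_measure)"
    by (rule nn_integral_maxwell_div[symmetric]) simp_all
  also have "\<dots> = (\<integral>\<^sup>+v. step (\<lambda>r. \<tau> * r powr \<gamma>) (\<lambda>v. ennreal (f v / maxwellian v)) v \<partial>maxwell_measure)"
    by (rule nn_integral_cong_AE, use st' in eventually_elim) simp
  also have "\<dots> = (\<integral>\<^sup>+v. ennreal (f v / maxwellian v) \<partial>maxwell_measure)"
    using \<tau> by (intro nn_integral_step freq_euler_le) simp_all
  also have "\<dots> = (\<integral>\<^sup>+v. ennreal (f v) \<partial>lborel)"
    by (rule nn_integral_maxwell_div) (simp_all add: nn)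
  finally have "(\<integral>\<^sup>+v. ennreal (euler \<tau> f v) \<partial>lborel) = (\<integral>\<^sup>+v. ennreal (f v) \<partial>lborel)" .
  then show ?thesis
    using e_nn nn by (subst integral_eq_nn_integral, simp, simp, subst integral_eq_nn_integral) simp_all
qed

lemma euler_cong:
  assumes "integrable lborel f" "integrable lborel g" "AE v in lborel. f v = g v"
  shows "AE v in lborel. euler \<tau> f v = euler \<tau> g v"
  using op_cong[OF assms] assms(3) by eventually_elim (simp add: euler_def)

lemma euler_diff:
  assumes "integrable lborel f" "integrable lborel g"
  shows "AE v in lborel. euler \<tau> (\<lambda>v. f v - g v) v = euler \<tau> f v - euler \<tau> g v"
  using op_linear[OF assms, of 1 "-1"] by eventually_elim (simp add: euler_def right_diff_distrib)

text \<open>Positive and negative part are stepped separately: each stays nonnegative and keeps its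
  mass, and their difference is the step of \<open>f\<close>.\<close>

lemma L1_norm_euler_le:
  assumes f: "integrable lborel f" and \<tau>: "0 \<le> \<tau>" "\<tau> * a \<le> 1"
  shows "L1_norm (euler \<tau> f) \<le> L1_norm f"
proof -
  define p n where "p v = max 0 (f v)" and "n v = max 0 (- f v)" for v
  have pn: "f v = p v - n v" "0 \<le> p v" "0 \<le> n v" "\<bar>f v\<bar> = p v + n v" for v by (auto simp: p_def n_def)
  have i: "integrable lborel p" "integrable lborel n" unfolding p_def[abs_def] n_def[abs_def] using f by simp_all
  note e = euler_step_nonneg[OF i(1) pn(2) \<tau>] euler_step_nonneg[OF i(2) pn(3) \<tau>] euler_diff[OF i, of \<tau>]
  have "L1_norm (euler \<tau> f) \<le> (\<integral>v. euler \<tau> p v + euler \<tau> n v \<partial>lborel)"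
    unfolding L1_norm_def
  proof (rule integral_mono_AE)
    show "AE v in lborel. \<bar>euler \<tau> f v\<bar> \<le> euler \<tau> p v + euler \<tau> n v"
      using e unfolding pn(1)[symmetric] by eventually_elim auto
  qed (use integrable_euler[OF f] integrable_euler[OF i(1)] integrable_euler[OF i(2)] in simp_all)
  also have "\<dots> = (\<integral>v. p v \<partial>lborel) + (\<integral>v. n v \<partial>lborel)"
    using integrable_euler[OF i(1)] integrable_euler[OF i(2)] euler_mass_nonneg[OF i(1) pn(2) \<tau>] euler_mass_nonneg[OF i(2) pn(3) \<tau>] by simp
  also have "\<dots> = L1_norm f"
    unfolding L1_norm_def pn(4) using i by simp
  finally show ?thesis .
qed

end

subsection \<open>Pointwise lower bound for the gain term\<close>

text \<open>On the half-line where \<open>s + z\<close> is negative, the substitution has derivative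
  \<open>1/2 + D / (2 * (s + z)\<^sup>2)\<close>, which is at least one half; hence the factor
  two.\<close>

lemma shear_line:
  fixes W :: "real \<Rightarrow> ennreal" and z :: real
  assumes [measurable]: "W \<in> borel_measurable borel" and D: "0 \<le> D"
  defines "\<tau> \<equiv> \<lambda>s. (s + z) / 2 - z - D / (2 * (s + z))"
  shows "(\<integral>\<^sup>+s. W (\<tau> s) * indicator {s. s + z < 0} s \<partial>lborel) \<le> 2 * (\<integral>\<^sup>+t. W t \<partial>lborel)"
proof -
  \<comment> \<open>Compact intervals exhausting the open half-line, away from the pole at
    \<open>s = - z\<close>, so that the substitution rule applies on each.\<close>
  define A B where "A n = - z - real (n + 2)" and "B n = - z - 1 / real (n + 2)" for n
  define \<tau>' where "\<tau>' s = 1/2 + D / (2 * (s + z)\<^sup>2)" for s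
  have [measurable]: "\<tau> \<in> borel_measurable borel" unfolding \<tau>_def by measurable
  have piece: "(\<integral>\<^sup>+s. W (\<tau> s) * indicator {A n..B n} s \<partial>lborel) \<le> 2 * (\<integral>\<^sup>+t. W t \<partial>lborel)" for n
  proof -
    have neg: "s + z < 0" if "s \<in> {A n..B n}" for s
    proof -
      have "0 < 1 / real (n + 2)" by simp
      with that show ?thesis unfolding B_def atLeastAtMost_iff by linarith
    qed
    have "1 / real (n + 2) < 1" "1 < real (n + 2)" by auto
    then have AB: "A n < B n" unfolding A_def B_def by linarith
    have "(\<integral>\<^sup>+s. W (\<tau> s) * indicator {A n..B n} s \<partial>lborel) \<le> (\<integral>\<^sup>+s. 2 * (W (\<tau> s) * ennreal (\<tau>' s) * indicator {A n..B n} s) \<partial>lborel)"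
    proof (rule nn_integral_mono)
      fix s
      have "1 \<le> 2 * \<tau>' s" using D by (simp add: \<tau>'_def)
      then have "1 \<le> ennreal (2 * \<tau>' s)" by simp
      also have "\<dots> = 2 * ennreal (\<tau>' s)" by (subst ennreal_mult) (use D in \<open>auto simp: \<tau>'_def\<close>)
      finally have "W (\<tau> s) * indicator {A n..B n} s * 1 \<le> W (\<tau> s) * indicator {A n..B n} s * (2 * ennreal (\<tau>' s))"
        by (rule mult_left_mono) simp
      then show "W (\<tau> s) * indicator {A n..B n} s \<le> 2 * (W (\<tau> s) * ennreal (\<tau>' s) * indicator {A n..B n} s)"
        by (simp add: mult_ac)
    qed
    also have "\<dots> = 2 * (\<integral>\<^sup>+s. W (\<tau> s) * ennreal (\<tau>' s) * indicator {A n..B n} s \<partial>lborel)"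
      unfolding \<tau>'_def by (rule nn_integral_cmult) measurable
    also have "(\<integral>\<^sup>+s. W (\<tau> s) * ennreal (\<tau>' s) * indicator {A n..B n} s \<partial>lborel) = (\<integral>\<^sup>+t. W t * indicator {\<tau> (A n)..\<tau> (B n)} t \<partial>lborel)"
    proof (rule nn_integral_substitution_aux[symmetric])
      fix s assume "s \<in> {A n..B n}"
      then have "s + z \<noteq> 0" using neg by force
      then show "(\<tau> has_real_derivative \<tau>' s) (at s)"
      proof -
        assume nz: "s + z \<noteq> 0"
        have alg: "1/2 - (0 * (2 * x) - D * 2) / ((2 * x) * (2 * x)) = 1/2 + D / (2 * x\<^sup>2)" if "x \<noteq> 0" for x
          using that by (simp add: power2_eq_square field_simps)
        have "(\<tau> has_real_derivative 1/2 - (0 * (2 * (s + z)) - D * 2) / ((2 * (s + z)) * (2 * (s + z)))) (at s)"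
          unfolding \<tau>_def using nz by (auto intro!: derivative_eq_intros)
        then show "(\<tau> has_real_derivative \<tau>' s) (at s)" unfolding \<tau>'_def alg[OF nz] .
      qed
    next
      show "continuous_on {A n..B n} \<tau>'"
        unfolding \<tau>'_def using neg by (intro continuous_intros) force
    qed (use AB D in \<open>auto simp: \<tau>'_def\<close>)
    also have "2 * \<dots> \<le> 2 * (\<integral>\<^sup>+t. W t \<partial>lborel)"
      by (intro mult_left_mono nn_integral_mono) (auto split: split_indicator)
    finally show ?thesis .
  qed
  have "(\<lambda>n. \<integral>\<^sup>+s. W (\<tau> s) * indicator {A n..B n} s \<partial>lborel) \<longlonglongrightarrow> (\<integral>\<^sup>+s. W (\<tau> s) * indicator {s. s + z < 0} s \<partial>lborel)"
  proof (rule nn_integral_LIMSEQ)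
    have "indicator {A m..B m} s \<le> (indicator {A n..B n} s :: ennreal)" if "m \<le> n" for m n s
    proof -
      have "1 / real (n + 2) \<le> 1 / real (m + 2)" using that by (intro divide_left_mono) auto
      then have "{A m..B m} \<subseteq> {A n..B n}" using that unfolding A_def B_def by auto
      then show ?thesis by (auto split: split_indicator)
    qed
    then show "incseq (\<lambda>n s. W (\<tau> s) * indicator {A n..B n} s)"
      by (intro incseq_def[THEN iffD2] allI impI le_funI mult_left_mono) simp_all
    fix s
    show "(\<lambda>n. W (\<tau> s) * indicator {A n..B n} s) \<longlonglongrightarrow> W (\<tau> s) * indicator {s. s + z < 0} s"
    proof (rule tendsto_eventually)
      obtain N1 where N1: "- (s + z) \<le> real N1" using real_arch_simple by blast
      show "\<forall>\<^sub>F n in sequentially. W (\<tau> s) * indicator {A n..B n} s = W (\<tau> s) * indicator {s. s + z < 0} s"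
      proof (cases "s + z < 0")
        case True
        obtain N2 where N2: "1 / - (s + z) \<le> real N2" using real_arch_simple by blast
        have "s \<in> {A n..B n}" if n: "max N1 N2 \<le> n" for n
        proof -
          have "1 / - (s + z) \<le> real (n + 2)" using N2 n by (simp only: of_nat_add)
          then have "1 / real (n + 2) \<le> - (s + z)" using True by (simp add: field_simps)
          moreover have "- (s + z) \<le> real (n + 2)" using N1 n by simp
          ultimately show ?thesis unfolding A_def B_def by auto
        qed
        then show ?thesis unfolding eventually_sequentially using True by (intro exI[of _ "max N1 N2"]) auto
      next
        case False
        have "s \<notin> {A n..B n}" for n
        proof -
          have "0 < 1 / real (n + 2)" by simp
          then show ?thesis using False unfolding B_def atLeastAtMost_iff by linarith
        qed
        then show ?thesis using False by simp
      qed
    qed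
  qed simp
  then show ?thesis by (rule LIMSEQ_le_const2) (use piece in auto)
qed

text \<open>The map moves \<open>y\<close> only along \<sigma>, so the claim reduces to
  \<open>shear_line\<close> on every line parallel to \<sigma>. It is the inverse of
  \<open>y = u - norm u *\<^sub>R \<sigma>\<close>, where \<open>y\<close> is twice the velocity
  change \<open>v - post v w \<sigma>\<close> and \<open>u\<close> the relative velocity.\<close>

lemma shear_integral_le:
  fixes G :: "'a::euclidean_space \<Rightarrow> ennreal"
  assumes [measurable]: "G \<in> borel_measurable borel" and \<sigma>: "norm \<sigma> = 1"
  shows "(\<integral>\<^sup>+y. G (y - ((norm y)\<^sup>2 / (2 * (y \<bullet> \<sigma>))) *\<^sub>R \<sigma>) * indicator {y. y \<bullet> \<sigma> < 0} y \<partial>lborel) \<le> 2 * (\<integral>\<^sup>+u. G u \<partial>lborel)"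
proof -
  define q where "q y = - (norm y)\<^sup>2 / (2 * (y \<bullet> \<sigma>))" for y
  have [measurable]: "q \<in> borel_measurable borel" unfolding q_def[abs_def] by measurable
  define J where "J y = G (y + q y *\<^sub>R \<sigma>) * indicator {y. y \<bullet> \<sigma> < 0} y" for y
  have [measurable]: "J \<in> borel_measurable borel" unfolding J_def[abs_def] by measurable
  \<comment> \<open>A window of mass one replaces a coordinate system adapted to \<sigma>. The
    points are written as \<open>s *\<^sub>R \<sigma> + \<zeta>\<close> with \<zeta> running through
    the whole space, and the window absorbs the surplus dimension.\<close>
  define \<omega> :: "real \<Rightarrow> ennreal" where "\<omega> = indicator {0..1}"
  have [measurable]: "\<omega> \<in> borel_measurable borel" unfolding \<omega>_def by measurable
  have \<omega>1: "(\<integral>\<^sup>+t. \<omega> t \<partial>lborel) = 1" unfolding \<omega>_def by simp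
  have ss: "\<sigma> \<bullet> \<sigma> = 1" using \<sigma> by (simp add: norm_eq_1)
  have "(\<integral>\<^sup>+y. J y \<partial>lborel) = (\<integral>\<^sup>+y. \<integral>\<^sup>+s. \<omega> (q y + s) * J y \<partial>lborel \<partial>lborel)"
  proof (rule nn_integral_cong)
    fix y
    have "(\<integral>\<^sup>+s. \<omega> (q y + s) * J y \<partial>lborel) = (\<integral>\<^sup>+s. \<omega> (q y + s) \<partial>lborel) * J y"
      by (rule nn_integral_multc) measurable
    also have "(\<integral>\<^sup>+s. \<omega> (q y + s) \<partial>lborel) = 1"
      by (subst nn_integral_lborel_translate) (simp_all add: \<omega>1)
    finally show "J y = (\<integral>\<^sup>+s. \<omega> (q y + s) * J y \<partial>lborel)" by simp
  qed
  also have "\<dots> = (\<integral>\<^sup>+s. \<integral>\<^sup>+y. \<omega> (q y + s) * J y \<partial>lborel \<partial>lborel)"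
    by (rule lborel_pair.Fubini') measurable
  also have "\<dots> = (\<integral>\<^sup>+s. \<integral>\<^sup>+\<zeta>. \<omega> (q (s *\<^sub>R \<sigma> + \<zeta>) + s) * J (s *\<^sub>R \<sigma> + \<zeta>) \<partial>lborel \<partial>lborel)"
    by (intro nn_integral_cong nn_integral_lborel_translate[symmetric]) measurable
  also have "\<dots> = (\<integral>\<^sup>+\<zeta>. \<integral>\<^sup>+s. \<omega> (q (s *\<^sub>R \<sigma> + \<zeta>) + s) * J (s *\<^sub>R \<sigma> + \<zeta>) \<partial>lborel \<partial>lborel)"
    by (rule lborel_pair.Fubini'[symmetric]) measurable
  also have "\<dots> \<le> (\<integral>\<^sup>+\<zeta>. 2 * (\<integral>\<^sup>+t. \<omega> t * G (t *\<^sub>R \<sigma> + \<zeta>) \<partial>lborel) \<partial>lborel)"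
  proof (rule nn_integral_mono)
    fix \<zeta> :: 'a
    define z where "z = \<zeta> \<bullet> \<sigma>"
    define D where "D = (norm \<zeta>)\<^sup>2 - z\<^sup>2"
    have D: "0 \<le> D"
    proof -
      have "z\<^sup>2 \<le> (norm \<zeta>)\<^sup>2 * (norm \<sigma>)\<^sup>2"
        unfolding z_def using Cauchy_Schwarz_ineq[of \<zeta> \<sigma>] by (simp add: power2_norm_eq_inner)
      then show ?thesis using \<sigma> by (simp add: D_def)
    qed
    define \<tau> where "\<tau> = (\<lambda>s. (s + z) / 2 - z - D / (2 * (s + z)))"
    have \<tau>: "q (s *\<^sub>R \<sigma> + \<zeta>) + s = \<tau> s" if "s + z < 0" for s
    proof -
      have i: "(s *\<^sub>R \<sigma> + \<zeta>) \<bullet> \<sigma> = s + z" by (simp add: inner_add_left ss z_def)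
      have "(s *\<^sub>R \<sigma> + \<zeta>) \<bullet> (s *\<^sub>R \<sigma> + \<zeta>) = s * s * (\<sigma> \<bullet> \<sigma>) + 2 * s * (\<zeta> \<bullet> \<sigma>) + \<zeta> \<bullet> \<zeta>"
        by (simp add: inner_add_left inner_add_right inner_commute algebra_simps)
      then have n: "(norm (s *\<^sub>R \<sigma> + \<zeta>))\<^sup>2 = (s + z)\<^sup>2 + D"
        unfolding D_def power2_norm_eq_inner z_def ss by (simp add: power2_eq_square algebra_simps)
      define E where "E = D / (2 * (s + z))"
      have sq: "x\<^sup>2 / (2 * x) = x / 2" if "x \<noteq> 0" for x :: real
        using that by (simp add: power2_eq_square)
      have "q (s *\<^sub>R \<sigma> + \<zeta>) + s = s - ((s + z)\<^sup>2 + D) / (2 * (s + z))"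
        unfolding q_def i n minus_divide_left[symmetric] by linarith
      also have "\<dots> = s - ((s + z) / 2 + E)"
        using that unfolding E_def add_divide_distrib[of "(s + z)\<^sup>2"] by (subst sq) auto
      also have "\<dots> = \<tau> s" unfolding \<tau>_def E_def[symmetric] by (simp add: field_simps)
      finally show ?thesis .
    qed
    have "(\<integral>\<^sup>+s. \<omega> (q (s *\<^sub>R \<sigma> + \<zeta>) + s) * J (s *\<^sub>R \<sigma> + \<zeta>) \<partial>lborel) =
       (\<integral>\<^sup>+s. (\<omega> (\<tau> s) * G (\<tau> s *\<^sub>R \<sigma> + \<zeta>)) * indicator {s. s + z < 0} s \<partial>lborel)"
    proof (rule nn_integral_cong)
      fix s
      have i: "(s *\<^sub>R \<sigma> + \<zeta>) \<bullet> \<sigma> = s + z" by (simp add: inner_add_left ss z_def)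
      show "\<omega> (q (s *\<^sub>R \<sigma> + \<zeta>) + s) * J (s *\<^sub>R \<sigma> + \<zeta>) = (\<omega> (\<tau> s) * G (\<tau> s *\<^sub>R \<sigma> + \<zeta>)) * indicator {s. s + z < 0} s"
      proof (cases "s + z < 0")
        case True
        have "s *\<^sub>R \<sigma> + \<zeta> + q (s *\<^sub>R \<sigma> + \<zeta>) *\<^sub>R \<sigma> = \<tau> s *\<^sub>R \<sigma> + \<zeta>"
          unfolding \<tau>[OF True, symmetric] by (simp add: scaleR_add_left add_ac)
        then have "J (s *\<^sub>R \<sigma> + \<zeta>) = G (\<tau> s *\<^sub>R \<sigma> + \<zeta>)"
          using True i by (simp only: J_def) simp
        then show ?thesis using True by (simp add: \<tau>)
      next
        case False
        then show ?thesis by (simp add: J_def i)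
      qed
    qed
    also have "\<dots> \<le> 2 * (\<integral>\<^sup>+t. \<omega> t * G (t *\<^sub>R \<sigma> + \<zeta>) \<partial>lborel)"
      unfolding \<tau>_def by (rule shear_line[where W = "\<lambda>t. \<omega> t * G (t *\<^sub>R \<sigma> + \<zeta>)", OF _ D]) measurable
    finally show "(\<integral>\<^sup>+s. \<omega> (q (s *\<^sub>R \<sigma> + \<zeta>) + s) * J (s *\<^sub>R \<sigma> + \<zeta>) \<partial>lborel) \<le> 2 * (\<integral>\<^sup>+t. \<omega> t * G (t *\<^sub>R \<sigma> + \<zeta>) \<partial>lborel)" .
  qed
  also have "\<dots> = 2 * (\<integral>\<^sup>+\<zeta>. \<integral>\<^sup>+t. \<omega> t * G (t *\<^sub>R \<sigma> + \<zeta>) \<partial>lborel \<partial>lborel)"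
    by (rule nn_integral_cmult) measurable
  also have "(\<integral>\<^sup>+\<zeta>. \<integral>\<^sup>+t. \<omega> t * G (t *\<^sub>R \<sigma> + \<zeta>) \<partial>lborel \<partial>lborel) = (\<integral>\<^sup>+t. \<integral>\<^sup>+\<zeta>. \<omega> t * G (t *\<^sub>R \<sigma> + \<zeta>) \<partial>lborel \<partial>lborel)"
    by (rule lborel_pair.Fubini') measurable
  also have "\<dots> = (\<integral>\<^sup>+t. \<omega> t * (\<integral>\<^sup>+u. G u \<partial>lborel) \<partial>lborel)"
  proof (rule nn_integral_cong)
    fix t
    have "(\<integral>\<^sup>+\<zeta>. \<omega> t * G (t *\<^sub>R \<sigma> + \<zeta>) \<partial>lborel) = \<omega> t * (\<integral>\<^sup>+\<zeta>. G (t *\<^sub>R \<sigma> + \<zeta>) \<partial>lborel)"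
      by (rule nn_integral_cmult) measurable
    then show "(\<integral>\<^sup>+\<zeta>. \<omega> t * G (t *\<^sub>R \<sigma> + \<zeta>) \<partial>lborel) = \<omega> t * (\<integral>\<^sup>+u. G u \<partial>lborel)"
      by (simp add: nn_integral_lborel_translate)
  qed
  also have "\<dots> = (\<integral>\<^sup>+u. G u \<partial>lborel)"
    by (simp add: nn_integral_multc \<omega>1)
  finally show ?thesis
    unfolding J_def q_def by simp
qed

section \<open>Gaussian lower bound from one collision\<close>

text \<open>The dimension times the volume of a ball of radius 1/20, which fits into the cone over
  the set of directions used below.\<close>

definition cone_const :: "'a::euclidean_space itself \<Rightarrow> real" where
  "cone_const _ = real DIM('a) * (unit_ball_vol (real DIM('a)) * (1/20) ^ DIM('a))"

lemma cone_const_pos: "0 < cone_const TYPE('a::euclidean_space)"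
  by (simp add: cone_const_def)

text \<open>The cone contains a fixed ball around a point whose cosine with \<open>- e\<close> is
  one half, the middle of the allowed range. Building that point takes a direction orthogonal to
  \<open>e\<close>, hence a dimension of at least two.\<close>

lemma emeasure_sph_cap_ge:
  fixes e :: "'a::euclidean_space"
  assumes d: "2 \<le> DIM('a)" and e: "norm e = 1"
  shows "ennreal (cone_const TYPE('a)) \<le> emeasure sph {\<sigma>. 1/4 \<le> - (e \<bullet> \<sigma>) \<and> - (e \<bullet> \<sigma>) \<le> 3/4}"
proof -
  obtain y :: 'a where y: "y \<noteq> 0" "orthogonal e y" using orthogonal_to_vector_exists[OF d] by blast
  define e2 where "e2 = y /\<^sub>R norm y"
  have e2: "norm e2 = 1" "e \<bullet> e2 = 0" using y by (auto simp: e2_def orthogonal_def)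
  \<comment> \<open>Norm 1/2 and inner product -1/4 with \<open>e\<close>; the radius 1/20 leaves
    room on both sides.\<close>
  define x0 where "x0 = - (1/4) *\<^sub>R e + (sqrt 3 / 4) *\<^sub>R e2"
  have ee: "e \<bullet> e = 1" "e2 \<bullet> e2 = 1" "e2 \<bullet> e = 0" using e e2 by (simp_all add: norm_eq_1 inner_commute)
  have ex0: "e \<bullet> x0 = - (1/4)" by (simp add: x0_def inner_add_right ee e2 inner_diff_right)
  have "x0 \<bullet> x0 = 1/16 + (sqrt 3)\<^sup>2 / 16"
    by (simp add: x0_def inner_add_left inner_add_right inner_diff_left inner_diff_right ee e2 power2_eq_square)
  then have "x0 \<bullet> x0 = (1/2)\<^sup>2" by (simp add: power2_eq_square)
  then have "(norm x0)\<^sup>2 = (1/2)\<^sup>2" unfolding power2_norm_eq_inner .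
  then have nx0: "norm x0 = 1/2" by (rule power2_eq_imp_eq) auto
  let ?B = "{\<sigma>. 1/4 \<le> - (e \<bullet> \<sigma>) \<and> - (e \<bullet> \<sigma>) \<le> 3/4}"
  have sub: "ball x0 (1/20) \<subseteq> {u. norm u < 1 \<and> unit_dir u \<in> ?B}"
  proof
    fix u assume "u \<in> ball x0 (1/20)"
    then have du: "norm (u - x0) < 1/20" by (simp add: dist_norm norm_minus_commute)
    have n1: "norm u \<le> norm x0 + norm (u - x0)" using norm_triangle_sub[of u x0] by simp
    have n2: "norm x0 \<le> norm u + norm (u - x0)" using norm_triangle_sub[of x0 u] by (simp add: norm_minus_commute)
    have "\<bar>e \<bullet> (u - x0)\<bar> \<le> norm e * norm (u - x0)" by (rule Cauchy_Schwarz_ineq2)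
    then have i: "\<bar>e \<bullet> u + 1/4\<bar> < 1/20" using du by (simp add: inner_diff_right ex0 e)
    have u0: "u \<noteq> 0" using n2 nx0 du by auto
    have ud: "e \<bullet> unit_dir u = (e \<bullet> u) / norm u" using u0 by (simp add: unit_dir_def divide_inverse mult.commute)
    have r: "9/20 < norm u" "norm u < 11/20" using n1 n2 nx0 du by linarith+
    have "1/5 < - (e \<bullet> u)" "- (e \<bullet> u) < 3/10" using i by linarith+
    then have "1/4 * norm u \<le> - (e \<bullet> u)" "- (e \<bullet> u) \<le> 3/4 * norm u" using r by linarith+
    then have "1/4 \<le> - (e \<bullet> unit_dir u) \<and> - (e \<bullet> unit_dir u) \<le> 3/4"
      unfolding ud using u0 by (simp add: field_simps)
    then show "u \<in> {u. norm u < 1 \<and> unit_dir u \<in> ?B}" using r by auto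
  qed
  have "ennreal (cone_const TYPE('a)) = of_nat DIM('a) * emeasure lborel (ball x0 (1/20))"
    unfolding cone_const_def by (subst ennreal_mult) (simp_all add: ennreal_of_nat_eq_real_of_nat emeasure_ball)
  also have "\<dots> \<le> of_nat DIM('a) * emeasure lborel {u. norm u < 1 \<and> unit_dir u \<in> ?B}"
    by (intro mult_left_mono emeasure_mono sub) simp_all
  also have "\<dots> = emeasure sph ?B"
    by (rule emeasure_sph_cone[symmetric]) measurable
  finally show ?thesis .
qed

context soft_collisions
begin

text \<open>Here \<open>y\<close> is twice the difference of the velocity \<open>x\<close> and the
  outgoing velocity, and \<open>u\<close> is recovered from \<open>y\<close> and \<sigma>. In the
  given cone \<open>norm u\<close> is at most twice \<open>norm y\<close>, and the scattering cosine
  \<open>1 - 2 * (y \<bullet> \<sigma>)\<^sup>2 / (norm y)\<^sup>2\<close> stays between -1/8 and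
  7/8, away from the zeros of the bound on \<open>b\<close>. The second outgoing velocity has norm
  at most \<open>6 * r0\<close>, and half of 36 is the 18 in the exponent.\<close>

lemma gain_integrand_ge:
  fixes x y \<sigma> :: 'a
  assumes \<sigma>: "norm \<sigma> = 1" and y: "y \<noteq> 0" "norm y / 4 \<le> - (y \<bullet> \<sigma>)" "- (y \<bullet> \<sigma>) \<le> 3/4 * norm y"
    and \<rho>: "0 < \<rho>" "norm (x - (1/2) *\<^sub>R y) \<le> \<rho>" and f: "\<And>v. 0 \<le> f v"
    and b0: "0 < b0" "\<And>t. t \<in> {-1..1} \<Longrightarrow> b0 * sqrt (1 - t\<^sup>2) \<le> b t"
  defines "u \<equiv> y - ((norm y)\<^sup>2 / (2 * (y \<bullet> \<sigma>))) *\<^sub>R \<sigma>" and "r0 \<equiv> norm x + \<rho>"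
  shows "(4 * r0) powr \<gamma> * (b0 / 4) * (f (x - (1/2) *\<^sub>R y) * ((2 * pi) powr (- real DIM('a) / 2) * exp (- 18 * r0\<^sup>2))) \<le>
    gain_integrand f x (x - u, \<sigma>)"
proof -
  define s where "s = y \<bullet> \<sigma>"
  define r where "r = - (norm y)\<^sup>2 / (2 * s)"
  have ny: "0 < norm y" using y by simp
  have s: "s < 0" using y(2) ny unfolding s_def by linarith
  have ss: "\<sigma> \<bullet> \<sigma> = 1" using \<sigma> by (simp add: norm_eq_1)
  have r: "0 < r" unfolding r_def using s ny by (intro divide_neg_neg) auto
  have u: "u = y + r *\<^sub>R \<sigma>" by (simp add: u_def r_def s_def)
  have rs: "2 * r * s = - (norm y)\<^sup>2" using s by (simp add: r_def)
  have "u \<bullet> u = y \<bullet> y + 2 * r * s + r * r"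
    by (simp add: u inner_add_left inner_add_right ss s_def inner_commute)
  then have "(norm u)\<^sup>2 = r\<^sup>2" unfolding power2_norm_eq_inner[of u] rs power2_norm_eq_inner[of y] by (simp add: power2_eq_square)
  then have nu: "norm u = r" by (rule power2_eq_imp_eq) (use r in auto)
  have r2: "r \<le> 2 * norm y"
  proof -
    have "r * (norm y / 4) \<le> r * (- s)" using y(2) r unfolding s_def by (intro mult_left_mono) auto
    also have "\<dots> = (norm y)\<^sup>2 / 2" using rs by simp
    finally have "r * norm y \<le> (2 * norm y) * norm y" by (simp add: power2_eq_square)
    then show ?thesis using ny by (simp add: mult_le_cancel_right)
  qed
  have diff: "x - (x - u) = u" by simp
  have sum: "x + (x - u) = 2 *\<^sub>R x - u" by (simp add: scaleR_2)
  have half: "(1/2) *\<^sub>R (2 *\<^sub>R x - u) = x - (1/2) *\<^sub>R u" by (simp add: scaleR_right_diff_distrib)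
  have hu: "(1/2) *\<^sub>R u = (1/2) *\<^sub>R y + (r / 2) *\<^sub>R \<sigma>" by (simp add: u scaleR_right_distrib)
  have post: "post x (x - u) \<sigma> = x - (1/2) *\<^sub>R y"
    unfolding post_def diff sum nu half hu by simp
  have r_half: "r *\<^sub>R \<sigma> = (r / 2) *\<^sub>R \<sigma> + (r / 2) *\<^sub>R \<sigma>" by (simp flip: scaleR_left_distrib)
  have post_star: "post_star x (x - u) \<sigma> = (x - (1/2) *\<^sub>R y) - r *\<^sub>R \<sigma>"
    unfolding post_star_def diff sum nu half hu r_half by (simp only: diff_diff_eq add.assoc)
  have "(1/2) *\<^sub>R y = x - (x - (1/2) *\<^sub>R y)" by simp
  then have "norm ((1/2) *\<^sub>R y) \<le> norm x + norm (x - (1/2) *\<^sub>R y)" by (metis norm_triangle_ineq4)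
  then have yr: "norm y \<le> 2 * r0" using \<rho> by (simp add: r0_def)
  have r0: "0 < r0" using \<rho> by (simp add: r0_def add_nonneg_pos)
  define t where "t = cos_dev x (x - u) \<sigma>"
  have t: "t = 1 - 2 * (s\<^sup>2 / (norm y)\<^sup>2)"
  proof -
    have "t = (u \<bullet> \<sigma>) / r" unfolding t_def cos_dev_def diff nu by (simp add: divide_inverse mult.commute)
    also have "u \<bullet> \<sigma> = s + r" by (simp add: u inner_add_left ss s_def)
    also have "(s + r) / r = 1 + s / r" using r by (simp add: field_simps)
    also have "s / r = - 2 * (s\<^sup>2 / (norm y)\<^sup>2)" using s ny by (simp add: r_def power2_eq_square)
    finally show ?thesis by simp
  qed
  have sq1: "(norm y / 4)\<^sup>2 \<le> s\<^sup>2" using y(2) ny s unfolding s_def by (subst power2_minus[of "y \<bullet> \<sigma>", symmetric], intro power_mono) auto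
  have sq2: "s\<^sup>2 \<le> (3/4 * norm y)\<^sup>2" using y(3) ny s unfolding s_def by (subst power2_minus[of "y \<bullet> \<sigma>", symmetric], intro power_mono) auto
  have q: "1/16 \<le> s\<^sup>2 / (norm y)\<^sup>2" "s\<^sup>2 / (norm y)\<^sup>2 \<le> 9/16"
    using sq1 sq2 ny by (simp_all add: field_simps power2_eq_square)
  have tr: "\<bar>t\<bar> \<le> 7/8" unfolding t by (rule abs_leI) (use q in linarith)+
  have "t\<^sup>2 \<le> (7/8)\<^sup>2" using power_mono[OF tr, of 2] by simp
  then have "1/16 \<le> 1 - t\<^sup>2" by (simp add: power2_eq_square)
  then have "sqrt (1/16) \<le> sqrt (1 - t\<^sup>2)" by (rule real_sqrt_le_mono)
  moreover have "sqrt (1/16) = (1/4 :: real)" by (rule real_sqrt_unique) (simp_all add: power2_eq_square)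
  ultimately have "b0 * (1/4) \<le> b0 * sqrt (1 - t\<^sup>2)" using b0 by (intro mult_left_mono) auto
  also have "\<dots> \<le> b t" using tr by (intro b0) auto
  also have "b t = bk t" using tr by (auto simp: bk_def)
  finally have bk: "b0 / 4 \<le> bk t" by simp
  have "norm ((x - (1/2) *\<^sub>R y) - r *\<^sub>R \<sigma>) \<le> norm (x - (1/2) *\<^sub>R y) + norm (r *\<^sub>R \<sigma>)" by (rule norm_triangle_ineq4)
  also have "\<dots> \<le> \<rho> + 4 * r0" using \<rho> \<sigma> r r2 yr by simp
  also have "\<dots> \<le> 6 * r0" using r0 unfolding r0_def by (smt (verit) norm_ge_zero)
  finally have "(norm (post_star x (x - u) \<sigma>))\<^sup>2 \<le> (6 * r0)\<^sup>2" unfolding post_star by (intro power_mono) auto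
  then have M: "(2 * pi) powr (- real DIM('a) / 2) * exp (- 18 * r0\<^sup>2) \<le> maxwellian (post_star x (x - u) \<sigma>)"
    unfolding maxwellian_def by (intro mult_left_mono) (auto simp: power_mult_distrib)
  have P: "(4 * r0) powr \<gamma> \<le> norm u powr \<gamma>"
    unfolding nu using \<gamma>_neg r r2 yr by (intro powr_mono2') auto
  have "(4 * r0) powr \<gamma> * (b0 / 4) \<le> norm u powr \<gamma> * bk t"
    using b0(1) by (intro mult_mono P bk) auto
  then have "(4 * r0) powr \<gamma> * (b0 / 4) * (f (x - (1/2) *\<^sub>R y) * ((2 * pi) powr (- real DIM('a) / 2) * exp (- 18 * r0\<^sup>2))) \<le>
    (norm u powr \<gamma> * bk t) * (f (x - (1/2) *\<^sub>R y) * maxwellian (post_star x (x - u) \<sigma>))"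
    by (rule mult_mono) (use f M in \<open>auto intro!: mult_left_mono mult_nonneg_nonneg\<close>)
  also have "\<dots> = gain_integrand f x (x - u, \<sigma>)"
    unfolding gain_integrand_def prod.case diff post t_def by (rule refl)
  finally show ?thesis .
qed

text \<open>The mass of \<open>f\<close> in a ball is written as an integral over \<open>y\<close>
  (the Jacobian of the halving is at most one), spread over the cone of directions, and carried to
  the variable \<open>u\<close> for each fixed \<sigma> by the shear, which costs the factor
  two.\<close>

lemma gain_integral_ge:
  assumes d: "2 \<le> DIM('a)" and fm[measurable]: "f \<in> borel_measurable borel" and f: "\<And>v. 0 \<le> f v"
    and b0: "0 < b0" "\<And>t. t \<in> {-1..1} \<Longrightarrow> b0 * sqrt (1 - t\<^sup>2) \<le> b t"
    and \<rho>: "0 < \<rho>"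
  shows "ennreal ((4 * (norm x + \<rho>)) powr \<gamma> * (b0 / 4) * ((2 * pi) powr (- real DIM('a) / 2) * exp (- 18 * (norm x + \<rho>)\<^sup>2)) * cone_const TYPE('a)) *
       (\<integral>\<^sup>+z. ennreal (f z) * indicator {z. norm z \<le> \<rho>} z \<partial>lborel) \<le>
     2 * (\<integral>\<^sup>+z. ennreal (gain_integrand f x z) \<partial>(lborel \<Otimes>\<^sub>M sph))"
proof -
  define \<kappa> where "\<kappa> = (4 * (norm x + \<rho>)) powr \<gamma> * (b0 / 4) * ((2 * pi) powr (- real DIM('a) / 2) * exp (- 18 * (norm x + \<rho>)\<^sup>2))"
  have \<kappa>: "0 \<le> \<kappa>" using b0 by (simp add: \<kappa>_def)
  define F where "F y = ennreal (f (x - (1/2) *\<^sub>R y)) * indicator {z. norm z \<le> \<rho>} (x - (1/2) *\<^sub>R y)" for y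
  have [measurable]: "F \<in> borel_measurable borel" unfolding F_def[abs_def] by measurable
  define C where "C = (\<lambda>(y::'a, \<sigma>). norm y / 4 \<le> - (y \<bullet> \<sigma>) \<and> - (y \<bullet> \<sigma>) \<le> 3/4 * norm y)"
  define ind :: "'a \<Rightarrow> 'a \<Rightarrow> ennreal" where "ind y \<sigma> = (if C (y, \<sigma>) then 1 else 0)" for y \<sigma>
  have [measurable]: "case_prod ind \<in> borel_measurable (borel \<Otimes>\<^sub>M borel)"
    unfolding ind_def[abs_def] C_def split_beta' by measurable
  define g where "g \<sigma> u = ennreal (gain_integrand f x (x - u, \<sigma>))" for \<sigma> u
  have [measurable]: "case_prod g \<in> borel_measurable (borel \<Otimes>\<^sub>M borel)"
    unfolding g_def[abs_def] gain_integrand_def by measurable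
  interpret pair_sigma_finite "lborel :: 'a measure" "sph :: 'a measure" ..
  have "ennreal (cone_const TYPE('a)) * (\<integral>\<^sup>+z. ennreal (f z) * indicator {z. norm z \<le> \<rho>} z \<partial>lborel) \<le> ennreal (cone_const TYPE('a)) * (\<integral>\<^sup>+y. F y \<partial>lborel)"
  proof (rule mult_left_mono)
    have "(\<integral>\<^sup>+z. ennreal (f z) * indicator {z. norm z \<le> \<rho>} z \<partial>lborel) =
       ennreal (\<bar>- (1/2)\<bar> ^ DIM('a)) * (\<integral>\<^sup>+y. ennreal (f (x + (- (1/2)) *\<^sub>R y)) * indicator {z. norm z \<le> \<rho>} (x + (- (1/2)) *\<^sub>R y) \<partial>lborel)"
      by (rule nn_integral_lborel_affine) auto
    also have "\<dots> \<le> 1 * (\<integral>\<^sup>+y. F y \<partial>lborel)"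
      unfolding F_def by (intro mult_mono nn_integral_mono) (auto simp: power_le_one)
    finally show "(\<integral>\<^sup>+z. ennreal (f z) * indicator {z. norm z \<le> \<rho>} z \<partial>lborel) \<le> (\<integral>\<^sup>+y. F y \<partial>lborel)" by simp
  qed simp
  also have "\<dots> = (\<integral>\<^sup>+y. ennreal (cone_const TYPE('a)) * F y \<partial>lborel)"
    by (simp add: nn_integral_cmult)
  also have "\<dots> \<le> (\<integral>\<^sup>+y. \<integral>\<^sup>+\<sigma>. ind y \<sigma> * F y \<partial>sph \<partial>lborel)"
  proof (rule nn_integral_mono_AE, use AE_lborel_singleton[of "0::'a"] in eventually_elim)
    case (elim y)
    define e where "e = y /\<^sub>R norm y"
    have e: "norm e = 1" "y = norm y *\<^sub>R e" using elim by (auto simp: e_def)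
    have "ind y \<sigma> = indicator {\<sigma>. 1/4 \<le> - (e \<bullet> \<sigma>) \<and> - (e \<bullet> \<sigma>) \<le> 3/4} \<sigma>" for \<sigma>
    proof -
      have "y \<bullet> \<sigma> = norm y * (e \<bullet> \<sigma>)" by (subst e(2)) simp
      moreover have "0 < norm y" using elim by simp
      ultimately have "norm y / 4 \<le> - (y \<bullet> \<sigma>) \<longleftrightarrow> 1/4 \<le> - (e \<bullet> \<sigma>)" "- (y \<bullet> \<sigma>) \<le> 3/4 * norm y \<longleftrightarrow> - (e \<bullet> \<sigma>) \<le> 3/4"
        using mult_le_cancel_left_pos[of "norm y" "1/4" "- (e \<bullet> \<sigma>)"] mult_le_cancel_left_pos[of "norm y" "- (e \<bullet> \<sigma>)" "3/4"]
        by (simp_all add: mult.commute)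
      then show ?thesis by (simp add: ind_def C_def)
    qed
    then have "(\<integral>\<^sup>+\<sigma>. ind y \<sigma> * F y \<partial>sph) = emeasure sph {\<sigma>. 1/4 \<le> - (e \<bullet> \<sigma>) \<and> - (e \<bullet> \<sigma>) \<le> 3/4} * F y"
      by (simp add: nn_integral_multc)
    then show ?case using emeasure_sph_cap_ge[OF d e(1)] by (simp add: mult_right_mono)
  qed
  finally have 1: "ennreal (cone_const TYPE('a)) * (\<integral>\<^sup>+z. ennreal (f z) * indicator {z. norm z \<le> \<rho>} z \<partial>lborel) \<le> (\<integral>\<^sup>+y. \<integral>\<^sup>+\<sigma>. ind y \<sigma> * F y \<partial>sph \<partial>lborel)" .
  have "ennreal \<kappa> * (\<integral>\<^sup>+y. \<integral>\<^sup>+\<sigma>. ind y \<sigma> * F y \<partial>sph \<partial>lborel) = (\<integral>\<^sup>+\<sigma>. \<integral>\<^sup>+y. ennreal \<kappa> * (ind y \<sigma> * F y) \<partial>lborel \<partial>sph)"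
    by (simp add: nn_integral_cmult[symmetric] Fubini')
  also have "\<dots> \<le> (\<integral>\<^sup>+\<sigma>. 2 * (\<integral>\<^sup>+u. g \<sigma> u \<partial>lborel) \<partial>sph)"
  proof (rule nn_integral_mono_AE, use AE_sph_norm in eventually_elim)
    case (elim \<sigma>)
    have "(\<integral>\<^sup>+y. ennreal \<kappa> * (ind y \<sigma> * F y) \<partial>lborel) \<le>
      (\<integral>\<^sup>+y. g \<sigma> (y - ((norm y)\<^sup>2 / (2 * (y \<bullet> \<sigma>))) *\<^sub>R \<sigma>) * indicator {y. y \<bullet> \<sigma> < 0} y \<partial>lborel)"
    proof (rule nn_integral_mono_AE, use AE_lborel_singleton[of "0::'a"] in eventually_elim)
      case (elim y)
      show ?case
      proof (cases "C (y, \<sigma>) \<and> norm (x - (1/2) *\<^sub>R y) \<le> \<rho>")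
        case True
        then have c: "norm y / 4 \<le> - (y \<bullet> \<sigma>)" "- (y \<bullet> \<sigma>) \<le> 3/4 * norm y" "norm (x - (1/2) *\<^sub>R y) \<le> \<rho>" by (auto simp: C_def)
        have "0 < norm y" using elim by simp
        then have "y \<bullet> \<sigma> < 0" using c(1) by linarith
        moreover have "ennreal (\<kappa> * f (x - (1/2) *\<^sub>R y)) \<le> g \<sigma> (y - ((norm y)\<^sup>2 / (2 * (y \<bullet> \<sigma>))) *\<^sub>R \<sigma>)"
          using gain_integrand_ge[OF \<open>norm \<sigma> = 1\<close> elim c(1,2) \<rho> c(3) f b0]
          unfolding g_def \<kappa>_def by (intro ennreal_leI) (simp add: mult_ac)
        moreover have "ennreal \<kappa> * (ind y \<sigma> * F y) = ennreal (\<kappa> * f (x - (1/2) *\<^sub>R y))"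
          using True \<kappa> f by (simp add: ind_def F_def ennreal_mult)
        ultimately show ?thesis by simp
      next
        case False
        then have "ind y \<sigma> * F y = 0" by (auto simp: ind_def F_def)
        then have "ennreal \<kappa> * (ind y \<sigma> * F y) = 0" by (simp only: mult_zero_right)
        then show ?thesis by (simp only: zero_le)
      qed
    qed
    also have "\<dots> \<le> 2 * (\<integral>\<^sup>+u. g \<sigma> u \<partial>lborel)"
      by (rule shear_integral_le[OF _ elim]) measurable
    finally show ?case .
  qed
  also have "\<dots> = 2 * (\<integral>\<^sup>+\<sigma>. \<integral>\<^sup>+u. g \<sigma> u \<partial>lborel \<partial>sph)"
    by (rule nn_integral_cmult) measurable
  also have "(\<integral>\<^sup>+\<sigma>. \<integral>\<^sup>+u. g \<sigma> u \<partial>lborel \<partial>sph) = (\<integral>\<^sup>+\<sigma>. \<integral>\<^sup>+w. ennreal (gain_integrand f x (w, \<sigma>)) \<partial>lborel \<partial>sph)"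
    unfolding g_def
    by (rule nn_integral_cong, rule nn_integral_lborel_reflect[where f = "\<lambda>w. ennreal (gain_integrand f x (w, _))"])
       (simp add: gain_integrand_def)
  also have "\<dots> = (\<integral>\<^sup>+w. \<integral>\<^sup>+\<sigma>. ennreal (gain_integrand f x (w, \<sigma>)) \<partial>sph \<partial>lborel)"
    by (rule Fubini') (simp add: gain_integrand_def split_beta')
  also have "\<dots> = (\<integral>\<^sup>+z. ennreal (gain_integrand f x z) \<partial>(lborel \<Otimes>\<^sub>M sph))"
    by (rule sphere.nn_integral_fst) (simp add: measurable_cong_sets[OF sets_lborel_sph refl])
  finally have 2: "ennreal \<kappa> * (\<integral>\<^sup>+y. \<integral>\<^sup>+\<sigma>. ind y \<sigma> * F y \<partial>sph \<partial>lborel) \<le> 2 * (\<integral>\<^sup>+z. ennreal (gain_integrand f x z) \<partial>(lborel \<Otimes>\<^sub>M sph))" .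
  have "ennreal (\<kappa> * cone_const TYPE('a)) * (\<integral>\<^sup>+z. ennreal (f z) * indicator {z. norm z \<le> \<rho>} z \<partial>lborel) =
     ennreal \<kappa> * (ennreal (cone_const TYPE('a)) * (\<integral>\<^sup>+z. ennreal (f z) * indicator {z. norm z \<le> \<rho>} z \<partial>lborel))"
    using \<kappa> cone_const_pos[where 'a='a] by (simp add: ennreal_mult mult.assoc)
  also have "\<dots> \<le> ennreal \<kappa> * (\<integral>\<^sup>+y. \<integral>\<^sup>+\<sigma>. ind y \<sigma> * F y \<partial>sph \<partial>lborel)"
    by (rule mult_left_mono[OF 1]) simp
  finally show ?thesis using 2 unfolding \<kappa>_def by (rule order_trans)
qed

text \<open>A probability density has positive mass in some ball, and one collision spreads that
  mass over the whole space with a Gaussian weight. The constants depend on \<open>f\<close>, which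
  is harmless: the bound serves only to establish integrability.\<close>

lemma gain_op_gaussian_lower_bound:
  assumes d: "2 \<le> DIM('a)" and fi: "integrable lborel f" and f: "\<And>v. 0 \<le> f v" and m: "(\<integral>v. f v \<partial>lborel) = 1"
    and b0: "0 < b0" "\<And>t. t \<in> {-1..1} \<Longrightarrow> b0 * sqrt (1 - t\<^sup>2) \<le> b t"
  shows "\<exists>A B. 0 \<le> B \<and> (AE x in lborel. exp (- A - B * (norm x)\<^sup>2) \<le> gain_op f x)"
proof -
  have fm[measurable]: "f \<in> borel_measurable borel" using fi by auto
  have mass: "(\<integral>\<^sup>+z. ennreal (f z) \<partial>lborel) = 1"
    using nn_integral_eq_integral[OF fi] f m by simp
  have "\<exists>n::nat. (\<integral>\<^sup>+z. ennreal (f z) * indicator {z. norm z \<le> real (n + 1)} z \<partial>lborel) > 0"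
  proof (rule ccontr)
    assume "\<not> ?thesis"
    then have 0: "(\<integral>\<^sup>+z. ennreal (f z) * indicator {z. norm z \<le> real (n + 1)} z \<partial>lborel) = 0" for n
      by (auto simp: not_less)
    have "AE z in lborel. ennreal (f z) * indicator {z. norm z \<le> real (n + 1)} z = 0" for n
      using 0[of n] by (subst (asm) nn_integral_0_iff_AE) simp_all
    then have "AE z in lborel. \<forall>n. ennreal (f z) * indicator {z. norm z \<le> real (n + 1)} z = 0"
      by (subst AE_all_countable) simp
    then have "AE z in lborel. ennreal (f z) = 0"
    proof eventually_elim
      case (elim z)
      obtain n where "norm z \<le> real n" using real_arch_simple by blast
      then show ?case using elim[rule_format, of n] by (auto simp: indicator_def split: if_splits)
    qed
    then have "(\<integral>\<^sup>+z. ennreal (f z) \<partial>lborel) = 0" by (subst nn_integral_0_iff_AE) simp_all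
    then show False using mass by simp
  qed
  then obtain n :: nat where n: "(\<integral>\<^sup>+z. ennreal (f z) * indicator {z. norm z \<le> real (n + 1)} z \<partial>lborel) > 0" by blast
  define \<rho> where "\<rho> = real (n + 1)"
  have \<rho>: "0 < \<rho>" by (simp add: \<rho>_def)
  let ?I = "\<integral>\<^sup>+z. ennreal (f z) * indicator {z. norm z \<le> \<rho>} z \<partial>lborel"
  have "?I \<le> (\<integral>\<^sup>+z. ennreal (f z) \<partial>lborel)" by (intro nn_integral_mono) (auto split: split_indicator)
  then have "?I \<le> 1" using mass by simp
  then obtain i where i: "?I = ennreal i" "0 < i"
    using n unfolding \<rho>_def by (cases "?I") (auto simp: \<rho>_def top_unique)
  define c where "c = (b0 / 4) * (2 * pi) powr (- real DIM('a) / 2) * cone_const TYPE('a) * i / 2"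
  have c: "0 < c" using b0 i cone_const_pos[where 'a='a] by (simp add: c_def)
  \<comment> \<open>Absorbs the factor \<open>(4 * r0) powr \<gamma>\<close>: its logarithm is at
    least \<open>4 * \<gamma> * r0\<close>, and \<open>r0 \<le> 1 + r0\<^sup>2\<close>.\<close>
  define D where "D = 4 * \<bar>\<gamma>\<bar> + 18"
  have low: "exp (ln c - D - D * (norm x + \<rho>)\<^sup>2) \<le> gain_op f x" if fin: "abs_gain f x < top" for x
  proof -
    define r0 where "r0 = norm x + \<rho>"
    have r0: "0 < r0" using \<rho> by (simp add: r0_def add_nonneg_pos)
    have G: "(\<integral>\<^sup>+z. ennreal (gain_integrand f x z) \<partial>(lborel \<Otimes>\<^sub>M sph)) = ennreal (gain_op f x)"
      using fin f by (simp add: nn_integral_gain_integrand gain_op_nonneg_eq ennreal_mult)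
    have g0: "0 \<le> gain_op f x" by (simp add: gain_op_nonneg_eq f)
    define X where "X = (4 * r0) powr \<gamma> * (b0 / 4) * ((2 * pi) powr (- real DIM('a) / 2) * exp (- 18 * r0\<^sup>2)) * cone_const TYPE('a)"
    have "ennreal X * ennreal i \<le> 2 * ennreal (gain_op f x)"
      using gain_integral_ge[OF d fm f b0 \<rho>, of x] unfolding r0_def X_def i(1) G .
    then have "ennreal (X * i) \<le> ennreal (2 * gain_op f x)"
      using i g0 by (simp add: ennreal_mult'')
    then have "X * i \<le> 2 * gain_op f x"
      using g0 by (subst (asm) ennreal_le_iff) auto
    then have "X * i / 2 \<le> gain_op f x" by simp
    moreover have "X * i / 2 = c * ((4 * r0) powr \<gamma> * exp (- 18 * r0\<^sup>2))"
      by (simp add: X_def c_def)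
    ultimately have le: "c * ((4 * r0) powr \<gamma> * exp (- 18 * r0\<^sup>2)) \<le> gain_op f x" by simp
    have "ln c - D - D * r0\<^sup>2 = ln c + (- D - D * r0\<^sup>2)" by simp
    then have "exp (ln c - D - D * r0\<^sup>2) = c * exp (- D - D * r0\<^sup>2)"
      using c by (simp only: exp_add exp_ln)
    also have "\<dots> \<le> c * ((4 * r0) powr \<gamma> * exp (- 18 * r0\<^sup>2))"
    proof (rule mult_left_mono)
      have "ln (4 * r0) \<le> 4 * r0 - 1" using r0 by (intro ln_le_minus_one) auto
      then have "ln (4 * r0) \<le> 4 * r0" by simp
      then have ln: "\<gamma> * (4 * r0) \<le> \<gamma> * ln (4 * r0)" using \<gamma>_neg by (intro mult_left_mono_neg) auto
      have "0 \<le> (r0 - 1/2) * (r0 - 1/2)" by (rule zero_le_square)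
      also have "\<dots> = r0\<^sup>2 - r0 + 1/4" by (simp add: power2_eq_square algebra_simps)
      finally have "r0 \<le> 1 + r0\<^sup>2" by linarith
      then have "4 * \<gamma> * (1 + r0\<^sup>2) \<le> 4 * \<gamma> * r0" using \<gamma>_neg by (intro mult_left_mono_neg) auto
      moreover have "- D - D * r0\<^sup>2 = 4 * \<gamma> * (1 + r0\<^sup>2) - 18 - 18 * r0\<^sup>2"
        using \<gamma>_neg by (simp add: D_def algebra_simps)
      ultimately have "- D - D * r0\<^sup>2 \<le> \<gamma> * ln (4 * r0) + (- 18 * r0\<^sup>2)" using ln by linarith
      then show "exp (- D - D * r0\<^sup>2) \<le> (4 * r0) powr \<gamma> * exp (- 18 * r0\<^sup>2)"
        using r0 by (simp add: powr_def exp_add[symmetric])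
    qed (use c in simp)
    finally show ?thesis using le unfolding r0_def by simp
  qed
  have D: "0 \<le> D" by (simp add: D_def)
  show ?thesis
  proof (intro exI conjI)
    show "0 \<le> 2 * D" using D by simp
    show "AE x in lborel. exp (- (D - ln c + 2 * D * \<rho>\<^sup>2) - 2 * D * (norm x)\<^sup>2) \<le> gain_op f x"
      using op_decomp[OF fi]
    proof eventually_elim
      case (elim x)
      have "(norm x + \<rho>)\<^sup>2 \<le> 2 * ((norm x)\<^sup>2 + \<rho>\<^sup>2)"
        using sum_squares_bound[of "norm x" \<rho>] by (simp add: power2_sum)
      then have "D * (norm x + \<rho>)\<^sup>2 \<le> D * (2 * ((norm x)\<^sup>2 + \<rho>\<^sup>2))" using D by (rule mult_left_mono)
      then have "exp (- (D - ln c + 2 * D * \<rho>\<^sup>2) - 2 * D * (norm x)\<^sup>2) \<le> exp (ln c - D - D * (norm x + \<rho>)\<^sup>2)"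
        by (simp add: algebra_simps)
      also have "\<dots> \<le> gain_op f x" using low elim by blast
      finally show ?case .
    qed
  qed
qed

end

subsection \<open>Explicit Euler iterates\<close>

text \<open>Solutions are nonnegative only almost everywhere; the maximum makes the density relative
  to the Maxwellian nonnegative at every point.\<close>

definition dens :: "('a::euclidean_space \<Rightarrow> real) \<Rightarrow> 'a \<Rightarrow> real" where
  "dens f v = max 0 (f v) / maxwellian v"

definition Ent :: "('a::euclidean_space \<Rightarrow> real) \<Rightarrow> ennreal" where
  "Ent f = (\<integral>\<^sup>+v. ennreal (ent (dens f v)) \<partial>maxwell_measure)"

definition Hq :: "real \<Rightarrow> ('a::euclidean_space \<Rightarrow> real) \<Rightarrow> ennreal" where
  "Hq p f = (\<integral>\<^sup>+v. ennreal (dens f v powr p) \<partial>maxwell_measure)"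

definition prob_density :: "('a::euclidean_space \<Rightarrow> real) \<Rightarrow> bool" where
  "prob_density f \<longleftrightarrow> integrable lborel f \<and> (AE v in lborel. 0 \<le> f v) \<and> (\<integral>v. f v \<partial>lborel) = 1"

lemma dens_nonneg [simp]: "0 \<le> dens f v"
  by (simp add: dens_def)

lemma measurable_dens [measurable]:
  assumes [measurable]: "f \<in> borel_measurable borel"
  shows "dens f \<in> borel_measurable borel"
  unfolding dens_def[abs_def] by measurable

lemma prob_density_mass:
  fixes f :: "'a::euclidean_space \<Rightarrow> real"
  assumes "prob_density f"
  shows "(\<integral>\<^sup>+v. ennreal (dens f v) \<partial>maxwell_measure) = 1"
proof -
  have f: "integrable lborel f" "AE v in lborel. 0 \<le> f v" "(\<integral>v. f v \<partial>lborel) = 1"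
    using assms by (auto simp: prob_density_def)
  have [measurable]: "f \<in> borel_measurable borel" using f by auto
  have "(\<integral>\<^sup>+v. ennreal (dens f v) \<partial>maxwell_measure) = (\<integral>\<^sup>+v. ennreal (max 0 (f v)) \<partial>lborel)"
    unfolding dens_def by (rule nn_integral_maxwell_div) simp_all
  also have "\<dots> = (\<integral>\<^sup>+v. ennreal (f v) \<partial>lborel)"
    by (rule nn_integral_cong_AE, use f(2) in eventually_elim) simp
  also have "\<dots> = 1" using nn_integral_eq_integral[OF f(1,2)] f(3) by simp
  finally show ?thesis .
qed

lemma one_minus_ge_exp:
  fixes x :: real
  assumes "0 \<le> x" "x \<le> 1/2"
  shows "exp (- 2 * x) \<le> 1 - x"
proof -
  have "1 + x * (1 - 2 * x) = (1 - x) * (1 + 2 * x)" by (simp add: algebra_simps)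
  moreover have "0 \<le> x * (1 - 2 * x)" using assms by (intro mult_nonneg_nonneg) auto
  ultimately have "1 \<le> (1 - x) * (1 + 2 * x)" by linarith
  also have "\<dots> \<le> (1 - x) * exp (2 * x)" using assms exp_ge_add_one_self[of "2 * x"] by (intro mult_left_mono) auto
  finally have "exp (- 2 * x) * 1 \<le> exp (- 2 * x) * ((1 - x) * exp (2 * x))" by (intro mult_left_mono) auto
  also have "\<dots> = 1 - x" by (simp add: exp_minus)
  finally show ?thesis by simp
qed

context soft_collisions
begin

lemma euler_dens:
  assumes f: "prob_density f" and \<tau>: "0 \<le> \<tau>" "\<tau> * a \<le> 1"
  shows "AE v in maxwell_measure. step (\<lambda>r. \<tau> * r powr \<gamma>) (\<lambda>v. ennreal (dens f v)) v = ennreal (dens (euler \<tau> f) v)"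
    and prob_density_euler: "prob_density (euler \<tau> f)"
proof -
  define g where "g v = max 0 (f v)" for v
  have fi: "integrable lborel f" "AE v in lborel. 0 \<le> f v" "(\<integral>v. f v \<partial>lborel) = 1"
    using f by (auto simp: prob_density_def)
  have gi: "integrable lborel g" unfolding g_def[abs_def] using fi by simp
  have gf: "AE v in lborel. f v = g v" using fi(2) by eventually_elim (simp add: g_def)
  have eg: "AE v in lborel. euler \<tau> f v = euler \<tau> g v" by (rule euler_cong[OF fi(1) gi gf])
  have g0: "0 \<le> g v" for v by (simp add: g_def)
  note st = euler_step_nonneg[OF gi g0 \<tau>]
  have dg: "dens f = (\<lambda>v. g v / maxwellian v)" by (auto simp: dens_def g_def)
  show "AE v in maxwell_measure. step (\<lambda>r. \<tau> * r powr \<gamma>) (\<lambda>v. ennreal (dens f v)) v = ennreal (dens (euler \<tau> f) v)"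
    unfolding AE_maxwell_iff using st eg
  proof eventually_elim
    case (elim v)
    then have "dens (euler \<tau> f) v = euler \<tau> g v / maxwellian v" by (simp add: dens_def)
    then show ?case unfolding dg using elim by simp
  qed
  have "(\<integral>v. euler \<tau> f v \<partial>lborel) = (\<integral>v. euler \<tau> g v \<partial>lborel)"
    using integrable_euler[OF fi(1)] integrable_euler[OF gi] eg by (intro integral_cong_AE) auto
  also have "\<dots> = (\<integral>v. f v \<partial>lborel)"
    unfolding euler_mass_nonneg[OF gi g0 \<tau>] using fi gi gf by (intro integral_cong_AE) auto
  moreover have "AE v in lborel. 0 \<le> euler \<tau> f v" using st eg by eventually_elim simp
  ultimately show "prob_density (euler \<tau> f)"
    unfolding prob_density_def using integrable_euler[OF fi(1)] fi(3) by simp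
qed

lemma Hq_euler_le:
  assumes f: "prob_density f" and \<tau>: "0 \<le> \<tau>" "\<tau> * a \<le> 1" and p: "1 < p"
  shows "Hq p (euler \<tau> f) \<le> Hq p f"
proof -
  have fi: "integrable lborel f" using f by (simp add: prob_density_def)
  have [measurable]: "f \<in> borel_measurable borel" "euler \<tau> f \<in> borel_measurable borel"
    using fi integrable_euler[OF fi] by auto
  show ?thesis unfolding Hq_def
    by (rule powr_step_le[OF _ _ _ _ freq_euler_le[OF \<tau>] _ _ p euler_dens(1)[OF f \<tau>]]) (use \<tau> in simp_all)
qed

lemma Ent_euler_le:
  assumes f: "prob_density f" and \<tau>: "0 < \<tau>" "\<tau> * (2 * a) \<le> 1" and p: "1 < p" and R: "1 \<le> R"
    and K: "Hq p f \<le> ennreal K" "0 \<le> K"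
  shows "Ent (euler \<tau> f) \<le> ennreal (1 - \<tau> * R powr \<gamma> / 2) * Ent f +
    ennreal (\<tau> * R powr \<gamma> / 2 * (tail_const TYPE('a) p K * exp (- tail_rate p * R\<^sup>2)))"
proof -
  have fi: "integrable lborel f" using f by (simp add: prob_density_def)
  have [measurable]: "f \<in> borel_measurable borel" "euler \<tau> f \<in> borel_measurable borel"
    using fi integrable_euler[OF fi] by auto
  have "0 \<le> \<tau> * a" using \<tau> a_ge by simp
  then have \<tau>': "0 \<le> \<tau>" "\<tau> * a \<le> 1" using \<tau> by (simp_all add: mult.left_commute)
  show ?thesis unfolding Ent_def
    by (rule ent_soft_step[OF \<gamma>_neg a_ge freq_le \<tau> R _ _ _ _ prob_density_mass[OF f] euler_dens(1)[OF f \<tau>'] p])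
       (use K in \<open>simp_all add: Hq_def\<close>)
qed

text \<open>Step sizes may vary along the way, as the continuity argument for the flow requires; the
  bound on them is the one needed for the entropy drop.\<close>

inductive reach :: "('a \<Rightarrow> real) \<Rightarrow> real \<Rightarrow> ('a \<Rightarrow> real) \<Rightarrow> bool" for f0 where
  reach_0: "reach f0 0 f0"
| reach_euler: "reach f0 t g \<Longrightarrow> 0 < \<tau> \<Longrightarrow> \<tau> * (2 * a) \<le> 1 \<Longrightarrow> reach f0 (t + \<tau>) (euler \<tau> g)"

lemma small_step: "0 < \<tau> \<Longrightarrow> \<tau> * (2 * a) \<le> 1 \<Longrightarrow> 0 \<le> \<tau> \<and> \<tau> * a \<le> 1 \<and> \<tau> * a \<le> 1 / 2"
proof -
  assume "0 < \<tau>" "\<tau> * (2 * a) \<le> 1"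
  moreover have "0 \<le> \<tau> * a" using \<open>0 < \<tau>\<close> a_ge by simp
  moreover have "\<tau> * (2 * a) = 2 * (\<tau> * a)" by simp
  ultimately show ?thesis by linarith
qed

lemma reach_time: "reach f0 t g \<Longrightarrow> 0 \<le> t"
  by (induction rule: reach.induct) auto

lemma reach_prob_density: "reach f0 t g \<Longrightarrow> prob_density f0 \<Longrightarrow> prob_density g"
  by (induction rule: reach.induct) (use small_step prob_density_euler in auto)

lemma reach_Hq: "reach f0 t g \<Longrightarrow> prob_density f0 \<Longrightarrow> 1 < p \<Longrightarrow> Hq p g \<le> Hq p f0"
proof (induction rule: reach.induct)
  case (reach_euler t g \<tau>)
  have "Hq p (euler \<tau> g) \<le> Hq p g"
    using small_step[OF reach_euler.hyps(2,3)] reach_prob_density[OF reach_euler.hyps(1) reach_euler.prems(1)] reach_euler.prems(2)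
    by (intro Hq_euler_le) auto
  with reach_euler show ?case by simp
qed simp

text \<open>The tail error does not accumulate: each step takes a convex combination of the current
  bound and the same \<open>e\<close>, so \<open>e\<close> is a fixed point, while the factors
  \<open>1 - s\<close> multiply to at most an exponential in the elapsed time.\<close>

lemma reach_Ent:
  assumes "reach f0 t g" "prob_density f0" and p: "1 < p" and R: "1 \<le> R"
    and K: "Hq p f0 \<le> ennreal K" "0 \<le> K"
  shows "Ent g \<le> ennreal (exp (- t * R powr \<gamma> / 2)) * Ent f0 + ennreal (tail_const TYPE('a) p K * exp (- tail_rate p * R\<^sup>2))"
  using assms(1,2)
proof (induction rule: reach.induct)
  case (reach_euler t g \<tau>)
  define e where "e = tail_const TYPE('a) p K * exp (- tail_rate p * R\<^sup>2)"
  have e: "0 \<le> e" using tail_const_pos[OF p K(2), where 'a='a] by (simp add: e_def)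
  define s where "s = \<tau> * R powr \<gamma> / 2"
  have Rg: "R powr \<gamma> \<le> 1" using R \<gamma>_neg powr_mono2'[of \<gamma> 1 R] by simp
  have "1 \<le> 2 * a" using a_ge by simp
  then have "\<tau> * 1 \<le> \<tau> * (2 * a)" using reach_euler.hyps(2) by (intro mult_left_mono) auto
  then have "\<tau> \<le> 1" using reach_euler.hyps(3) by linarith
  then have "\<tau> * R powr \<gamma> \<le> 1 * 1" using Rg reach_euler.hyps(2) by (intro mult_mono) auto
  then have s: "0 \<le> s" "s \<le> 1" using reach_euler.hyps(2) by (auto simp: s_def)
  have K': "Hq p g \<le> ennreal K" using reach_Hq[OF reach_euler.hyps(1) reach_euler.prems p] K(1) by (rule order_trans)
  have "Ent (euler \<tau> g) \<le> ennreal (1 - s) * Ent g + ennreal (s * e)"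
    unfolding s_def e_def
    by (rule Ent_euler_le[OF reach_prob_density[OF reach_euler.hyps(1) reach_euler.prems] reach_euler.hyps(2,3) p R K' K(2)])
  also have "\<dots> \<le> ennreal (1 - s) * (ennreal (exp (- t * R powr \<gamma> / 2)) * Ent f0 + ennreal e) + ennreal (s * e)"
    using reach_euler.IH[OF reach_euler.prems] unfolding e_def[symmetric] by (intro add_right_mono mult_left_mono) auto
  also have "\<dots> = ennreal ((1 - s) * exp (- t * R powr \<gamma> / 2)) * Ent f0 + ennreal e"
  proof -
    have "ennreal (1 - s) * ennreal e + ennreal (s * e) = ennreal ((1 - s) * e + s * e)"
      using s e by (simp add: ennreal_mult[symmetric] ennreal_plus[symmetric] del: ennreal_plus)
    also have "(1 - s) * e + s * e = e" by (simp add: algebra_simps)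
    finally show ?thesis using s by (simp add: distrib_left ennreal_mult mult.assoc add.assoc)
  qed
  also have "\<dots> \<le> ennreal (exp (- (t + \<tau>) * R powr \<gamma> / 2)) * Ent f0 + ennreal e"
  proof (intro add_right_mono mult_right_mono ennreal_leI)
    have "(1 - s) * exp (- t * R powr \<gamma> / 2) \<le> exp (- s) * exp (- t * R powr \<gamma> / 2)"
      using exp_ge_add_one_self[of "- s"] by (intro mult_right_mono) auto
    also have "\<dots> = exp (- (t + \<tau>) * R powr \<gamma> / 2)"
      unfolding exp_add[symmetric] s_def by (simp add: field_simps)
    finally show "(1 - s) * exp (- t * R powr \<gamma> / 2) \<le> exp (- (t + \<tau>) * R powr \<gamma> / 2)" .
  qed simp
  finally show ?case unfolding e_def .
qed simp

text \<open>A discrete Duhamel expansion stopped after one collision. Writing the step as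
  \<open>(1 - \<tau> * a) * g + \<tau> * (L g + a * g)\<close> with \<open>L + a\<close> positive,
  the first part carries the old lower bound and the second adds a fresh term. The exponent
  \<open>2 * a\<close> comes from
  \<open>exp (- 2 * (\<tau> * a)) \<le> 1 - \<tau> * a\<close>.\<close>

lemma reach_lower_bound:
  assumes "reach f0 t g" "prob_density f0"
  shows "AE v in lborel. exp (- 2 * a * t) * (f0 v + t * (L f0 v + a * f0 v)) \<le> g v"
  using assms
proof (induction rule: reach.induct)
  case (reach_euler t g \<tau>)
  define G where "G v = L f0 v + a * f0 v" for v
  define e where "e = exp (- 2 * a * t)"
  have f0: "integrable lborel f0" "AE v in lborel. 0 \<le> f0 v"
    using reach_euler.prems by (auto simp: prob_density_def)
  have Gi: "integrable lborel G" unfolding G_def[abs_def] using f0 op_integrable by simp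
  have gi: "integrable lborel g"
    using reach_prob_density[OF reach_euler.hyps(1) reach_euler.prems] by (simp add: prob_density_def)
  have t: "0 \<le> t" by (rule reach_time[OF reach_euler.hyps(1)])
  have G0: "AE v in lborel. 0 \<le> G v" unfolding G_def by (rule op_lower[OF f0])
  have i: "integrable lborel (\<lambda>v. e * f0 v + (e * t) * G v)" using f0 Gi by simp
  have le: "AE v in lborel. e * f0 v + (e * t) * G v \<le> g v"
    using reach_euler.IH[OF reach_euler.prems] by eventually_elim (simp add: e_def G_def algebra_simps)
  from op_lower_mono[OF i gi le] op_linear[OF f0(1) Gi, of e "e * t"] op_lower[OF Gi G0] le G0 f0(2) show ?case
  proof eventually_elim
    case (elim v)
    have ta: "\<tau> * a \<le> 1 / 2" "0 \<le> \<tau> * a" using small_step[OF reach_euler.hyps(2,3)] a_ge by auto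
    have e0: "0 < e" by (simp add: e_def)
    have x: "exp (- 2 * (\<tau> * a)) \<le> 1 - \<tau> * a" by (rule one_minus_ge_exp) (use ta in auto)
    have x1: "exp (- 2 * (\<tau> * a)) \<le> 1" using ta by simp
    have ee: "exp (- 2 * a * (t + \<tau>)) = e * exp (- 2 * (\<tau> * a))"
      unfolding e_def exp_add[symmetric] by (simp add: algebra_simps)
    have fg: "0 \<le> f0 v + t * G v" using elim t by simp
    have "e * G v \<le> L g v + a * g v"
    proof -
      have "0 \<le> (e * t) * (L G v + a * G v)" using elim e0 t by simp
      moreover have "L (\<lambda>v. e * f0 v + e * t * G v) v + a * (e * f0 v + e * t * G v) = e * G v + (e * t) * (L G v + a * G v)"
        using elim(2) by (simp add: G_def algebra_simps)
      ultimately show ?thesis using elim(1) by linarith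
    qed
    then have A: "\<tau> * (e * G v) \<le> \<tau> * (L g v + a * g v)" using reach_euler.hyps(2) by (intro mult_left_mono) auto
    have B: "(1 - \<tau> * a) * (e * (f0 v + t * G v)) \<le> (1 - \<tau> * a) * g v"
      using ta elim(4) by (intro mult_left_mono) (auto simp: algebra_simps)
    have C: "exp (- 2 * (\<tau> * a)) * (e * (f0 v + t * G v)) \<le> (1 - \<tau> * a) * (e * (f0 v + t * G v))"
      using e0 fg by (intro mult_right_mono x) auto
    have D: "exp (- 2 * (\<tau> * a)) * (\<tau> * (e * G v)) \<le> 1 * (\<tau> * (e * G v))"
      using e0 elim reach_euler.hyps(2) by (intro mult_right_mono x1) auto
    have "exp (- 2 * a * (t + \<tau>)) * (f0 v + (t + \<tau>) * G v) = exp (- 2 * (\<tau> * a)) * (e * (f0 v + t * G v)) + exp (- 2 * (\<tau> * a)) * (\<tau> * (e * G v))"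
      unfolding ee by (simp add: algebra_simps)
    also have "\<dots> \<le> (1 - \<tau> * a) * g v + \<tau> * (L g v + a * g v)" using A B C D by linarith
    also have "\<dots> = euler \<tau> g v" by (simp add: euler_def algebra_simps)
    finally show ?case unfolding G_def .
  qed
qed simp

end

subsection \<open>Semigroups on L1\<close>

lemma L1_norm_nonneg [simp]: "0 \<le> L1_norm f"
  by (simp add: L1_norm_def)

lemma L1_norm_cong_AE:
  fixes f g :: "'a::euclidean_space \<Rightarrow> real"
  assumes "integrable lborel f" "integrable lborel g" "AE v in lborel. f v = g v"
  shows "L1_norm f = L1_norm g"
  unfolding L1_norm_def using assms
  by (intro integral_cong_AE) (auto elim!: eventually_mono)

lemma L1_norm_add_le:
  assumes "integrable lborel f" "integrable lborel g"
  shows "L1_norm (\<lambda>v. f v + g v) \<le> L1_norm f + L1_norm g"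
proof -
  have "L1_norm (\<lambda>v. f v + g v) \<le> (\<integral>v. \<bar>f v\<bar> + \<bar>g v\<bar> \<partial>lborel)"
    unfolding L1_norm_def using assms by (intro integral_mono) auto
  then show ?thesis using assms by (simp add: L1_norm_def)
qed

lemma L1_norm_cmult: "L1_norm (\<lambda>v. c * f v) = \<bar>c\<bar> * L1_norm f"
  by (simp add: L1_norm_def abs_mult)

lemma L1_norm_minus_commute: "L1_norm (\<lambda>v. f v - g v) = L1_norm (\<lambda>v. g v - f v)"
  by (simp add: L1_norm_def abs_minus_commute)

lemma L1_norm_triangle:
  assumes "integrable lborel f" "integrable lborel g" "integrable lborel h"
  shows "L1_norm (\<lambda>v. f v - h v) \<le> L1_norm (\<lambda>v. f v - g v) + L1_norm (\<lambda>v. g v - h v)"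
  using L1_norm_add_le[of "\<lambda>v. f v - g v" "\<lambda>v. g v - h v"] assms by simp

lemma L1_norm_zero_AE:
  assumes "integrable lborel f" "AE v in lborel. f v = 0"
  shows "L1_norm f = 0"
  using L1_norm_cong_AE[OF assms(1) _ assms(2)] by (simp add: L1_norm_def)

section \<open>Uniform boundedness and continuity of the semigroup\<close>

text \<open>Completeness in the quantitative form needed below: the increments after index
  \<open>n\<close> sum to at most half of \<open>(1/3) ^ n\<close>.\<close>

lemma L1_fast_cauchy_limit:
  fixes x :: "nat \<Rightarrow> 'a::euclidean_space \<Rightarrow> real"
  assumes x: "\<And>n. integrable lborel (x n)" and d: "\<And>n. L1_norm (\<lambda>v. x (Suc n) v - x n v) \<le> (1/3) ^ Suc n"
  shows "\<exists>y. integrable lborel y \<and> (\<forall>n. L1_norm (\<lambda>v. y v - x n v) \<le> (1/3) ^ n / 2)"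
proof -
  define u where "u n v = x (Suc n) v - x n v" for n v
  have ui: "integrable lborel (u n)" for n unfolding u_def[abs_def] using x by simp
  have un: "(\<integral>v. norm (u n v) \<partial>lborel) \<le> (1/3) ^ Suc n" for n using d[of n] by (simp add: L1_norm_def u_def)
  have geo: "summable (\<lambda>n. (1/3 :: real) ^ Suc n)" by (subst summable_Suc_iff) (rule summable_geometric, simp)
  have su: "summable (\<lambda>n. \<integral>v. norm (u n v) \<partial>lborel)"
    by (rule summable_comparison_test'[OF geo, of 0]) (use un in auto)
  have ae: "AE v in lborel. summable (\<lambda>n. norm (u n v))"
  proof -
    have "(\<integral>\<^sup>+v. (\<Sum>n. ennreal (norm (u n v))) \<partial>lborel) = (\<Sum>n. \<integral>\<^sup>+v. ennreal (norm (u n v)) \<partial>lborel)"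
      by (rule nn_integral_suminf) (use ui in simp)
    also have "\<dots> = (\<Sum>n. ennreal (\<integral>v. norm (u n v) \<partial>lborel))"
      by (intro suminf_cong nn_integral_eq_integral integrable_norm ui) simp
    also have "\<dots> = ennreal (\<Sum>n. \<integral>v. norm (u n v) \<partial>lborel)" by (rule suminf_ennreal2[OF _ su]) simp
    finally have "(\<integral>\<^sup>+v. (\<Sum>n. ennreal (norm (u n v))) \<partial>lborel) \<noteq> \<infinity>" by simp
    then have "AE v in lborel. (\<Sum>n. ennreal (norm (u n v))) \<noteq> \<infinity>"
      by (intro nn_integral_PInf_AE borel_measurable_suminf) (use ui in auto)
    then show ?thesis by eventually_elim (rule summable_suminf_not_top, auto)
  qed
  define y where "y v = x 0 v + (\<Sum>n. u n v)" for v
  have yi: "integrable lborel y"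
    unfolding y_def[abs_def] by (intro Bochner_Integration.integrable_add x integrable_suminf ui ae su)
  have "L1_norm (\<lambda>v. y v - x n v) \<le> (1/3) ^ n / 2" for n
  proof -
    have si: "summable (\<lambda>k. \<integral>v. norm (u (k + n) v) \<partial>lborel)" using su by (subst summable_iff_shift)
    have ai: "AE v in lborel. summable (\<lambda>k. norm (u (k + n) v))"
      using ae by eventually_elim (subst summable_iff_shift)
    have ni: "integrable lborel (\<lambda>v. \<Sum>k. norm (u (k + n) v))"
      by (rule integrable_suminf) (use ui ai si in simp_all)
    have "L1_norm (\<lambda>v. y v - x n v) \<le> (\<integral>v. (\<Sum>k. norm (u (k + n) v)) \<partial>lborel)"
      unfolding L1_norm_def
    proof (rule integral_mono_AE)
      show "AE v in lborel. \<bar>y v - x n v\<bar> \<le> (\<Sum>k. norm (u (k + n) v))"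
        using ae ai
      proof eventually_elim
        case (elim v)
        have "summable (\<lambda>k. u k v)" using elim(1) by (rule summable_norm_cancel)
        from suminf_split_initial_segment[OF this, of n]
        have "(\<Sum>k. u k v) = (\<Sum>k. u (k + n) v) + (\<Sum>k<n. u k v)" .
        moreover have "(\<Sum>k<n. u k v) = x n v - x 0 v"
          unfolding u_def by (rule sum_lessThan_telescope)
        ultimately have "y v - x n v = (\<Sum>k. u (k + n) v)" by (simp add: y_def)
        then show ?case using summable_norm[OF elim(2)] by simp
      qed
    qed (use yi x ni in simp_all)
    also have "\<dots> = (\<Sum>k. \<integral>v. norm (u (k + n) v) \<partial>lborel)"
      by (rule integral_suminf) (use ui ai si in simp_all)
    also have "\<dots> \<le> (\<Sum>k. (1/3) ^ Suc n * (1/3 :: real) ^ k)"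
    proof (rule suminf_le[OF _ si])
      show "(\<integral>v. norm (u (k + n) v) \<partial>lborel) \<le> (1/3) ^ Suc n * (1/3) ^ k" for k
        using un[of "k + n"] by (simp add: power_add mult_ac)
      show "summable (\<lambda>k. (1/3) ^ Suc n * (1/3 :: real) ^ k)" by (intro summable_mult summable_geometric) simp
    qed
    also have "\<dots> = (1/3) ^ Suc n * (1 / (1 - 1/3))"
      by (subst suminf_mult) (simp_all add: suminf_geometric)
    also have "\<dots> = (1/3) ^ n / 2" by simp
    finally show ?thesis .
  qed
  with yi show ?thesis by blast
qed

locale L1_semigroup =
  fixes U :: "real \<Rightarrow> ('a::euclidean_space \<Rightarrow> real) \<Rightarrow> 'a \<Rightarrow> real"
  assumes C0: "C0_semigroup_L1 U"
begin

lemma U_integrable: "0 \<le> t \<Longrightarrow> integrable lborel f \<Longrightarrow> integrable lborel (U t f)"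
  by (rule C0[unfolded C0_semigroup_L1_def, THEN conjunct1, rule_format])

lemma U_linear: "0 \<le> t \<Longrightarrow> integrable lborel f \<Longrightarrow> integrable lborel g \<Longrightarrow>
    AE v in lborel. U t (\<lambda>x. \<alpha> * f x + \<beta> * g x) v = \<alpha> * U t f v + \<beta> * U t g v"
  by (rule C0[unfolded C0_semigroup_L1_def, THEN conjunct2, THEN conjunct1, rule_format])

lemma U_bounded: "0 \<le> t \<Longrightarrow> \<exists>B. \<forall>f. integrable lborel f \<longrightarrow> L1_norm (U t f) \<le> B * L1_norm f"
  by (rule C0[unfolded C0_semigroup_L1_def, THEN conjunct2, THEN conjunct2, THEN conjunct1, rule_format])

lemma U_0: "integrable lborel f \<Longrightarrow> AE v in lborel. U 0 f v = f v"
  by (rule C0[unfolded C0_semigroup_L1_def, THEN conjunct2, THEN conjunct2, THEN conjunct2, THEN conjunct1, rule_format])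

lemma U_add: "0 \<le> s \<Longrightarrow> 0 \<le> t \<Longrightarrow> integrable lborel f \<Longrightarrow> AE v in lborel. U (s + t) f v = U s (U t f) v"
  by (rule C0[unfolded C0_semigroup_L1_def, THEN conjunct2, THEN conjunct2, THEN conjunct2, THEN conjunct2, THEN conjunct1, rule_format])

lemma U_tendsto: "integrable lborel f \<Longrightarrow> ((\<lambda>t. L1_norm (\<lambda>v. U t f v - f v)) \<longlongrightarrow> 0) (at_right 0)"
  by (rule C0[unfolded C0_semigroup_L1_def, THEN conjunct2, THEN conjunct2, THEN conjunct2, THEN conjunct2, THEN conjunct2, rule_format])

lemma U_continuous_0:
  assumes f: "integrable lborel f" and e: "0 < e"
  shows "\<exists>d>0. \<forall>t. 0 \<le> t \<and> t < d \<longrightarrow> L1_norm (\<lambda>v. U t f v - f v) < e"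
proof -
  have "eventually (\<lambda>t. L1_norm (\<lambda>v. U t f v - f v) < e) (at_right 0)"
    using U_tendsto[OF f] e by (rule order_tendstoD)
  then obtain d where d: "0 < d" "\<And>t. 0 < t \<Longrightarrow> t < d \<Longrightarrow> L1_norm (\<lambda>v. U t f v - f v) < e"
    unfolding eventually_at_right_field by auto
  have "L1_norm (\<lambda>v. U 0 f v - f v) = 0"
    using U_0[OF f] U_integrable[OF order_refl f] f by (intro L1_norm_zero_AE) (auto elim!: eventually_mono)
  then have "L1_norm (\<lambda>v. U t f v - f v) < e" if "0 \<le> t" "t < d" for t
    using d(2)[of t] that e by (cases "t = 0") auto
  then show ?thesis using d(1) by blast
qed

lemma L1_norm_U_add:
  assumes t: "0 \<le> t" and f: "integrable lborel f" and g: "integrable lborel g"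
  shows "L1_norm (U t (\<lambda>v. f v + g v)) \<le> L1_norm (U t f) + L1_norm (U t g)"
proof -
  have "L1_norm (U t (\<lambda>v. f v + g v)) = L1_norm (\<lambda>v. U t f v + U t g v)"
    using U_linear[OF t f g, of 1 1] U_integrable[OF t] f g by (intro L1_norm_cong_AE) auto
  also have "\<dots> \<le> L1_norm (U t f) + L1_norm (U t g)"
    by (intro L1_norm_add_le U_integrable t f g)
  finally show ?thesis .
qed

lemma L1_norm_U_cmult:
  assumes t: "0 \<le> t" and f: "integrable lborel f"
  shows "L1_norm (U t (\<lambda>v. c * f v)) = \<bar>c\<bar> * L1_norm (U t f)"
proof -
  have "L1_norm (U t (\<lambda>v. c * f v)) = L1_norm (\<lambda>v. c * U t f v)"
    using U_linear[OF t f f, of c 0] U_integrable[OF t] f by (intro L1_norm_cong_AE) auto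
  then show ?thesis by (simp add: L1_norm_cmult)
qed

lemma L1_norm_U_diff:
  assumes t: "0 \<le> t" and f: "integrable lborel f" and g: "integrable lborel g"
  shows "L1_norm (\<lambda>v. U t f v - U t g v) = L1_norm (U t (\<lambda>v. f v - g v))"
proof (rule L1_norm_cong_AE)
  have "AE v in lborel. U t (\<lambda>v. f v - g v) v = U t f v - U t g v"
    using U_linear[OF t f g, of 1 "-1"] by simp
  then show "AE v in lborel. U t f v - U t g v = U t (\<lambda>v. f v - g v) v"
    by eventually_elim simp
qed (intro Bochner_Integration.integrable_diff U_integrable t f g)+

text \<open>Here \<open>N\<close> is the operator norm, as the infimum of all admissible bounds. Two
  thirds of it is no admissible bound, which yields a vector that nearly attains the norm and can be
  rescaled to norm \<open>r\<close>.\<close>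

lemma U_almost_norm:
  assumes t: "0 \<le> t" and big: "\<not> (\<forall>f. integrable lborel f \<longrightarrow> L1_norm (U t f) \<le> C * L1_norm f)" and C: "0 < C" and r: "0 < r"
  shows "\<exists>N z. C \<le> N \<and> (\<forall>f. integrable lborel f \<longrightarrow> L1_norm (U t f) \<le> N * L1_norm f) \<and>
     integrable lborel z \<and> L1_norm z = r \<and> 2 / 3 * N * r \<le> L1_norm (U t z)"
proof -
  define S where "S = {B. \<forall>f. integrable lborel f \<longrightarrow> L1_norm (U t f) \<le> B * L1_norm f}"
  have S_ge: "C \<le> B" if "B \<in> S" for B
  proof (rule ccontr)
    assume "\<not> C \<le> B"
    then have BC: "B \<le> C" by simp
    have "L1_norm (U t f) \<le> C * L1_norm f" if f: "integrable lborel f" for f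
    proof -
      have "L1_norm (U t f) \<le> B * L1_norm f" using \<open>B \<in> S\<close> f by (simp add: S_def)
      also have "\<dots> \<le> C * L1_norm f" using BC by (rule mult_right_mono) simp
      finally show ?thesis .
    qed
    with big show False by blast
  qed
  have ne: "S \<noteq> {}" using U_bounded[OF t] by (auto simp: S_def)
  have bdd: "bdd_below S" using S_ge by (intro bdd_belowI[of _ C]) auto
  define N where "N = Inf S"
  have NC: "C \<le> N" unfolding N_def using ne S_ge by (rule cInf_greatest)
  have NS: "L1_norm (U t f) \<le> N * L1_norm f" if f: "integrable lborel f" for f
  proof (cases "L1_norm f = 0")
    case True
    obtain B where "B \<in> S" using ne by blast
    then have "L1_norm (U t f) \<le> B * L1_norm f" using f by (simp add: S_def)
    then show ?thesis using True by simp
  next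
    case False
    then have p: "0 < L1_norm f" using L1_norm_nonneg[of f] by linarith
    have "L1_norm (U t f) / L1_norm f \<le> N"
      unfolding N_def using ne
    proof (rule cInf_greatest)
      fix B assume "B \<in> S"
      then have "L1_norm (U t f) \<le> B * L1_norm f" using f by (simp add: S_def)
      then show "L1_norm (U t f) / L1_norm f \<le> B" using p by (simp add: divide_le_eq)
    qed
    then show ?thesis using p by (simp add: field_simps)
  qed
  have "2 / 3 * N < N" using NC C by simp
  moreover have "N \<le> B" if "B \<in> S" for B unfolding N_def using that bdd by (rule cInf_lower)
  ultimately have "2 / 3 * N \<notin> S" by force
  then obtain f where f: "integrable lborel f" "2 / 3 * N * L1_norm f < L1_norm (U t f)"
    unfolding S_def by (auto simp: not_le)
  have p: "0 < L1_norm f"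
  proof (rule ccontr)
    assume "\<not> 0 < L1_norm f"
    then have "L1_norm f = 0" using L1_norm_nonneg[of f] by linarith
    then show False using NS[OF f(1)] f(2) by simp
  qed
  define z where "z v = (r / L1_norm f) * f v" for v
  have "L1_norm (U t z) = \<bar>r / L1_norm f\<bar> * L1_norm (U t f)"
    unfolding z_def[abs_def] by (rule L1_norm_U_cmult[OF t f(1)])
  moreover have "\<bar>r / L1_norm f\<bar> = r / L1_norm f" using p r by simp
  moreover have "r / L1_norm f * (2 / 3 * N * L1_norm f) = 2 / 3 * N * r" using p by simp
  moreover have "r / L1_norm f * (2 / 3 * N * L1_norm f) \<le> r / L1_norm f * L1_norm (U t f)"
    using f(2) p r by (intro mult_left_mono) auto
  ultimately have "2 / 3 * N * r \<le> L1_norm (U t z)" by linarith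
  moreover have "L1_norm z = r" unfolding z_def[abs_def] L1_norm_cmult using p r by simp
  moreover have "integrable lborel z" unfolding z_def[abs_def] using f by simp
  ultimately show ?thesis using NC NS by blast
qed

end

context L1_semigroup
begin

text \<open>Sokal's elementary proof of the uniform boundedness principle.\<close>

lemma U_locally_bounded:
  "\<exists>d>0. \<exists>M. \<forall>t f. 0 \<le> t \<and> t \<le> d \<and> integrable lborel f \<longrightarrow> L1_norm (U t f) \<le> M * L1_norm f"
proof (rule ccontr)
  assume contra: "\<not> ?thesis"
  \<comment> \<open>The times shrink to zero while the norms grow. The factor six is the reciprocal
    of \<open>2/3 - 1/2\<close>, the part that survives the later corrections, and
    \<open>3 ^ n\<close> compensates the size of the increments.\<close>
  define Ph where "Ph n t N z \<longleftrightarrow> 0 \<le> t \<and> t \<le> 1 / real (n + 1) \<and> 6 * real (n + 1) * 3 ^ n \<le> N \<and>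
      (\<forall>f. integrable lborel f \<longrightarrow> L1_norm (U t f) \<le> N * L1_norm f) \<and>
      integrable lborel z \<and> L1_norm z = (1/3) ^ n \<and> 2 / 3 * N * (1/3) ^ n \<le> L1_norm (U t z)" for n :: nat and t N z
  have ex: "\<exists>t N z. Ph n t N z" for n :: nat
  proof -
    let ?C = "6 * real (n + 1) * 3 ^ n"
    have "\<exists>t. 0 \<le> t \<and> t \<le> 1 / real (n + 1) \<and> \<not> (\<forall>f. integrable lborel f \<longrightarrow> L1_norm (U t f) \<le> ?C * L1_norm f)"
    proof (rule ccontr)
      assume "\<not> ?thesis"
      then have "\<forall>t f. 0 \<le> t \<and> t \<le> 1 / real (n + 1) \<and> integrable lborel f \<longrightarrow> L1_norm (U t f) \<le> ?C * L1_norm f" by blast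
      moreover have "0 < 1 / real (n + 1)" by simp
      ultimately show False using contra by blast
    qed
    then obtain t where t: "0 \<le> t" "t \<le> 1 / real (n + 1)" "\<not> (\<forall>f. integrable lborel f \<longrightarrow> L1_norm (U t f) \<le> ?C * L1_norm f)" by blast
    have "0 < ?C" "0 < (1/3 :: real) ^ n" by simp_all
    from U_almost_norm[OF t(1,3) this] obtain N z where "?C \<le> N" "\<forall>f. integrable lborel f \<longrightarrow> L1_norm (U t f) \<le> N * L1_norm f"
      "integrable lborel z" "L1_norm z = (1/3) ^ n" "2 / 3 * N * (1/3) ^ n \<le> L1_norm (U t z)" by blast
    then have "Ph n t N z" unfolding Ph_def using t(1,2) by blast
    then show ?thesis by blast
  qed
  then have "\<forall>n. \<exists>t N z. Ph n t N z" by blast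
  from choice[OF this] obtain T where T: "\<forall>n. \<exists>N z. Ph n (T n) N z" ..
  from choice[OF T] obtain N where N: "\<forall>n. \<exists>z. Ph n (T n) (N n) z" ..
  from choice[OF N] obtain z where z: "\<forall>n. Ph n (T n) (N n) (z n)" ..
  have T0: "0 \<le> T n" and T1: "T n \<le> 1 / real (n + 1)" and NN: "6 * real (n + 1) * 3 ^ n \<le> N n"
    and Nb: "\<And>f. integrable lborel f \<Longrightarrow> L1_norm (U (T n) f) \<le> N n * L1_norm f"
    and zi: "integrable lborel (z n)" and zn: "L1_norm (z n) = (1/3) ^ n"
    and zl: "2 / 3 * N n * (1/3) ^ n \<le> L1_norm (U (T n) (z n))" for n
    using z[rule_format, of n] unfolding Ph_def by blast+
  define P where "P n y \<longleftrightarrow> integrable lborel y \<and> L1_norm (U (T n) (z n)) \<le> L1_norm (U (T n) y)" for n y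
  define Q where "Q n y y' \<longleftrightarrow> L1_norm (\<lambda>v. y' v - y v) \<le> (1/3) ^ Suc n" for n :: nat and y y' :: "'a \<Rightarrow> real"
  have "\<exists>x. \<forall>n. P n (x n) \<and> Q n (x n) (x (Suc n))"
  proof (rule dependent_nat_choice)
    show "\<exists>x. P 0 x" using zi[of 0] by (auto simp: P_def)
    fix y n assume "P n y"
    then have y: "integrable lborel y" by (simp add: P_def)
    let ?z = "z (Suc n)" and ?T = "T (Suc n)"
    \<comment> \<open>Since \<open>2 * z = (y + z) + (z - y)\<close>, adding or subtracting the new
      vector gives an image at least as large as that of the vector alone, whatever \<open>y\<close>
      is.\<close>
    have sum: "2 * L1_norm (U ?T ?z) \<le> L1_norm (U ?T (\<lambda>v. y v + ?z v)) + L1_norm (U ?T (\<lambda>v. ?z v - y v))"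
    proof -
      have "(\<lambda>v. (y v + ?z v) + (?z v - y v)) = (\<lambda>v. 2 * ?z v)" by auto
      then have "2 * L1_norm (U ?T ?z) = L1_norm (U ?T (\<lambda>v. (y v + ?z v) + (?z v - y v)))"
        using L1_norm_U_cmult[OF T0 zi, of "Suc n" 2 "Suc n"] by simp
      also have "\<dots> \<le> L1_norm (U ?T (\<lambda>v. y v + ?z v)) + L1_norm (U ?T (\<lambda>v. ?z v - y v))"
        by (rule L1_norm_U_add[OF T0]) (use y zi in simp_all)
      finally show ?thesis .
    qed
    have neg: "L1_norm (U ?T (\<lambda>v. ?z v - y v)) = L1_norm (U ?T (\<lambda>v. y v - ?z v))"
      using L1_norm_U_cmult[OF T0, of "\<lambda>v. y v - ?z v" "Suc n" "-1"] y zi by simp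
    show "\<exists>y'. P (Suc n) y' \<and> Q n y y'"
    proof (cases "L1_norm (U ?T ?z) \<le> L1_norm (U ?T (\<lambda>v. y v + ?z v))")
      case True
      then show ?thesis using y zi zn by (intro exI[of _ "\<lambda>v. y v + ?z v"]) (simp add: P_def Q_def)
    next
      case False
      then have "L1_norm (U ?T ?z) \<le> L1_norm (U ?T (\<lambda>v. y v - ?z v))" using sum neg by linarith
      moreover have "L1_norm (\<lambda>v. - ?z v) = (1/3) ^ Suc n" using zn by (simp add: L1_norm_def)
      ultimately show ?thesis using y zi by (intro exI[of _ "\<lambda>v. y v - ?z v"]) (simp add: P_def Q_def)
    qed
  qed
  then obtain x where x: "\<And>n. P n (x n)" "\<And>n. Q n (x n) (x (Suc n))" by blast
  have xi: "integrable lborel (x n)" for n using x(1)[of n] by (simp add: P_def)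
  have "L1_norm (\<lambda>v. x (Suc n) v - x n v) \<le> (1/3) ^ Suc n" for n using x(2)[of n] unfolding Q_def .
  from L1_fast_cauchy_limit[OF xi this]
  obtain y where "integrable lborel y \<and> (\<forall>n. L1_norm (\<lambda>v. y v - x n v) \<le> (1/3) ^ n / 2)" ..
  then have y: "integrable lborel y" "\<And>n. L1_norm (\<lambda>v. y v - x n v) \<le> (1/3) ^ n / 2" by simp_all
  \<comment> \<open>The limit differs from the \<open>n\<close>-th approximation by at most
    \<open>(1/3) ^ n / 2\<close>, which costs half of \<open>N n * (1/3) ^ n\<close> out of two
    thirds.\<close>
  have blow: "real (n + 1) \<le> L1_norm (U (T n) y)" for n
  proof -
    have d: "integrable lborel (\<lambda>v. x n v - y v)" using xi y by simp
    have N0: "0 \<le> N n" by (rule order_trans[OF _ NN[of n]]) simp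
    have "L1_norm (U (T n) (\<lambda>v. x n v - y v)) \<le> N n * L1_norm (\<lambda>v. x n v - y v)" using d by (rule Nb)
    also have "\<dots> \<le> N n * ((1/3) ^ n / 2)"
      using y(2)[of n] N0 by (intro mult_left_mono) (simp_all add: L1_norm_minus_commute[of "x n"])
    finally have a: "L1_norm (U (T n) (\<lambda>v. x n v - y v)) \<le> N n * ((1/3) ^ n / 2)" .
    have "2 / 3 * N n * (1/3) ^ n \<le> L1_norm (U (T n) (z n))" by (rule zl)
    also have "\<dots> \<le> L1_norm (U (T n) (x n))" using x(1)[of n] by (simp add: P_def)
    also have "\<dots> = L1_norm (U (T n) (\<lambda>v. y v + (x n v - y v)))" by simp
    also have "\<dots> \<le> L1_norm (U (T n) y) + L1_norm (U (T n) (\<lambda>v. x n v - y v))"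
      by (rule L1_norm_U_add[OF T0 y(1) d])
    finally have "2 / 3 * N n * (1/3) ^ n - N n * ((1/3) ^ n / 2) \<le> L1_norm (U (T n) y)" using a by linarith
    moreover have "2 / 3 * N n * (1/3) ^ n - N n * ((1/3) ^ n / 2) = N n * ((1/3) ^ n / 6)" by (simp add: algebra_simps)
    moreover have "6 * real (n + 1) * 3 ^ n * ((1/3) ^ n / 6) \<le> N n * ((1/3) ^ n / 6)"
      using NN[of n] by (intro mult_right_mono) auto
    moreover have "6 * real (n + 1) * 3 ^ n * ((1/3) ^ n / 6) = real (n + 1)"
      by (simp add: power_one_over)
    ultimately show ?thesis by linarith
  qed
  \<comment> \<open>Strong continuity at zero keeps the images of \<open>y\<close> bounded for short
    times, although they are at least \<open>n + 1\<close> at the times \<open>T n\<close>, which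
    tend to zero.\<close>
  obtain d where d: "0 < d" "\<And>t. 0 \<le> t \<Longrightarrow> t < d \<Longrightarrow> L1_norm (\<lambda>v. U t y v - y v) < 1"
    using U_continuous_0[OF y(1), of 1] by auto
  obtain n1 :: nat where n1: "1 / d < real n1" using reals_Archimedean2 by blast
  obtain n2 :: nat where n2: "L1_norm y + 1 < real n2" using reals_Archimedean2 by blast
  define n where "n = max n1 n2"
  have "1 / d < real (n + 1)" using n1 by (simp add: n_def)
  then have "1 / real (n + 1) < d" using d(1) by (simp add: field_simps)
  then have Td: "T n < d" using T1[of n] by linarith
  have "L1_norm (U (T n) y) = L1_norm (\<lambda>v. (U (T n) y v - y v) + y v)" by simp
  also have "\<dots> \<le> L1_norm (\<lambda>v. U (T n) y v - y v) + L1_norm y"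
    by (rule L1_norm_add_le) (use y(1) U_integrable[OF T0 y(1)] in simp_all)
  also have "\<dots> < 1 + L1_norm y" using d(2)[OF T0 Td] by simp
  finally have "real (n + 1) < 1 + L1_norm y" using blow[of n] by linarith
  then show False using n2 by (simp add: n_def)
qed

text \<open>With the fixed vector \<open>q = U (t - d0) f\<close> and \<open>r = d0 - s\<close>, the
  difference is \<open>U r\<close> applied to \<open>U s q - q\<close>. The second factor tends to
  zero by continuity at zero, and \<open>U r\<close> is bounded uniformly for
  \<open>r \<le> d\<close>.\<close>

lemma U_left_continuous:
  assumes f: "integrable lborel f" and t: "0 < t" and e: "0 < e"
  shows "\<exists>d>0. \<forall>s. 0 < s \<and> s < d \<longrightarrow> s < t \<and> L1_norm (\<lambda>v. U t f v - U (t - s) f v) < e"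
proof -
  obtain d M where d: "0 < d" and M: "\<And>s f. 0 \<le> s \<Longrightarrow> s \<le> d \<Longrightarrow> integrable lborel f \<Longrightarrow> L1_norm (U s f) \<le> M * L1_norm f"
    using U_locally_bounded by blast
  define M' where "M' = \<bar>M\<bar> + 1"
  define d0 where "d0 = min d t"
  define q where "q = U (t - d0) f"
  have d0: "0 < d0" "d0 \<le> d" "d0 \<le> t" using d t by (auto simp: d0_def)
  have qi: "integrable lborel q" unfolding q_def using d0 f by (intro U_integrable) auto
  have M': "L1_norm (U s g) \<le> M' * L1_norm g" if "0 \<le> s" "s \<le> d" "integrable lborel g" for s g
  proof -
    have "M \<le> M'" unfolding M'_def by linarith
    then have "M * L1_norm g \<le> M' * L1_norm g" by (rule mult_right_mono) simp
    with M[OF that] show ?thesis by linarith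
  qed
  obtain d1 where d1: "0 < d1" "\<And>s. 0 \<le> s \<Longrightarrow> s < d1 \<Longrightarrow> L1_norm (\<lambda>v. U s q v - q v) < e / M'"
    using U_continuous_0[OF qi, of "e / M'"] e by (auto simp: M'_def)
  have "s < t \<and> L1_norm (\<lambda>v. U t f v - U (t - s) f v) < e" if s: "0 < s" "s < min d0 d1" for s
  proof -
    define r where "r = d0 - s"
    have r: "0 \<le> r" "r \<le> d" using s d0 by (auto simp: r_def)
    have Us: "integrable lborel (U s q)" using s qi by (intro U_integrable) auto
    have 1: "AE v in lborel. U (t - s) f v = U r q v"
      using U_add[of r "t - d0" f] r d0 f by (simp add: r_def q_def)
    have 2: "AE v in lborel. U (s + (t - d0)) f v = U s q v"
      using U_add[of s "t - d0" f] s d0 f by (simp add: q_def)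
    define g where "g = U (s + (t - d0)) f"
    have gi: "integrable lborel g" unfolding g_def using s d0 f by (intro U_integrable) auto
    have 3: "AE v in lborel. U t f v = U r g v"
      using U_add[of r "s + (t - d0)" f] r s d0 f by (simp add: r_def g_def)
    have i: "integrable lborel (U t f)" "integrable lborel (U (t - s) f)" "integrable lborel (U r g)" "integrable lborel (U r q)"
      using s d0 t r f gi qi by (auto intro!: U_integrable)
    have "L1_norm (\<lambda>v. U t f v - U (t - s) f v) = L1_norm (\<lambda>v. U r g v - U r q v)"
      using 1 3 i by (intro L1_norm_cong_AE) auto
    also have "\<dots> = L1_norm (U r (\<lambda>v. g v - q v))" by (rule L1_norm_U_diff[OF r(1) gi qi])
    also have "\<dots> \<le> M' * L1_norm (\<lambda>v. g v - q v)" by (rule M'[OF r]) (use gi qi in simp)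
    also have "L1_norm (\<lambda>v. g v - q v) = L1_norm (\<lambda>v. U s q v - q v)"
      using 2 gi Us qi by (intro L1_norm_cong_AE) (auto simp: g_def)
    also have "M' * \<dots> < M' * (e / M')"
      using d1(2)[of s] s by (intro mult_strict_left_mono) (auto simp: M'_def)
    also have "\<dots> = e" by (simp add: M'_def)
    finally show ?thesis using s d0 by auto
  qed
  then show ?thesis using d0 d1 by (intro exI[of _ "min d0 d1"]) auto
qed

end

subsection \<open>The flow as a limit of Euler iterates\<close>

locale boltzmann_flow = soft_collisions b ty \<gamma> a + L1_semigroup U
  for b :: "real \<Rightarrow> real" and ty :: "'a::euclidean_space itself" and \<gamma> a :: real and U :: "real \<Rightarrow> ('a \<Rightarrow> real) \<Rightarrow> 'a \<Rightarrow> real" +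
  assumes generator: "\<And>f. integrable lborel f \<Longrightarrow> ((\<lambda>t. L1_norm (\<lambda>v. (U t f v - f v) / t - L f v)) \<longlongrightarrow> 0) (at_right 0)"
begin

lemma euler_local_error:
  assumes f: "integrable lborel f" and e: "0 < e"
  shows "\<exists>d>0. \<forall>h. 0 < h \<and> h < d \<longrightarrow> L1_norm (\<lambda>v. U h f v - euler h f v) \<le> e * h"
proof -
  have "eventually (\<lambda>t. L1_norm (\<lambda>v. (U t f v - f v) / t - L f v) < e) (at_right 0)"
    using generator[OF f] e by (rule order_tendstoD)
  then obtain d where d: "0 < d" "\<And>t. 0 < t \<Longrightarrow> t < d \<Longrightarrow> L1_norm (\<lambda>v. (U t f v - f v) / t - L f v) < e"
    unfolding eventually_at_right_field by auto
  have "L1_norm (\<lambda>v. U h f v - euler h f v) \<le> e * h" if h: "0 < h" "h < d" for h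
  proof -
    have "h * (X / h - Z) = X - h * Z" for X Z using h by (simp add: field_simps)
    then have "(\<lambda>v. U h f v - euler h f v) = (\<lambda>v. h * ((U h f v - f v) / h - L f v))"
      by (auto simp: euler_def)
    then have "L1_norm (\<lambda>v. U h f v - euler h f v) = h * L1_norm (\<lambda>v. (U h f v - f v) / h - L f v)"
      using h by (simp only: L1_norm_cmult)
    also have "\<dots> \<le> h * e" using d(2)[OF h] h by (intro mult_left_mono) auto
    finally show ?thesis by (simp add: mult.commute)
  qed
  with d(1) show ?thesis by blast
qed

text \<open>Solving the Euler step of size \<open>1 / a\<close>, which is a contraction, for
  \<open>L f\<close>.\<close>

lemma L1_norm_op_le:
  assumes f: "integrable lborel f"
  shows "L1_norm (L f) \<le> 2 * a * L1_norm f"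
proof -
  have ia: "0 \<le> 1 / a" "1 / a * a \<le> 1" using a_ge by auto
  have "L f = (\<lambda>v. a * (euler (1 / a) f v - f v))"
    using a_ge by (auto simp: euler_def)
  then have "L1_norm (L f) = \<bar>a\<bar> * L1_norm (\<lambda>v. euler (1 / a) f v - f v)"
    by (simp only: L1_norm_cmult)
  also have "L1_norm (\<lambda>v. euler (1 / a) f v - f v) \<le> L1_norm (euler (1 / a) f) + L1_norm (\<lambda>v. - f v)"
    using L1_norm_add_le[OF integrable_euler[OF f, of "1 / a"], of "\<lambda>v. - f v"] f by simp
  also have "L1_norm (\<lambda>v. - f v) = L1_norm f" by (simp add: L1_norm_def)
  also have "L1_norm (euler (1 / a) f) \<le> L1_norm f" by (rule L1_norm_euler_le[OF f ia])
  finally show ?thesis using a_ge by (simp add: mult_left_mono)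
qed

lemma L1_norm_prob_density: "prob_density f \<Longrightarrow> L1_norm f = 1"
proof -
  assume "prob_density f"
  then have f: "integrable lborel f" "AE v in lborel. 0 \<le> f v" "(\<integral>v. f v \<partial>lborel) = 1" by (auto simp: prob_density_def)
  have "L1_norm f = (\<integral>v. f v \<partial>lborel)"
    unfolding L1_norm_def using f by (intro integral_cong_AE) (auto elim!: eventually_mono)
  then show ?thesis using f by simp
qed

lemma L1_norm_euler_diff:
  assumes f: "integrable lborel f" and g: "integrable lborel g" and \<tau>: "0 \<le> \<tau>" "\<tau> * a \<le> 1"
  shows "L1_norm (\<lambda>v. euler \<tau> f v - euler \<tau> g v) \<le> L1_norm (\<lambda>v. f v - g v)"
proof -
  have i: "integrable lborel (\<lambda>v. f v - g v)" using f g by simp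
  have "AE v in lborel. euler \<tau> f v - euler \<tau> g v = euler \<tau> (\<lambda>v. f v - g v) v"
    using euler_diff[OF f g, of \<tau>] by eventually_elim simp
  then have "L1_norm (\<lambda>v. euler \<tau> f v - euler \<tau> g v) = L1_norm (euler \<tau> (\<lambda>v. f v - g v))"
    using integrable_euler[OF f] integrable_euler[OF g] integrable_euler[OF i] by (intro L1_norm_cong_AE) auto
  also have "\<dots> \<le> L1_norm (\<lambda>v. f v - g v)" by (rule L1_norm_euler_le[OF i \<tau>])
  finally show ?thesis .
qed

text \<open>The error may grow at rate \<open>e\<close> per unit time; the slack \<eta> is
  arbitrary, which makes the property stable under limits of times from the left.\<close>

definition approximable :: "('a \<Rightarrow> real) \<Rightarrow> real \<Rightarrow> real \<Rightarrow> bool" where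
  "approximable f0 e t \<longleftrightarrow> (\<forall>\<eta>>0. \<exists>g. reach f0 t g \<and> L1_norm (\<lambda>v. U t f0 v - g v) \<le> e * t + \<eta>)"

lemma approximable_0:
  assumes f0: "prob_density f0"
  shows "approximable f0 e 0"
proof -
  have i: "integrable lborel f0" using f0 by (simp add: prob_density_def)
  have "L1_norm (\<lambda>v. U 0 f0 v - f0 v) = 0"
    using U_0[OF i] U_integrable[OF order_refl i] i by (intro L1_norm_zero_AE) (auto elim!: eventually_mono)
  then show ?thesis unfolding approximable_def using reach_0[of f0] by auto
qed

text \<open>One more Euler step: applied to the exact solution its error is at most
  \<open>e * h\<close> by the generator, and being a contraction it does not enlarge the error
  already present.\<close>

lemma approximable_right:
  assumes f0: "prob_density f0" and e: "0 < e" and t: "0 \<le> t" and ap: "approximable f0 e t"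
  shows "\<exists>d>0. \<forall>h. 0 < h \<and> h < d \<longrightarrow> approximable f0 e (t + h)"
proof -
  have i0: "integrable lborel f0" using f0 by (simp add: prob_density_def)
  define F where "F = U t f0"
  have Fi: "integrable lborel F" unfolding F_def by (rule U_integrable[OF t i0])
  obtain d where d: "0 < d" "\<And>h. 0 < h \<Longrightarrow> h < d \<Longrightarrow> L1_norm (\<lambda>v. U h F v - euler h F v) \<le> e * h"
    using euler_local_error[OF Fi e] by blast
  have "approximable f0 e (t + h)" if h: "0 < h" "h < min d (1 / (2 * a))" for h
    unfolding approximable_def
  proof (intro allI impI)
    fix \<eta> :: real assume "0 < \<eta>"
    then obtain g where g: "reach f0 t g" "L1_norm (\<lambda>v. F v - g v) \<le> e * t + \<eta>"
      using ap unfolding approximable_def F_def by blast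
    have h2: "h * (2 * a) \<le> 1"
    proof -
      have "h * (2 * a) \<le> 1 / (2 * a) * (2 * a)" using h a_ge by (intro mult_right_mono) auto
      then show ?thesis using a_ge by simp
    qed
    have hs: "0 \<le> h" "h * a \<le> 1" using small_step[OF h(1) h2] by auto
    have gi: "integrable lborel g" using reach_prob_density[OF g(1) f0] by (simp add: prob_density_def)
    have r: "reach f0 (t + h) (euler h g)" by (rule reach_euler[OF g(1) h(1) h2])
    have Ui: "integrable lborel (U h F)" "integrable lborel (U (t + h) f0)"
      using h t Fi i0 by (auto intro!: U_integrable)
    have "AE v in lborel. U (t + h) f0 v = U h F v"
      using U_add[of h t f0] h t i0 by (simp add: F_def add.commute)
    then have "L1_norm (\<lambda>v. U (t + h) f0 v - euler h g v) = L1_norm (\<lambda>v. U h F v - euler h g v)"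
      using Ui integrable_euler[OF gi] by (intro L1_norm_cong_AE) auto
    also have "\<dots> \<le> L1_norm (\<lambda>v. U h F v - euler h F v) + L1_norm (\<lambda>v. euler h F v - euler h g v)"
      by (intro L1_norm_triangle Ui integrable_euler Fi gi)
    also have "\<dots> \<le> e * h + (e * t + \<eta>)"
      using d(2)[of h] h L1_norm_euler_diff[OF Fi gi hs] g(2) by auto
    also have "\<dots> = e * (t + h) + \<eta>" by (simp add: algebra_simps)
    finally show "\<exists>g. reach f0 (t + h) g \<and> L1_norm (\<lambda>v. U (t + h) f0 v - g v) \<le> e * (t + h) + \<eta>" using r by blast
  qed
  moreover have "0 < min d (1 / (2 * a))" using d(1) a_ge by auto
  ultimately show ?thesis by blast
qed

text \<open>A last step of length \<open>s\<close>, small compared with \<eta>, starts at time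
  \<open>t - s\<close>: it changes the iterate little because the operator is bounded, and left
  continuity does the same for the flow.\<close>

lemma approximable_left:
  assumes f0: "prob_density f0" and e: "0 < e" and t: "0 < t" and ap: "\<And>s. 0 \<le> s \<Longrightarrow> s < t \<Longrightarrow> approximable f0 e s"
  shows "approximable f0 e t"
  unfolding approximable_def
proof (intro allI impI)
  fix \<eta> :: real assume \<eta>: "0 < \<eta>"
  have i0: "integrable lborel f0" using f0 by (simp add: prob_density_def)
  obtain d where d: "0 < d" "\<And>s. 0 < s \<Longrightarrow> s < d \<Longrightarrow> s < t \<and> L1_norm (\<lambda>v. U t f0 v - U (t - s) f0 v) < \<eta> / 3"
    using U_left_continuous[OF i0 t, of "\<eta> / 3"] \<eta> by auto
  define m where "m = min d (min (1 / (2 * a)) (\<eta> / (6 * a)))"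
  have m: "0 < m" "m \<le> d" "m \<le> 1 / (2 * a)" "m \<le> \<eta> / (6 * a)" using d \<eta> a_ge by (auto simp: m_def)
  define s where "s = m / 2"
  have s: "0 < s" "s < d" "s \<le> 1 / (2 * a)" "s \<le> \<eta> / (6 * a)" using m by (auto simp: s_def)
  have st: "s < t" "L1_norm (\<lambda>v. U t f0 v - U (t - s) f0 v) < \<eta> / 3" using d(2)[OF s(1,2)] by auto
  obtain g where g: "reach f0 (t - s) g" "L1_norm (\<lambda>v. U (t - s) f0 v - g v) \<le> e * (t - s) + \<eta> / 3"
    using ap[of "t - s"] st s \<eta> unfolding approximable_def by (metis diff_ge_0_iff_ge diff_less_eq less_add_same_cancel1 less_imp_le zero_less_divide_iff zero_less_numeral)
  have s2: "s * (2 * a) \<le> 1"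
  proof -
    have "s * (2 * a) \<le> 1 / (2 * a) * (2 * a)" using s a_ge by (intro mult_right_mono) auto
    then show ?thesis using a_ge by simp
  qed
  have gp: "prob_density g" by (rule reach_prob_density[OF g(1) f0])
  then have gi: "integrable lborel g" by (simp add: prob_density_def)
  have r: "reach f0 t (euler s g)" using reach_euler[OF g(1) s(1) s2] by simp
  have Ui: "integrable lborel (U t f0)" "integrable lborel (U (t - s) f0)"
    using t st i0 by (auto intro!: U_integrable)
  have "(\<lambda>v. g v - euler s g v) = (\<lambda>v. (- s) * L g v)" by (auto simp: euler_def)
  then have "L1_norm (\<lambda>v. g v - euler s g v) = s * L1_norm (L g)" using s by (simp only: L1_norm_cmult)
  also have "\<dots> \<le> s * (2 * a)" using L1_norm_op_le[OF gi] L1_norm_prob_density[OF gp] s by (intro mult_left_mono) auto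
  also have "\<dots> \<le> \<eta> / (6 * a) * (2 * a)" using s a_ge by (intro mult_right_mono) auto
  also have "\<dots> = \<eta> / 3" using a_ge by (simp add: field_simps)
  finally have 3: "L1_norm (\<lambda>v. g v - euler s g v) \<le> \<eta> / 3" .
  have "L1_norm (\<lambda>v. U t f0 v - euler s g v) \<le> L1_norm (\<lambda>v. U t f0 v - U (t - s) f0 v) + L1_norm (\<lambda>v. U (t - s) f0 v - euler s g v)"
    by (intro L1_norm_triangle Ui integrable_euler gi)
  moreover have "L1_norm (\<lambda>v. U (t - s) f0 v - euler s g v) \<le> L1_norm (\<lambda>v. U (t - s) f0 v - g v) + L1_norm (\<lambda>v. g v - euler s g v)"
    by (intro L1_norm_triangle Ui integrable_euler gi)
  moreover have "e * (t - s) \<le> e * t" using e s by (intro mult_left_mono) auto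
  ultimately have "L1_norm (\<lambda>v. U t f0 v - euler s g v) \<le> e * t + \<eta>" using g(2) st(2) 3 by linarith
  with r show "\<exists>g. reach f0 t g \<and> L1_norm (\<lambda>v. U t f0 v - g v) \<le> e * t + \<eta>" by blast
qed

text \<open>Induction over real time by way of the infimum of the bad times. A fixed mesh is avoided
  because the step size allowed by the generator depends on the current state.\<close>

lemma approximable_all:
  assumes f0: "prob_density f0" and e: "0 < e" and t: "0 \<le> t"
  shows "approximable f0 e t"
proof (rule ccontr)
  assume bad: "\<not> approximable f0 e t"
  define S where "S = {s. 0 \<le> s \<and> \<not> approximable f0 e s}"
  have ne: "S \<noteq> {}" using bad t by (auto simp: S_def)
  have bdd: "bdd_below S" by (rule bdd_belowI[of _ 0]) (auto simp: S_def)
  define i where "i = Inf S"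
  have i0: "0 \<le> i" unfolding i_def using ne by (rule cInf_greatest) (simp add: S_def)
  have below: "approximable f0 e s" if "0 \<le> s" "s < i" for s
  proof (rule ccontr)
    assume "\<not> approximable f0 e s"
    then have "s \<in> S" using that by (simp add: S_def)
    then have "i \<le> s" unfolding i_def using bdd by (rule cInf_lower)
    then show False using that by simp
  qed
  have ai: "approximable f0 e i"
  proof (cases "i = 0")
    case True
    then show ?thesis using approximable_0[OF f0] by simp
  next
    case False
    then show ?thesis using approximable_left[OF f0 e _ below] i0 by simp
  qed
  obtain d where d: "0 < d" "\<And>h. 0 < h \<Longrightarrow> h < d \<Longrightarrow> approximable f0 e (i + h)"
    using approximable_right[OF f0 e i0 ai] by blast
  have "i + d \<le> s" if "s \<in> S" for s
  proof (rule ccontr)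
    assume "\<not> i + d \<le> s"
    moreover have "i \<le> s" unfolding i_def using that bdd by (rule cInf_lower)
    ultimately have "approximable f0 e s"
      using d(2)[of "s - i"] ai by (cases "s = i") auto
    then show False using that by (simp add: S_def)
  qed
  then have "i + d \<le> i" unfolding i_def[symmetric] using ne by (subst i_def, intro cInf_greatest) auto
  then show False using d(1) by simp
qed

lemma flow_limit:
  assumes f0: "prob_density f0" and t: "0 \<le> t" and f: "integrable lborel f" "AE v in lborel. f v = U t f0 v"
  shows "\<exists>g. (\<forall>n. reach f0 t (g n)) \<and> (\<lambda>n. L1_norm (\<lambda>v. g n v - f v)) \<longlonglongrightarrow> 0 \<and>
    (AE v in lborel. (\<lambda>n. g n v) \<longlonglongrightarrow> f v)"
proof -
  have i0: "integrable lborel f0" using f0 by (simp add: prob_density_def)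
  have "\<exists>g. reach f0 t g \<and> L1_norm (\<lambda>v. U t f0 v - g v) \<le> 1 / real (Suc n)" for n
  proof -
    define e where "e = 1 / real (Suc n) / (t + 1)"
    have e: "0 < e" using t by (simp add: e_def)
    from approximable_all[OF f0 e t] e obtain g where g: "reach f0 t g" "L1_norm (\<lambda>v. U t f0 v - g v) \<le> e * t + e"
      unfolding approximable_def by blast
    have "e * t + e = e * (t + 1)" by (simp add: algebra_simps)
    also have "\<dots> = 1 / real (Suc n)" using t by (simp add: e_def)
    finally show ?thesis using g by auto
  qed
  then have "\<forall>n. \<exists>g. reach f0 t g \<and> L1_norm (\<lambda>v. U t f0 v - g v) \<le> 1 / real (Suc n)" by blast
  from choice[OF this] obtain g where "\<forall>n. reach f0 t (g n) \<and> L1_norm (\<lambda>v. U t f0 v - g n v) \<le> 1 / real (Suc n)" ..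
  then have g: "\<And>n. reach f0 t (g n)" "\<And>n. L1_norm (\<lambda>v. U t f0 v - g n v) \<le> 1 / real (Suc n)" by auto
  have gi: "integrable lborel (g n)" for n using reach_prob_density[OF g(1) f0] by (simp add: prob_density_def)
  have "L1_norm (\<lambda>v. g n v - f v) \<le> 1 / real (Suc n)" for n
  proof -
    have "L1_norm (\<lambda>v. g n v - f v) = L1_norm (\<lambda>v. U t f0 v - g n v)"
      unfolding L1_norm_minus_commute[of "g n"]
      using f gi U_integrable[OF t i0] by (intro L1_norm_cong_AE) auto
    then show ?thesis using g(2) by simp
  qed
  then have lim: "(\<lambda>n. L1_norm (\<lambda>v. g n v - f v)) \<longlonglongrightarrow> 0"
    by (intro tendsto_sandwich[OF _ _ tendsto_const LIMSEQ_inverse_real_of_nat]) (auto simp: inverse_eq_divide)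
  have "\<exists>r::nat \<Rightarrow> nat. strict_mono r \<and> (AE v in lborel. (\<lambda>n. g (r n) v - f v) \<longlonglongrightarrow> 0)"
    using lim by (intro tendsto_L1_AE_subseq) (use gi f in \<open>simp_all add: L1_norm_def\<close>)
  then obtain r where r: "strict_mono r" "AE v in lborel. (\<lambda>n. g (r n) v - f v) \<longlonglongrightarrow> 0" by blast
  have "(\<lambda>n. L1_norm (\<lambda>v. g (r n) v - f v)) \<longlonglongrightarrow> 0"
    using LIMSEQ_subseq_LIMSEQ[OF lim r(1)] by (simp add: o_def)
  moreover have "AE v in lborel. (\<lambda>n. g (r n) v) \<longlonglongrightarrow> f v"
    using r(2) by eventually_elim (simp add: LIM_zero_iff)
  ultimately show ?thesis using g(1) by (intro exI[of _ "\<lambda>n. g (r n)"]) simp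
qed

end

section \<open>Passing the bounds to the flow\<close>

text \<open>At zero the logarithm is not continuous; there \<open>x * ln x\<close> is squeezed by
  \<open>2 * sqrt x + x * x\<close>, which tends to zero.\<close>

lemma ent_tendsto:
  assumes x: "\<And>n. 0 \<le> x n" "x \<longlonglongrightarrow> y"
  shows "(\<lambda>n. ent (x n)) \<longlonglongrightarrow> ent y"
proof (cases "y = 0")
  case False
  then show ?thesis unfolding ent_def using x by (intro tendsto_intros) auto
next
  case True
  have bound: "\<bar>z * ln z\<bar> \<le> 2 * sqrt z + z * z" if z: "0 \<le> z" for z :: real
  proof (cases "z = 0")
    case False
    then have z0: "0 < z" using z by simp
    have up: "z * ln z \<le> z * (z - 1)" using ln_le_minus_one[OF z0] z by (intro mult_left_mono) auto
    have s: "0 < sqrt z" using z0 by simp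
    have "ln (1 / sqrt z) \<le> 1 / sqrt z - 1" using s by (intro ln_le_minus_one) auto
    then have "- (ln z / 2) \<le> 1 / sqrt z" using z0 by (simp add: ln_div ln_sqrt)
    then have "z * (- (ln z / 2)) \<le> z * (1 / sqrt z)" using z by (rule mult_left_mono)
    also have "z * (1 / sqrt z) = sqrt z" using z by (simp add: real_div_sqrt)
    finally have "- (z * ln z) \<le> 2 * sqrt z" by simp
    moreover have "z * (z - 1) = z * z - z" by (simp add: right_diff_distrib)
    then have "z * ln z \<le> z * z" using up z0 by linarith
    moreover have "0 \<le> z * z" "0 \<le> sqrt z" using z by auto
    ultimately show ?thesis by (intro abs_leI) linarith+
  qed simp
  have "(\<lambda>n. 2 * sqrt (x n) + x n * x n) \<longlonglongrightarrow> 2 * sqrt 0 + 0 * 0"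
    using x(2) unfolding True by (intro tendsto_intros)
  then have lim0: "(\<lambda>n. 2 * sqrt (x n) + x n * x n) \<longlonglongrightarrow> 0" by simp
  have "(\<lambda>n. x n * ln (x n)) \<longlonglongrightarrow> 0"
  proof (rule Lim_null_comparison[OF _ lim0], intro always_eventually allI)
    show "norm (x n * ln (x n)) \<le> 2 * sqrt (x n) + x n * x n" for n
      unfolding real_norm_def by (rule bound[OF x(1)])
  qed
  then have "(\<lambda>n. x n * ln (x n) - x n + 1) \<longlonglongrightarrow> 0 - 0 + 1"
    using x(2) unfolding True by (intro tendsto_intros)
  then show ?thesis unfolding ent_def True by simp
qed

text \<open>Fatou's lemma: functionals that are integrals of a continuous function of the density
  are lower semicontinuous, so upper bounds on Euler iterates survive in the limit.\<close>

lemma dens_fatou: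
  fixes g :: "nat \<Rightarrow> 'a::euclidean_space \<Rightarrow> real"
  assumes [measurable]: "\<And>n. g n \<in> borel_measurable borel" "f \<in> borel_measurable borel" "\<Phi> \<in> borel_measurable borel"
    and lim: "AE v in lborel. (\<lambda>n. g n v) \<longlonglongrightarrow> f v"
    and cont: "\<And>x y. (\<And>n::nat. 0 \<le> x n) \<Longrightarrow> x \<longlonglongrightarrow> y \<Longrightarrow> (\<lambda>n. \<Phi> (x n)) \<longlonglongrightarrow> \<Phi> y"
    and le: "\<And>n. (\<integral>\<^sup>+v. ennreal (\<Phi> (dens (g n) v)) \<partial>maxwell_measure) \<le> C"
  shows "(\<integral>\<^sup>+v. ennreal (\<Phi> (dens f v)) \<partial>maxwell_measure) \<le> C"
proof -
  have "AE v in maxwell_measure. ennreal (\<Phi> (dens f v)) = liminf (\<lambda>n. ennreal (\<Phi> (dens (g n) v)))"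
    unfolding AE_maxwell_iff using lim
  proof eventually_elim
    case (elim v)
    have "(\<lambda>n. dens (g n) v) \<longlonglongrightarrow> dens f v"
      unfolding dens_def using elim by (intro tendsto_intros) auto
    then have "(\<lambda>n. \<Phi> (dens (g n) v)) \<longlonglongrightarrow> \<Phi> (dens f v)" by (intro cont) auto
    then have "(\<lambda>n. ennreal (\<Phi> (dens (g n) v))) \<longlonglongrightarrow> ennreal (\<Phi> (dens f v))" by (rule tendsto_ennrealI)
    then show ?case by (intro lim_imp_Liminf[symmetric]) auto
  qed
  then have "(\<integral>\<^sup>+v. ennreal (\<Phi> (dens f v)) \<partial>maxwell_measure) = (\<integral>\<^sup>+v. liminf (\<lambda>n. ennreal (\<Phi> (dens (g n) v))) \<partial>maxwell_measure)"
    by (rule nn_integral_cong_AE)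
  also have "\<dots> \<le> liminf (\<lambda>n. \<integral>\<^sup>+v. ennreal (\<Phi> (dens (g n) v)) \<partial>maxwell_measure)"
    by (rule nn_integral_liminf) simp
  also have "\<dots> \<le> limsup (\<lambda>n. \<integral>\<^sup>+v. ennreal (\<Phi> (dens (g n) v)) \<partial>maxwell_measure)"
    by (rule Liminf_le_Limsup) simp
  also have "\<dots> \<le> C" by (rule Limsup_bounded) (use le in auto)
  finally show ?thesis .
qed

context boltzmann_flow
begin

context
  fixes f0 f :: "'a \<Rightarrow> real" and t :: real
  assumes f0: "prob_density f0" and t: "0 \<le> t" and f: "integrable lborel f" "AE v in lborel. f v = U t f0 v"
begin

lemma flow_prob_density: "prob_density f"
proof -
  from flow_limit[OF f0 t f] obtain g where "(\<forall>n. reach f0 t (g n)) \<and> (\<lambda>n. L1_norm (\<lambda>v. g n v - f v)) \<longlonglongrightarrow> 0 \<and>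
    (AE v in lborel. (\<lambda>n. g n v) \<longlonglongrightarrow> f v)" ..
  then have g: "\<And>n. reach f0 t (g n)" "(\<lambda>n. L1_norm (\<lambda>v. g n v - f v)) \<longlonglongrightarrow> 0" "AE v in lborel. (\<lambda>n. g n v) \<longlonglongrightarrow> f v"
    by blast+
  have gp: "prob_density (g n)" for n by (rule reach_prob_density[OF g(1) f0])
  have gi: "integrable lborel (g n)" for n using gp by (simp add: prob_density_def)
  have "AE v in lborel. \<forall>n. 0 \<le> g n v" using gp by (subst AE_all_countable) (simp add: prob_density_def)
  with g(3) have nn: "AE v in lborel. 0 \<le> f v"
    by eventually_elim (rule LIMSEQ_le_const, auto)
  have "\<bar>1 - (\<integral>v. f v \<partial>lborel)\<bar> \<le> L1_norm (\<lambda>v. g n v - f v)" for n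
  proof -
    have "1 - (\<integral>v. f v \<partial>lborel) = (\<integral>v. g n v - f v \<partial>lborel)" using gi f gp[of n] by (simp add: prob_density_def)
    also have "\<bar>\<dots>\<bar> \<le> (\<integral>v. \<bar>g n v - f v\<bar> \<partial>lborel)" by (rule integral_abs_bound)
    finally show ?thesis by (simp add: L1_norm_def)
  qed
  then have "\<bar>1 - (\<integral>v. f v \<partial>lborel)\<bar> \<le> 0" using LIMSEQ_le_const[OF g(2)] by blast
  then show ?thesis using nn f by (simp add: prob_density_def)
qed

lemma flow_Hq: 
  assumes p: "1 < p"
  shows "Hq p f \<le> Hq p f0"
proof -
  from flow_limit[OF f0 t f] obtain g where "(\<forall>n. reach f0 t (g n)) \<and> (\<lambda>n. L1_norm (\<lambda>v. g n v - f v)) \<longlonglongrightarrow> 0 \<and>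
    (AE v in lborel. (\<lambda>n. g n v) \<longlonglongrightarrow> f v)" ..
  then have g: "\<And>n. reach f0 t (g n)" "(\<lambda>n. L1_norm (\<lambda>v. g n v - f v)) \<longlonglongrightarrow> 0" "AE v in lborel. (\<lambda>n. g n v) \<longlonglongrightarrow> f v"
    by blast+
  have gi: "integrable lborel (g n)" for n using reach_prob_density[OF g(1) f0] by (simp add: prob_density_def)
  show ?thesis unfolding Hq_def
  proof (rule dens_fatou[OF _ _ _ g(3), where \<Phi> = "\<lambda>x. x powr p"])
    show "(\<integral>\<^sup>+v. ennreal (dens (g n) v powr p) \<partial>maxwell_measure) \<le> (\<integral>\<^sup>+v. ennreal (dens f0 v powr p) \<partial>maxwell_measure)" for n
      using reach_Hq[OF g(1) f0 p] by (simp add: Hq_def)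
    show "(\<lambda>n. x n powr p) \<longlonglongrightarrow> y powr p" if "\<And>n. 0 \<le> x n" "x \<longlonglongrightarrow> y" for x :: "nat \<Rightarrow> real" and y
      using that p by (intro tendsto_powr2 tendsto_const) auto
  qed (use gi f in auto)
qed

lemma flow_Ent:
  assumes p: "1 < p" and R: "1 \<le> R" and K: "Hq p f0 \<le> ennreal K" "0 \<le> K"
  shows "Ent f \<le> ennreal (exp (- t * R powr \<gamma> / 2)) * Ent f0 + ennreal (tail_const TYPE('a) p K * exp (- tail_rate p * R\<^sup>2))"
proof -
  from flow_limit[OF f0 t f] obtain g where "(\<forall>n. reach f0 t (g n)) \<and> (\<lambda>n. L1_norm (\<lambda>v. g n v - f v)) \<longlonglongrightarrow> 0 \<and>
    (AE v in lborel. (\<lambda>n. g n v) \<longlonglongrightarrow> f v)" ..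
  then have g: "\<And>n. reach f0 t (g n)" "(\<lambda>n. L1_norm (\<lambda>v. g n v - f v)) \<longlonglongrightarrow> 0" "AE v in lborel. (\<lambda>n. g n v) \<longlonglongrightarrow> f v"
    by blast+
  have gi: "integrable lborel (g n)" for n using reach_prob_density[OF g(1) f0] by (simp add: prob_density_def)
  show ?thesis unfolding Ent_def[of f]
  proof (rule dens_fatou[OF _ _ _ g(3) ent_tendsto])
    show "(\<integral>\<^sup>+v. ennreal (ent (dens (g n) v)) \<partial>maxwell_measure) \<le>
      ennreal (exp (- t * R powr \<gamma> / 2)) * Ent f0 + ennreal (tail_const TYPE('a) p K * exp (- tail_rate p * R\<^sup>2))" for n
      using reach_Ent[OF g(1) f0 p R K] by (simp add: Ent_def)
  qed (use gi f in auto)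
qed

text \<open>At a positive time the one-collision term of \<open>reach_lower_bound\<close> is present
  with factor \<open>t\<close>, and \<open>L f0 + a * f0\<close> dominates the gain of
  \<open>f0\<close>, which has a Gaussian lower bound.\<close>

lemma flow_lower_bound:
  assumes t0: "0 < t" and d: "2 \<le> DIM('a)" and b0: "0 < b0" "\<And>x. x \<in> {-1..1} \<Longrightarrow> b0 * sqrt (1 - x\<^sup>2) \<le> b x"
  shows "\<exists>A B. 0 \<le> B \<and> (AE v in lborel. exp (- A - B * (norm v)\<^sup>2) \<le> f v)"
proof -
  from flow_limit[OF f0 t f] obtain g where "(\<forall>n. reach f0 t (g n)) \<and> (\<lambda>n. L1_norm (\<lambda>v. g n v - f v)) \<longlonglongrightarrow> 0 \<and>
    (AE v in lborel. (\<lambda>n. g n v) \<longlonglongrightarrow> f v)" ..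
  then have g: "\<And>n. reach f0 t (g n)" "(\<lambda>n. L1_norm (\<lambda>v. g n v - f v)) \<longlonglongrightarrow> 0" "AE v in lborel. (\<lambda>n. g n v) \<longlonglongrightarrow> f v"
    by blast+
  have "AE v in lborel. \<forall>n. exp (- 2 * a * t) * (f0 v + t * (L f0 v + a * f0 v)) \<le> g n v"
    by (subst AE_all_countable) (use reach_lower_bound[OF g(1) f0] in blast)
  with g(3) have low: "AE v in lborel. exp (- 2 * a * t) * (f0 v + t * (L f0 v + a * f0 v)) \<le> f v"
    by eventually_elim (rule LIMSEQ_le_const, auto)
  have f0i: "integrable lborel f0" "AE v in lborel. 0 \<le> f0 v" "(\<integral>v. f0 v \<partial>lborel) = 1"
    using f0 by (auto simp: prob_density_def)
  define h where "h v = max 0 (f0 v)" for v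
  have hi: "integrable lborel h" unfolding h_def[abs_def] using f0i by simp
  have h0: "0 \<le> h v" for v by (simp add: h_def)
  have hf: "AE v in lborel. f0 v = h v" using f0i(2) by eventually_elim (simp add: h_def)
  have h1: "(\<integral>v. h v \<partial>lborel) = 1"
  proof -
    have "AE v in lborel. h v = f0 v" using hf by eventually_elim simp
    then have "(\<integral>v. h v \<partial>lborel) = (\<integral>v. f0 v \<partial>lborel)" using f0i(1) hi by (intro integral_cong_AE) auto
    then show ?thesis using f0i(3) by simp
  qed
  obtain A B where AB: "0 \<le> B" "AE x in lborel. exp (- A - B * (norm x)\<^sup>2) \<le> gain_op h x"
    using gain_op_gaussian_lower_bound[OF d hi h0 h1 b0] by blast
  have "AE v in lborel. exp (- (A + 2 * a * t - ln t) - B * (norm v)\<^sup>2) \<le> f v"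
    using low AB(2) op_cong[OF f0i(1) hi hf] op_decomp[OF hi] hf
  proof eventually_elim
    case (elim v)
    have Lh: "L h v = gain_op h v - h v * nu v" using elim(4) by blast
    have "h v * nu v \<le> h v * a" using h0 nu(3)[of v] by (intro mult_left_mono) auto
    then have "gain_op h v \<le> L f0 v + a * f0 v" unfolding elim(3) elim(5) Lh by (simp add: mult.commute)
    then have "exp (- A - B * (norm v)\<^sup>2) \<le> L f0 v + a * f0 v" using elim(2) by linarith
    then have "t * exp (- A - B * (norm v)\<^sup>2) \<le> t * (L f0 v + a * f0 v)" using t by (rule mult_left_mono)
    also have "\<dots> \<le> f0 v + t * (L f0 v + a * f0 v)" using elim(5) h0[of v] by simp
    finally have "exp (- 2 * a * t) * (t * exp (- A - B * (norm v)\<^sup>2)) \<le> exp (- 2 * a * t) * (f0 v + t * (L f0 v + a * f0 v))"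
      by (rule mult_left_mono) simp
    also have "\<dots> \<le> f v" by (rule elim(1))
    finally have "exp (- 2 * a * t) * (t * exp (- A - B * (norm v)\<^sup>2)) \<le> f v" .
    moreover have "exp (- 2 * a * t) * (t * exp (- A - B * (norm v)\<^sup>2)) = exp (- (A + 2 * a * t - ln t) - B * (norm v)\<^sup>2)"
    proof -
      have "- (A + 2 * a * t - ln t) - B * (norm v)\<^sup>2 = - 2 * a * t + (ln t + (- A - B * (norm v)\<^sup>2))" by simp
      then show ?thesis using t0 by (simp only: exp_add exp_ln)
    qed
    ultimately show ?case by simp
  qed
  with AB(1) show ?thesis by blast
qed

end

end

subsection \<open>Entropy production along the flow\<close>

lemma initial_datum_prob_density:
  fixes f0 :: "'a::euclidean_space \<Rightarrow> real"
  assumes f0: "initial_datum p f0" and p: "1 < p"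
  shows "prob_density f0" "Hq p f0 = ennreal (Hp_entropy p f0)" "0 \<le> Hp_entropy p f0"
proof -
  have f: "integrable lborel f0" "AE v in lborel. 0 \<le> f0 v" "(\<integral>v. f0 v \<partial>lborel) = 1" "integrable lborel (Hp_density p f0)"
    using f0 by (auto simp: initial_datum_def)
  have [measurable]: "f0 \<in> borel_measurable borel" using f by auto
  show "prob_density f0" using f by (simp add: prob_density_def)
  have nn: "0 \<le> Hp_density p f0 v" for v by (simp add: Hp_density_def)
  have "Hq p f0 = (\<integral>\<^sup>+v. ennreal (maxwellian v) * ennreal (dens f0 v powr p) \<partial>lborel)"
    unfolding Hq_def by (rule nn_integral_maxwell) simp
  also have "\<dots> = (\<integral>\<^sup>+v. ennreal (Hp_density p f0 v) \<partial>lborel)"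
  proof (rule nn_integral_cong_AE, use f(2) in eventually_elim)
    case (elim v)
    have "maxwellian v * (f0 v / maxwellian v) powr p = maxwellian v powr (1 - p) * f0 v powr p"
      using elim by (simp add: powr_divide powr_diff)
    then show ?case using elim by (simp add: dens_def Hp_density_def ennreal_mult[symmetric])
  qed
  also have "\<dots> = ennreal (Hp_entropy p f0)"
    unfolding Hp_entropy_def by (rule nn_integral_eq_integral[OF f(4)]) (simp add: nn)
  finally show "Hq p f0 = ennreal (Hp_entropy p f0)" .
  show "0 \<le> Hp_entropy p f0" unfolding Hp_entropy_def using nn by (rule Bochner_Integration.integral_nonneg)
qed

lemma ent_le_powr:
  assumes p: "1 < p" and x: "0 \<le> x"
  shows "ent x \<le> x powr p / (p - 1) + 1"
proof (cases "x \<le> 1")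
  case True
  then have "ln x \<le> 0" using x by (cases "x = 0") auto
  then have "x * ln x \<le> 0" using x by (intro mult_nonneg_nonpos)
  moreover have "0 \<le> x powr p / (p - 1)" using p by simp
  ultimately show ?thesis using x by (simp add: ent_def)
next
  case False
  have "x * ln x \<le> x * (x powr (p - 1) / (p - 1))" using False p by (intro mult_left_mono ln_powr_bound) auto
  also have "\<dots> = x powr p / (p - 1)" using False by (simp add: powr_diff)
  finally show ?thesis using x by (simp add: ent_def)
qed

lemma Ent_le:
  fixes f :: "'a::euclidean_space \<Rightarrow> real"
  assumes [measurable]: "f \<in> borel_measurable borel" and p: "1 < p" and K: "Hq p f \<le> ennreal K" "0 \<le> K"
  shows "Ent f \<le> ennreal (K / (p - 1) + 1)"
proof -
  have "Ent f \<le> (\<integral>\<^sup>+v. ennreal (1 / (p - 1)) * ennreal (dens f v powr p) + 1 \<partial>maxwell_measure)"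
    unfolding Ent_def
  proof (rule nn_integral_mono)
    fix v
    have "ennreal (ent (dens f v)) \<le> ennreal (1 / (p - 1) * dens f v powr p + 1)"
      using ent_le_powr[OF p, of "dens f v"] by (intro ennreal_leI) simp
    also have "\<dots> = ennreal (1 / (p - 1) * dens f v powr p) + 1" using p by (subst ennreal_plus) auto
    also have "ennreal (1 / (p - 1) * dens f v powr p) = ennreal (1 / (p - 1)) * ennreal (dens f v powr p)"
      using p by (intro ennreal_mult) auto
    finally show "ennreal (ent (dens f v)) \<le> ennreal (1 / (p - 1)) * ennreal (dens f v powr p) + 1" .
  qed
  also have "\<dots> = ennreal (1 / (p - 1)) * Hq p f + 1"
    unfolding Hq_def by (simp add: nn_integral_add nn_integral_cmult maxwell.emeasure_space_1[simplified])
  also have "\<dots> \<le> ennreal (1 / (p - 1)) * ennreal K + 1" by (intro add_right_mono mult_left_mono K) simp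
  also have "ennreal (1 / (p - 1)) * ennreal K = ennreal (K / (p - 1))" using p K by (simp add: ennreal_mult[symmetric])
  also have "ennreal (K / (p - 1)) + 1 = ennreal (K / (p - 1) + 1)" using p K by (subst ennreal_plus) auto
  finally show ?thesis .
qed

lemma maxwellian_integrable: "integrable lborel (maxwellian :: 'a::euclidean_space \<Rightarrow> real)"
  and maxwellian_integral: "(\<integral>v. maxwellian (v::'a) \<partial>lborel) = 1"
proof -
  show "integrable lborel (maxwellian :: 'a \<Rightarrow> real)"
    by (rule integrableI_nonneg) (simp_all add: nn_integral_maxwellian)
  show "(\<integral>v. maxwellian (v::'a) \<partial>lborel) = 1"
    by (subst integral_eq_nn_integral) (simp_all add: nn_integral_maxwellian)
qed

lemma ent_density_integrable:
  fixes f :: "'a::euclidean_space \<Rightarrow> real"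
  assumes [measurable]: "f \<in> borel_measurable borel" and fin: "Ent f < \<infinity>"
  shows "integrable lborel (\<lambda>v. maxwellian v * ent (dens f v))"
    and "(\<integral>v. maxwellian v * ent (dens f v) \<partial>lborel) = enn2real (Ent f)"
proof -
  have nn: "0 \<le> maxwellian v * ent (dens f v)" for v by (simp add: ent_nonneg)
  have e: "(\<integral>\<^sup>+v. ennreal (maxwellian v * ent (dens f v)) \<partial>lborel) = Ent f"
    unfolding Ent_def by (subst nn_integral_maxwell) (simp_all add: ennreal_mult ent_nonneg)
  show "integrable lborel (\<lambda>v. maxwellian v * ent (dens f v))"
    by (rule integrableI_nonneg) (use e fin nn in simp_all)
  show "(\<integral>v. maxwellian v * ent (dens f v) \<partial>lborel) = enn2real (Ent f)"
    by (subst integral_eq_nn_integral) (use e nn in simp_all)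
qed

text \<open>Almost everywhere the two integrands differ by \<open>f - M\<close>, which has integral
  zero since both are probability densities.\<close>

lemma entropy_density_integrable:
  fixes f :: "'a::euclidean_space \<Rightarrow> real"
  assumes f: "prob_density f" and fin: "Ent f < \<infinity>"
  shows "integrable lborel (entropy_density f)" "rel_entropy f = enn2real (Ent f)"
proof -
  have fi: "integrable lborel f" "AE v in lborel. 0 \<le> f v" "(\<integral>v. f v \<partial>lborel) = 1" using f by (auto simp: prob_density_def)
  have fm[measurable]: "f \<in> borel_measurable borel" using fi by auto
  have [measurable]: "entropy_density f \<in> borel_measurable borel" unfolding entropy_density_def[abs_def] by measurable
  have eq: "AE v in lborel. entropy_density f v = maxwellian v * ent (dens f v) + f v - maxwellian v"
    using fi(2)
  proof eventually_elim
    case (elim v)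
    then have "dens f v = f v / maxwellian v" by (simp add: dens_def)
    moreover have "maxwellian v * (dens f v * ln (dens f v)) = f v * ln (dens f v)" using elim by (simp add: dens_def)
    moreover have "maxwellian v * dens f v = f v" using elim by (simp add: dens_def)
    ultimately show ?case by (simp add: entropy_density_def ent_def algebra_simps)
  qed
  note i = ent_density_integrable[OF fm fin]
  have ii: "integrable lborel (\<lambda>v. maxwellian v * ent (dens f v) + f v - maxwellian v)"
    using i(1) fi(1) maxwellian_integrable[where 'a='a] by simp
  show "integrable lborel (entropy_density f)"
    using integrable_cong_AE[OF _ _ eq] ii by simp
  have "rel_entropy f = (\<integral>v. maxwellian v * ent (dens f v) + f v - maxwellian v \<partial>lborel)"
    unfolding rel_entropy_def using eq by (intro integral_cong_AE) simp_all
  then show "rel_entropy f = enn2real (Ent f)"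
    using i fi maxwellian_integrable[where 'a='a] by (simp add: maxwellian_integral)
qed

section \<open>Integrability of the logarithm and Gibbs' inequality\<close>

lemma mult_powr_le:
  fixes k h p :: real
  assumes "0 \<le> k" "0 \<le> h" "1 < p"
  shows "k * h powr (p - 1) \<le> k powr p + h powr p"
proof (cases "k \<le> h")
  case True
  then have "k * h powr (p - 1) \<le> h * h powr (p - 1)" by (intro mult_right_mono) auto
  also have "\<dots> = h powr p" using assms by (cases "h = 0") (auto simp: powr_diff)
  finally show ?thesis by (simp add: add_increasing)
next
  case False
  then have "k * h powr (p - 1) \<le> k * k powr (p - 1)" using assms by (intro mult_left_mono powr_mono2) auto
  also have "\<dots> = k powr p" using assms False by (simp add: powr_diff)
  finally show ?thesis by (simp add: add_increasing2)
qed

lemma abs_mult_ln_le: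
  fixes k h p l :: real
  assumes k: "0 \<le> k" and h: "0 < h" and p: "1 < p" and l: "- ln h \<le> l" "0 \<le> l"
  shows "\<bar>k * ln h\<bar> \<le> 1 / (p - 1) * (k powr p + h powr p) + k * l"
proof (cases "1 \<le> h")
  case True
  then have "\<bar>k * ln h\<bar> = k * ln h" using k by simp
  also have "\<dots> \<le> k * (h powr (p - 1) / (p - 1))" using True k p by (intro mult_left_mono ln_powr_bound) auto
  also have "\<dots> \<le> (k powr p + h powr p) / (p - 1)"
    using mult_powr_le[of k h p] k h p by (simp add: divide_right_mono)
  finally show ?thesis using k l by (simp add: add_increasing2)
next
  case False
  then have "ln h \<le> 0" using h by simp
  then have "\<bar>k * ln h\<bar> = k * (- ln h)" using k by (simp add: abs_mult)
  also have "\<dots> \<le> k * l" using l k by (intro mult_left_mono) auto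
  finally have "\<bar>k * ln h\<bar> \<le> k * l" .
  moreover have "0 \<le> 1 / (p - 1) * (k powr p + h powr p)" using p by simp
  ultimately show ?thesis by linarith
qed

context soft_collisions
begin

lemma Ent_euler_le_Ent:
  assumes f: "prob_density f" and \<tau>: "0 \<le> \<tau>" "\<tau> * a \<le> 1"
  shows "Ent (euler \<tau> f) \<le> Ent f"
proof -
  have fi: "integrable lborel f" using f by (simp add: prob_density_def)
  have [measurable]: "f \<in> borel_measurable borel" "euler \<tau> f \<in> borel_measurable borel"
    using fi integrable_euler[OF fi] by auto
  show ?thesis unfolding Ent_def
    by (rule ent_step_le[OF _ _ _ _ freq_euler_le[OF \<tau>] _ _ prob_density_mass[OF f] euler_dens(1)[OF f \<tau>]]) (use \<tau> in simp_all)
qed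

text \<open>Where the density is above one, its logarithm is bounded by a power and the weighted
  \<open>p\<close>-norms suffice. Below one, the Gaussian lower bound makes the logarithm at most
  quadratic in \<open>norm v\<close>, and this is covered by the exponential moment of
  \<open>F\<close>.\<close>

lemma ln_dens_integrable:
  assumes f: "prob_density f" and F: "prob_density F" and p: "1 < p"
    and K: "Hq p f \<le> ennreal K" "Hq p F \<le> ennreal K" "0 \<le> K"
    and B: "0 \<le> B" and low: "AE v in lborel. exp (- A - B * (norm v)\<^sup>2) \<le> f v"
  shows "integrable lborel (\<lambda>v. F v * ln (f v / maxwellian v))"
proof -
  have fi: "integrable lborel f" "AE v in lborel. 0 \<le> f v" using f by (auto simp: prob_density_def)
  have Fi: "integrable lborel F" "AE v in lborel. 0 \<le> F v" using F by (auto simp: prob_density_def)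
  have [measurable]: "f \<in> borel_measurable borel" "F \<in> borel_measurable borel" using fi Fi by auto
  define \<kappa> where "\<kappa> = 4 * tail_rate p"
  have \<kappa>: "0 < \<kappa>" using tail_rate_pos[OF p] by (simp add: \<kappa>_def)
  define C where "C = \<bar>A\<bar> + B / \<kappa>"
  have C: "0 \<le> C" using B \<kappa> by (simp add: C_def)
  have em: "(\<integral>\<^sup>+v. ennreal (dens F v * exp (\<kappa> * (norm v)\<^sup>2)) \<partial>maxwell_measure) \<le> ennreal (K + gauss_const TYPE('b))"
    using exp_moment[of "dens F" p K] p K by (simp add: \<kappa>_def Hq_def)
  have "(\<integral>\<^sup>+v. ennreal (norm (F v * ln (f v / maxwellian v))) \<partial>lborel) \<le>
    (\<integral>\<^sup>+v. ennreal (maxwellian v) * (ennreal (1 / (p - 1)) * (ennreal (dens F v powr p) + ennreal (dens f v powr p)) +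
       ennreal C * ennreal (dens F v * exp (\<kappa> * (norm v)\<^sup>2))) \<partial>lborel)"
  proof (rule nn_integral_mono_AE, use low fi(2) Fi(2) in eventually_elim)
    case (elim v)
    have f0: "0 < f v" using elim(1) by (rule less_le_trans[OF exp_gt_zero])
    have h: "dens f v = f v / maxwellian v" "0 < dens f v" using f0 by (simp_all add: dens_def)
    have k: "F v = maxwellian v * dens F v" using elim by (simp add: dens_def)
    have "f v \<le> dens f v" unfolding h(1) using f0 maxwellian_le_1[of v] by (simp add: le_divide_eq mult_left_le)
    then have "exp (- A - B * (norm v)\<^sup>2) \<le> dens f v" using elim(1) by linarith
    then have "- A - B * (norm v)\<^sup>2 \<le> ln (dens f v)" using h(2) by (simp add: ln_ge_iff)
    then have l: "- ln (dens f v) \<le> \<bar>A\<bar> + B * (norm v)\<^sup>2" by linarith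
    have e1: "1 + \<kappa> * (norm v)\<^sup>2 \<le> exp (\<kappa> * (norm v)\<^sup>2)" by (rule exp_ge_add_one_self)
    have "\<bar>A\<bar> + B * (norm v)\<^sup>2 \<le> C * exp (\<kappa> * (norm v)\<^sup>2)"
    proof -
      have n: "0 \<le> \<kappa> * (norm v)\<^sup>2" using \<kappa> by simp
      have "\<bar>A\<bar> * 1 \<le> \<bar>A\<bar> * exp (\<kappa> * (norm v)\<^sup>2)" using e1 n by (intro mult_left_mono) auto
      moreover have "B / \<kappa> * (\<kappa> * (norm v)\<^sup>2) \<le> B / \<kappa> * exp (\<kappa> * (norm v)\<^sup>2)" using e1 B \<kappa> by (intro mult_left_mono, linarith) simp
      moreover have "B / \<kappa> * (\<kappa> * (norm v)\<^sup>2) = B * (norm v)\<^sup>2" using \<kappa> by simp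
      ultimately show ?thesis unfolding C_def distrib_right by linarith
    qed
    with l have l': "- ln (dens f v) \<le> C * exp (\<kappa> * (norm v)\<^sup>2)" by linarith
    have "\<bar>dens F v * ln (dens f v)\<bar> \<le> 1 / (p - 1) * (dens F v powr p + dens f v powr p) + dens F v * (C * exp (\<kappa> * (norm v)\<^sup>2))"
      by (rule abs_mult_ln_le[OF _ h(2) p l']) (use C in simp_all)
    then have "maxwellian v * \<bar>dens F v * ln (dens f v)\<bar> \<le> maxwellian v * (1 / (p - 1) * (dens F v powr p + dens f v powr p) + dens F v * (C * exp (\<kappa> * (norm v)\<^sup>2)))"
      by (rule mult_left_mono) simp
    then have "norm (F v * ln (f v / maxwellian v)) \<le> maxwellian v * (1 / (p - 1) * (dens F v powr p + dens f v powr p) + C * (dens F v * exp (\<kappa> * (norm v)\<^sup>2)))"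
      unfolding h(1)[symmetric] by (subst k) (simp add: abs_mult mult_ac)
    then have "ennreal (norm (F v * ln (f v / maxwellian v))) \<le> ennreal (maxwellian v * (1 / (p - 1) * (dens F v powr p + dens f v powr p) + C * (dens F v * exp (\<kappa> * (norm v)\<^sup>2))))"
      by (rule ennreal_leI)
    also have "\<dots> = ennreal (maxwellian v) * (ennreal (1 / (p - 1)) * (ennreal (dens F v powr p) + ennreal (dens f v powr p)) +
       ennreal C * ennreal (dens F v * exp (\<kappa> * (norm v)\<^sup>2)))"
    proof -
      have "ennreal (1 / (p - 1) * (dens F v powr p + dens f v powr p)) = ennreal (1 / (p - 1)) * (ennreal (dens F v powr p) + ennreal (dens f v powr p))"
        using p by (subst ennreal_mult) simp_all
      moreover have "ennreal (C * (dens F v * exp (\<kappa> * (norm v)\<^sup>2))) = ennreal C * ennreal (dens F v * exp (\<kappa> * (norm v)\<^sup>2))"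
        using C by (intro ennreal_mult) auto
      ultimately show ?thesis using p C by (subst ennreal_mult, simp, simp, subst ennreal_plus) simp_all
    qed
    finally show ?case .
  qed
  also have "\<dots> = (\<integral>\<^sup>+v. ennreal (1 / (p - 1)) * (ennreal (dens F v powr p) + ennreal (dens f v powr p)) +
       ennreal C * ennreal (dens F v * exp (\<kappa> * (norm v)\<^sup>2)) \<partial>maxwell_measure)"
    by (rule nn_integral_maxwell[symmetric]) measurable
  also have "\<dots> = ennreal (1 / (p - 1)) * (Hq p F + Hq p f) + ennreal C * (\<integral>\<^sup>+v. ennreal (dens F v * exp (\<kappa> * (norm v)\<^sup>2)) \<partial>maxwell_measure)"
    unfolding Hq_def by (simp add: nn_integral_add nn_integral_cmult)
  also have "\<dots> \<le> ennreal (1 / (p - 1)) * (ennreal K + ennreal K) + ennreal C * ennreal (K + gauss_const TYPE('b))"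
    by (intro add_mono mult_left_mono K(1,2) em) simp_all
  also have "\<dots> < \<infinity>" by (simp add: ennreal_mult_less_top ennreal_add_less_top)
  finally show ?thesis by (intro integrableI_bounded) auto
qed

text \<open>Writing \<open>L f\<close> as the Euler increment divided by \<tau>, the production
  becomes the entropy of \<open>f\<close> minus the integral of \<open>F\<close> against
  \<open>ln (f / M)\<close>, and Gibbs' inequality bounds that integral by the entropy of
  \<open>F\<close>. No limit in \<tau> is taken: every admissible step size gives a bound.\<close>

lemma entropy_production_ge:
  assumes f: "prob_density f" and p: "1 < p"
    and K: "Hq p f \<le> ennreal K" "0 \<le> K"
    and B: "0 \<le> B" and low: "AE v in lborel. exp (- A - B * (norm v)\<^sup>2) \<le> f v"
    and \<tau>: "0 < \<tau>" "\<tau> * a \<le> 1"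
  shows "enn2real (Ent f) - enn2real (Ent (euler \<tau> f)) \<le> \<tau> * entropy_production \<gamma> b f"
proof -
  define F where "F = euler \<tau> f"
  have \<tau>': "0 \<le> \<tau>" using \<tau> by simp
  have Fp: "prob_density F" unfolding F_def by (rule prob_density_euler[OF f \<tau>' \<tau>(2)])
  have KF: "Hq p F \<le> ennreal K" unfolding F_def using Hq_euler_le[OF f \<tau>' \<tau>(2) p] K(1) by (rule order_trans)
  have fi: "integrable lborel f" "AE v in lborel. 0 \<le> f v" "(\<integral>v. f v \<partial>lborel) = 1" using f by (auto simp: prob_density_def)
  have Fi: "integrable lborel F" "AE v in lborel. 0 \<le> F v" "(\<integral>v. F v \<partial>lborel) = 1" using Fp by (auto simp: prob_density_def)
  have fm: "f \<in> borel_measurable borel" "F \<in> borel_measurable borel" using fi Fi by auto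
  have fin: "Ent f < \<infinity>" "Ent F < \<infinity>"
    using le_less_trans[OF Ent_le[OF fm(1) p K]] le_less_trans[OF Ent_le[OF fm(2) p KF K(2)]] by auto
  let ?l = "\<lambda>v. ln (f v / maxwellian v)"
  have I: "integrable lborel (\<lambda>v. F v * ?l v)" by (rule ln_dens_integrable[OF f Fp p K(1) KF K(2) B low])
  have J: "integrable lborel (\<lambda>v. f v * ?l v)" and Hf: "(\<integral>v. f v * ?l v \<partial>lborel) = enn2real (Ent f)"
    using entropy_density_integrable[OF f fin(1)] by (simp_all add: entropy_density_def[abs_def] rel_entropy_def)
  have "(\<integral>v. F v * ?l v \<partial>lborel) \<le> (\<integral>v. maxwellian v * ent (dens F v) + f v - maxwellian v \<partial>lborel)"
  proof (rule integral_mono_AE[OF I])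
    show "integrable lborel (\<lambda>v. maxwellian v * ent (dens F v) + f v - maxwellian v)"
      using ent_density_integrable(1)[OF fm(2) fin(2)] fi(1) maxwellian_integrable[where 'a='a] by simp
    show "AE v in lborel. F v * ?l v \<le> maxwellian v * ent (dens F v) + f v - maxwellian v"
      using low Fi(2)
    proof eventually_elim
      case (elim v)
      have f0: "0 < f v" using elim(1) by (rule less_le_trans[OF exp_gt_zero])
      have "dens F v * ?l v \<le> ent (dens F v) + f v / maxwellian v - 1" using f0 by (intro ent_young) auto
      then have "maxwellian v * (dens F v * ?l v) \<le> maxwellian v * (ent (dens F v) + f v / maxwellian v - 1)"
        by (rule mult_left_mono) simp
      also have "\<dots> = maxwellian v * ent (dens F v) + f v - maxwellian v" by (simp add: algebra_simps)
      also have "maxwellian v * (dens F v * ?l v) = F v * ?l v" using elim by (simp add: dens_def)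
      finally show ?case .
    qed
  qed
  also have "\<dots> = enn2real (Ent F)"
    using ent_density_integrable[OF fm(2) fin(2)] fi maxwellian_integrable[where 'a='a] by (simp add: maxwellian_integral)
  finally have le: "(\<integral>v. F v * ?l v \<partial>lborel) \<le> enn2real (Ent F)" .
  have "L f v * ?l v = (1 / \<tau>) * (F v * ?l v - f v * ?l v)" for v
  proof -
    have "F v * ?l v - f v * ?l v = \<tau> * (L f v * ?l v)" by (simp add: F_def euler_def algebra_simps)
    then show ?thesis using \<tau> by simp
  qed
  then have "(\<integral>v. L f v * ?l v \<partial>lborel) = (1 / \<tau>) * ((\<integral>v. F v * ?l v \<partial>lborel) - (\<integral>v. f v * ?l v \<partial>lborel))"
    using I J by simp
  then have "\<tau> * entropy_production \<gamma> b f = (\<integral>v. f v * ?l v \<partial>lborel) - (\<integral>v. F v * ?l v \<partial>lborel)"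
    unfolding entropy_production_def using \<tau> by simp
  then show ?thesis using le Hf unfolding F_def by simp
qed

end

context boltzmann_flow
begin

context
  fixes f0 f :: "'a \<Rightarrow> real" and t p K :: real
  assumes f0: "prob_density f0" and t: "0 \<le> t" and f: "integrable lborel f" "AE v in lborel. f v = U t f0 v"
    and p: "1 < p" and K: "Hq p f0 \<le> ennreal K" "0 \<le> K"
begin

lemma flow_Ent_finite: "Ent f \<le> ennreal (K / (p - 1) + 1)"
  using f flow_Hq[OF f0 t f p] K p by (intro Ent_le[OF _ p]) (auto intro: order_trans)

lemma flow_entropy_integrable: "integrable lborel (entropy_density f)"
  and flow_rel_entropy: "ennreal (rel_entropy f) = Ent f"
  and flow_rel_entropy_nonneg: "0 \<le> rel_entropy f"
  and flow_rel_entropy_le: "rel_entropy f \<le> K / (p - 1) + 1"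
proof -
  have fin: "Ent f < \<infinity>" using flow_Ent_finite by (rule le_less_trans) simp
  note e = entropy_density_integrable[OF flow_prob_density[OF f0 t f] fin]
  show "integrable lborel (entropy_density f)" by (rule e(1))
  show r: "ennreal (rel_entropy f) = Ent f" using fin by (simp add: e(2))
  show "0 \<le> rel_entropy f" by (simp add: e(2))
  show "rel_entropy f \<le> K / (p - 1) + 1"
    using flow_Ent_finite p K unfolding r[symmetric] by (subst (asm) ennreal_le_iff) auto
qed

lemma flow_rel_entropy_decay:
  assumes R: "1 \<le> R"
  shows "rel_entropy f \<le> exp (- t * R powr \<gamma> / 2) * (K / (p - 1) + 1) + tail_const TYPE('a) p K * exp (- tail_rate p * R\<^sup>2)"
proof -
  have T: "0 \<le> tail_const TYPE('a) p K" using tail_const_pos[OF p K(2), where 'a='a] by simp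
  have f0m: "f0 \<in> borel_measurable borel" using f0 by (auto simp: prob_density_def)
  have "Ent f \<le> ennreal (exp (- t * R powr \<gamma> / 2)) * Ent f0 + ennreal (tail_const TYPE('a) p K * exp (- tail_rate p * R\<^sup>2))"
    by (rule flow_Ent[OF f0 t f p R K])
  also have "\<dots> \<le> ennreal (exp (- t * R powr \<gamma> / 2)) * ennreal (K / (p - 1) + 1) + ennreal (tail_const TYPE('a) p K * exp (- tail_rate p * R\<^sup>2))"
    by (intro add_right_mono mult_left_mono Ent_le[OF f0m p K]) simp
  also have "\<dots> = ennreal (exp (- t * R powr \<gamma> / 2) * (K / (p - 1) + 1) + tail_const TYPE('a) p K * exp (- tail_rate p * R\<^sup>2))"
    using T K p by (simp add: ennreal_mult[symmetric] ennreal_plus[symmetric] del: ennreal_plus)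
  finally show ?thesis
    unfolding flow_rel_entropy[symmetric] using T K p by (subst (asm) ennreal_le_iff) auto
qed

lemma flow_entropy_production:
  assumes t0: "0 < t" and d: "2 \<le> DIM('a)" and b0: "0 < b0" "\<And>x. x \<in> {-1..1} \<Longrightarrow> b0 * sqrt (1 - x\<^sup>2) \<le> b x"
  shows "0 \<le> entropy_production \<gamma> b f"
    and "1 \<le> R \<Longrightarrow> R powr \<gamma> / 2 * (rel_entropy f - tail_const TYPE('a) p K * exp (- tail_rate p * R\<^sup>2)) \<le> entropy_production \<gamma> b f"
proof -
  have fp: "prob_density f" by (rule flow_prob_density[OF f0 t f])
  have Kf: "Hq p f \<le> ennreal K" using flow_Hq[OF f0 t f p] K(1) by (rule order_trans)
  obtain A B where AB: "0 \<le> B" "AE v in lborel. exp (- A - B * (norm v)\<^sup>2) \<le> f v"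
    using flow_lower_bound[OF f0 t f t0 d b0] by blast
  \<comment> \<open>The largest step to which the entropy drop applies; it cancels from the final
    bound, so the bound does not involve \<open>a\<close>.\<close>
  define \<tau> where "\<tau> = 1 / (2 * a)"
  have \<tau>: "0 < \<tau>" "\<tau> * (2 * a) \<le> 1" using a_ge by (auto simp: \<tau>_def)
  have \<tau>a: "0 \<le> \<tau>" "\<tau> * a \<le> 1" using small_step[OF \<tau>] by auto
  have prod: "rel_entropy f - enn2real (Ent (euler \<tau> f)) \<le> \<tau> * entropy_production \<gamma> b f"
    using entropy_production_ge[OF fp p Kf K(2) AB \<tau>(1) \<tau>a(2)] flow_rel_entropy flow_rel_entropy_nonneg
    by (metis enn2real_ennreal)
  have "enn2real (Ent (euler \<tau> f)) \<le> rel_entropy f"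
    using Ent_euler_le_Ent[OF fp \<tau>a] flow_rel_entropy flow_rel_entropy_nonneg
    by (metis enn2real_leI)
  then have "0 \<le> \<tau> * entropy_production \<gamma> b f" using prod by linarith
  then show "0 \<le> entropy_production \<gamma> b f" using \<tau>(1) by (simp add: zero_le_mult_iff)
  assume R: "1 \<le> R"
  define e where "e = tail_const TYPE('a) p K * exp (- tail_rate p * R\<^sup>2)"
  have e: "0 \<le> e" using tail_const_pos[OF p K(2), where 'a='a] by (simp add: e_def)
  define s where "s = \<tau> * R powr \<gamma> / 2"
  have "R powr \<gamma> \<le> 1" using R \<gamma>_neg powr_mono2'[of \<gamma> 1 R] by simp
  moreover have "\<tau> \<le> 1" using a_ge by (simp add: \<tau>_def)
  ultimately have "\<tau> * R powr \<gamma> \<le> 1 * 1" using \<tau>a by (intro mult_mono) auto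
  then have s: "0 \<le> s" "s \<le> 1" using \<tau>a by (auto simp: s_def)
  have "Ent (euler \<tau> f) \<le> ennreal (1 - s) * Ent f + ennreal (s * e)"
    unfolding s_def e_def by (rule Ent_euler_le[OF fp \<tau> p R Kf K(2)])
  also have "\<dots> = ennreal ((1 - s) * rel_entropy f + s * e)"
    unfolding flow_rel_entropy[symmetric] using s e flow_rel_entropy_nonneg
    by (simp add: ennreal_mult[symmetric] ennreal_plus[symmetric] del: ennreal_plus)
  finally have "enn2real (Ent (euler \<tau> f)) \<le> (1 - s) * rel_entropy f + s * e"
    using s e flow_rel_entropy_nonneg by (intro enn2real_leI) auto
  then have "s * (rel_entropy f - e) \<le> \<tau> * entropy_production \<gamma> b f"
    using prod by (simp add: algebra_simps)
  then have "\<tau> * (R powr \<gamma> / 2 * (rel_entropy f - e)) \<le> \<tau> * entropy_production \<gamma> b f"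
    by (simp add: s_def mult_ac)
  then show "R powr \<gamma> / 2 * (rel_entropy f - e) \<le> entropy_production \<gamma> b f"
    using \<tau>(1) by (simp only: mult_le_cancel_left_pos)
qed

end

end

subsection \<open>Optimising the truncation radius\<close>

text \<open>The radius is chosen so that the tail is at most half of the entropy, which turns
  \<open>R powr \<gamma>\<close> into a power of a logarithm. The factor \<open>exp \<kappa>\<close>
  in \<open>C\<close> guarantees \<open>1 \<le> R\<close>, and the factor two in
  \<open>1 / (2 * C)\<close> keeps the argument of the logarithm at most one half.\<close>

lemma optimise_production:
  fixes H Hm T \<kappa> \<gamma> D :: real
  assumes \<gamma>: "\<gamma> < 0" and H: "0 \<le> H" "H \<le> Hm" and T: "0 < T" and \<kappa>: "0 < \<kappa>" and D: "0 \<le> D"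
    and le: "\<And>R. 1 \<le> R \<Longrightarrow> R powr \<gamma> / 2 * (H - T * exp (- \<kappa> * R\<^sup>2)) \<le> D"
  defines "C \<equiv> (T + Hm) * exp \<kappa>"
  shows "1 / (2 * C) * H \<noteq> 1 \<and> \<kappa> powr (\<bar>\<gamma>\<bar> / 2) / 4 * H / \<bar>ln (1 / (2 * C) * H)\<bar> powr (\<bar>\<gamma>\<bar> / 2) \<le> D"
proof (cases "H = 0")
  case True
  then show ?thesis using D by simp
next
  case False
  then have H0: "0 < H" using H by simp
  have ek: "1 \<le> exp \<kappa>" using \<kappa> by simp
  have "(T + Hm) * 1 \<le> C" unfolding C_def using ek T H by (intro mult_left_mono) auto
  then have TC: "T \<le> C" using order_trans[OF H] by simp
  have HC: "H * exp \<kappa> \<le> C" unfolding C_def using H T by (intro mult_right_mono) auto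
  have "H * 1 \<le> H * exp \<kappa>" using ek H0 by (intro mult_left_mono) auto
  then have "H \<le> C" using HC by linarith
  then have C: "0 < C" using H0 by linarith
  define l where "l = ln (2 * C / H)"
  have "exp \<kappa> \<le> 2 * C / H" using HC H0 C by (simp add: le_divide_eq mult.commute)
  then have "ln (exp \<kappa>) \<le> l" unfolding l_def using H0 C by (subst ln_le_cancel_iff) auto
  then have l: "\<kappa> \<le> l" by simp
  \<comment> \<open>Solves \<open>exp (- \<kappa> * R\<^sup>2) = H / (2 * C)\<close>.\<close>
  define R where "R = sqrt (l / \<kappa>)"
  have lk: "1 \<le> l / \<kappa>" using l \<kappa> by (simp add: le_divide_eq)
  have R: "1 \<le> R" "R\<^sup>2 = l / \<kappa>" using lk by (simp_all add: R_def)
  have "exp (- \<kappa> * R\<^sup>2) = exp (- l)" using \<kappa> by (simp add: R(2))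
  also have "\<dots> = H / (2 * C)" unfolding l_def using H0 C by (simp add: exp_minus inverse_eq_divide)
  finally have ex: "exp (- \<kappa> * R\<^sup>2) = H / (2 * C)" .
  have "T * (H / (2 * C)) \<le> C * (H / (2 * C))" using TC H0 C by (intro mult_right_mono) auto
  also have "\<dots> = H / 2" using C by simp
  finally have "H / 2 \<le> H - T * exp (- \<kappa> * R\<^sup>2)" unfolding ex by linarith
  then have "R powr \<gamma> / 2 * (H / 2) \<le> R powr \<gamma> / 2 * (H - T * exp (- \<kappa> * R\<^sup>2))" by (intro mult_left_mono) auto
  also have "\<dots> \<le> D" by (rule le[OF R(1)])
  finally have main: "R powr \<gamma> / 4 * H \<le> D" by simp
  have "R powr \<gamma> = (l / \<kappa>) powr (\<gamma> / 2)"
    unfolding R_def using lk by (simp add: powr_half_sqrt[symmetric] powr_powr)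
  also have "\<gamma> / 2 = - (\<bar>\<gamma>\<bar> / 2)" using \<gamma> by simp
  also have "(l / \<kappa>) powr - (\<bar>\<gamma>\<bar> / 2) = \<kappa> powr (\<bar>\<gamma>\<bar> / 2) / l powr (\<bar>\<gamma>\<bar> / 2)"
    using l \<kappa> by (simp add: powr_minus powr_divide inverse_eq_divide)
  finally have Rg: "R powr \<gamma> = \<kappa> powr (\<bar>\<gamma>\<bar> / 2) / l powr (\<bar>\<gamma>\<bar> / 2)" .
  have "1 / (2 * C) * H = inverse (2 * C / H)" by simp
  then have "ln (1 / (2 * C) * H) = - l" unfolding l_def using H0 C by (simp only: ln_inverse) 
  then have "\<bar>ln (1 / (2 * C) * H)\<bar> = l" using l \<kappa> by simp
  moreover have "1 / (2 * C) * H \<noteq> 1" using \<open>H \<le> C\<close> C by (simp add: divide_eq_eq)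
  ultimately show ?thesis using main unfolding Rg by simp
qed

text \<open>The two exponents \<open>t * R powr \<gamma> / 2\<close> and
  \<open>\<kappa> * R\<^sup>2\<close> are of equal order when \<open>R\<close> is \<open>t\<close>
  to the power 1/(2+|\<gamma>|). This choice is admissible once \<open>1 \<le> t\<close>; for
  earlier times the factor \<open>exp \<Lambda>\<close> makes the claim weaker than the bound
  \<open>Hm\<close>.\<close>

lemma optimise_decay:
  fixes H Hm T \<kappa> \<gamma> t :: real
  assumes \<gamma>: "\<gamma> < 0" and H: "H \<le> Hm" "0 \<le> Hm" and T: "0 \<le> T" and \<kappa>: "0 < \<kappa>" and t: "0 \<le> t"
    and le: "\<And>R. 1 \<le> R \<Longrightarrow> H \<le> exp (- t * R powr \<gamma> / 2) * Hm + T * exp (- \<kappa> * R\<^sup>2)"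
  defines "\<Lambda> \<equiv> min (1/2) \<kappa>"
  shows "H \<le> (Hm + T) * exp \<Lambda> * exp (- \<Lambda> * t powr (2 / (2 + \<bar>\<gamma>\<bar>)))"
proof -
  define \<theta> where "\<theta> = 2 / (2 + \<bar>\<gamma>\<bar>)"
  have \<theta>: "0 < \<theta>" by (simp add: \<theta>_def add_pos_nonneg)
  have \<Lambda>: "0 < \<Lambda>" "\<Lambda> \<le> 1/2" "\<Lambda> \<le> \<kappa>" using \<kappa> by (auto simp: \<Lambda>_def)
  show ?thesis unfolding \<theta>_def[symmetric]
  proof (cases "t \<le> 1")
    case True
    then have "t powr \<theta> \<le> 1" using t \<theta> by (intro powr_le1) auto
    then have "\<Lambda> * t powr \<theta> \<le> \<Lambda> * 1" using \<Lambda> by (intro mult_left_mono) auto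
    then have "1 \<le> exp \<Lambda> * exp (- \<Lambda> * t powr \<theta>)" unfolding exp_add[symmetric] by simp
    then have "(Hm + T) * 1 \<le> (Hm + T) * (exp \<Lambda> * exp (- \<Lambda> * t powr \<theta>))" using H T by (intro mult_left_mono) auto
    then show "H \<le> (Hm + T) * exp \<Lambda> * exp (- \<Lambda> * t powr \<theta>)" using H T by (simp add: mult.assoc)
  next
    case False
    define R where "R = t powr (\<theta> / 2)"
    have R1: "1 \<le> R" unfolding R_def using False \<theta> by (intro ge_one_powr_ge_zero) auto
    have R2: "R\<^sup>2 = t powr \<theta>" by (simp add: R_def power2_eq_square powr_add[symmetric])
    have "t * R powr \<gamma> = t powr (1 + \<theta> / 2 * \<gamma>)" using False by (simp add: R_def powr_powr powr_add)
    also have "1 + \<theta> / 2 * \<gamma> = \<theta>" using \<gamma> by (simp add: \<theta>_def field_simps)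
    finally have tR: "t * R powr \<gamma> = t powr \<theta>" .
    have tp: "0 \<le> t powr \<theta>" by simp
    have a1: "\<Lambda> * t powr \<theta> \<le> 1/2 * t powr \<theta>" and a2: "\<Lambda> * t powr \<theta> \<le> \<kappa> * t powr \<theta>"
      by (rule mult_right_mono[OF \<Lambda>(2) tp], rule mult_right_mono[OF \<Lambda>(3) tp])
    have "- t * R powr \<gamma> / 2 = - (1/2 * t powr \<theta>)" using tR by simp
    then have e1: "exp (- t * R powr \<gamma> / 2) \<le> exp (- \<Lambda> * t powr \<theta>)" using a1 by simp
    have e2: "exp (- \<kappa> * R\<^sup>2) \<le> exp (- \<Lambda> * t powr \<theta>)" unfolding R2 using a2 by simp
    have "H \<le> exp (- t * R powr \<gamma> / 2) * Hm + T * exp (- \<kappa> * R\<^sup>2)" by (rule le[OF R1])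
    also have "\<dots> \<le> exp (- \<Lambda> * t powr \<theta>) * Hm + T * exp (- \<Lambda> * t powr \<theta>)"
      using e1 e2 H T by (intro add_mono mult_left_mono mult_right_mono) auto
    also have "\<dots> = (Hm + T) * 1 * exp (- \<Lambda> * t powr \<theta>)" by (simp add: algebra_simps)
    also have "\<dots> \<le> (Hm + T) * exp \<Lambda> * exp (- \<Lambda> * t powr \<theta>)"
      using H T \<Lambda> by (intro mult_right_mono mult_left_mono) auto
    finally show "H \<le> (Hm + T) * exp \<Lambda> * exp (- \<Lambda> * t powr \<theta>)" .
  qed
qed

section \<open>From the generated semigroup to uniform constants\<close>

lemma boltzmann_flowI:
  fixes \<gamma> :: real and U :: "real \<Rightarrow> ('a::euclidean_space \<Rightarrow> real) \<Rightarrow> 'a \<Rightarrow> real"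
  assumes \<gamma>: "- real DIM('a) < \<gamma>" "\<gamma> < 0" and b: "angular_kernel TYPE('a) b" and U: "generates_L1 (boltzmann_op \<gamma> b) U"
  shows "\<exists>a. boltzmann_flow b \<gamma> a U"
proof -
  obtain a where a: "0 < a" "\<And>v::'a. (\<integral>\<^sup>+w. ennreal (norm (v - w) powr \<gamma>) \<partial>maxwell_measure) \<le> ennreal a"
    using collision_frequency_bounded[OF \<gamma>] by blast
  have "boltzmann_flow b \<gamma> (a + 1) U"
  proof
    show "angular_kernel TYPE('a) b" by (rule b)
    show "\<gamma> < 0" by (rule \<gamma>)
    show "1 \<le> a + 1" using a by simp
    show "collision_freq (\<lambda>r. r powr \<gamma>) v \<le> ennreal (a + 1)" for v :: 'a
    proof -
      have "collision_freq (\<lambda>r. r powr \<gamma>) v \<le> ennreal a" unfolding collision_freq_def by (rule a)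
      also have "\<dots> \<le> ennreal (a + 1)" by (rule ennreal_leI) simp
      finally show ?thesis .
    qed
    show "integrable lborel (boltzmann_op \<gamma> b f)" if "integrable lborel f" for f :: "'a \<Rightarrow> real"
      using U that unfolding generates_L1_def by blast
    show "C0_semigroup_L1 U" using U unfolding generates_L1_def by (rule conjunct1)
    show "((\<lambda>t. L1_norm (\<lambda>v. (U t f v - f v) / t - boltzmann_op \<gamma> b f v)) \<longlongrightarrow> 0) (at_right 0)"
      if "integrable lborel f" for f :: "'a \<Rightarrow> real"
      using U that unfolding generates_L1_def by blast
  qed
  then show ?thesis by blast
qed

text \<open>On the unit interval the lower bound for the kernel is weakest at \<nu> = 1, so that
  every \<nu> reduces to the square root.\<close>

lemma sqrt_le_powr_half:
  fixes y \<nu> :: real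
  assumes "0 \<le> y" "y \<le> 1" "0 \<le> \<nu>" "\<nu> \<le> 1"
  shows "sqrt y \<le> y powr (\<nu> / 2)"
proof (cases "y = 0")
  case False
  then have "sqrt y = y powr (1 / 2)" using assms by (simp add: powr_half_sqrt)
  also have "\<dots> \<le> y powr (\<nu> / 2)" using assms False by (intro powr_mono') auto
  finally show ?thesis .
qed simp

theorem theorem1p5:
  fixes \<gamma> p b0 K :: real
  assumes "CARD('n::finite) \<ge> 2"
    and "- real CARD('n) < \<gamma>" and "\<gamma> < 0"
    and "p > 1" and "b0 > 0"
  shows
    "(\<forall>\<nu> t0. 0 \<le> \<nu> \<and> \<nu> \<le> 1 \<and> 0 < t0 \<longrightarrow>
       (\<exists>C1>0. \<exists>C2>0. \<forall>b (f0 :: real ^ 'n \<Rightarrow> real) f.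
          angular_kernel TYPE(real ^ 'n) b \<and> bounded (b ` {-1..1}) \<and>
          (\<forall>x\<in>{-1..1}. b x \<ge> b0 * (1 - x\<^sup>2) powr (\<nu> / 2)) \<and>
          initial_datum p f0 \<and> Hp_entropy p f0 = K \<and>
          boltzmann_solution \<gamma> b f0 f \<and> (\<forall>t\<ge>0. AE v in lborel. 0 \<le> f t v) \<longrightarrow>
          (\<forall>t\<ge>t0.
             C2 * rel_entropy (f t) \<noteq> 1 \<and>
             entropy_production \<gamma> b (f t)
               \<ge> C1 * rel_entropy (f t) / \<bar>ln (C2 * rel_entropy (f t))\<bar> powr (\<bar>\<gamma>\<bar> / 2))))
     \<and>
     (\<exists>C>0. \<exists>\<Lambda>>0. \<forall>\<nu> b (f0 :: real ^ 'n \<Rightarrow> real) f.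
        0 \<le> \<nu> \<and> \<nu> \<le> 1 \<and>
        angular_kernel TYPE(real ^ 'n) b \<and> bounded (b ` {-1..1}) \<and>
        (\<forall>x\<in>{-1..1}. b x \<ge> b0 * (1 - x\<^sup>2) powr (\<nu> / 2)) \<and>
        initial_datum p f0 \<and> Hp_entropy p f0 = K \<and>
        boltzmann_solution \<gamma> b f0 f \<and> (\<forall>t\<ge>0. AE v in lborel. 0 \<le> f t v) \<longrightarrow>
        (\<forall>t\<ge>0.
           integrable lborel (entropy_density (f t)) \<and>
           rel_entropy (f t) \<le> C * exp (- \<Lambda> * t powr (2 / (2 + \<bar>\<gamma>\<bar>)))))"
proof -
  have d: "DIM(real ^ 'n) = CARD('n)" by simp
  have \<gamma>: "- real DIM(real ^ 'n) < \<gamma>" using assms(2) unfolding d .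
  have d2: "2 \<le> DIM(real ^ 'n)" using assms(1) unfolding d .
  \<comment> \<open>The real \<open>K\<close> is fixed before any initial datum is given and might
    be negative, in which case no datum has it as its value; the modulus keeps all constants
    positive in either case.\<close>
  define Hm where "Hm = \<bar>K\<bar> / (p - 1) + 1"
  define T where "T = tail_const TYPE(real ^ 'n) p \<bar>K\<bar>"
  define \<kappa> where "\<kappa> = tail_rate p"
  have Hm: "0 < Hm" using \<open>p > 1\<close> by (auto simp: Hm_def intro!: add_nonneg_pos)
  have T: "0 < T" unfolding T_def by (rule tail_const_pos[OF \<open>p > 1\<close>]) simp
  have \<kappa>: "0 < \<kappa>" unfolding \<kappa>_def by (rule tail_rate_pos[OF \<open>p > 1\<close>])
  define C where "C = (T + Hm) * exp \<kappa>"
  have C: "0 < C" using T Hm by (simp add: C_def)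
  define \<Lambda> where "\<Lambda> = min (1/2) \<kappa>"
  have \<Lambda>: "0 < \<Lambda>" using \<kappa> by (simp add: \<Lambda>_def)
  \<comment> \<open>Both claims are proved together at a single time, with constants fixed
    beforehand, so that the quantifier order of the two conclusions needs only these
    witnesses.\<close>
  have main: "integrable lborel (entropy_density (f t)) \<and> rel_entropy (f t) \<le> (Hm + T) * exp \<Lambda> * exp (- \<Lambda> * t powr (2 / (2 + \<bar>\<gamma>\<bar>))) \<and>
      (0 < t \<longrightarrow> 1 / (2 * C) * rel_entropy (f t) \<noteq> 1 \<and>
        \<kappa> powr (\<bar>\<gamma>\<bar> / 2) / 4 * rel_entropy (f t) / \<bar>ln (1 / (2 * C) * rel_entropy (f t))\<bar> powr (\<bar>\<gamma>\<bar> / 2) \<le> entropy_production \<gamma> b (f t))"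
    if \<nu>: "0 \<le> \<nu>" "\<nu> \<le> 1" and b: "angular_kernel TYPE(real ^ 'n) b" and low: "\<forall>x\<in>{-1..1}. b x \<ge> b0 * (1 - x\<^sup>2) powr (\<nu> / 2)"
      and f0: "initial_datum p f0" "Hp_entropy p f0 = K" and sol: "boltzmann_solution \<gamma> b f0 f" and t: "0 \<le> t"
    for \<nu> t :: real and b and f0 :: "real ^ 'n \<Rightarrow> real" and f
  proof -
    note init = initial_datum_prob_density[OF f0(1) \<open>p > 1\<close>, unfolded f0(2)]
    have K: "\<bar>K\<bar> = K" using init(3) by simp
    have Kq: "Hq p f0 \<le> ennreal \<bar>K\<bar>" "0 \<le> \<bar>K\<bar>" using init(2,3) by (simp_all add: K)
    obtain U where U: "generates_L1 (boltzmann_op \<gamma> b) U" and fU: "\<forall>t\<ge>0. integrable lborel (f t) \<and> (AE v in lborel. f t v = U t f0 v)"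
      using sol unfolding boltzmann_solution_def by blast
    have f: "integrable lborel (f t)" "AE v in lborel. f t v = U t f0 v" using fU t by auto
    obtain a where "boltzmann_flow b \<gamma> a U" using boltzmann_flowI[OF \<gamma> \<open>\<gamma> < 0\<close> b U] by blast
    then interpret boltzmann_flow b "TYPE(real ^ 'n)" \<gamma> a U .
    note ctx = init(1) t f \<open>p > 1\<close> Kq
    have bs: "b0 * sqrt (1 - x\<^sup>2) \<le> b x" if "x \<in> {-1..1}" for x
    proof -
      have "x\<^sup>2 \<le> 1" using that by (simp add: abs_square_le_1 abs_le_iff)
      then have "b0 * sqrt (1 - x\<^sup>2) \<le> b0 * (1 - x\<^sup>2) powr (\<nu> / 2)"
        using \<nu> \<open>b0 > 0\<close> by (intro mult_left_mono sqrt_le_powr_half) auto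
      also have "\<dots> \<le> b x" using low that by blast
      finally show ?thesis .
    qed
    have H: "0 \<le> rel_entropy (f t)" "rel_entropy (f t) \<le> Hm"
      unfolding Hm_def using flow_rel_entropy_nonneg[OF ctx] flow_rel_entropy_le[OF ctx] by auto
    have "rel_entropy (f t) \<le> (Hm + T) * exp \<Lambda> * exp (- \<Lambda> * t powr (2 / (2 + \<bar>\<gamma>\<bar>)))"
      unfolding \<Lambda>_def
    proof (rule optimise_decay)
      show "rel_entropy (f t) \<le> exp (- t * R powr \<gamma> / 2) * Hm + T * exp (- \<kappa> * R\<^sup>2)" if "1 \<le> R" for R
        unfolding Hm_def T_def \<kappa>_def by (rule flow_rel_entropy_decay[OF ctx that])
    qed (use \<open>\<gamma> < 0\<close> H Hm T \<kappa> t in auto)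
    moreover have "1 / (2 * C) * rel_entropy (f t) \<noteq> 1 \<and>
        \<kappa> powr (\<bar>\<gamma>\<bar> / 2) / 4 * rel_entropy (f t) / \<bar>ln (1 / (2 * C) * rel_entropy (f t))\<bar> powr (\<bar>\<gamma>\<bar> / 2) \<le> entropy_production \<gamma> b (f t)"
      if t0: "0 < t"
      unfolding C_def
    proof (rule optimise_production)
      show "0 \<le> entropy_production \<gamma> b (f t)" by (rule flow_entropy_production(1)[OF ctx t0 d2 \<open>b0 > 0\<close> bs])
      show "R powr \<gamma> / 2 * (rel_entropy (f t) - T * exp (- \<kappa> * R\<^sup>2)) \<le> entropy_production \<gamma> b (f t)" if "1 \<le> R" for R
        unfolding T_def \<kappa>_def by (rule flow_entropy_production(2)[OF ctx t0 d2 \<open>b0 > 0\<close> bs that])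
    qed (use \<open>\<gamma> < 0\<close> H T \<kappa> in auto)
    ultimately show ?thesis using flow_entropy_integrable[OF ctx] by blast
  qed
  show ?thesis
  proof (rule conjI)
    show "\<forall>\<nu> t0. 0 \<le> \<nu> \<and> \<nu> \<le> 1 \<and> 0 < t0 \<longrightarrow>
       (\<exists>C1>0. \<exists>C2>0. \<forall>b (f0 :: real ^ 'n \<Rightarrow> real) f.
          angular_kernel TYPE(real ^ 'n) b \<and> bounded (b ` {-1..1}) \<and>
          (\<forall>x\<in>{-1..1}. b x \<ge> b0 * (1 - x\<^sup>2) powr (\<nu> / 2)) \<and>
          initial_datum p f0 \<and> Hp_entropy p f0 = K \<and>
          boltzmann_solution \<gamma> b f0 f \<and> (\<forall>t\<ge>0. AE v in lborel. 0 \<le> f t v) \<longrightarrow>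
          (\<forall>t\<ge>t0.
             C2 * rel_entropy (f t) \<noteq> 1 \<and>
             entropy_production \<gamma> b (f t)
               \<ge> C1 * rel_entropy (f t) / \<bar>ln (C2 * rel_entropy (f t))\<bar> powr (\<bar>\<gamma>\<bar> / 2)))"
    proof (intro allI impI, elim conjE, rule exI[of _ "\<kappa> powr (\<bar>\<gamma>\<bar> / 2) / 4"], rule conjI, use \<kappa> in simp,
        rule exI[of _ "1 / (2 * C)"], rule conjI, use C in simp, intro allI impI, elim conjE)
      fix \<nu> t0 t :: real and b and f0 :: "real ^ 'n \<Rightarrow> real" and f
      assume \<nu>: "0 \<le> \<nu>" "\<nu> \<le> 1" and t0: "0 < t0" "t0 \<le> t"
        and b: "angular_kernel TYPE(real ^ 'n) b" and low: "\<forall>x\<in>{-1..1}. b x \<ge> b0 * (1 - x\<^sup>2) powr (\<nu> / 2)"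
        and f0: "initial_datum p f0" "Hp_entropy p f0 = K" and sol: "boltzmann_solution \<gamma> b f0 f"
      have t: "0 \<le> t" "0 < t" using t0 by auto
      show "1 / (2 * C) * rel_entropy (f t) \<noteq> 1 \<and>
        \<kappa> powr (\<bar>\<gamma>\<bar> / 2) / 4 * rel_entropy (f t) / \<bar>ln (1 / (2 * C) * rel_entropy (f t))\<bar> powr (\<bar>\<gamma>\<bar> / 2) \<le> entropy_production \<gamma> b (f t)"
        using main[OF \<nu> b low f0 sol t(1)] t(2) by blast
    qed
    show "\<exists>C>0. \<exists>\<Lambda>>0. \<forall>\<nu> b (f0 :: real ^ 'n \<Rightarrow> real) f.
        0 \<le> \<nu> \<and> \<nu> \<le> 1 \<and>
        angular_kernel TYPE(real ^ 'n) b \<and> bounded (b ` {-1..1}) \<and>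
        (\<forall>x\<in>{-1..1}. b x \<ge> b0 * (1 - x\<^sup>2) powr (\<nu> / 2)) \<and>
        initial_datum p f0 \<and> Hp_entropy p f0 = K \<and>
        boltzmann_solution \<gamma> b f0 f \<and> (\<forall>t\<ge>0. AE v in lborel. 0 \<le> f t v) \<longrightarrow>
        (\<forall>t\<ge>0.
           integrable lborel (entropy_density (f t)) \<and>
           rel_entropy (f t) \<le> C * exp (- \<Lambda> * t powr (2 / (2 + \<bar>\<gamma>\<bar>))))"
    proof (rule exI[of _ "(Hm + T) * exp \<Lambda>"], rule conjI, use Hm T in simp,
        rule exI[of _ \<Lambda>], rule conjI, use \<Lambda> in simp, intro allI impI, elim conjE)
      fix \<nu> t :: real and b and f0 :: "real ^ 'n \<Rightarrow> real" and f
      assume \<nu>: "0 \<le> \<nu>" "\<nu> \<le> 1" and t: "0 \<le> t"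
        and b: "angular_kernel TYPE(real ^ 'n) b" and low: "\<forall>x\<in>{-1..1}. b x \<ge> b0 * (1 - x\<^sup>2) powr (\<nu> / 2)"
        and f0: "initial_datum p f0" "Hp_entropy p f0 = K" and sol: "boltzmann_solution \<gamma> b f0 f"
      show "integrable lborel (entropy_density (f t)) \<and>
           rel_entropy (f t) \<le> (Hm + T) * exp \<Lambda> * exp (- \<Lambda> * t powr (2 / (2 + \<bar>\<gamma>\<bar>)))"
        using main[OF \<nu> b low f0 sol t] by blast
    qed
  qed
qed

end
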